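(* Let $R$ be a commutative ring with unit, $C$ an $R$-coalgebra that is flat as an $R$-module, and $X$ a right $C$-comodule which is quasi-finite, faithfully coflat and an injector. Then $C$ is Morita-Takeuchi equivalent to $e_C(X)$, the coendomorphism coalgebra of $X$.
   Context: $\otimes=\otimes_R$. $R$-coalgebras are coassociative and counital. $\mathcal M^C$ (resp. ${}^C\mathcal M$) is the category of right (resp. left) $C$-comodules with $C$-colinear maps. For an $R$-module $W$ and $M\in\mathcal M^C$, $W\otimes M$ is a right $C$-comodule via $\mathrm{id}_W\otimes\varrho_M$. Two coalgebras are Morita-Takeuchi equivalent if their categories of right comodules are equivalent (via $R$-linear functors). Cotensor product: for $M\in\mathcal M^C$, $N\in{}^C\mathcal M$, $M\Box_C N=\ker(\varrho_M\otimes\mathrm{id}_N-\mathrm{id}_M\otimes\varrho_N:M\otimes N\to M\otimes C\otimes N)$. A right $C$-comodule $M$ is faithfully coflat if $M\Box_C-:{}^C\mathcal M\to R\text{-Mod}$ is exact and faithful; it is an injector if $-\otimes M:R\text{-Mod}\to\mathcal M^C$ sends injective objects to injective objects. A right $C$-comodule $X$ is quasi-finite if $-\otimes X:R\text{-Mod}\to\mathcal M^C$ has a left adjoint, denoted $h_C(X,-)$, with unit $\eta_M:M\to h_C(X,M)\otimes X$. Then $e_C(X):=h_C(X,X)$ is an $R$-coalgebra, with comultiplication $\Delta$ and counit $\varepsilon$ the unique $R$-linear maps satisfying $(\Delta\otimes\mathrm{id}_X)\eta_X=(\mathrm{id}\otimes\eta_X)\eta_X$ and $(\varepsilon\otimes\mathrm{id}_X)\eta_X=$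 the canonical isomorphism $X\cong R\otimes X$. *)

theory Defs
  imports
    "HOL-Algebra.Module"
    "HOL-Algebra.Free_Abelian_Groups"
    "HOL-Library.Equipollence"
begin

section \<open>Linear maps and tensor products\<close>

text \<open>
  Maps between modules are extensional functions, so that two maps are equal iff they agree on the
  carrier of their source. The fields \<open>mult\<close> and \<open>one\<close>, which the record type of modules inherits
  from rings, carry no meaning for a module and are left undefined in constructions.
\<close>

definition mod_hom ::
  "('r, 'x) ring_scheme \<Rightarrow> ('r, 'm, 'y) module_scheme \<Rightarrow> ('r, 'n, 'z) module_scheme \<Rightarrow> ('m \<Rightarrow> 'n) set"
  where "mod_hom R M N =
    {f \<in> carrier M \<rightarrow>\<^sub>E carrier N.
       (\<forall>x\<in>carrier M. \<forall>y\<in>carrier M. f (x \<oplus>\<^bsub>M\<^esub> y) = f x \<oplus>\<^bsub>N\<^esub> f y) \<and>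
       (\<forall>r\<in>carrier R. \<forall>x\<in>carrier M. f (r \<odot>\<^bsub>M\<^esub> x) = r \<odot>\<^bsub>N\<^esub> f x)}"

definition id_map :: "('m, 'x) partial_object_scheme \<Rightarrow> 'm \<Rightarrow> 'm"
  where "id_map M = (\<lambda>x\<in>carrier M. x)"

definition regular_module :: "('r, 'x) ring_scheme \<Rightarrow> ('r, 'r) module"
  where "regular_module R =
    \<lparr>carrier = carrier R, monoid.mult = monoid.mult R, one = one R,
     ring.zero = ring.zero R, add = add R, smult = monoid.mult R\<rparr>"

type_synonym ('m, 'n) tens = "('m \<times> 'n \<Rightarrow>\<^sub>0 int) set"

text \<open>
  \<open>M \<otimes> N\<close> is the free abelian group on \<open>M \<times> N\<close> modulo the subgroup generated by the relations of
  biadditivity and of balancedness over \<open>R\<close>; its elements are cosets, and \<open>r\<close> acts on the coset of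
  a formal sum of pairs \<open>(x, y)\<close> by replacing each of them by \<open>(r x, y)\<close>.
\<close>

definition tensor_relations ::
  "('r, 'x) ring_scheme \<Rightarrow> ('r, 'm, 'y) module_scheme \<Rightarrow> ('r, 'n, 'z) module_scheme
    \<Rightarrow> ('m \<times> 'n \<Rightarrow>\<^sub>0 int) set"
  where "tensor_relations R M N =
    {frag_of (x \<oplus>\<^bsub>M\<^esub> x', y) - frag_of (x, y) - frag_of (x', y) | x x' y.
       x \<in> carrier M \<and> x' \<in> carrier M \<and> y \<in> carrier N} \<union>
    {frag_of (x, y \<oplus>\<^bsub>N\<^esub> y') - frag_of (x, y) - frag_of (x, y') | x y y'.
       x \<in> carrier M \<and> y \<in> carrier N \<and> y' \<in> carrier N} \<union>
    {frag_of (r \<odot>\<^bsub>M\<^esub> x, y) - frag_of (x, r \<odot>\<^bsub>N\<^esub> y) | r x y.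
       r \<in> carrier R \<and> x \<in> carrier M \<and> y \<in> carrier N}"

definition tensor_class ::
  "('r, 'x) ring_scheme \<Rightarrow> ('r, 'm, 'y) module_scheme \<Rightarrow> ('r, 'n, 'z) module_scheme
    \<Rightarrow> ('m \<times> 'n \<Rightarrow>\<^sub>0 int) \<Rightarrow> ('m, 'n) tens"
  where "tensor_class R M N c =
    (let F = free_Abelian_group (carrier M \<times> carrier N)
     in generate F (tensor_relations R M N) #>\<^bsub>F\<^esub> c)"

definition tensor ::
  "('r, 'x) ring_scheme \<Rightarrow> ('r, 'm, 'y) module_scheme \<Rightarrow> ('r, 'n, 'z) module_scheme
    \<Rightarrow> ('r, ('m, 'n) tens) module"
  where "tensor R M N =
    (let F = free_Abelian_group (carrier M \<times> carrier N);
         Q = F Mod generate F (tensor_relations R M N)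
     in \<lparr>carrier = carrier Q, monoid.mult = undefined, one = undefined,
         ring.zero = one Q, add = monoid.mult Q,
         smult = \<lambda>r A. \<Union>c\<in>A. tensor_class R M N (frag_extend (\<lambda>(x, y). frag_of (r \<odot>\<^bsub>M\<^esub> x, y)) c)\<rparr>)"

definition pure_tensor ::
  "('r, 'x) ring_scheme \<Rightarrow> ('r, 'm, 'y) module_scheme \<Rightarrow> ('r, 'n, 'z) module_scheme
    \<Rightarrow> 'm \<Rightarrow> 'n \<Rightarrow> ('m, 'n) tens"
  where "pure_tensor R M N x y = tensor_class R M N (frag_of (x, y))"

text \<open>\<open>f \<otimes> g : M \<otimes> N \<rightarrow> M' \<otimes> N'\<close>\<close>

definition tensor_map ::
  "('r, 'x) ring_scheme \<Rightarrow> ('r, 'm, 'y) module_scheme \<Rightarrow> ('r, 'n, 'z) module_scheme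
    \<Rightarrow> ('r, 'm1, 'y1) module_scheme \<Rightarrow> ('r, 'n1, 'z1) module_scheme
    \<Rightarrow> ('m \<Rightarrow> 'm1) \<Rightarrow> ('n \<Rightarrow> 'n1) \<Rightarrow> ('m, 'n) tens \<Rightarrow> ('m1, 'n1) tens"
  where "tensor_map R M N M' N' f g =
    (THE h. h \<in> mod_hom R (tensor R M N) (tensor R M' N') \<and>
       (\<forall>x\<in>carrier M. \<forall>y\<in>carrier N.
          h (pure_tensor R M N x y) = pure_tensor R M' N' (f x) (g y)))"

text \<open>The associativity isomorphism \<open>(M \<otimes> N) \<otimes> P \<rightarrow> M \<otimes> (N \<otimes> P)\<close> and its inverse.\<close>

definition tensor_assoc ::
  "('r, 'x) ring_scheme \<Rightarrow> ('r, 'm, 'y) module_scheme \<Rightarrow> ('r, 'n, 'z) module_scheme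
    \<Rightarrow> ('r, 'p, 'w) module_scheme \<Rightarrow> (('m, 'n) tens, 'p) tens \<Rightarrow> ('m, ('n, 'p) tens) tens"
  where "tensor_assoc R M N P =
    (THE h. h \<in> mod_hom R (tensor R (tensor R M N) P) (tensor R M (tensor R N P)) \<and>
       (\<forall>x\<in>carrier M. \<forall>y\<in>carrier N. \<forall>z\<in>carrier P.
          h (pure_tensor R (tensor R M N) P (pure_tensor R M N x y) z) =
          pure_tensor R M (tensor R N P) x (pure_tensor R N P y z)))"

definition tensor_assoc_inv ::
  "('r, 'x) ring_scheme \<Rightarrow> ('r, 'm, 'y) module_scheme \<Rightarrow> ('r, 'n, 'z) module_scheme
    \<Rightarrow> ('r, 'p, 'w) module_scheme \<Rightarrow> ('m, ('n, 'p) tens) tens \<Rightarrow> (('m, 'n) tens, 'p) tens"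
  where "tensor_assoc_inv R M N P =
    (\<lambda>t\<in>carrier (tensor R M (tensor R N P)).
       inv_into (carrier (tensor R (tensor R M N) P)) (tensor_assoc R M N P) t)"


section \<open>Coalgebras and comodules\<close>

record ('r, 'c) coalgebra = "('r, 'c) module" +
  comult :: "'c \<Rightarrow> ('c, 'c) tens"
  counit :: "'c \<Rightarrow> 'r"

locale coalgebra = module R C
  for R :: "('r, 'x) ring_scheme" and C :: "('r, 'c, 'z) coalgebra_scheme" +
  assumes comult_hom: "comult C \<in> mod_hom R C (tensor R C C)"
    and counit_hom: "counit C \<in> mod_hom R C (regular_module R)"
    and coassoc: "\<And>c. c \<in> carrier C \<Longrightarrow>
      tensor_assoc R C C C (tensor_map R C C (tensor R C C) C (comult C) (id_map C) (comult C c)) =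
      tensor_map R C C C (tensor R C C) (id_map C) (comult C) (comult C c)"
    and counit_left: "\<And>c. c \<in> carrier C \<Longrightarrow>
      tensor_map R C C (regular_module R) C (counit C) (id_map C) (comult C c) =
      pure_tensor R (regular_module R) C \<one>\<^bsub>R\<^esub> c"
    and counit_right: "\<And>c. c \<in> carrier C \<Longrightarrow>
      tensor_map R C C C (regular_module R) (id_map C) (counit C) (comult C c) =
      pure_tensor R C (regular_module R) c \<one>\<^bsub>R\<^esub>"

text \<open>
  Left and right comodules share one record type: modules and coalgebras have their carriers in one
  type \<open>'u\<close>, so the coaction \<open>M \<rightarrow> M \<otimes> C\<close> or \<open>M \<rightarrow> C \<otimes> M\<close> has the same type in both cases.
\<close>

record ('r, 'u) comodule = "('r, 'u) module" +
  coact :: "'u \<Rightarrow> ('u, 'u) tens"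

locale right_comodule = coalgebra R C + M?: module R M
  for R :: "('r, 'x) ring_scheme" and C :: "('r, 'u, 'z) coalgebra_scheme"
    and M :: "('r, 'u, 'y) comodule_scheme" +
  assumes coact_hom: "coact M \<in> mod_hom R M (tensor R M C)"
    and coact_coassoc: "\<And>x. x \<in> carrier M \<Longrightarrow>
      tensor_assoc R M C C (tensor_map R M C (tensor R M C) C (coact M) (id_map C) (coact M x)) =
      tensor_map R M C M (tensor R C C) (id_map M) (comult C) (coact M x)"
    and coact_counit: "\<And>x. x \<in> carrier M \<Longrightarrow>
      tensor_map R M C M (regular_module R) (id_map M) (counit C) (coact M x) =
      pure_tensor R M (regular_module R) x \<one>\<^bsub>R\<^esub>"

locale left_comodule = coalgebra R C + M?: module R M
  for R :: "('r, 'x) ring_scheme" and C :: "('r, 'u, 'z) coalgebra_scheme"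
    and M :: "('r, 'u, 'y) comodule_scheme" +
  assumes coact_hom: "coact M \<in> mod_hom R M (tensor R C M)"
    and coact_coassoc: "\<And>x. x \<in> carrier M \<Longrightarrow>
      tensor_assoc R C C M (tensor_map R C M (tensor R C C) M (comult C) (id_map M) (coact M x)) =
      tensor_map R C M C (tensor R C M) (id_map C) (coact M) (coact M x)"
    and coact_counit: "\<And>x. x \<in> carrier M \<Longrightarrow>
      tensor_map R C M (regular_module R) M (counit C) (id_map M) (coact M x) =
      pure_tensor R (regular_module R) M \<one>\<^bsub>R\<^esub> x"

definition right_colinear ::
  "('r, 'x) ring_scheme \<Rightarrow> ('r, 'u, 'z) coalgebra_scheme \<Rightarrow> ('r, 'u, 'y) comodule_scheme
    \<Rightarrow> ('r, 'u, 'w) comodule_scheme \<Rightarrow> ('u \<Rightarrow> 'u) set"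
  where "right_colinear R C M N =
    {f \<in> mod_hom R M N. \<forall>x\<in>carrier M.
       tensor_map R M C N C f (id_map C) (coact M x) = coact N (f x)}"

definition left_colinear ::
  "('r, 'x) ring_scheme \<Rightarrow> ('r, 'u, 'z) coalgebra_scheme \<Rightarrow> ('r, 'u, 'y) comodule_scheme
    \<Rightarrow> ('r, 'u, 'w) comodule_scheme \<Rightarrow> ('u \<Rightarrow> 'u) set"
  where "left_colinear R C M N =
    {f \<in> mod_hom R M N. \<forall>x\<in>carrier M.
       tensor_map R C M C N (id_map C) f (coact M x) = coact N (f x)}"


section \<open>Categories and functors\<close>

text \<open>
  Arrows do not determine their source and target, so composition and the arrow part of a functor
  take the objects involved as arguments: \<open>Cmp K A B D g f\<close> is \<open>g \<circ> f\<close> for \<open>f : A \<rightarrow> B\<close> and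
  \<open>g : B \<rightarrow> D\<close>, and \<open>Arr F A B f\<close> is the image of \<open>f : A \<rightarrow> B\<close>.
\<close>

record ('o, 'a) category =
  Ob :: "'o set"
  Hom :: "'o \<Rightarrow> 'o \<Rightarrow> 'a set"
  Id :: "'o \<Rightarrow> 'a"
  Cmp :: "'o \<Rightarrow> 'o \<Rightarrow> 'o \<Rightarrow> 'a \<Rightarrow> 'a \<Rightarrow> 'a"

record ('o, 'a, 'p, 'b) functor_data =
  Obj :: "'o \<Rightarrow> 'p"
  Arr :: "'o \<Rightarrow> 'o \<Rightarrow> 'a \<Rightarrow> 'b"

definition is_functor ::
  "('o, 'a) category \<Rightarrow> ('p, 'b) category \<Rightarrow> ('o, 'a, 'p, 'b) functor_data \<Rightarrow> bool"
  where "is_functor K L F \<longleftrightarrow>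
    (\<forall>A\<in>Ob K. Obj F A \<in> Ob L) \<and>
    (\<forall>A\<in>Ob K. \<forall>B\<in>Ob K. \<forall>f\<in>Hom K A B. Arr F A B f \<in> Hom L (Obj F A) (Obj F B)) \<and>
    (\<forall>A\<in>Ob K. Arr F A A (Id K A) = Id L (Obj F A)) \<and>
    (\<forall>A\<in>Ob K. \<forall>B\<in>Ob K. \<forall>D\<in>Ob K. \<forall>f\<in>Hom K A B. \<forall>g\<in>Hom K B D.
       Arr F A D (Cmp K A B D g f) =
       Cmp L (Obj F A) (Obj F B) (Obj F D) (Arr F B D g) (Arr F A B f))"

definition id_functor :: "('o, 'a, 'o, 'a) functor_data"
  where "id_functor = \<lparr>Obj = \<lambda>A. A, Arr = \<lambda>A B f. f\<rparr>"

definition comp_functor ::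
  "('p, 'b, 'q, 'c) functor_data \<Rightarrow> ('o, 'a, 'p, 'b) functor_data \<Rightarrow> ('o, 'a, 'q, 'c) functor_data"
  where "comp_functor G F =
    \<lparr>Obj = \<lambda>A. Obj G (Obj F A), Arr = \<lambda>A B f. Arr G (Obj F A) (Obj F B) (Arr F A B f)\<rparr>"

definition nat_trans ::
  "('o, 'a) category \<Rightarrow> ('p, 'b) category \<Rightarrow> ('o, 'a, 'p, 'b) functor_data
    \<Rightarrow> ('o, 'a, 'p, 'b) functor_data \<Rightarrow> ('o \<Rightarrow> 'b) \<Rightarrow> bool"
  where "nat_trans K L F G t \<longleftrightarrow>
    (\<forall>A\<in>Ob K. t A \<in> Hom L (Obj F A) (Obj G A)) \<and>
    (\<forall>A\<in>Ob K. \<forall>B\<in>Ob K. \<forall>f\<in>Hom K A B.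
       Cmp L (Obj F A) (Obj F B) (Obj G B) (t B) (Arr F A B f) =
       Cmp L (Obj F A) (Obj G A) (Obj G B) (Arr G A B f) (t A))"

definition iso_arrow :: "('o, 'a) category \<Rightarrow> 'o \<Rightarrow> 'o \<Rightarrow> 'a \<Rightarrow> bool"
  where "iso_arrow K A B f \<longleftrightarrow> f \<in> Hom K A B \<and>
    (\<exists>g\<in>Hom K B A. Cmp K A B A g f = Id K A \<and> Cmp K B A B f g = Id K B)"

definition naturally_isomorphic ::
  "('o, 'a) category \<Rightarrow> ('p, 'b) category \<Rightarrow> ('o, 'a, 'p, 'b) functor_data
    \<Rightarrow> ('o, 'a, 'p, 'b) functor_data \<Rightarrow> bool"
  where "naturally_isomorphic K L F G \<longleftrightarrow>
    (\<exists>t. nat_trans K L F G t \<and> (\<forall>A\<in>Ob K. iso_arrow L (Obj F A) (Obj G A) (t A)))"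

definition mono_arrow :: "('o, 'a) category \<Rightarrow> 'o \<Rightarrow> 'o \<Rightarrow> 'a \<Rightarrow> bool"
  where "mono_arrow K A B i \<longleftrightarrow> i \<in> Hom K A B \<and>
    (\<forall>D\<in>Ob K. \<forall>f\<in>Hom K D A. \<forall>g\<in>Hom K D A. Cmp K D A B i f = Cmp K D A B i g \<longrightarrow> f = g)"

definition injective_object :: "('o, 'a) category \<Rightarrow> 'o \<Rightarrow> bool"
  where "injective_object K Q \<longleftrightarrow> Q \<in> Ob K \<and>
    (\<forall>A\<in>Ob K. \<forall>B\<in>Ob K. \<forall>i. mono_arrow K A B i \<longrightarrow>
       (\<forall>f\<in>Hom K A Q. \<exists>g\<in>Hom K B Q. Cmp K A B Q g i = f))"

text \<open>\<open>F : K \<rightarrow> L\<close> is left adjoint to \<open>G : L \<rightarrow> K\<close> with unit \<open>\<eta>\<close>.\<close>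

definition left_adjoint ::
  "('o, 'a) category \<Rightarrow> ('p, 'b) category \<Rightarrow> ('o, 'a, 'p, 'b) functor_data
    \<Rightarrow> ('p, 'b, 'o, 'a) functor_data \<Rightarrow> ('o \<Rightarrow> 'a) \<Rightarrow> bool"
  where "left_adjoint K L F G \<eta> \<longleftrightarrow>
    is_functor K L F \<and> is_functor L K G \<and> nat_trans K K id_functor (comp_functor G F) \<eta> \<and>
    (\<forall>A\<in>Ob K. \<forall>B\<in>Ob L. \<forall>f\<in>Hom K A (Obj G B). \<exists>!g. g \<in> Hom L (Obj F A) B \<and>
       Cmp K A (Obj G (Obj F A)) (Obj G B) (Arr G (Obj F A) B g) (\<eta> A) = f)"

definition faithful_functor :: "('o, 'a) category \<Rightarrow> ('o, 'a, 'p, 'b) functor_data \<Rightarrow> bool"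
  where "faithful_functor K F \<longleftrightarrow>
    (\<forall>A\<in>Ob K. \<forall>B\<in>Ob K. inj_on (Arr F A B) (Hom K A B))"

text \<open>
  The remaining notions are for categories whose objects are modules with additional structure and
  whose arrows are linear maps. Exactness of a sequence is that of the underlying modules.
\<close>

definition short_exact ::
  "('r, 'm, 'x) module_scheme \<Rightarrow> ('r, 'n, 'y) module_scheme \<Rightarrow> ('r, 'p, 'z) module_scheme
    \<Rightarrow> ('m \<Rightarrow> 'n) \<Rightarrow> ('n \<Rightarrow> 'p) \<Rightarrow> bool"
  where "short_exact A B D f g \<longleftrightarrow>
    inj_on f (carrier A) \<and> f ` carrier A = {b \<in> carrier B. g b = \<zero>\<^bsub>D\<^esub>} \<and> g ` carrier B = carrier D"

definition exact_functor ::
  "(('r, 'm, 'x) module_scheme, 'm \<Rightarrow> 'm) category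
    \<Rightarrow> (('r, 'm, 'x) module_scheme, 'm \<Rightarrow> 'm, ('r, 'n, 'y) module_scheme, 'n \<Rightarrow> 'n) functor_data
    \<Rightarrow> bool"
  where "exact_functor K F \<longleftrightarrow>
    (\<forall>A\<in>Ob K. \<forall>B\<in>Ob K. \<forall>D\<in>Ob K. \<forall>f\<in>Hom K A B. \<forall>g\<in>Hom K B D.
       short_exact A B D f g \<longrightarrow>
       short_exact (Obj F A) (Obj F B) (Obj F D) (Arr F A B f) (Arr F B D g))"

definition linear_functor ::
  "('r, 't) ring_scheme \<Rightarrow> (('r, 'm, 'x) module_scheme, 'm \<Rightarrow> 'm) category
    \<Rightarrow> (('r, 'm, 'x) module_scheme, 'm \<Rightarrow> 'm, ('r, 'n, 'y) module_scheme, 'n \<Rightarrow> 'n) functor_data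
    \<Rightarrow> bool"
  where "linear_functor R K F \<longleftrightarrow>
    (\<forall>A\<in>Ob K. \<forall>B\<in>Ob K. \<forall>f\<in>Hom K A B. \<forall>g\<in>Hom K A B.
       Arr F A B (\<lambda>x\<in>carrier A. f x \<oplus>\<^bsub>B\<^esub> g x) =
       (\<lambda>x\<in>carrier (Obj F A). Arr F A B f x \<oplus>\<^bsub>Obj F B\<^esub> Arr F A B g x)) \<and>
    (\<forall>A\<in>Ob K. \<forall>B\<in>Ob K. \<forall>r\<in>carrier R. \<forall>f\<in>Hom K A B.
       Arr F A B (\<lambda>x\<in>carrier A. r \<odot>\<^bsub>B\<^esub> f x) =
       (\<lambda>x\<in>carrier (Obj F A). r \<odot>\<^bsub>Obj F B\<^esub> Arr F A B f x))"


section \<open>Module and comodule categories\<close>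

text \<open>
  The type \<open>'u\<close> is the universe: objects of the three categories are the modules and comodules
  whose carriers are arbitrary subsets of \<open>'u\<close>.
\<close>

definition Mod_cat :: "('r, 'x) ring_scheme \<Rightarrow> (('r, 'u) module, 'u \<Rightarrow> 'u) category"
  where "Mod_cat R =
    \<lparr>Ob = {M. module R M}, Hom = mod_hom R, Id = id_map,
     Cmp = \<lambda>A B D g f. compose (carrier A) g f\<rparr>"

definition right_comodules ::
  "('r, 'x) ring_scheme \<Rightarrow> ('r, 'u, 'z) coalgebra_scheme
    \<Rightarrow> (('r, 'u) comodule, 'u \<Rightarrow> 'u) category"
  where "right_comodules R C =
    \<lparr>Ob = {M. right_comodule R C M}, Hom = right_colinear R C, Id = id_map,
     Cmp = \<lambda>A B D g f. compose (carrier A) g f\<rparr>"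

definition left_comodules ::
  "('r, 'x) ring_scheme \<Rightarrow> ('r, 'u, 'z) coalgebra_scheme
    \<Rightarrow> (('r, 'u) comodule, 'u \<Rightarrow> 'u) category"
  where "left_comodules R C =
    \<lparr>Ob = {M. left_comodule R C M}, Hom = left_colinear R C, Id = id_map,
     Cmp = \<lambda>A B D g f. compose (carrier A) g f\<rparr>"

definition morita_takeuchi ::
  "('r, 'x) ring_scheme \<Rightarrow> ('r, 'u) coalgebra \<Rightarrow> ('r, 'u) coalgebra \<Rightarrow> bool"
  where "morita_takeuchi R C D \<longleftrightarrow> coalgebra R C \<and> coalgebra R D \<and>
    (\<exists>F G. is_functor (right_comodules R C) (right_comodules R D) F \<and>
       is_functor (right_comodules R D) (right_comodules R C) G \<and>
       linear_functor R (right_comodules R C) F \<and>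
       linear_functor R (right_comodules R D) G \<and>
       naturally_isomorphic (right_comodules R C) (right_comodules R C)
         (comp_functor G F) id_functor \<and>
       naturally_isomorphic (right_comodules R D) (right_comodules R D)
         (comp_functor F G) id_functor)"


section \<open>Flatness and coflatness\<close>

definition tensor_functor ::
  "('r, 'x) ring_scheme \<Rightarrow> ('r, 'u, 'z) module_scheme
    \<Rightarrow> (('r, 'u) module, 'u \<Rightarrow> 'u, ('r, ('u, 'u) tens) module, ('u, 'u) tens \<Rightarrow> ('u, 'u) tens)
         functor_data"
  where "tensor_functor R V =
    \<lparr>Obj = \<lambda>W. tensor R W V, Arr = \<lambda>W W' f. tensor_map R W V W' V f (id_map V)\<rparr>"

definition flat_module :: "('r, 'x) ring_scheme \<Rightarrow> ('r, 'u, 'z) module_scheme \<Rightarrow> bool"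
  where "flat_module R V \<longleftrightarrow> module R V \<and> exact_functor (Mod_cat R) (tensor_functor R V)"

text \<open>\<open>M \<box>\<^sub>C N\<close> is a submodule of \<open>M \<otimes> N\<close>; the two maps to \<open>M \<otimes> C \<otimes> N\<close> are compared in
  \<open>M \<otimes> (C \<otimes> N)\<close>.\<close>

definition cotensor ::
  "('r, 'x) ring_scheme \<Rightarrow> ('r, 'u, 'z) coalgebra_scheme \<Rightarrow> ('r, 'u, 'y) comodule_scheme
    \<Rightarrow> ('r, 'u, 'w) comodule_scheme \<Rightarrow> ('r, ('u, 'u) tens) module"
  where "cotensor R C M N = (tensor R M N)
    \<lparr>carrier := {t \<in> carrier (tensor R M N).
       tensor_assoc R M C N (tensor_map R M N (tensor R M C) N (coact M) (id_map N) t) =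
       tensor_map R M N M (tensor R C N) (id_map M) (coact N) t}\<rparr>"

definition cotensor_functor ::
  "('r, 'x) ring_scheme \<Rightarrow> ('r, 'u, 'z) coalgebra_scheme \<Rightarrow> ('r, 'u, 'y) comodule_scheme
    \<Rightarrow> (('r, 'u) comodule, 'u \<Rightarrow> 'u, ('r, ('u, 'u) tens) module, ('u, 'u) tens \<Rightarrow> ('u, 'u) tens)
         functor_data"
  where "cotensor_functor R C M =
    \<lparr>Obj = cotensor R C M,
     Arr = \<lambda>N N' f. restrict (tensor_map R M N M N' (id_map M) f) (carrier (cotensor R C M N))\<rparr>"

definition faithfully_coflat ::
  "('r, 'x) ring_scheme \<Rightarrow> ('r, 'u, 'z) coalgebra_scheme \<Rightarrow> ('r, 'u, 'y) comodule_scheme \<Rightarrow> bool"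
  where "faithfully_coflat R C M \<longleftrightarrow>
    exact_functor (left_comodules R C) (cotensor_functor R C M) \<and>
    faithful_functor (left_comodules R C) (cotensor_functor R C M)"


section \<open>Quasi-finite comodules and injectors\<close>

text \<open>
  The elements of \<open>W \<otimes> M\<close> are cosets and not elements of \<open>'u\<close>. To view \<open>W \<otimes> M\<close> as an object of
  the comodule category over the universe \<open>'u\<close>, its structure is transported along an arbitrary
  injection of its carrier into \<open>'u\<close>, which exists when \<open>'u\<close> is infinite.
\<close>

definition small_inj :: "('m, 'x) partial_object_scheme \<Rightarrow> 'm \<Rightarrow> 'u"
  where "small_inj M = restrict (SOME j. inj_on j (carrier M)) (carrier M)"

definition small_copy :: "('r, 'm, 'x) module_scheme \<Rightarrow> ('r, 'u) module"
  where "small_copy M =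
    (let j = small_inj M; k = inv_into (carrier M) j
     in \<lparr>carrier = j ` carrier M, monoid.mult = undefined, one = undefined,
         ring.zero = j \<zero>\<^bsub>M\<^esub>, add = \<lambda>x y. j (k x \<oplus>\<^bsub>M\<^esub> k y), smult = \<lambda>r x. j (r \<odot>\<^bsub>M\<^esub> k x)\<rparr>)"

definition small_tensor ::
  "('r, 'x) ring_scheme \<Rightarrow> ('r, 'u) module \<Rightarrow> ('r, 'u, 'y) comodule_scheme \<Rightarrow> ('r, 'u) module"
  where "small_tensor R W M = small_copy (tensor R W M)"

definition to_small ::
  "('r, 'x) ring_scheme \<Rightarrow> ('r, 'u) module \<Rightarrow> ('r, 'u, 'y) comodule_scheme \<Rightarrow> ('u, 'u) tens \<Rightarrow> 'u"
  where "to_small R W M = small_inj (tensor R W M)"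

definition of_small ::
  "('r, 'x) ring_scheme \<Rightarrow> ('r, 'u) module \<Rightarrow> ('r, 'u, 'y) comodule_scheme \<Rightarrow> 'u \<Rightarrow> ('u, 'u) tens"
  where "of_small R W M = inv_into (carrier (tensor R W M)) (to_small R W M)"

text \<open>\<open>W \<otimes> M\<close> as a right comodule with coaction \<open>id\<^sub>W \<otimes> \<rho>\<^sub>M\<close>, and the functor \<open>- \<otimes> M\<close>.\<close>

definition tensor_comodule ::
  "('r, 'x) ring_scheme \<Rightarrow> ('r, 'u, 'z) coalgebra_scheme \<Rightarrow> ('r, 'u, 'y) comodule_scheme
    \<Rightarrow> ('r, 'u) module \<Rightarrow> ('r, 'u) comodule"
  where "tensor_comodule R C M W =
    (let T = small_tensor R W M
     in \<lparr>carrier = carrier T, monoid.mult = monoid.mult T, one = one T,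
         ring.zero = ring.zero T, add = add T, smult = smult T,
         coact = \<lambda>t\<in>carrier T.
           tensor_map R (tensor R W M) C T C (to_small R W M) (id_map C)
             (tensor_assoc_inv R W M C
               (tensor_map R W M W (tensor R M C) (id_map W) (coact M) (of_small R W M t)))\<rparr>)"

definition tensor_comodule_functor ::
  "('r, 'x) ring_scheme \<Rightarrow> ('r, 'u, 'z) coalgebra_scheme \<Rightarrow> ('r, 'u, 'y) comodule_scheme
    \<Rightarrow> (('r, 'u) module, 'u \<Rightarrow> 'u, ('r, 'u) comodule, 'u \<Rightarrow> 'u) functor_data"
  where "tensor_comodule_functor R C M =
    \<lparr>Obj = tensor_comodule R C M,
     Arr = \<lambda>W W' f. \<lambda>t\<in>carrier (small_tensor R W M).
       to_small R W' M (tensor_map R W M W' M f (id_map M) (of_small R W M t))\<rparr>"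

definition injector ::
  "('r, 'x) ring_scheme \<Rightarrow> ('r, 'u, 'z) coalgebra_scheme \<Rightarrow> ('r, 'u, 'y) comodule_scheme \<Rightarrow> bool"
  where "injector R C M \<longleftrightarrow>
    (\<forall>Q. injective_object (Mod_cat R) Q \<longrightarrow>
       injective_object (right_comodules R C) (Obj (tensor_comodule_functor R C M) Q))"

text \<open>\<open>h = h\<^sub>C(X, -)\<close> is a left adjoint of \<open>- \<otimes> X\<close>, with unit \<open>\<eta>\<close>.\<close>

definition cohom_functor ::
  "('r, 'x) ring_scheme \<Rightarrow> ('r, 'u, 'z) coalgebra_scheme \<Rightarrow> ('r, 'u, 'y) comodule_scheme
    \<Rightarrow> (('r, 'u) comodule, 'u \<Rightarrow> 'u, ('r, 'u) module, 'u \<Rightarrow> 'u) functor_data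
    \<Rightarrow> (('r, 'u) comodule \<Rightarrow> 'u \<Rightarrow> 'u) \<Rightarrow> bool"
  where "cohom_functor R C X h \<eta> \<longleftrightarrow>
    left_adjoint (right_comodules R C) (Mod_cat R) h (tensor_comodule_functor R C X) \<eta>"

definition quasi_finite ::
  "('r, 'x) ring_scheme \<Rightarrow> ('r, 'u, 'z) coalgebra_scheme \<Rightarrow> ('r, 'u, 'y) comodule_scheme \<Rightarrow> bool"
  where "quasi_finite R C X \<longleftrightarrow> (\<exists>h \<eta>. cohom_functor R C X h \<eta>)"

text \<open>The component \<open>\<eta>\<^sub>X\<close> with values in \<open>h\<^sub>C(X, X) \<otimes> X\<close> itself instead of its copy in \<open>'u\<close>.\<close>

definition coend_unit ::
  "('r, 'x) ring_scheme \<Rightarrow> ('r, 'u) comodule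
    \<Rightarrow> (('r, 'u) comodule, 'u \<Rightarrow> 'u, ('r, 'u) module, 'u \<Rightarrow> 'u) functor_data
    \<Rightarrow> (('r, 'u) comodule \<Rightarrow> 'u \<Rightarrow> 'u) \<Rightarrow> 'u \<Rightarrow> ('u, 'u) tens"
  where "coend_unit R X h \<eta> = (\<lambda>x\<in>carrier X. of_small R (Obj h X) X (\<eta> X x))"

text \<open>The coendomorphism coalgebra \<open>e\<^sub>C(X) = h\<^sub>C(X, X)\<close>.\<close>

definition coend_coalgebra ::
  "('r, 'x) ring_scheme \<Rightarrow> ('r, 'u) comodule
    \<Rightarrow> (('r, 'u) comodule, 'u \<Rightarrow> 'u, ('r, 'u) module, 'u \<Rightarrow> 'u) functor_data
    \<Rightarrow> (('r, 'u) comodule \<Rightarrow> 'u \<Rightarrow> 'u) \<Rightarrow> ('r, 'u) coalgebra"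
  where "coend_coalgebra R X h \<eta> =
    (let E = Obj h X; u = coend_unit R X h \<eta>
     in \<lparr>carrier = carrier E, monoid.mult = monoid.mult E, one = one E,
         ring.zero = ring.zero E, add = add E, smult = smult E,
         comult = (THE \<Delta>. \<Delta> \<in> mod_hom R E (tensor R E E) \<and>
           (\<forall>x\<in>carrier X.
              tensor_assoc R E E X (tensor_map R E X (tensor R E E) X \<Delta> (id_map X) (u x)) =
              tensor_map R E X E (tensor R E X) (id_map E) u (u x))),
         counit = (THE \<epsilon>. \<epsilon> \<in> mod_hom R E (regular_module R) \<and>
           (\<forall>x\<in>carrier X.
              tensor_map R E X (regular_module R) X \<epsilon> (id_map X) (u x) =
              pure_tensor R (regular_module R) X \<one>\<^bsub>R\<^esub> x))\<rparr>)"

text \<open>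
  The closure properties required of the universe \<open>'u\<close>: it is infinite and closed under families
  indexed by \<open>R\<close>. For every \<open>R\<close> there are arbitrarily large such types, for instance the sets over
  any infinite type into which \<open>R\<close> embeds. They ensure that tensor products, quotients, direct
  sums of \<open>'u\<close>-indexed families, and injective hulls of modules in \<open>'u\<close> are again, up to
  isomorphism, modules in \<open>'u\<close>; in particular \<^term>\<open>Mod_cat R\<close> has enough injectives.
\<close>

definition universe_for :: "'u itself \<Rightarrow> ('r, 'x) ring_scheme \<Rightarrow> bool"
  where "universe_for U R \<longleftrightarrow> infinite (UNIV :: 'u set) \<and>
    (carrier R \<rightarrow>\<^sub>E (UNIV :: 'u set)) \<lesssim> (UNIV :: 'u set)"

end

theory Submission
  imports Complex_Main Defs
begin

text \<open>
  Write \<open>h(M)\<close> for the value of the left adjoint of \<open>- \<otimes> X\<close> at a right \<open>C\<close>-comodule \<open>M\<close>,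
  \<open>u\<^sub>M : M \<rightarrow> h(M) \<otimes> X\<close> for the unit, \<open>E = h(X)\<close> for the coendomorphism coalgebra, and
  \<open>Q = Hom\<^sub>\<int>(R, \<mu>)\<close> with \<open>\<mu>\<close> the group of complex roots of unity, an injective cogenerator of the
  category of \<open>R\<close>-modules. The equivalence sends \<open>M\<close> to \<open>h(M)\<close>, whose coaction \<open>\<theta>\<close> over \<open>E\<close> is
  determined by \<open>(\<theta> \<otimes> X) u\<^sub>M = (h(M) \<otimes> u\<^sub>X) u\<^sub>M\<close>; the inverse sends an \<open>E\<close>-comodule \<open>N\<close> with
  coaction \<open>\<rho>\<close> to \<open>N \<box>\<^sub>E X\<close>, the kernel of \<open>\<rho> \<otimes> X - N \<otimes> u\<^sub>X\<close> on \<open>N \<otimes> X\<close>, which is a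
  \<open>C\<close>-subcomodule because \<open>C\<close> is flat.

  Two facts about \<open>h\<close> carry the argument. It commutes with tensor products: for every module \<open>W\<close>
  the map \<open>W \<otimes> u\<^sub>M\<close> is a unit for \<open>W \<otimes> M\<close> (\<open>univ_tensor\<close>), since a colinear map out of
  \<open>W \<otimes> M\<close> is a linear family of colinear maps out of \<open>M\<close>. And it preserves injectivity
  (\<open>univ_mono\<close>): \<open>X\<close> is an injector, so colinear maps into \<open>Q \<otimes> X\<close> extend along injective colinear
  maps; by adjunction linear forms \<open>h(M) \<rightarrow> Q\<close> extend along \<open>h(M) \<rightarrow> h(N)\<close>, and these forms
  separate points.

  All units are injective (\<open>unit_inj\<close>). Naturality along the injective coaction \<open>M \<rightarrow> M \<otimes> C\<close>
  reduces this to comodules \<open>T = W \<otimes> C\<close> (\<open>unit_WC_inj\<close>). There \<open>T\<close> is also a left comodule, and by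
  flatness the kernel \<open>K\<close> of \<open>u\<^sub>T\<close> is a left subcomodule. The cotensor product \<open>X \<box>\<^sub>C T\<close> is
  \<open>W \<otimes> X\<close>, whose unit is split by the counit of \<open>E\<close>; together with \<open>univ_mono\<close> this makes
  \<open>X \<otimes> u\<^sub>T\<close> injective on \<open>X \<box>\<^sub>C T\<close>. As it vanishes on the image of \<open>X \<box>\<^sub>C K\<close>, the inclusion
  \<open>K \<rightarrow> T\<close> induces the zero map after \<open>X \<box>\<^sub>C -\<close>, and faithfulness gives \<open>K = 0\<close>.

  The isomorphism \<open>M \<cong> h(M) \<box>\<^sub>E X\<close> is \<open>u\<^sub>M\<close> itself. For surjectivity (\<open>boxX_F_subset_unit\<close>) let \<open>p\<close>
  be the projection onto the cokernel \<open>P\<close> of \<open>u\<^sub>M\<close>. By adjunction \<open>u\<^sub>P p\<close> is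
  \<open>(k \<otimes> X) (h(M) \<otimes> u\<^sub>X)\<close> for a linear map \<open>k : h(M) \<otimes> E \<rightarrow> h(P)\<close>. From \<open>p u\<^sub>M = 0\<close> follows
  \<open>k \<theta> = 0\<close>, so that \<open>u\<^sub>P p\<close> vanishes on \<open>h(M) \<box>\<^sub>E X\<close>, and \<open>u\<^sub>P\<close> is injective.

  The isomorphism \<open>\<tau> : h(N \<box>\<^sub>E X) \<rightarrow> N\<close> corresponds to the inclusion into \<open>N \<otimes> X\<close>. Its composite
  with \<open>\<rho>\<close> is the image under \<open>h\<close> of that inclusion, hence injective. If \<open>\<tau>\<close> is not surjective
  (\<open>tau_surj\<close>), some nonzero \<open>q : N \<rightarrow> Q\<close> vanishes on its image. Then \<open>q \<otimes> X\<close> vanishes on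
  \<open>N \<box>\<^sub>E X\<close>, so it factors through the injective map induced by \<open>\<rho> \<otimes> X - N \<otimes> u\<^sub>X\<close> and extends to
  a colinear map on \<open>N \<otimes> E \<otimes> X\<close>, which corresponds to a linear map
  \<open>k : N \<otimes> E \<otimes> E \<rightarrow> Q\<close>. Translated by adjunction, the factorization reads
  \<open>q (N \<otimes> \<epsilon>) = k (\<rho> \<otimes> E) - k (N \<otimes> \<Delta>)\<close>; at \<open>\<rho>(n)\<close> the right hand side vanishes by
  coassociativity and the left hand side is \<open>q(n)\<close>, so \<open>q = 0\<close>.

  Iterated tensor products and quotients have carriers in types other than the universe \<open>'u\<close>. Hence
  comodules and universal arrows are treated for carriers in arbitrary types (\<open>rcomod\<close>, \<open>colin\<close>,
  \<open>univ\<close>), and the hypotheses on the categories, which speak of carriers in \<open>'u\<close>, are transported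
  along bijections for all modules that are small enough.
\<close>

section \<open>Linear maps\<close>

text \<open>
  In contrast to \<open>mod_hom\<close>, values off the carrier are unconstrained, so linear maps can be written
  as lambda terms and composed without restriction to carriers.
\<close>

definition lin :: "('r, 'x) ring_scheme \<Rightarrow> ('r, 'm, 'y) module_scheme \<Rightarrow> ('r, 'n, 'z) module_scheme
    \<Rightarrow> ('m \<Rightarrow> 'n) \<Rightarrow> bool"
  where "lin R M N f \<longleftrightarrow> f \<in> carrier M \<rightarrow> carrier N \<and>
    (\<forall>x\<in>carrier M. \<forall>y\<in>carrier M. f (x \<oplus>\<^bsub>M\<^esub> y) = f x \<oplus>\<^bsub>N\<^esub> f y) \<and>
    (\<forall>r\<in>carrier R. \<forall>x\<in>carrier M. f (r \<odot>\<^bsub>M\<^esub> x) = r \<odot>\<^bsub>N\<^esub> f x)"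

lemma mod_hom_iff: "f \<in> mod_hom R M N \<longleftrightarrow> lin R M N f \<and> f \<in> extensional (carrier M)"
  by (auto simp: mod_hom_def lin_def PiE_def)

lemma linI:
  assumes "\<And>x. x \<in> carrier M \<Longrightarrow> f x \<in> carrier N"
    and "\<And>x y. x \<in> carrier M \<Longrightarrow> y \<in> carrier M \<Longrightarrow> f (x \<oplus>\<^bsub>M\<^esub> y) = f x \<oplus>\<^bsub>N\<^esub> f y"
    and "\<And>r x. r \<in> carrier R \<Longrightarrow> x \<in> carrier M \<Longrightarrow> f (r \<odot>\<^bsub>M\<^esub> x) = r \<odot>\<^bsub>N\<^esub> f x"
  shows "lin R M N f"
  using assms by (auto simp: lin_def)

lemma lin_closed: "lin R M N f \<Longrightarrow> x \<in> carrier M \<Longrightarrow> f x \<in> carrier N"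
  by (auto simp: lin_def)

lemma lin_add: "lin R M N f \<Longrightarrow> x \<in> carrier M \<Longrightarrow> y \<in> carrier M \<Longrightarrow> f (x \<oplus>\<^bsub>M\<^esub> y) = f x \<oplus>\<^bsub>N\<^esub> f y"
  by (auto simp: lin_def)

lemma lin_smult: "lin R M N f \<Longrightarrow> r \<in> carrier R \<Longrightarrow> x \<in> carrier M \<Longrightarrow> f (r \<odot>\<^bsub>M\<^esub> x) = r \<odot>\<^bsub>N\<^esub> f x"
  by (auto simp: lin_def)

lemma lin_cong:
  assumes "module R M" "\<And>x. x \<in> carrier M \<Longrightarrow> f x = g x"
  shows "lin R M N f \<longleftrightarrow> lin R M N g"
proof -
  interpret M: module R M by fact
  show ?thesis using assms(2) by (simp add: lin_def Pi_def)
qed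

lemma lin_comp: "lin R M N f \<Longrightarrow> lin R N P g \<Longrightarrow> lin R M P (\<lambda>x. g (f x))"
  by (simp add: lin_def Pi_def)

lemma lin_id: "lin R M M (\<lambda>x. x)"
  by (auto simp: lin_def)

lemma lin_restrict: 
  assumes "module R M"
  shows "lin R M N (restrict f (carrier M)) \<longleftrightarrow> lin R M N f"
  by (rule lin_cong[OF assms]) simp

lemma lin_id_map: "module R M \<Longrightarrow> lin R M M (id_map M)"
  unfolding id_map_def by (simp add: lin_restrict lin_id)

lemma id_map_apply [simp]: "x \<in> carrier M \<Longrightarrow> id_map M x = x"
  by (simp add: id_map_def)

locale over_ring = cring R for R :: "('r, 'x) ring_scheme" (structure)
begin

lemma lin_zero:
  assumes "module R M" "module R N" "lin R M N f"
  shows "f \<zero>\<^bsub>M\<^esub> = \<zero>\<^bsub>N\<^esub>"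
proof -
  interpret M: module R M by fact
  interpret N: module R N by fact
  have "f (\<zero> \<odot>\<^bsub>M\<^esub> \<zero>\<^bsub>M\<^esub>) = \<zero> \<odot>\<^bsub>N\<^esub> f \<zero>\<^bsub>M\<^esub>"
    by (rule lin_smult[OF assms(3)]) auto
  then show ?thesis by (simp add: lin_closed[OF assms(3)])
qed

lemma lin_minus:
  assumes "module R M" "module R N" "lin R M N f" "x \<in> carrier M"
  shows "f (\<ominus>\<^bsub>M\<^esub> x) = \<ominus>\<^bsub>N\<^esub> f x"
proof -
  interpret M: module R M by fact
  interpret N: module R N by fact
  have "f (\<ominus>\<^bsub>M\<^esub> x) \<oplus>\<^bsub>N\<^esub> f x = f (\<ominus>\<^bsub>M\<^esub> x \<oplus>\<^bsub>M\<^esub> x)"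
    using assms(4) by (simp add: lin_add[OF assms(3)])
  also have "\<dots> = \<zero>\<^bsub>N\<^esub>"
    using assms by (simp add: M.l_neg lin_zero)
  finally show ?thesis
    using assms(4) by (simp add: N.minus_equality lin_closed[OF assms(3)])
qed

lemma lin_diff:
  assumes "module R M" "module R N" "lin R M N f" "x \<in> carrier M" "y \<in> carrier M"
  shows "f (x \<ominus>\<^bsub>M\<^esub> y) = f x \<ominus>\<^bsub>N\<^esub> f y"
proof -
  interpret M: module R M by fact
  interpret N: module R N by fact
  show ?thesis
    using assms by (simp add: M.minus_eq N.minus_eq lin_add[OF assms(3)] lin_minus)
qed

lemma diff_zero_imp_eq:
  assumes "module R M" "x \<in> carrier M" "y \<in> carrier M" "x \<ominus>\<^bsub>M\<^esub> y = \<zero>\<^bsub>M\<^esub>"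
  shows "x = y"
proof -
  interpret M: module R M by fact
  have "x = x \<ominus>\<^bsub>M\<^esub> y \<oplus>\<^bsub>M\<^esub> y"
    using assms(2,3) by (simp add: M.minus_eq M.a_assoc M.l_neg)
  then show ?thesis using assms by simp
qed

lemma lin_inj_iff:
  assumes "module R M" "module R N" "lin R M N f"
  shows "inj_on f (carrier M) \<longleftrightarrow> (\<forall>x\<in>carrier M. f x = \<zero>\<^bsub>N\<^esub> \<longrightarrow> x = \<zero>\<^bsub>M\<^esub>)"
proof -
  interpret M: module R M by fact
  interpret N: module R N by fact
  show ?thesis
  proof
    assume "inj_on f (carrier M)"
    then show "\<forall>x\<in>carrier M. f x = \<zero>\<^bsub>N\<^esub> \<longrightarrow> x = \<zero>\<^bsub>M\<^esub>"
      using lin_zero[OF assms] by (metis M.zero_closed inj_onD)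
  next
    assume *: "\<forall>x\<in>carrier M. f x = \<zero>\<^bsub>N\<^esub> \<longrightarrow> x = \<zero>\<^bsub>M\<^esub>"
    show "inj_on f (carrier M)"
    proof (rule inj_onI)
      fix x y assume xy: "x \<in> carrier M" "y \<in> carrier M" "f x = f y"
      then have "f (x \<ominus>\<^bsub>M\<^esub> y) = \<zero>\<^bsub>N\<^esub>"
        using lin_diff[OF assms xy(1,2)] by (simp add: N.minus_eq N.r_neg lin_closed[OF assms(3)])
      then have "x \<ominus>\<^bsub>M\<^esub> y = \<zero>\<^bsub>M\<^esub>" using * xy by blast
      then show "x = y" by (rule diff_zero_imp_eq[OF assms(1) xy(1,2)])
    qed
  qed
qed

lemma lin_const_zero:
  assumes "module R N"
  shows "lin R M N (\<lambda>_. \<zero>\<^bsub>N\<^esub>)"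
proof -
  interpret N: module R N by fact
  show ?thesis by (rule linI) auto
qed

lemma lin_plus:
  assumes "module R N" "lin R M N f" "lin R M N g"
  shows "lin R M N (\<lambda>x. f x \<oplus>\<^bsub>N\<^esub> g x)"
proof -
  interpret N: module R N by fact
  show ?thesis
    by (rule linI)
      (simp_all add: lin_closed[OF assms(2)] lin_closed[OF assms(3)] lin_add[OF assms(2)]
        lin_add[OF assms(3)] lin_smult[OF assms(2)] lin_smult[OF assms(3)] N.smult_r_distr
        N.a_ac)
qed

lemma lin_scale:
  assumes "module R N" "lin R M N f" "r \<in> carrier R"
  shows "lin R M N (\<lambda>x. r \<odot>\<^bsub>N\<^esub> f x)"
proof -
  interpret N: module R N by fact
  show ?thesis
    using assms(3) by (intro linI)
      (simp_all add: lin_closed[OF assms(2)] lin_add[OF assms(2)] lin_smult[OF assms(2)]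
        N.smult_r_distr m_comm flip: N.smult_assoc1)
qed

lemma lin_scalar_action:
  assumes "module R N" "x \<in> carrier N"
  shows "lin R (regular_module R) N (\<lambda>r. r \<odot>\<^bsub>N\<^esub> x)"
proof -
  interpret N: module R N by fact
  show ?thesis
    using assms(2) by (intro linI) (simp_all add: regular_module_def N.smult_l_distr N.smult_assoc1)
qed

lemma module_regular: "module R (regular_module R)"
proof (rule moduleI)
  show "abelian_group (regular_module R)"
    by (rule abelian_groupI) (auto simp: regular_module_def a_ac intro: l_neg)
qed (auto simp: regular_module_def l_distr r_distr m_assoc cring_axioms)

lemma carrier_regular [simp]: "carrier (regular_module R) = carrier R"
  by (simp add: regular_module_def)

lemma lin_inverse:
  assumes "module R M" "module R N" "lin R M N f" "bij_betw f (carrier M) (carrier N)"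
  shows "lin R N M (inv_into (carrier M) f)"
proof -
  interpret M: module R M by fact
  interpret N: module R N by fact
  let ?g = "inv_into (carrier M) f"
  have g: "?g y \<in> carrier M" "f (?g y) = y" if "y \<in> carrier N" for y
    using that assms(4) by (auto simp: bij_betw_def inv_into_into f_inv_into_f)
  have gf: "?g (f x) = x" if "x \<in> carrier M" for x
    using that assms(4) by (auto simp: bij_betw_def inv_into_f_f)
  show ?thesis
  proof (rule linI)
    fix x y assume xy: "x \<in> carrier N" "y \<in> carrier N"
    have "?g (f (?g x \<oplus>\<^bsub>M\<^esub> ?g y)) = ?g x \<oplus>\<^bsub>M\<^esub> ?g y"
      using xy g by (intro gf) simp
    then show "?g (x \<oplus>\<^bsub>N\<^esub> y) = ?g x \<oplus>\<^bsub>M\<^esub> ?g y"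
      using xy g by (simp add: lin_add[OF assms(3)])
  next
    fix r x assume rx: "r \<in> carrier R" "x \<in> carrier N"
    have "?g (f (r \<odot>\<^bsub>M\<^esub> ?g x)) = r \<odot>\<^bsub>M\<^esub> ?g x"
      using rx g by (intro gf) simp
    then show "?g (r \<odot>\<^bsub>N\<^esub> x) = r \<odot>\<^bsub>M\<^esub> ?g x"
      using rx g by (simp add: lin_smult[OF assms(3)])
  qed (use g in auto)
qed

definition bilin :: "('r, 'm, 'y) module_scheme \<Rightarrow> ('r, 'n, 'z) module_scheme \<Rightarrow> ('r, 'p, 'w) module_scheme
    \<Rightarrow> ('m \<Rightarrow> 'n \<Rightarrow> 'p) \<Rightarrow> bool"
  where "bilin M N P b \<longleftrightarrow>
    (\<forall>x\<in>carrier M. lin R N P (b x)) \<and> (\<forall>y\<in>carrier N. lin R M P (\<lambda>x. b x y))"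

lemma bilinI:
  assumes "\<And>x. x \<in> carrier M \<Longrightarrow> lin R N P (b x)" "\<And>y. y \<in> carrier N \<Longrightarrow> lin R M P (\<lambda>x. b x y)"
  shows "bilin M N P b"
  using assms by (simp add: bilin_def)

section \<open>Tensor products\<close>

context
  fixes M :: "('r, 'm, 'y) module_scheme" and N :: "('r, 'n, 'z) module_scheme"
  assumes M: "module R M" and N: "module R N"
begin

interpretation M: module R M by (rule M)
interpretation N: module R N by (rule N)

abbreviation (input) Free where "Free \<equiv> free_Abelian_group (carrier M \<times> carrier N)"
abbreviation (input) Rel where "Rel \<equiv> generate Free (tensor_relations R M N)"
abbreviation (input) tcls where "tcls \<equiv> tensor_class R M N"
abbreviation (input) tact where "tact \<equiv> \<lambda>r. frag_extend (\<lambda>(x, y). frag_of (r \<odot>\<^bsub>M\<^esub> x, y))"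

interpretation Free: comm_group Free by (rule abelian_free_Abelian_group)

lemma tensor_relations_subset: "tensor_relations R M N \<subseteq> carrier Free"
  unfolding tensor_relations_def
  by (auto simp del: carrier_free_Abelian_group_iff
      intro!: Free.m_closed Free.inv_closed
      simp: carrier_free_Abelian_group_iff[symmetric])
    (auto dest!: subsetD[OF keys_diff])

lemma Rel_subgroup: "subgroup Rel Free"
  by (rule Free.generate_is_subgroup[OF tensor_relations_subset])

lemma Rel_normal: "normal Rel Free"
  using Rel_subgroup by (rule Free.subgroup_imp_normal)

lemma carrier_tensor: "carrier (tensor R M N) = tcls ` carrier Free"
  by (auto simp: tensor_def tensor_class_def Let_def FactGroup_def RCOSETS_def)

lemma tc_closed: "c \<in> carrier Free \<Longrightarrow> tcls c \<in> carrier (tensor R M N)"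
  by (simp add: carrier_tensor)

lemma tc_add:
  assumes "c \<in> carrier Free" "d \<in> carrier Free"
  shows "tcls c \<oplus>\<^bsub>tensor R M N\<^esub> tcls d = tcls (c + d)"
  using normal.rcos_sum[OF Rel_normal assms]
  by (simp add: tensor_def tensor_class_def Let_def FactGroup_def)

lemma tc_eq_iff:
  assumes "c \<in> carrier Free" "d \<in> carrier Free"
  shows "tcls c = tcls d \<longleftrightarrow> c - d \<in> Rel"
proof
  assume "tcls c = tcls d"
  then have "c \<in> Rel #>\<^bsub>Free\<^esub> d"
    using Free.rcos_self[OF assms(1) Rel_subgroup] by (simp add: tensor_class_def Let_def)
  then obtain h where "h \<in> Rel" "c = h + d" by (auto simp: r_coset_def)
  then show "c - d \<in> Rel" by simp
next
  assume *: "c - d \<in> Rel"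
  have "c \<in> Rel #>\<^bsub>Free\<^esub> d"
    using * by (auto simp: r_coset_def intro!: bexI[where x = "c - d"])
  then show "tcls c = tcls d"
    using Free.repr_independence[OF _ assms(2) Rel_subgroup] by (simp add: tensor_class_def Let_def)
qed

lemma tc_of_coset:
  assumes "c \<in> carrier Free" "d \<in> tcls c"
  shows "d \<in> carrier Free" "tcls d = tcls c"
proof -
  obtain h where h: "h \<in> Rel" "d = h + c"
    using assms(2) by (auto simp: tensor_class_def Let_def r_coset_def)
  have hF: "h \<in> carrier Free" using h(1) subgroup.subset[OF Rel_subgroup] by blast
  then show dF: "d \<in> carrier Free" using h(2) assms(1) Free.m_closed[OF hF assms(1)] by simp
  show "tcls d = tcls c" unfolding tc_eq_iff[OF dF assms(1)] using h by simp
qed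

lemma act_closed: "r \<in> carrier R \<Longrightarrow> c \<in> carrier Free \<Longrightarrow> tact r c \<in> carrier Free"
  by (simp, rule order_trans[OF keys_frag_extend]) auto

text \<open>
  Scaling the left factor maps relations to relations of the same kind. For the relation of
  balancedness this is where commutativity of \<open>R\<close> enters: \<open>r (s x) = s (r x)\<close>.
\<close>

lemma act_rel:
  assumes r: "r \<in> carrier R" and "c \<in> tensor_relations R M N"
  shows "tact r c \<in> tensor_relations R M N"
    using assms unfolding tensor_relations_def
    apply (elim UnE CollectE exE conjE)
      apply (rule UnI1, rule UnI1)
      apply (simp add: frag_extend_diff M.smult_r_distr)
      apply blast
     apply (rule UnI1, rule UnI2)
     apply (simp add: frag_extend_diff)
     apply blast
    apply (rule UnI2)
    apply (simp add: frag_extend_diff m_comm flip: M.smult_assoc1)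
    apply (simp add: M.smult_assoc1)
    apply blast
    done

lemma act_Rel:
  assumes r: "r \<in> carrier R" and "c \<in> Rel"
  shows "tact r c \<in> Rel"
  using assms(2)
proof (induction rule: generate.induct)
  case one
  then show ?case using subgroup.one_closed[OF Rel_subgroup] by simp
next
  case (incl c)
  from act_rel[OF r this] show ?case by (rule generate.incl)
next
  case (inv c)
  have "c \<in> carrier Free" using inv tensor_relations_subset by blast
  then have c: "inv\<^bsub>Free\<^esub> c = - c" by simp
  have "tact r c \<in> Rel" using act_rel[OF r inv] by (rule generate.incl)
  then have "inv\<^bsub>Free\<^esub> (tact r c) \<in> Rel" by (rule subgroup.m_inv_closed[OF Rel_subgroup])
  moreover have "inv\<^bsub>Free\<^esub> (tact r c) = - tact r c"
    using act_closed[OF r \<open>c \<in> carrier Free\<close>] by simp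
  ultimately show ?case by (simp only: c frag_extend_minus)
next
  case (eng c d)
  then show ?case using subgroup.m_closed[OF Rel_subgroup] by (simp add: frag_extend_add)
qed

lemma tc_act_cong:
  assumes "r \<in> carrier R" "c \<in> carrier Free" "d \<in> carrier Free" "tcls c = tcls d"
  shows "tcls (tact r c) = tcls (tact r d)"
  using assms act_Rel[OF assms(1), of "c - d"]
  by (simp add: tc_eq_iff act_closed frag_extend_diff del: carrier_free_Abelian_group_iff)

text \<open>
  All sets in the union that defines the scalar action coincide, because the action respects the
  relations.
\<close>

lemma tc_smult:
  assumes "r \<in> carrier R" "c \<in> carrier Free"
  shows "r \<odot>\<^bsub>tensor R M N\<^esub> tcls c = tcls (tact r c)"
proof -
  have "r \<odot>\<^bsub>tensor R M N\<^esub> tcls c = (\<Union>d\<in>tcls c. tcls (tact r d))"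
    by (simp add: tensor_def Let_def)
  also have "\<dots> = (\<Union>d\<in>tcls c. tcls (tact r c))"
    using tc_of_coset[OF assms(2)] tc_act_cong[OF assms(1) _ assms(2)] by (intro SUP_cong) auto
  also have "\<dots> = tcls (tact r c)"
    using Free.rcos_self[OF assms(2) Rel_subgroup] by (auto simp: tensor_class_def Let_def)
  finally show ?thesis .
qed

lemma tensor_zero: "\<zero>\<^bsub>tensor R M N\<^esub> = tcls 0"
proof -
  have "Rel #>\<^bsub>Free\<^esub> \<one>\<^bsub>Free\<^esub> = Rel"
    by (rule Free.coset_mult_one) (rule subgroup.subset[OF Rel_subgroup])
  then show ?thesis
    by (simp add: tensor_def tensor_class_def Let_def FactGroup_def)
qed

lemma frag_of_Free: "x \<in> carrier M \<Longrightarrow> y \<in> carrier N \<Longrightarrow> frag_of (x, y) \<in> carrier Free"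
  by simp

lemma zero_Free: "0 \<in> carrier Free"
  by simp

lemma add_Free: "c \<in> carrier Free \<Longrightarrow> d \<in> carrier Free \<Longrightarrow> c + d \<in> carrier Free"
  using Free.m_closed by simp

lemma abelian_group_tensor: "abelian_group (tensor R M N)"
proof (rule abelian_groupI)
  fix s assume "s \<in> carrier (tensor R M N)"
  then obtain c where c: "c \<in> carrier Free" "s = tcls c" by (auto simp: carrier_tensor)
  then have "- c \<in> carrier Free" by simp
  with c have "tcls (- c) \<oplus>\<^bsub>tensor R M N\<^esub> s = \<zero>\<^bsub>tensor R M N\<^esub>"
    by (simp add: tc_add tensor_zero del: carrier_free_Abelian_group_iff)
  then show "\<exists>t\<in>carrier (tensor R M N). t \<oplus>\<^bsub>tensor R M N\<^esub> s = \<zero>\<^bsub>tensor R M N\<^esub>"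
    using tc_closed[OF \<open>- c \<in> carrier Free\<close>] by blast
qed (auto simp: carrier_tensor tc_add tensor_zero add_Free algebra_simps zero_Free
    simp del: carrier_free_Abelian_group_iff)

text \<open>
  The axioms of the scalar action are identities between additive operations on formal sums; this
  reduces them to a single pair.
\<close>

lemma tc_ext:
  assumes f: "\<And>c d. f (c - d) = f c - f d" and g: "\<And>c d. g (c - d) = g c - g d"
    and fF: "\<And>c. c \<in> carrier Free \<Longrightarrow> f c \<in> carrier Free" and gF: "\<And>c. c \<in> carrier Free \<Longrightarrow> g c \<in> carrier Free"
    and gen: "\<And>x y. x \<in> carrier M \<Longrightarrow> y \<in> carrier N \<Longrightarrow> tcls (f (frag_of (x, y))) = tcls (g (frag_of (x, y)))"
    and c: "c \<in> carrier Free"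
  shows "tcls (f c) = tcls (g c)"
proof -
  have "f c - g c \<in> Rel"
  proof (rule free_Abelian_group_induct[where S = "carrier M \<times> carrier N" and P = "\<lambda>c. f c - g c \<in> Rel"])
    show "Poly_Mapping.keys c \<subseteq> carrier M \<times> carrier N" using c by simp
    have "f 0 = 0" "g 0 = 0" using f[of 0 0] g[of 0 0] by simp_all
    then show "f 0 - g 0 \<in> Rel" using subgroup.one_closed[OF Rel_subgroup] by simp
  next
    fix a b assume a: "f a - g a \<in> Rel" and b: "f b - g b \<in> Rel"
    have "f a - g a + inv\<^bsub>Free\<^esub> (f b - g b) \<in> Rel"
      using subgroup.m_closed[OF Rel_subgroup a subgroup.m_inv_closed[OF Rel_subgroup b]] by simp
    moreover have "inv\<^bsub>Free\<^esub> (f b - g b) = - (f b - g b)"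
      using subsetD[OF subgroup.subset[OF Rel_subgroup] b] by (intro inv_free_Abelian_group) simp
    ultimately show "f (a - b) - g (a - b) \<in> Rel" by (simp add: f g algebra_simps)
  next
    fix p assume p: "p \<in> carrier M \<times> carrier N"
    then have "frag_of p \<in> carrier Free" by simp
    from tc_eq_iff[OF fF[OF this] gF[OF this]] p gen show "f (frag_of p) - g (frag_of p) \<in> Rel" by auto
  qed
  then show ?thesis using tc_eq_iff[OF fF[OF c] gF[OF c]] by simp
qed

lemma pure_tensor_closed:
  "x \<in> carrier M \<Longrightarrow> y \<in> carrier N \<Longrightarrow> pure_tensor R M N x y \<in> carrier (tensor R M N)"
  unfolding pure_tensor_def by (rule tc_closed) simp

lemma pure_tensor_add_left:
  assumes "x \<in> carrier M" "x' \<in> carrier M" "y \<in> carrier N"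
  shows "pure_tensor R M N (x \<oplus>\<^bsub>M\<^esub> x') y = pure_tensor R M N x y \<oplus>\<^bsub>tensor R M N\<^esub> pure_tensor R M N x' y"
proof -
  have "frag_of (x \<oplus>\<^bsub>M\<^esub> x', y) - (frag_of (x, y) + frag_of (x', y)) \<in> Rel"
    using assms by (intro generate.incl) (auto simp: tensor_relations_def diff_diff_eq)
  then show ?thesis
    unfolding pure_tensor_def
    using assms by (simp add: tc_add tc_eq_iff frag_of_Free add_Free del: carrier_free_Abelian_group_iff)
qed

lemma pure_tensor_add_right:
  assumes "x \<in> carrier M" "y \<in> carrier N" "y' \<in> carrier N"
  shows "pure_tensor R M N x (y \<oplus>\<^bsub>N\<^esub> y') = pure_tensor R M N x y \<oplus>\<^bsub>tensor R M N\<^esub> pure_tensor R M N x y'"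
proof -
  have "frag_of (x, y \<oplus>\<^bsub>N\<^esub> y') - (frag_of (x, y) + frag_of (x, y')) \<in> Rel"
    using assms by (intro generate.incl) (auto simp: tensor_relations_def diff_diff_eq)
  then show ?thesis
    unfolding pure_tensor_def
    using assms by (simp add: tc_add tc_eq_iff frag_of_Free add_Free del: carrier_free_Abelian_group_iff)
qed

lemma pure_tensor_smult_left:
  assumes "r \<in> carrier R" "x \<in> carrier M" "y \<in> carrier N"
  shows "pure_tensor R M N (r \<odot>\<^bsub>M\<^esub> x) y = r \<odot>\<^bsub>tensor R M N\<^esub> pure_tensor R M N x y"
  unfolding pure_tensor_def using assms by (simp add: tc_smult frag_of_Free del: carrier_free_Abelian_group_iff)

lemma pure_tensor_balanced:
  assumes "r \<in> carrier R" "x \<in> carrier M" "y \<in> carrier N"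
  shows "pure_tensor R M N (r \<odot>\<^bsub>M\<^esub> x) y = pure_tensor R M N x (r \<odot>\<^bsub>N\<^esub> y)"
proof -
  have "frag_of (r \<odot>\<^bsub>M\<^esub> x, y) - frag_of (x, r \<odot>\<^bsub>N\<^esub> y) \<in> Rel"
    using assms by (intro generate.incl) (auto simp: tensor_relations_def)
  then show ?thesis
    unfolding pure_tensor_def
    using assms by (simp add: tc_eq_iff frag_of_Free del: carrier_free_Abelian_group_iff)
qed

lemma module_tensor: "module R (tensor R M N)"
proof -
  interpret T: abelian_group "tensor R M N" by (rule abelian_group_tensor)
  show ?thesis
  proof (rule moduleI)
    fix a t assume "a \<in> carrier R" "t \<in> carrier (tensor R M N)"
    then show "a \<odot>\<^bsub>tensor R M N\<^esub> t \<in> carrier (tensor R M N)"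
      by (auto simp: carrier_tensor tc_smult act_closed simp del: carrier_free_Abelian_group_iff)
  next
    fix a b t assume ab: "a \<in> carrier R" "b \<in> carrier R" "t \<in> carrier (tensor R M N)"
    then obtain c where c: "c \<in> carrier Free" "t = tcls c" by (auto simp: carrier_tensor)
    have "tcls (tact (a \<oplus> b) c) = tcls (tact a c + tact b c)"
    proof (rule tc_ext[OF _ _ _ _ _ c(1)])
      fix x y assume xy: "x \<in> carrier M" "y \<in> carrier N"
      then show "tcls (tact (a \<oplus> b) (frag_of (x, y))) = tcls (tact a (frag_of (x, y)) + tact b (frag_of (x, y)))"
        using pure_tensor_add_left[of "a \<odot>\<^bsub>M\<^esub> x" "b \<odot>\<^bsub>M\<^esub> x" y] ab
        by (simp add: pure_tensor_def M.smult_l_distr tc_add frag_of_Free del: carrier_free_Abelian_group_iff)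
    qed (use ab in \<open>simp_all add: frag_extend_diff act_closed add_Free del: carrier_free_Abelian_group_iff\<close>)
    then show "(a \<oplus> b) \<odot>\<^bsub>tensor R M N\<^esub> t = a \<odot>\<^bsub>tensor R M N\<^esub> t \<oplus>\<^bsub>tensor R M N\<^esub> b \<odot>\<^bsub>tensor R M N\<^esub> t"
      using ab c by (simp add: tc_smult tc_add act_closed del: carrier_free_Abelian_group_iff)
    have "tcls (tact (a \<otimes> b) c) = tcls (tact a (tact b c))"
    proof (rule tc_ext[OF _ _ _ _ _ c(1)])
      fix x y assume xy: "x \<in> carrier M" "y \<in> carrier N"
      then show "tcls (tact (a \<otimes> b) (frag_of (x, y))) = tcls (tact a (tact b (frag_of (x, y))))"
        using ab by (simp add: M.smult_assoc1)
    qed (use ab in \<open>simp_all add: frag_extend_diff act_closed del: carrier_free_Abelian_group_iff\<close>)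
    then show "(a \<otimes> b) \<odot>\<^bsub>tensor R M N\<^esub> t = a \<odot>\<^bsub>tensor R M N\<^esub> (b \<odot>\<^bsub>tensor R M N\<^esub> t)"
      using ab c by (simp add: tc_smult act_closed del: carrier_free_Abelian_group_iff)
  next
    fix a s t assume "a \<in> carrier R" "s \<in> carrier (tensor R M N)" "t \<in> carrier (tensor R M N)"
    then show "a \<odot>\<^bsub>tensor R M N\<^esub> (s \<oplus>\<^bsub>tensor R M N\<^esub> t) =
        a \<odot>\<^bsub>tensor R M N\<^esub> s \<oplus>\<^bsub>tensor R M N\<^esub> a \<odot>\<^bsub>tensor R M N\<^esub> t"
      by (auto simp: carrier_tensor tc_smult tc_add act_closed add_Free frag_extend_add
          simp del: carrier_free_Abelian_group_iff)
  next
    fix t assume "t \<in> carrier (tensor R M N)"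
    then obtain c where c: "c \<in> carrier Free" "t = tcls c" by (auto simp: carrier_tensor)
    have "tcls (tact \<one> c) = tcls c"
      by (rule tc_ext[OF _ _ _ _ _ c(1)])
        (simp_all add: frag_extend_diff act_closed del: carrier_free_Abelian_group_iff)
    then show "\<one> \<odot>\<^bsub>tensor R M N\<^esub> t = t"
      using c by (simp add: tc_smult del: carrier_free_Abelian_group_iff)
  qed (rule cring_axioms, rule abelian_group_tensor)
qed

lemma pure_tensor_smult_right:
  assumes "r \<in> carrier R" "x \<in> carrier M" "y \<in> carrier N"
  shows "pure_tensor R M N x (r \<odot>\<^bsub>N\<^esub> y) = r \<odot>\<^bsub>tensor R M N\<^esub> pure_tensor R M N x y"
  using assms by (simp add: pure_tensor_smult_left flip: pure_tensor_balanced)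

lemma lin_pure_tensor_right: "x \<in> carrier M \<Longrightarrow> lin R N (tensor R M N) (pure_tensor R M N x)"
  by (rule linI) (simp_all add: pure_tensor_closed pure_tensor_add_right pure_tensor_smult_right)

lemma lin_pure_tensor_left: "y \<in> carrier N \<Longrightarrow> lin R M (tensor R M N) (\<lambda>x. pure_tensor R M N x y)"
  by (rule linI) (simp_all add: pure_tensor_closed pure_tensor_add_left pure_tensor_smult_left)

text \<open>
  Negatives are absorbed by the left factor, so sums of pure tensors exhaust the tensor product.
  The induction over the free abelian group proves the property for a formal sum together with its
  negative, as its step is a difference.
\<close>

lemma tensor_induct [consumes 1, case_names pure add]:
  assumes t: "t \<in> carrier (tensor R M N)"
    and pure: "\<And>x y. x \<in> carrier M \<Longrightarrow> y \<in> carrier N \<Longrightarrow> P (pure_tensor R M N x y)"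
    and add: "\<And>s t. s \<in> carrier (tensor R M N) \<Longrightarrow> t \<in> carrier (tensor R M N) \<Longrightarrow> P s \<Longrightarrow> P t \<Longrightarrow>
      P (s \<oplus>\<^bsub>tensor R M N\<^esub> t)"
  shows "P t"
proof -
  interpret T: module R "tensor R M N" by (rule module_tensor)
  obtain c where c: "c \<in> carrier Free" "t = tcls c" using t by (auto simp: carrier_tensor)
  have neg: "tcls (- c) = \<ominus>\<^bsub>tensor R M N\<^esub> tcls c" if "c \<in> carrier Free" for c
  proof -
    have "- c \<in> carrier Free" using that by simp
    then have "tcls (- c) \<oplus>\<^bsub>tensor R M N\<^esub> tcls c = \<zero>\<^bsub>tensor R M N\<^esub>"
      using that by (simp add: tc_add tensor_zero del: carrier_free_Abelian_group_iff)
    then show ?thesis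
      using that \<open>- c \<in> carrier Free\<close> by (simp add: T.minus_equality tc_closed del: carrier_free_Abelian_group_iff)
  qed
  have zero: "pure_tensor R M N \<zero>\<^bsub>M\<^esub> y = \<zero>\<^bsub>tensor R M N\<^esub>" if "y \<in> carrier N" for y
    by (rule lin_zero[OF M module_tensor lin_pure_tensor_left[OF that]])
  have "P (tcls c) \<and> P (tcls (- c))"
  proof (rule free_Abelian_group_induct[where S = "carrier M \<times> carrier N" and P = "\<lambda>c. P (tcls c) \<and> P (tcls (- c))"])
    show "Poly_Mapping.keys c \<subseteq> carrier M \<times> carrier N" using c by simp
    show "P (tcls 0) \<and> P (tcls (- 0))"
      using pure[OF M.zero_closed N.zero_closed] by (simp add: zero tensor_zero)
  next
    fix a b assume ab: "Poly_Mapping.keys a \<subseteq> carrier M \<times> carrier N" "Poly_Mapping.keys b \<subseteq> carrier M \<times> carrier N"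
      "P (tcls a) \<and> P (tcls (- a))" "P (tcls b) \<and> P (tcls (- b))"
    have Free: "a \<in> carrier Free" "b \<in> carrier Free" "- a \<in> carrier Free" "- b \<in> carrier Free" using ab by simp_all
    have "tcls (a - b) = tcls a \<oplus>\<^bsub>tensor R M N\<^esub> tcls (- b)" "tcls (- (a - b)) = tcls b \<oplus>\<^bsub>tensor R M N\<^esub> tcls (- a)"
      using Free by (simp_all add: tc_add del: carrier_free_Abelian_group_iff)
    then show "P (tcls (a - b)) \<and> P (tcls (- (a - b)))"
      using ab Free by (simp add: add tc_closed del: carrier_free_Abelian_group_iff)
  next
    fix p assume "p \<in> carrier M \<times> carrier N"
    then obtain x y where xy: "p = (x, y)" "x \<in> carrier M" "y \<in> carrier N" by auto
    have "tcls (- frag_of (x, y)) = pure_tensor R M N (\<ominus>\<^bsub>M\<^esub> x) y"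
      using lin_minus[OF M module_tensor lin_pure_tensor_left[OF xy(3)] xy(2)] xy
      by (simp add: neg frag_of_Free pure_tensor_def del: carrier_free_Abelian_group_iff)
    then show "P (tcls (frag_of p)) \<and> P (tcls (- frag_of p))"
      using pure[of x y] pure[of "\<ominus>\<^bsub>M\<^esub> x" y] xy by (simp add: pure_tensor_def)
  qed
  then show ?thesis using c by simp
qed

text \<open>
  The universal property: the homomorphism on the free abelian group that extends a bilinear map
  kills the relations, hence descends to cosets.
\<close>

lemma tensor_lift_exists:
  assumes P: "module R P" and b: "bilin M N P b"
  shows "\<exists>h. lin R (tensor R M N) P h \<and>
    (\<forall>x\<in>carrier M. \<forall>y\<in>carrier N. h (pure_tensor R M N x y) = b x y)"
proof -
  interpret P: module R P by (rule P)
  have PA: "group (add_monoid P)" using P.a_comm_group by (simp add: comm_group_def)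
  have bN: "lin R N P (b x)" if "x \<in> carrier M" for x using b that by (simp add: bilin_def)
  have bM: "lin R M P (\<lambda>x. b x y)" if "y \<in> carrier N" for y using b that by (simp add: bilin_def)
  have "(\<lambda>(x, y). b x y) ` (carrier M \<times> carrier N) \<subseteq> carrier (add_monoid P)"
    using lin_closed[OF bN] by auto
  then obtain h0 where h0: "h0 \<in> hom Free (add_monoid P)"
    and gen0: "\<And>p. p \<in> carrier M \<times> carrier N \<Longrightarrow> h0 (frag_of p) = (\<lambda>(x, y). b x y) p"
    using comm_group.free_Abelian_group_universal[OF P.a_comm_group] by blast
  interpret h0: group_hom Free "add_monoid P" h0
    by (simp add: group_hom_def group_hom_axioms_def h0 Free.is_group PA)
  have closed: "h0 c \<in> carrier P" if "c \<in> carrier Free" for c using h0.hom_closed[OF that] by simp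
  have plus: "h0 (c + d) = h0 c \<oplus>\<^bsub>P\<^esub> h0 d" if "c \<in> carrier Free" "d \<in> carrier Free" for c d
    using h0.hom_mult[OF that] by simp
  have minus: "h0 (c - d) = h0 c \<ominus>\<^bsub>P\<^esub> h0 d" if "c \<in> carrier Free" "d \<in> carrier Free" for c d
  proof -
    have "- d \<in> carrier Free" using that by simp
    have "h0 (- d) = \<ominus>\<^bsub>P\<^esub> h0 d"
      using h0.hom_inv[OF that(2)] that(2) by (simp add: a_inv_def)
    then show ?thesis using plus[OF that(1) \<open>- d \<in> carrier Free\<close>] by (simp add: P.minus_eq)
  qed
  have "tensor_relations R M N \<subseteq> kernel Free (add_monoid P) h0"
  proof
    fix c assume c: "c \<in> tensor_relations R M N"
    have sub: "c - d \<in> carrier Free" if "c \<in> carrier Free" "d \<in> carrier Free" for c d :: "'m \<times> 'n \<Rightarrow>\<^sub>0 int"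
      using that Free.m_closed[of c "- d"] by simp
    have "h0 c = \<zero>\<^bsub>P\<^esub>"
      using c unfolding tensor_relations_def
    proof (elim UnE CollectE exE conjE)
      fix x x' y assume "c = frag_of (x \<oplus>\<^bsub>M\<^esub> x', y) - frag_of (x, y) - frag_of (x', y)"
        "x \<in> carrier M" "x' \<in> carrier M" "y \<in> carrier N"
      then show ?thesis
        by (simp add: minus gen0 frag_of_Free sub lin_add[OF bM] lin_closed[OF bM] P.minus_eq
            P.minus_add P.a_ac P.r_neg P.r_neg1 P.r_neg2 del: carrier_free_Abelian_group_iff)
    next
      fix x y y' assume "c = frag_of (x, y \<oplus>\<^bsub>N\<^esub> y') - frag_of (x, y) - frag_of (x, y')"
        "x \<in> carrier M" "y \<in> carrier N" "y' \<in> carrier N"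
      then show ?thesis
        by (simp add: minus gen0 frag_of_Free sub lin_add[OF bN] lin_closed[OF bN] P.minus_eq
            P.minus_add P.a_ac P.r_neg P.r_neg1 P.r_neg2 del: carrier_free_Abelian_group_iff)
    next
      fix r x y assume "c = frag_of (r \<odot>\<^bsub>M\<^esub> x, y) - frag_of (x, r \<odot>\<^bsub>N\<^esub> y)"
        "r \<in> carrier R" "x \<in> carrier M" "y \<in> carrier N"
      then show ?thesis
        by (simp add: minus gen0 frag_of_Free sub lin_smult[OF bN] lin_smult[OF bM] lin_closed[OF bN] P.minus_eq
            P.r_neg del: carrier_free_Abelian_group_iff)
    qed
    then show "c \<in> kernel Free (add_monoid P) h0"
      using subsetD[OF tensor_relations_subset c] by (simp add: kernel_def)
  qed
  then have "Rel \<subseteq> kernel Free (add_monoid P) h0"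
    by (rule Free.generate_subgroup_incl[OF _ h0.subgroup_kernel])
  then have kill: "h0 c = \<zero>\<^bsub>P\<^esub>" if "c \<in> Rel" for c using that by (auto simp: kernel_def)
  have same: "h0 c = h0 d" if "c \<in> carrier Free" "d \<in> carrier Free" "tcls c = tcls d" for c d
    using kill[of "c - d"] that minus[OF that(1,2)] diff_zero_imp_eq[OF P closed closed]
    by (simp add: tc_eq_iff del: carrier_free_Abelian_group_iff)
  define h where "h t = h0 (SOME c. c \<in> carrier Free \<and> tcls c = t)" for t
  have h: "h (tcls c) = h0 c" if "c \<in> carrier Free" for c
  proof -
    have "(SOME d. d \<in> carrier Free \<and> tcls d = tcls c) \<in> carrier Free \<and> tcls (SOME d. d \<in> carrier Free \<and> tcls d = tcls c) = tcls c"
      by (rule someI_ex) (use that in blast)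
    then show ?thesis unfolding h_def using same[OF _ that] by blast
  qed
  have "lin R (tensor R M N) P h"
  proof (rule linI)
    fix r t assume r: "r \<in> carrier R" and t: "t \<in> carrier (tensor R M N)"
    from t r show "h (r \<odot>\<^bsub>tensor R M N\<^esub> t) = r \<odot>\<^bsub>P\<^esub> h t"
    proof (induction t rule: tensor_induct)
      case (pure x y)
      have "h (r \<odot>\<^bsub>tensor R M N\<^esub> pure_tensor R M N x y) = h (tcls (frag_of (r \<odot>\<^bsub>M\<^esub> x, y)))"
        using pure r by (simp add: pure_tensor_def tc_smult frag_of_Free del: carrier_free_Abelian_group_iff)
      then show ?case
        using pure r by (simp add: pure_tensor_def h frag_of_Free gen0 lin_smult[OF bM] del: carrier_free_Abelian_group_iff)
    next
      case (add s t)
      interpret T: module R "tensor R M N" by (rule module_tensor)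
      have hadd: "h (s \<oplus>\<^bsub>tensor R M N\<^esub> t) = h s \<oplus>\<^bsub>P\<^esub> h t"
        if "s \<in> carrier (tensor R M N)" "t \<in> carrier (tensor R M N)" for s t
        using that by (auto simp: carrier_tensor tc_add h plus add_Free simp del: carrier_free_Abelian_group_iff)
      have hcl: "h t \<in> carrier P" if "t \<in> carrier (tensor R M N)" for t
        using that by (auto simp: carrier_tensor h closed simp del: carrier_free_Abelian_group_iff)
      show ?case using add r by (simp add: T.smult_r_distr hadd hcl P.smult_r_distr)
    qed
  qed (auto simp: carrier_tensor tc_add h plus add_Free closed simp del: carrier_free_Abelian_group_iff)
  moreover have "h (pure_tensor R M N x y) = b x y" if "x \<in> carrier M" "y \<in> carrier N" for x y
    using that by (simp add: pure_tensor_def h frag_of_Free gen0 del: carrier_free_Abelian_group_iff)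
  ultimately show ?thesis by blast
qed

end

end

context over_ring
begin

lemma tensor_ext:
  assumes "module R M" "module R N" "module R P"
    and "lin R (tensor R M N) P f" "lin R (tensor R M N) P g"
    and "\<And>x y. x \<in> carrier M \<Longrightarrow> y \<in> carrier N \<Longrightarrow> f (pure_tensor R M N x y) = g (pure_tensor R M N x y)"
    and "t \<in> carrier (tensor R M N)"
  shows "f t = g t"
  by (rule tensor_induct[OF assms(1,2,7), where P = "\<lambda>t. f t = g t"])
    (simp_all add: assms(6) lin_add[OF assms(4)] lin_add[OF assms(5)])

definition tlift :: "('r, 'm, 'y) module_scheme \<Rightarrow> ('r, 'n, 'z) module_scheme \<Rightarrow> ('r, 'p, 'w) module_scheme
    \<Rightarrow> ('m \<Rightarrow> 'n \<Rightarrow> 'p) \<Rightarrow> ('m, 'n) tens \<Rightarrow> 'p"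
  where "tlift M N P b = (SOME h. lin R (tensor R M N) P h \<and>
    (\<forall>x\<in>carrier M. \<forall>y\<in>carrier N. h (pure_tensor R M N x y) = b x y))"

lemma
  assumes "module R M" "module R N" "module R P" "bilin M N P b"
  shows lin_tlift: "lin R (tensor R M N) P (tlift M N P b)"
    and tlift_pure: "x \<in> carrier M \<Longrightarrow> y \<in> carrier N \<Longrightarrow> tlift M N P b (pure_tensor R M N x y) = b x y"
  using someI_ex[OF tensor_lift_exists[OF assms]] by (auto simp: tlift_def)

text \<open>
  A map induced by a bilinear map is linear in any parameter on which the bilinear map depends
  linearly; this iterates the universal property to threefold products.
\<close>

lemma lin_tlift_parameter:
  assumes "module R M" "module R N" "module R P" "module R Q"
    and "\<And>y. y \<in> carrier Q \<Longrightarrow> bilin M N P (b y)"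
    and "\<And>x y. x \<in> carrier M \<Longrightarrow> y \<in> carrier N \<Longrightarrow> lin R Q P (\<lambda>z. b z x y)"
    and "t \<in> carrier (tensor R M N)"
  shows "lin R Q P (\<lambda>z. tlift M N P (b z) t)"
proof -
  interpret Q: module R Q by fact
  interpret P: module R P by fact
  interpret T: module R "tensor R M N" by (rule module_tensor) fact+
  note tl = lin_tlift[OF assms(1-3,5)] and tp = tlift_pure[OF assms(1-3,5)]
  show ?thesis
  proof (rule linI)
    fix z z' assume z: "z \<in> carrier Q" "z' \<in> carrier Q"
    show "tlift M N P (b (z \<oplus>\<^bsub>Q\<^esub> z')) t = tlift M N P (b z) t \<oplus>\<^bsub>P\<^esub> tlift M N P (b z') t"
      by (rule tensor_ext[OF assms(1-3) tl lin_plus[OF assms(3) tl tl] _ assms(7)])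
        (use z in \<open>simp_all add: tp lin_add[OF assms(6)]\<close>)
  next
    fix r z assume z: "r \<in> carrier R" "z \<in> carrier Q"
    show "tlift M N P (b (r \<odot>\<^bsub>Q\<^esub> z)) t = r \<odot>\<^bsub>P\<^esub> tlift M N P (b z) t"
      by (rule tensor_ext[OF assms(1-3) tl lin_scale[OF assms(3) tl] _ assms(7)])
        (use z in \<open>simp_all add: tp lin_smult[OF assms(6)]\<close>)
  qed (use assms(7) lin_closed[OF tl] in blast)
qed

lemma
  assumes "module R M" "module R N" "module R M'" "module R N'" "lin R M M' f" "lin R N N' g"
  shows tensor_map_mod_hom: "tensor_map R M N M' N' f g \<in> mod_hom R (tensor R M N) (tensor R M' N')"
    and tensor_map_pure: "x \<in> carrier M \<Longrightarrow> y \<in> carrier N \<Longrightarrow>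
      tensor_map R M N M' N' f g (pure_tensor R M N x y) = pure_tensor R M' N' (f x) (g y)"
proof -
  let ?b = "\<lambda>x y. pure_tensor R M' N' (f x) (g y)"
  let ?P = "\<lambda>h. h \<in> mod_hom R (tensor R M N) (tensor R M' N') \<and>
       (\<forall>x\<in>carrier M. \<forall>y\<in>carrier N.
          h (pure_tensor R M N x y) = pure_tensor R M' N' (f x) (g y))"
  note mt = module_tensor[OF assms(1,2)] module_tensor[OF assms(3,4)]
  have b: "bilin M N (tensor R M' N') ?b"
    by (intro bilinI lin_comp[OF assms(6) lin_pure_tensor_right[OF assms(3,4)]]
        lin_comp[OF assms(5) lin_pure_tensor_left[OF assms(3,4)]] lin_closed[OF assms(5)] lin_closed[OF assms(6)])
  let ?h = "restrict (tlift M N (tensor R M' N') ?b) (carrier (tensor R M N))"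
  have h: "?P ?h"
    using lin_tlift[OF assms(1,2) mt(2) b] tlift_pure[OF assms(1,2) mt(2) b] pure_tensor_closed[OF assms(1,2)]
    by (simp add: mod_hom_iff lin_restrict mt)
  have "?P (tensor_map R M N M' N' f g)"
    unfolding tensor_map_def
  proof (rule theI[of ?P, OF h])
    fix k assume k: "?P k"
    have lk: "lin R (tensor R M N) (tensor R M' N') k" and lh: "lin R (tensor R M N) (tensor R M' N') ?h"
      and ek: "k \<in> extensional (carrier (tensor R M N))" and eh: "?h \<in> extensional (carrier (tensor R M N))"
      using k h unfolding mod_hom_iff by blast+
    have kh: "k (pure_tensor R M N x y) = ?h (pure_tensor R M N x y)" if "x \<in> carrier M" "y \<in> carrier N" for x y
      using k h that by metis
    show "k = ?h"
      by (rule extensionalityI[OF ek eh]) (rule tensor_ext[OF assms(1,2) mt(2) lk lh kh])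
  qed
  then show "tensor_map R M N M' N' f g \<in> mod_hom R (tensor R M N) (tensor R M' N')"
    and "x \<in> carrier M \<Longrightarrow> y \<in> carrier N \<Longrightarrow>
      tensor_map R M N M' N' f g (pure_tensor R M N x y) = pure_tensor R M' N' (f x) (g y)"
    by blast+
qed

lemmas lin_tensor_map = tensor_map_mod_hom[unfolded mod_hom_iff, THEN conjunct1]

lemma tensor_map_cong:
  assumes "\<And>x. x \<in> carrier M \<Longrightarrow> f x = f' x" "\<And>y. y \<in> carrier N \<Longrightarrow> g y = g' y"
  shows "tensor_map R M N M' N' f g = tensor_map R M N M' N' f' g'"
  unfolding tensor_map_def using assms by (metis (no_types, lifting))

lemma tensor_map_comp:
  assumes "module R M" "module R N" "module R M'" "module R N'" "module R M''" "module R N''"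
    and "lin R M M' f" "lin R N N' g" "lin R M' M'' f'" "lin R N' N'' g'"
    and "t \<in> carrier (tensor R M N)"
  shows "tensor_map R M' N' M'' N'' f' g' (tensor_map R M N M' N' f g t) =
    tensor_map R M N M'' N'' (\<lambda>x. f' (f x)) (\<lambda>y. g' (g y)) t"
  by (rule tensor_ext[OF assms(1,2) module_tensor[OF assms(5,6)] lin_comp[OF lin_tensor_map lin_tensor_map]
        lin_tensor_map _ assms(11)])
    (simp_all add: assms tensor_map_pure lin_comp[OF assms(7,9)] lin_comp[OF assms(8,10)]
      lin_closed[OF assms(7)] lin_closed[OF assms(8)])

text \<open>\<open>f \<otimes> id\<^sub>P\<close> and \<open>id\<^sub>P \<otimes> f\<close>, where \<open>P\<close> is the last and the first module argument respectively\<close>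

abbreviation lt :: "('r, 'm, 'y) module_scheme \<Rightarrow> ('r, 'n, 'z) module_scheme \<Rightarrow> ('r, 'p, 'w) module_scheme
    \<Rightarrow> ('m \<Rightarrow> 'n) \<Rightarrow> ('m, 'p) tens \<Rightarrow> ('n, 'p) tens"
  where "lt M N P f \<equiv> tensor_map R M P N P f (id_map P)"

abbreviation rt :: "('r, 'p, 'y) module_scheme \<Rightarrow> ('r, 'm, 'z) module_scheme \<Rightarrow> ('r, 'n, 'w) module_scheme
    \<Rightarrow> ('m \<Rightarrow> 'n) \<Rightarrow> ('p, 'm) tens \<Rightarrow> ('p, 'n) tens"
  where "rt P M N f \<equiv> tensor_map R P M P N (id_map P) f"

context
  fixes M :: "('r, 'm, 'y) module_scheme" and N :: "('r, 'n, 'z) module_scheme" and P :: "('r, 'p, 'w) module_scheme"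
  assumes mods: "module R M" "module R N" "module R P"
begin

lemma lin_lt: "lin R M N f \<Longrightarrow> lin R (tensor R M P) (tensor R N P) (lt M N P f)"
  by (rule lin_tensor_map[OF mods(1,3,2,3) _ lin_id_map[OF mods(3)]])

lemma lin_rt: "lin R M N f \<Longrightarrow> lin R (tensor R P M) (tensor R P N) (rt P M N f)"
  by (rule lin_tensor_map[OF mods(3,1,3,2) lin_id_map[OF mods(3)]])

lemma lt_pure: "lin R M N f \<Longrightarrow> x \<in> carrier M \<Longrightarrow> y \<in> carrier P \<Longrightarrow>
    lt M N P f (pure_tensor R M P x y) = pure_tensor R N P (f x) y"
  using tensor_map_pure[OF mods(1,3,2,3) _ lin_id_map[OF mods(3)]] by simp

lemma rt_pure: "lin R M N f \<Longrightarrow> x \<in> carrier P \<Longrightarrow> y \<in> carrier M \<Longrightarrow>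
    rt P M N f (pure_tensor R P M x y) = pure_tensor R P N x (f y)"
  using tensor_map_pure[OF mods(3,1,3,2) lin_id_map[OF mods(3)]] by simp

lemma lt_plus:
  assumes "lin R M N f" "lin R M N g" "t \<in> carrier (tensor R M P)"
  shows "lt M N P (\<lambda>x. f x \<oplus>\<^bsub>N\<^esub> g x) t = lt M N P f t \<oplus>\<^bsub>tensor R N P\<^esub> lt M N P g t"
proof -
  note l = assms(1,2) lin_plus[OF mods(2) assms(1,2)]
  show ?thesis
    by (rule tensor_ext[OF mods(1,3) module_tensor[OF mods(2,3)] lin_lt[OF l(3)]
          lin_plus[OF module_tensor[OF mods(2,3)] lin_lt[OF l(1)] lin_lt[OF l(2)]] _ assms(3)])
      (simp add: lt_pure l pure_tensor_add_left[OF mods(2,3)] lin_closed[OF l(1)] lin_closed[OF l(2)])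
qed

lemma lt_scale:
  assumes "lin R M N f" "r \<in> carrier R" "t \<in> carrier (tensor R M P)"
  shows "lt M N P (\<lambda>x. r \<odot>\<^bsub>N\<^esub> f x) t = r \<odot>\<^bsub>tensor R N P\<^esub> lt M N P f t"
proof -
  note l = assms(1) lin_scale[OF mods(2) assms(1,2)]
  show ?thesis
    by (rule tensor_ext[OF mods(1,3) module_tensor[OF mods(2,3)] lin_lt[OF l(2)]
          lin_scale[OF module_tensor[OF mods(2,3)] lin_lt[OF l(1)] assms(2)] _ assms(3)])
      (simp add: lt_pure l pure_tensor_smult_left[OF mods(2,3)] lin_closed[OF l(1)] assms)
qed

lemma lt_zero:
  assumes "t \<in> carrier (tensor R M P)"
  shows "lt M N P (\<lambda>_. \<zero>\<^bsub>N\<^esub>) t = \<zero>\<^bsub>tensor R N P\<^esub>"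
proof -
  interpret N: module R N by (rule mods)
  note l = lin_const_zero[OF mods(2), of M]
  show ?thesis
    by (rule tensor_ext[OF mods(1,3) module_tensor[OF mods(2,3)] lin_lt[OF l]
          lin_const_zero[OF module_tensor[OF mods(2,3)]] _ assms])
      (simp add: lt_pure l lin_zero[OF mods(2) module_tensor[OF mods(2,3)] lin_pure_tensor_left[OF mods(2,3)]])
qed

lemma rt_zero:
  assumes "t \<in> carrier (tensor R P M)"
  shows "rt P M N (\<lambda>_. \<zero>\<^bsub>N\<^esub>) t = \<zero>\<^bsub>tensor R P N\<^esub>"
proof -
  interpret N: module R N by (rule mods)
  note l = lin_const_zero[OF mods(2), of M]
  show ?thesis
    by (rule tensor_ext[OF mods(3,1) module_tensor[OF mods(3,2)] lin_rt[OF l]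
          lin_const_zero[OF module_tensor[OF mods(3,2)]] _ assms])
      (simp add: rt_pure l lin_zero[OF mods(2) module_tensor[OF mods(3,2)] lin_pure_tensor_right[OF mods(3,2)]])
qed

end

lemma lt_cong: "(\<And>x. x \<in> carrier M \<Longrightarrow> f x = g x) \<Longrightarrow> lt M N P f = lt M N P g"
  by (rule tensor_map_cong) auto

lemma rt_cong: "(\<And>x. x \<in> carrier M \<Longrightarrow> f x = g x) \<Longrightarrow> rt P M N f = rt P M N g"
  by (rule tensor_map_cong) auto

lemma lt_ident: "module R M \<Longrightarrow> module R P \<Longrightarrow> t \<in> carrier (tensor R M P) \<Longrightarrow> lt M M P (\<lambda>x. x) t = t"
  by (rule tensor_ext[where f = "lt M M P (\<lambda>x. x)" and g = "\<lambda>t. t" and M = M and N = P and P = "tensor R M P"])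
    (auto intro: lin_lt lin_id simp: module_tensor lt_pure lin_id)

lemma rt_ident: "module R M \<Longrightarrow> module R P \<Longrightarrow> t \<in> carrier (tensor R P M) \<Longrightarrow> rt P M M (\<lambda>x. x) t = t"
  by (rule tensor_ext[where f = "rt P M M (\<lambda>x. x)" and g = "\<lambda>t. t" and M = P and N = M and P = "tensor R P M"])
    (auto intro: lin_rt lin_id simp: module_tensor rt_pure lin_id)

lemma lt_comp:
  assumes "module R M" "module R N" "module R L" "module R P" "lin R M N f" "lin R N L g"
    and "t \<in> carrier (tensor R M P)"
  shows "lt N L P g (lt M N P f t) = lt M L P (\<lambda>x. g (f x)) t"
proof -
  have "lt N L P g (lt M N P f t) = tensor_map R M P L P (\<lambda>x. g (f x)) (\<lambda>y. id_map P (id_map P y)) t"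
    by (intro tensor_map_comp assms lin_id_map)
  also have "\<dots> = lt M L P (\<lambda>x. g (f x)) t"
    by (rule fun_cong[OF tensor_map_cong]) auto
  finally show ?thesis .
qed

lemma rt_comp:
  assumes "module R M" "module R N" "module R L" "module R P" "lin R M N f" "lin R N L g"
    and "t \<in> carrier (tensor R P M)"
  shows "rt P N L g (rt P M N f t) = rt P M L (\<lambda>x. g (f x)) t"
proof -
  have "rt P N L g (rt P M N f t) = tensor_map R P M P L (\<lambda>y. id_map P (id_map P y)) (\<lambda>x. g (f x)) t"
    by (intro tensor_map_comp assms lin_id_map)
  also have "\<dots> = rt P M L (\<lambda>x. g (f x)) t"
    by (rule fun_cong[OF tensor_map_cong]) auto
  finally show ?thesis .
qed

lemma lt_rt:
  assumes "module R M" "module R M'" "module R N" "module R N'" "lin R M M' f" "lin R N N' g"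
    and "t \<in> carrier (tensor R M N)"
  shows "lt M M' N' f (rt M N N' g t) = rt M' N N' g (lt M M' N f t)"
  by (rule tensor_ext[OF assms(1,3) module_tensor[OF assms(2,4)] lin_comp[OF lin_rt lin_lt]
        lin_comp[OF lin_lt lin_rt] _ assms(7)])
    (simp_all add: assms rt_pure lt_pure lin_closed[OF assms(5)] lin_closed[OF assms(6)])

section \<open>Symmetry and associativity\<close>

definition tswap :: "('r, 'm, 'y) module_scheme \<Rightarrow> ('r, 'n, 'z) module_scheme \<Rightarrow> ('m, 'n) tens \<Rightarrow> ('n, 'm) tens"
  where "tswap M N = tlift M N (tensor R N M) (\<lambda>x y. pure_tensor R N M y x)"

lemma
  assumes "module R M" "module R N"
  shows lin_tswap: "lin R (tensor R M N) (tensor R N M) (tswap M N)"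
    and tswap_pure: "x \<in> carrier M \<Longrightarrow> y \<in> carrier N \<Longrightarrow> tswap M N (pure_tensor R M N x y) = pure_tensor R N M y x"
proof -
  have b: "bilin M N (tensor R N M) (\<lambda>x y. pure_tensor R N M y x)"
    by (intro bilinI lin_pure_tensor_left lin_pure_tensor_right assms)
  show "lin R (tensor R M N) (tensor R N M) (tswap M N)"
    unfolding tswap_def by (rule lin_tlift) (simp_all add: assms module_tensor b)
  show "x \<in> carrier M \<Longrightarrow> y \<in> carrier N \<Longrightarrow> tswap M N (pure_tensor R M N x y) = pure_tensor R N M y x"
    unfolding tswap_def by (rule tlift_pure) (simp_all add: assms module_tensor b)
qed

lemma tswap_tswap:
  assumes "module R M" "module R N" "t \<in> carrier (tensor R M N)"
  shows "tswap N M (tswap M N t) = t"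
  by (rule tensor_ext[OF assms(1,2) module_tensor[OF assms(1,2)]
        lin_comp[OF lin_tswap[OF assms(1,2)] lin_tswap[OF assms(2,1)]] lin_id _ assms(3)])
    (simp add: tswap_pure assms)

lemma tswap_lt:
  assumes "module R M" "module R N" "module R P" "lin R M N f" "t \<in> carrier (tensor R M P)"
  shows "tswap N P (lt M N P f t) = rt P M N f (tswap M P t)"
  by (rule tensor_ext[OF assms(1,3) module_tensor[OF assms(3,2)] lin_comp[OF lin_lt lin_tswap]
        lin_comp[OF lin_tswap lin_rt] _ assms(5)])
    (simp_all add: assms tswap_pure lt_pure rt_pure lin_closed[OF assms(4)])

lemma rt_inj_iff_lt_inj:
  assumes "module R M" "module R N" "module R P" "lin R M N f"
  shows "inj_on (rt P M N f) (carrier (tensor R P M)) \<longleftrightarrow> inj_on (lt M N P f) (carrier (tensor R M P))"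
proof
  assume *: "inj_on (rt P M N f) (carrier (tensor R P M))"
  show "inj_on (lt M N P f) (carrier (tensor R M P))"
  proof (rule inj_onI)
    fix s t assume st: "s \<in> carrier (tensor R M P)" "t \<in> carrier (tensor R M P)" "lt M N P f s = lt M N P f t"
    then have "rt P M N f (tswap M P s) = rt P M N f (tswap M P t)"
      using assms by (simp flip: tswap_lt)
    then have "tswap M P s = tswap M P t"
      using * st lin_closed[OF lin_tswap[OF assms(1,3)]] by (auto dest: inj_onD)
    then show "s = t" using st assms by (metis tswap_tswap)
  qed
next
  assume *: "inj_on (lt M N P f) (carrier (tensor R M P))"
  show "inj_on (rt P M N f) (carrier (tensor R P M))"
  proof (rule inj_onI)
    fix s t assume st: "s \<in> carrier (tensor R P M)" "t \<in> carrier (tensor R P M)" "rt P M N f s = rt P M N f t"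
    let ?s = "tswap P M s" and ?t = "tswap P M t"
    have c: "?s \<in> carrier (tensor R M P)" "?t \<in> carrier (tensor R M P)"
      using st lin_closed[OF lin_tswap[OF assms(3,1)]] by auto
    have "tswap N P (lt M N P f ?s) = tswap N P (lt M N P f ?t)"
      using st c assms by (simp add: tswap_lt tswap_tswap)
    then have "lt M N P f ?s = lt M N P f ?t"
      using c assms lin_closed[OF lin_lt[OF assms]] by (metis tswap_tswap)
    then have "?s = ?t" using * c by (auto dest: inj_onD)
    then show "s = t" using st assms by (metis tswap_tswap)
  qed
qed

context
  fixes M :: "('r, 'm, 'y) module_scheme" and N :: "('r, 'n, 'z) module_scheme" and P :: "('r, 'p, 'w) module_scheme"
  assumes mods: "module R M" "module R N" "module R P"
begin

abbreviation (input) t_MNP where "t_MNP \<equiv> tensor R M (tensor R N P)"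
abbreviation (input) tMN_P where "tMN_P \<equiv> tensor R (tensor R M N) P"

lemma mMN: "module R (tensor R M N)" "module R (tensor R N P)" "module R t_MNP" "module R tMN_P"
  by (intro module_tensor mods)+

lemma
  shows tensor_assoc_mod_hom: "tensor_assoc R M N P \<in> mod_hom R tMN_P t_MNP"
    and tensor_assoc_pure: "\<And>x y z. x \<in> carrier M \<Longrightarrow> y \<in> carrier N \<Longrightarrow> z \<in> carrier P \<Longrightarrow>
      tensor_assoc R M N P (pure_tensor R (tensor R M N) P (pure_tensor R M N x y) z) =
          pure_tensor R M (tensor R N P) x (pure_tensor R N P y z)"
proof -
  let ?b = "\<lambda>z x y. pure_tensor R M (tensor R N P) x (pure_tensor R N P y z)"
  let ?c = "\<lambda>t z. tlift M N t_MNP (?b z) t"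
  let ?P = "\<lambda>h. h \<in> mod_hom R tMN_P t_MNP \<and>
       (\<forall>x\<in>carrier M. \<forall>y\<in>carrier N. \<forall>z\<in>carrier P.
          h (pure_tensor R (tensor R M N) P (pure_tensor R M N x y) z) =
          pure_tensor R M (tensor R N P) x (pure_tensor R N P y z))"
  note pc = pure_tensor_closed[OF mods(1,2)] pure_tensor_closed[OF mods(2,3)] pure_tensor_closed[OF mods(1) mMN(2)]
  have b: "bilin M N t_MNP (?b z)" if "z \<in> carrier P" for z
    using that by (intro bilinI lin_comp[OF lin_pure_tensor_left[OF mods(2,3)] lin_pure_tensor_right[OF mods(1) mMN(2)]]
        lin_pure_tensor_left[OF mods(1) mMN(2)] pc)
  have bz: "lin R P t_MNP (\<lambda>z. ?b z x y)" if "x \<in> carrier M" "y \<in> carrier N" for x y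
    using that by (intro lin_comp[OF lin_pure_tensor_right[OF mods(2,3)] lin_pure_tensor_right[OF mods(1) mMN(2)]])
  have c: "bilin (tensor R M N) P t_MNP ?c"
    by (intro bilinI lin_tlift_parameter lin_tlift b bz mods mMN)
  let ?h = "restrict (tlift (tensor R M N) P t_MNP ?c) (carrier tMN_P)"
  have h: "?P ?h"
    using lin_tlift[OF mMN(1) mods(3) mMN(3) c] tlift_pure[OF mMN(1) mods(3) mMN(3) c] pc
      pure_tensor_closed[OF mMN(1) mods(3)] tlift_pure[OF mods(1,2) mMN(3) b]
    by (simp add: mod_hom_iff lin_restrict mMN)
  have "?P (tensor_assoc R M N P)"
    unfolding tensor_assoc_def
  proof (rule theI[of ?P, OF h])
    fix k assume k: "?P k"
    have lk: "lin R tMN_P t_MNP k" and lh: "lin R tMN_P t_MNP ?h"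
      and ek: "k \<in> extensional (carrier tMN_P)" and eh: "?h \<in> extensional (carrier tMN_P)"
      using k h unfolding mod_hom_iff by blast+
    have kh: "k (pure_tensor R (tensor R M N) P (pure_tensor R M N x y) z) = ?h (pure_tensor R (tensor R M N) P (pure_tensor R M N x y) z)"
      if "x \<in> carrier M" "y \<in> carrier N" "z \<in> carrier P" for x y z
      using k h that by metis
    have eq: "k (pure_tensor R (tensor R M N) P s z) = ?h (pure_tensor R (tensor R M N) P s z)"
      if "s \<in> carrier (tensor R M N)" "z \<in> carrier P" for s z
      by (rule tensor_ext[OF mods(1,2) mMN(3) lin_comp[OF lin_pure_tensor_left[OF mMN(1) mods(3) that(2)] lk]
            lin_comp[OF lin_pure_tensor_left[OF mMN(1) mods(3) that(2)] lh] _ that(1)])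
        (rule kh[OF _ _ that(2)])
    show "k = ?h"
      by (rule extensionalityI[OF ek eh]) (rule tensor_ext[OF mMN(1) mods(3) mMN(3) lk lh eq])
  qed
  then show "tensor_assoc R M N P \<in> mod_hom R tMN_P t_MNP"
    and "\<And>x y z. x \<in> carrier M \<Longrightarrow> y \<in> carrier N \<Longrightarrow> z \<in> carrier P \<Longrightarrow>
      tensor_assoc R M N P (pure_tensor R (tensor R M N) P (pure_tensor R M N x y) z) =
          pure_tensor R M (tensor R N P) x (pure_tensor R N P y z)"
    by blast+
qed

lemma lin_tensor_assoc: "lin R tMN_P t_MNP (tensor_assoc R M N P)"
  using tensor_assoc_mod_hom by (simp add: mod_hom_iff)

text \<open>
  The inverse sends \<open>x \<otimes> s\<close> to \<open>(x \<otimes> -) \<otimes> id\<close> applied to \<open>s\<close>. This description on all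
  \<open>x \<otimes> s\<close>, where \<open>s\<close> need not be pure, is what later computations rely on.
\<close>

lemma tensor_assoc_inverse:
  "\<exists>g. lin R t_MNP tMN_P g \<and> (\<forall>t\<in>carrier tMN_P. g (tensor_assoc R M N P t) = t) \<and>
    (\<forall>t\<in>carrier t_MNP. tensor_assoc R M N P (g t) = t) \<and>
    (\<forall>x\<in>carrier M. \<forall>s\<in>carrier (tensor R N P).
       g (pure_tensor R M (tensor R N P) x s) = lt N (tensor R M N) P (pure_tensor R M N x) s)"
proof -
  let ?b = "\<lambda>x s. lt N (tensor R M N) P (pure_tensor R M N x) s"
  note pc = pure_tensor_closed[OF mods(1,2)] pure_tensor_closed[OF mods(2,3)] pure_tensor_closed[OF mods(1) mMN(2)]
  note ll = lin_lt[OF mods(2) mMN(1) mods(3) lin_pure_tensor_right[OF mods(1,2)]]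
  have bx: "lin R M tMN_P (\<lambda>x. ?b x s)" if s: "s \<in> carrier (tensor R N P)" for s
  proof (rule linI)
    fix x x' assume x: "x \<in> carrier M" "x' \<in> carrier M"
    have "?b (x \<oplus>\<^bsub>M\<^esub> x') s = lt N (tensor R M N) P (\<lambda>y. pure_tensor R M N x y \<oplus>\<^bsub>tensor R M N\<^esub> pure_tensor R M N x' y) s"
      by (rule fun_cong[OF lt_cong]) (use x in \<open>simp add: pure_tensor_add_left[OF mods(1,2)]\<close>)
    also have "\<dots> = ?b x s \<oplus>\<^bsub>tMN_P\<^esub> ?b x' s"
      by (rule lt_plus[OF mods(2) mMN(1) mods(3) lin_pure_tensor_right[OF mods(1,2)] lin_pure_tensor_right[OF mods(1,2)]])
        (use x s in auto)
    finally show "?b (x \<oplus>\<^bsub>M\<^esub> x') s = ?b x s \<oplus>\<^bsub>tMN_P\<^esub> ?b x' s" .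
  next
    fix r x assume x: "r \<in> carrier R" "x \<in> carrier M"
    have "?b (r \<odot>\<^bsub>M\<^esub> x) s = lt N (tensor R M N) P (\<lambda>y. r \<odot>\<^bsub>tensor R M N\<^esub> pure_tensor R M N x y) s"
      by (rule fun_cong[OF lt_cong]) (use x in \<open>simp add: pure_tensor_smult_left[OF mods(1,2)]\<close>)
    also have "\<dots> = r \<odot>\<^bsub>tMN_P\<^esub> ?b x s"
      by (rule lt_scale[OF mods(2) mMN(1) mods(3) lin_pure_tensor_right[OF mods(1,2)]])
        (use x s in auto)
    finally show "?b (r \<odot>\<^bsub>M\<^esub> x) s = r \<odot>\<^bsub>tMN_P\<^esub> ?b x s" .
  qed (use lin_closed[OF ll s] in auto)
  have b: "bilin M (tensor R N P) tMN_P ?b"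
    by (intro bilinI bx ll)
  let ?g = "tlift M (tensor R N P) tMN_P ?b"
  note g = lin_tlift[OF mods(1) mMN(2,4) b] tlift_pure[OF mods(1) mMN(2,4) b]
  have g3: "?g (pure_tensor R M (tensor R N P) x (pure_tensor R N P y z)) = pure_tensor R (tensor R M N) P (pure_tensor R M N x y) z"
    if "x \<in> carrier M" "y \<in> carrier N" "z \<in> carrier P" for x y z
    using that by (simp add: g pc lt_pure[OF mods(2) mMN(1) mods(3) lin_pure_tensor_right[OF mods(1,2)]])
  note ga = lin_comp[OF lin_tensor_assoc g(1)] and ag = lin_comp[OF g(1) lin_tensor_assoc]
  have 1: "?g (tensor_assoc R M N P (pure_tensor R (tensor R M N) P s z)) = pure_tensor R (tensor R M N) P s z"
    if "s \<in> carrier (tensor R M N)" "z \<in> carrier P" for s z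
    by (rule tensor_ext[OF mods(1,2) mMN(4) lin_comp[OF lin_pure_tensor_left[OF mMN(1) mods(3)] ga]
          lin_pure_tensor_left[OF mMN(1) mods(3)] _ that(1)])
      (use that in \<open>simp_all add: tensor_assoc_pure g3\<close>)
  have 2: "tensor_assoc R M N P (?g (pure_tensor R M (tensor R N P) x s)) = pure_tensor R M (tensor R N P) x s"
    if "x \<in> carrier M" "s \<in> carrier (tensor R N P)" for x s
    by (rule tensor_ext[OF mods(2,3) mMN(3) lin_comp[OF lin_pure_tensor_right[OF mods(1) mMN(2)] ag]
          lin_pure_tensor_right[OF mods(1) mMN(2)] _ that(2)])
      (use that in \<open>simp_all add: tensor_assoc_pure g3\<close>)
  show ?thesis
  proof (intro exI[of _ ?g] conjI ballI, rule g(1))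
    fix t assume t: "t \<in> carrier tMN_P"
    show "?g (tensor_assoc R M N P t) = t"
      by (rule tensor_ext[OF mMN(1) mods(3) mMN(4) ga lin_id 1 t])
  next
    fix t assume t: "t \<in> carrier t_MNP"
    show "tensor_assoc R M N P (?g t) = t"
      by (rule tensor_ext[OF mods(1) mMN(2,3) ag lin_id 2 t])
  qed (rule g(2))
qed

lemma tensor_assoc_bij: "bij_betw (tensor_assoc R M N P) (carrier tMN_P) (carrier t_MNP)"
proof -
  obtain g where g: "lin R t_MNP tMN_P g" "\<And>t. t \<in> carrier tMN_P \<Longrightarrow> g (tensor_assoc R M N P t) = t"
    "\<And>t. t \<in> carrier t_MNP \<Longrightarrow> tensor_assoc R M N P (g t) = t"
    "\<And>x s. x \<in> carrier M \<Longrightarrow> s \<in> carrier (tensor R N P) \<Longrightarrow>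
       g (pure_tensor R M (tensor R N P) x s) = lt N (tensor R M N) P (pure_tensor R M N x) s"
    using tensor_assoc_inverse by metis
  show ?thesis
    by (rule bij_betw_byWitness[where f' = g])
      (use g lin_closed[OF g(1)] lin_closed[OF lin_tensor_assoc] in auto)
qed

lemma
  shows lin_tensor_assoc_inv: "lin R t_MNP tMN_P (tensor_assoc_inv R M N P)"
    and tensor_assoc_inv_assoc: "t \<in> carrier tMN_P \<Longrightarrow> tensor_assoc_inv R M N P (tensor_assoc R M N P t) = t"
    and tensor_assoc_assoc_inv: "s \<in> carrier t_MNP \<Longrightarrow> tensor_assoc R M N P (tensor_assoc_inv R M N P s) = s"
    and tensor_assoc_inv_pure: "x \<in> carrier M \<Longrightarrow> v \<in> carrier (tensor R N P) \<Longrightarrow>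
       tensor_assoc_inv R M N P (pure_tensor R M (tensor R N P) x v) = lt N (tensor R M N) P (pure_tensor R M N x) v"
proof -
  obtain g where g: "lin R t_MNP tMN_P g" "\<And>t. t \<in> carrier tMN_P \<Longrightarrow> g (tensor_assoc R M N P t) = t"
    "\<And>t. t \<in> carrier t_MNP \<Longrightarrow> tensor_assoc R M N P (g t) = t"
    "\<And>x s. x \<in> carrier M \<Longrightarrow> s \<in> carrier (tensor R N P) \<Longrightarrow>
       g (pure_tensor R M (tensor R N P) x s) = lt N (tensor R M N) P (pure_tensor R M N x) s"
    using tensor_assoc_inverse by metis
  have eq: "tensor_assoc_inv R M N P t = g t" if "t \<in> carrier t_MNP" for t
  proof -
    have "inv_into (carrier tMN_P) (tensor_assoc R M N P) (tensor_assoc R M N P (g t)) = g t"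
      using tensor_assoc_bij lin_closed[OF g(1) that] by (intro inv_into_f_f) (auto simp: bij_betw_def)
    then show ?thesis using that g(3) by (simp add: tensor_assoc_inv_def)
  qed
  show "lin R t_MNP tMN_P (tensor_assoc_inv R M N P)"
    using lin_cong[where f = "tensor_assoc_inv R M N P" and g = g, OF mMN(3) eq] g(1) by blast
  show "t \<in> carrier tMN_P \<Longrightarrow> tensor_assoc_inv R M N P (tensor_assoc R M N P t) = t"
    using g(2) lin_closed[OF lin_tensor_assoc] by (simp add: eq)
  show "s \<in> carrier t_MNP \<Longrightarrow> tensor_assoc R M N P (tensor_assoc_inv R M N P s) = s"
    using g(3) by (simp add: eq)
  show "x \<in> carrier M \<Longrightarrow> v \<in> carrier (tensor R N P) \<Longrightarrow>
       tensor_assoc_inv R M N P (pure_tensor R M (tensor R N P) x v) = lt N (tensor R M N) P (pure_tensor R M N x) v"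
    using g(4) pure_tensor_closed[OF mods(1) mMN(2)] by (simp add: eq)
qed

end

declare module_tensor [simp] pure_tensor_closed [simp] lin_pure_tensor_right [simp]
  lin_pure_tensor_left [simp] lin_lt [simp] lin_rt [simp] lt_pure [simp] rt_pure [simp]
  lin_id [simp] lin_tensor_assoc [simp] lin_tensor_assoc_inv [simp]

end

context over_ring
begin

lemma lt_closed [simp]:
  "module R M \<Longrightarrow> module R N \<Longrightarrow> module R P \<Longrightarrow> lin R M N f \<Longrightarrow> t \<in> carrier (tensor R M P) \<Longrightarrow>
    lt M N P f t \<in> carrier (tensor R N P)"
  by (rule lin_closed[OF lin_lt])

lemma rt_closed [simp]:
  "module R M \<Longrightarrow> module R N \<Longrightarrow> module R P \<Longrightarrow> lin R M N f \<Longrightarrow> t \<in> carrier (tensor R P M) \<Longrightarrow>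
    rt P M N f t \<in> carrier (tensor R P N)"
  by (rule lin_closed[OF lin_rt])

lemma inj_on_lt_if_left_inverse:
  assumes "module R M" "module R N" "module R P" "lin R M N f" "lin R N M g"
    and "\<And>x. x \<in> carrier M \<Longrightarrow> g (f x) = x"
  shows "inj_on (lt M N P f) (carrier (tensor R M P))"
proof (rule inj_on_inverseI[where g = "lt N M P g"])
  fix t assume t: "t \<in> carrier (tensor R M P)"
  have "lt N M P g (lt M N P f t) = lt M M P (\<lambda>x. g (f x)) t"
    by (rule lt_comp) fact+
  also have "\<dots> = lt M M P (\<lambda>x. x) t"
    by (rule fun_cong[OF lt_cong]) (rule assms(6))
  finally show "lt N M P g (lt M N P f t) = t"
    using t assms by (simp add: lt_ident)
qed

text \<open>
  The map \<open>id\<^sub>W \<otimes> u : W \<otimes> M \<rightarrow> W \<otimes> (H \<otimes> P)\<close>, bracketed to the left in the target. Coactions on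
  \<open>W \<otimes> M\<close>, coassociativity, the cotensor condition and units of tensor products are all of this
  form, which keeps associators out of almost all later statements.
\<close>

definition wten :: "('r, 'w, 'y1) module_scheme \<Rightarrow> ('r, 'm, 'y2) module_scheme \<Rightarrow> ('r, 'h, 'y3) module_scheme
    \<Rightarrow> ('r, 'p, 'y4) module_scheme \<Rightarrow> ('m \<Rightarrow> ('h, 'p) tens) \<Rightarrow> ('w, 'm) tens \<Rightarrow> (('w, 'h) tens, 'p) tens"
  where "wten W M H P u t = tensor_assoc_inv R W H P (rt W M (tensor R H P) u t)"

context
  fixes W :: "('r, 'w, 'y1) module_scheme" and M :: "('r, 'm, 'y2) module_scheme"
    and H :: "('r, 'h, 'y3) module_scheme" and P :: "('r, 'p, 'y4) module_scheme"
  assumes mods [simp]: "module R W" "module R M" "module R H" "module R P"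
begin

lemma lin_wten [simp]:
  assumes "lin R M (tensor R H P) u"
  shows "lin R (tensor R W M) (tensor R (tensor R W H) P) (wten W M H P u)"
  unfolding wten_def using assms by (intro lin_comp[OF lin_rt lin_tensor_assoc_inv]) simp_all

lemma wten_closed [simp]:
  assumes "lin R M (tensor R H P) u" "t \<in> carrier (tensor R W M)"
  shows "wten W M H P u t \<in> carrier (tensor R (tensor R W H) P)"
  by (rule lin_closed[OF lin_wten]) fact+

lemma wten_pure [simp]:
  assumes "lin R M (tensor R H P) u" "w \<in> carrier W" "m \<in> carrier M"
  shows "wten W M H P u (pure_tensor R W M w m) = lt H (tensor R W H) P (pure_tensor R W H w) (u m)"
  using assms lin_closed[OF assms(1)] by (simp add: wten_def tensor_assoc_inv_pure)

lemma wten_eq_iff: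
  assumes "lin R M (tensor R H P) u" "t \<in> carrier (tensor R W M)" "s \<in> carrier (tensor R (tensor R W H) P)"
  shows "tensor_assoc R W H P s = rt W M (tensor R H P) u t \<longleftrightarrow> s = wten W M H P u t"
  using assms tensor_assoc_inv_assoc[of W H P s] tensor_assoc_assoc_inv[of W H P "rt W M (tensor R H P) u t"]
  by (auto simp: wten_def)

lemma inj_wten_iff:
  assumes "lin R M (tensor R H P) u"
  shows "inj_on (wten W M H P u) (carrier (tensor R W M)) \<longleftrightarrow> inj_on (rt W M (tensor R H P) u) (carrier (tensor R W M))"
proof -
  have "inj_on (tensor_assoc_inv R W H P) (carrier (tensor R W (tensor R H P)))"
    by (rule inj_on_inverseI[where g = "tensor_assoc R W H P"]) (simp add: tensor_assoc_assoc_inv)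
  moreover have "rt W M (tensor R H P) u ` carrier (tensor R W M) \<subseteq> carrier (tensor R W (tensor R H P))"
    using assms by auto
  ultimately show ?thesis
    using comp_inj_on[of "rt W M (tensor R H P) u" _ "tensor_assoc_inv R W H P"]
      inj_on_imageI2[of "tensor_assoc_inv R W H P" "rt W M (tensor R H P) u"]
    by (auto simp: wten_def[abs_def] comp_def intro: inj_on_subset)
qed

lemma wten_rt:
  assumes "lin R M (tensor R H P) u" "module R M'" "lin R M' M f" "t \<in> carrier (tensor R W M')"
  shows "wten W M H P u (rt W M' M f t) = wten W M' H P (\<lambda>m. u (f m)) t"
  unfolding wten_def using assms by (simp add: rt_comp)

lemma wten_cong:
  assumes "\<And>m. m \<in> carrier M \<Longrightarrow> u m = u' m"
  shows "wten W M H P u = wten W M H P u'"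
  unfolding wten_def using rt_cong[of M u u' W "tensor R H P", OF assms] by simp

end

context
  fixes W :: "('r, 'w, 'y1) module_scheme" and M :: "('r, 'm, 'y2) module_scheme"
    and H :: "('r, 'h, 'y3) module_scheme" and P :: "('r, 'p, 'y4) module_scheme"
    and u :: "'m \<Rightarrow> ('h, 'p) tens" and t :: "('w, 'm) tens"
  assumes mods [simp]: "module R W" "module R M" "module R H" "module R P"
    and u [simp]: "lin R M (tensor R H P) u" and t: "t \<in> carrier (tensor R W M)"
begin

lemma u_closed [simp]: "m \<in> carrier M \<Longrightarrow> u m \<in> carrier (tensor R H P)"
  by (rule lin_closed[OF u])

lemma wten_lt:
  assumes W' [simp]: "module R W'" and f [simp]: "lin R W W' f"
  shows "lt (tensor R W H) (tensor R W' H) P (lt W W' H f) (wten W M H P u t) = wten W' M H P u (lt W W' M f t)"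
    (is "?l t = ?r t")
proof (rule tensor_ext[where f = ?l and g = ?r and t = t])
  show "lin R (tensor R W M) (tensor R (tensor R W' H) P) ?l"
    by (rule lin_comp[OF lin_wten lin_lt]) simp_all
  show "lin R (tensor R W M) (tensor R (tensor R W' H) P) ?r"
    by (rule lin_comp[OF lin_lt lin_wten]) simp_all
  fix w m assume w: "w \<in> carrier W" "m \<in> carrier M"
  then have fw: "f w \<in> carrier W'" by (simp add: lin_closed[OF f])
  have "?l (pure_tensor R W M w m) = lt H (tensor R W' H) P (\<lambda>h. lt W W' H f (pure_tensor R W H w h)) (u m)"
    using w by (simp add: lt_comp)
  also have "\<dots> = lt H (tensor R W' H) P (pure_tensor R W' H (f w)) (u m)"
    by (rule fun_cong[OF lt_cong]) (use w in simp)
  also have "\<dots> = ?r (pure_tensor R W M w m)"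
    using w fw by simp
  finally show "?l (pure_tensor R W M w m) = ?r (pure_tensor R W M w m)" .
qed (simp_all add: t)

lemma lt_wten:
  assumes H' [simp]: "module R H'" and f [simp]: "lin R H H' f"
  shows "lt (tensor R W H) (tensor R W H') P (rt W H H' f) (wten W M H P u t) = wten W M H' P (\<lambda>m. lt H H' P f (u m)) t"
    (is "?l t = ?r t")
proof (rule tensor_ext[where f = ?l and g = ?r and t = t])
  have u' [simp]: "lin R M (tensor R H' P) (\<lambda>m. lt H H' P f (u m))"
    by (rule lin_comp[OF u]) simp
  show "lin R (tensor R W M) (tensor R (tensor R W H') P) ?l"
    by (rule lin_comp[OF lin_wten lin_lt]) simp_all
  show "lin R (tensor R W M) (tensor R (tensor R W H') P) ?r"
    by simp
  fix w m assume w: "w \<in> carrier W" "m \<in> carrier M"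
  have "?l (pure_tensor R W M w m) = lt H (tensor R W H') P (\<lambda>h. rt W H H' f (pure_tensor R W H w h)) (u m)"
    using w by (simp add: lt_comp)
  also have "\<dots> = lt H (tensor R W H') P (\<lambda>h. pure_tensor R W H' w (f h)) (u m)"
    by (rule fun_cong[OF lt_cong]) (use w in simp)
  also have "\<dots> = ?r (pure_tensor R W M w m)"
    using w by (simp add: lt_comp)
  finally show "?l (pure_tensor R W M w m) = ?r (pure_tensor R W M w m)" .
qed (simp_all add: t)

lemma rt_wten:
  assumes P' [simp]: "module R P'" and f [simp]: "lin R P P' f"
  shows "rt (tensor R W H) P P' f (wten W M H P u t) = wten W M H P' (\<lambda>m. rt H P P' f (u m)) t"
    (is "?l t = ?r t")
proof (rule tensor_ext[where f = ?l and g = ?r and t = t])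
  have u' [simp]: "lin R M (tensor R H P') (\<lambda>m. rt H P P' f (u m))"
    by (rule lin_comp[OF u]) simp
  show "lin R (tensor R W M) (tensor R (tensor R W H) P') ?l"
    by (rule lin_comp[OF lin_wten lin_rt]) simp_all
  show "lin R (tensor R W M) (tensor R (tensor R W H) P') ?r"
    by simp
  fix w m assume w: "w \<in> carrier W" "m \<in> carrier M"
  then show "?l (pure_tensor R W M w m) = ?r (pure_tensor R W M w m)"
    by (simp add: lt_rt)
qed (simp_all add: t)

end

lemma functional_closed: "lin R C (regular_module R) e \<Longrightarrow> c \<in> carrier C \<Longrightarrow> e c \<in> carrier R"
  using lin_closed[of R C "regular_module R"] by simp

text \<open>
  \<open>id\<^sub>M \<otimes> e\<close> followed by \<open>M \<otimes> R \<cong> M\<close>. Counit laws take the form of a retraction with this map.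
\<close>

definition contract :: "('r, 'm, 'y) module_scheme \<Rightarrow> ('r, 'c, 'z) module_scheme \<Rightarrow> ('c \<Rightarrow> 'r) \<Rightarrow> ('m, 'c) tens \<Rightarrow> 'm"
  where "contract M C e = tlift M C M (\<lambda>x c. e c \<odot>\<^bsub>M\<^esub> x)"

context
  fixes M :: "('r, 'm, 'y) module_scheme" and C :: "('r, 'c, 'z) module_scheme" and e
  assumes mods: "module R M" "module R C" and e: "lin R C (regular_module R) e"
begin

lemma bilin_contract: "bilin M C M (\<lambda>x c. e c \<odot>\<^bsub>M\<^esub> x)"
  by (intro bilinI lin_comp[OF e lin_scalar_action] lin_scale functional_closed[OF e] mods lin_id)

lemma lin_contract [simp]: "lin R (tensor R M C) M (contract M C e)"
  unfolding contract_def by (rule lin_tlift[OF mods mods(1) bilin_contract])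

lemma contract_pure [simp]:
  "x \<in> carrier M \<Longrightarrow> c \<in> carrier C \<Longrightarrow> contract M C e (pure_tensor R M C x c) = e c \<odot>\<^bsub>M\<^esub> x"
  unfolding contract_def by (rule tlift_pure[OF mods mods(1) bilin_contract])

lemma contract_closed [simp]: "t \<in> carrier (tensor R M C) \<Longrightarrow> contract M C e t \<in> carrier M"
  by (rule lin_closed[OF lin_contract])

end

lemma contract_lt:
  assumes "module R M" "module R N" "module R C" "lin R C (regular_module R) e" "lin R M N f" "t \<in> carrier (tensor R M C)"
  shows "contract N C e (lt M N C f t) = f (contract M C e t)"
proof (rule tensor_ext[OF assms(1,3,2) _ _ _ assms(6)])
  show "lin R (tensor R M C) N (\<lambda>t. contract N C e (lt M N C f t))"
    by (rule lin_comp[OF lin_lt lin_contract]) fact+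
  show "lin R (tensor R M C) N (\<lambda>t. f (contract M C e t))"
    by (rule lin_comp[OF lin_contract]) fact+
qed (simp add: assms lin_closed[OF assms(5)] lin_smult[OF assms(5)] functional_closed[OF assms(4)])

lemma contract_eq_iff:
  assumes "module R M" "module R C" "lin R C (regular_module R) e" "t \<in> carrier (tensor R M C)" "x \<in> carrier M"
  shows "rt M C (regular_module R) e t = pure_tensor R M (regular_module R) x \<one> \<longleftrightarrow> contract M C e t = x"
proof -
  interpret M: module R M by fact
  have id: "lin R (regular_module R) (regular_module R) (\<lambda>x. x)" by simp
  note [simp] = module_regular assms(1)
  have 1: "contract M (regular_module R) (\<lambda>x. x) (rt M C (regular_module R) e t) = contract M C e t"
  proof (rule tensor_ext[OF assms(1,2,1) _ _ _ assms(4)])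
    show "lin R (tensor R M C) M (\<lambda>t. contract M (regular_module R) (\<lambda>x. x) (rt M C (regular_module R) e t))"
      by (rule lin_comp[OF lin_rt lin_contract]) (simp_all add: assms)
  qed (simp_all add: assms functional_closed[OF assms(3)])
  have 2: "pure_tensor R M (regular_module R) (contract M C e t) \<one> = rt M C (regular_module R) e t"
  proof (rule tensor_ext[OF assms(1,2) _ _ _ _ assms(4)])
    show "lin R (tensor R M C) (tensor R M (regular_module R)) (\<lambda>t. pure_tensor R M (regular_module R) (contract M C e t) \<one>)"
      by (rule lin_comp[OF lin_contract lin_pure_tensor_left]) (simp_all add: assms)
    fix x c assume "x \<in> carrier M" "c \<in> carrier C"
    then show "pure_tensor R M (regular_module R) (contract M C e (pure_tensor R M C x c)) \<one> =
        rt M C (regular_module R) e (pure_tensor R M C x c)"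
      using pure_tensor_balanced[of M "regular_module R" "e c" x \<one>]
      by (simp add: assms functional_closed[OF assms(3)]) (simp add: regular_module_def functional_closed[OF assms(3)])
  qed (simp_all add: assms)
  have 3: "contract M (regular_module R) (\<lambda>x. x) (pure_tensor R M (regular_module R) x \<one>) = x"
    using assms(5) by simp
  show ?thesis using 1 2 3 by metis
qed

end

context over_ring
begin

lemma tswap_closed [simp]:
  "module R M \<Longrightarrow> module R N \<Longrightarrow> t \<in> carrier (tensor R M N) \<Longrightarrow> tswap M N t \<in> carrier (tensor R N M)"
  by (rule lin_closed[OF lin_tswap])

lemma tswap_rt:
  assumes "module R M" "module R N" "module R P" "lin R M N f" "t \<in> carrier (tensor R P M)"
  shows "tswap P N (rt P M N f t) = lt M N P f (tswap P M t)"
  using tswap_lt[OF assms(1-4), of "tswap P M t"] assms by (simp add: tswap_tswap flip: tswap_lt)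
    (metis tswap_closed tswap_tswap lt_closed)

section \<open>Coalgebras and comodules\<close>

text \<open>
  The predicates \<open>coalg\<close>, \<open>rcomod\<close>, \<open>lcomod\<close> and \<open>colin\<close> restate the axioms of coalgebras,
  comodules and colinear maps without associators and without extensionality. The coaction is a
  separate argument, and the underlying module may live in any type.
\<close>

definition coalg :: "('r, 'c, 'z) coalgebra_scheme \<Rightarrow> bool"
  where "coalg C \<longleftrightarrow> module R C \<and> lin R C (tensor R C C) (comult C) \<and> lin R C (regular_module R) (counit C) \<and>
    (\<forall>c\<in>carrier C. lt C (tensor R C C) C (comult C) (comult C c) = wten C C C C (comult C) (comult C c)) \<and>
    (\<forall>c\<in>carrier C. contract C C (counit C) (tswap C C (comult C c)) = c) \<and>
    (\<forall>c\<in>carrier C. contract C C (counit C) (comult C c) = c)"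

lemma lt_counit_iff:
  assumes "module R M" "module R C" "lin R C (regular_module R) e" "t \<in> carrier (tensor R C M)" "x \<in> carrier M"
  shows "lt C (regular_module R) M e t = pure_tensor R (regular_module R) M \<one> x \<longleftrightarrow>
    contract M C e (tswap C M t) = x"
proof -
  note [simp] = module_regular
  have "lt C (regular_module R) M e t = pure_tensor R (regular_module R) M \<one> x \<longleftrightarrow>
      tswap (regular_module R) M (lt C (regular_module R) M e t) = tswap (regular_module R) M (pure_tensor R (regular_module R) M \<one> x)"
    using tswap_tswap[OF module_regular assms(1)] assms
    by (metis carrier_regular lt_closed module_regular one_closed pure_tensor_closed)
  also have "\<dots> \<longleftrightarrow> contract M C e (tswap C M t) = x"
    using assms by (simp add: tswap_lt tswap_pure contract_eq_iff)
  finally show ?thesis .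
qed

lemma coalgebra_iff:
  "coalgebra R C \<longleftrightarrow> coalg C \<and> comult C \<in> extensional (carrier C) \<and> counit C \<in> extensional (carrier C)"
proof (cases "module R C \<and> lin R C (tensor R C C) (comult C) \<and> lin R C (regular_module R) (counit C)")
  case True
  then have [simp]: "module R C" "lin R C (tensor R C C) (comult C)" "lin R C (regular_module R) (counit C)" by auto
  have [simp]: "comult C c \<in> carrier (tensor R C C)" if "c \<in> carrier C" for c
    using that by (simp add: lin_closed[of R C "tensor R C C"])
  show ?thesis
    unfolding coalgebra_def coalgebra_axioms_def coalg_def mod_hom_iff
    by (auto simp: wten_eq_iff lt_counit_iff contract_eq_iff)
next
  case False
  then show ?thesis
    unfolding coalgebra_def coalgebra_axioms_def coalg_def mod_hom_iff by auto
qed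

definition rcomod :: "('r, 'c, 'z) coalgebra_scheme \<Rightarrow> ('r, 'm, 'y) module_scheme \<Rightarrow> ('m \<Rightarrow> ('m, 'c) tens) \<Rightarrow> bool"
  where "rcomod C M \<rho> \<longleftrightarrow> module R M \<and> lin R M (tensor R M C) \<rho> \<and>
    (\<forall>x\<in>carrier M. lt M (tensor R M C) C \<rho> (\<rho> x) = wten M C C C (comult C) (\<rho> x)) \<and>
    (\<forall>x\<in>carrier M. contract M C (counit C) (\<rho> x) = x)"

definition lcomod :: "('r, 'c, 'z) coalgebra_scheme \<Rightarrow> ('r, 'm, 'y) module_scheme \<Rightarrow> ('m \<Rightarrow> ('c, 'm) tens) \<Rightarrow> bool"
  where "lcomod C M l \<longleftrightarrow> module R M \<and> lin R M (tensor R C M) l \<and>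
    (\<forall>x\<in>carrier M. lt C (tensor R C C) M (comult C) (l x) = wten C M C M l (l x)) \<and>
    (\<forall>x\<in>carrier M. contract M C (counit C) (tswap C M (l x)) = x)"

lemma right_comodule_iff:
  "right_comodule R C M \<longleftrightarrow> coalgebra R C \<and> rcomod C M (coact M) \<and> coact M \<in> extensional (carrier M)"
proof (cases "coalgebra R C \<and> module R M \<and> lin R M (tensor R M C) (coact M)")
  case True
  then have c: "coalg C" by (simp add: coalgebra_iff)
  have [simp]: "module R M" "module R C" "lin R C (tensor R C C) (comult C)" "lin R C (regular_module R) (counit C)"
    "lin R M (tensor R M C) (coact M)"
    using True c by (auto simp: coalg_def)
  have [simp]: "coact M c \<in> carrier (tensor R M C)" if "c \<in> carrier M" for c
    using that by (simp add: lin_closed[of R M "tensor R M C"])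
  show ?thesis
    using True unfolding right_comodule_def right_comodule_axioms_def rcomod_def mod_hom_iff
    by (auto simp: wten_eq_iff contract_eq_iff)
next
  case False
  then show ?thesis
    unfolding right_comodule_def right_comodule_axioms_def rcomod_def mod_hom_iff by auto
qed

lemma left_comodule_iff:
  "left_comodule R C M \<longleftrightarrow> coalgebra R C \<and> lcomod C M (coact M) \<and> coact M \<in> extensional (carrier M)"
proof (cases "coalgebra R C \<and> module R M \<and> lin R M (tensor R C M) (coact M)")
  case True
  then have c: "coalg C" by (simp add: coalgebra_iff)
  have [simp]: "module R M" "module R C" "lin R C (tensor R C C) (comult C)" "lin R C (regular_module R) (counit C)"
    "lin R M (tensor R C M) (coact M)"
    using True c by (auto simp: coalg_def)
  have [simp]: "coact M c \<in> carrier (tensor R C M)" if "c \<in> carrier M" for c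
    using that by (simp add: lin_closed[of R M "tensor R C M"])
  show ?thesis
    using True unfolding left_comodule_def left_comodule_axioms_def lcomod_def mod_hom_iff
    by (auto simp: wten_eq_iff lt_counit_iff)
next
  case False
  then show ?thesis
    unfolding left_comodule_def left_comodule_axioms_def lcomod_def mod_hom_iff by auto
qed

definition colin :: "('r, 'c, 'z) coalgebra_scheme \<Rightarrow> ('r, 'm, 'y) module_scheme \<Rightarrow> ('m \<Rightarrow> ('m, 'c) tens)
    \<Rightarrow> ('r, 'n, 'w) module_scheme \<Rightarrow> ('n \<Rightarrow> ('n, 'c) tens) \<Rightarrow> ('m \<Rightarrow> 'n) \<Rightarrow> bool"
  where "colin C M \<rho> N \<sigma> f \<longleftrightarrow> lin R M N f \<and> (\<forall>x\<in>carrier M. lt M N C f (\<rho> x) = \<sigma> (f x))"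

lemma right_colinear_iff:
  "f \<in> right_colinear R C M N \<longleftrightarrow> colin C M (coact M) N (coact N) f \<and> f \<in> extensional (carrier M)"
  by (auto simp: right_colinear_def colin_def mod_hom_iff)

lemma colin_lin: "colin C M \<rho> N \<sigma> f \<Longrightarrow> lin R M N f"
  by (simp add: colin_def)

lemma colin_cong:
  assumes "module R M" "\<And>x. x \<in> carrier M \<Longrightarrow> f x = g x"
  shows "colin C M \<rho> N \<sigma> f \<longleftrightarrow> colin C M \<rho> N \<sigma> g"
proof -
  have 1: "lin R M N f = lin R M N g" by (rule lin_cong[OF assms])
  have 2: "lt M N C f = lt M N C g" by (rule lt_cong[OF assms(2)])
  show ?thesis unfolding colin_def 1 2 using assms(2) by simp
qed

lemma colin_id:
  assumes "module R C" "rcomod C M \<rho>"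
  shows "colin C M \<rho> M \<rho> (\<lambda>x. x)"
  using assms by (simp add: colin_def rcomod_def lt_ident lin_closed[of R M "tensor R M C"])

lemma colin_comp:
  assumes "module R C" "rcomod C M \<rho>" "rcomod C N \<sigma>" "rcomod C L \<tau>"
    and "colin C M \<rho> N \<sigma> f" "colin C N \<sigma> L \<tau> g"
  shows "colin C M \<rho> L \<tau> (\<lambda>x. g (f x))"
  unfolding colin_def
proof (intro conjI ballI)
  show "lin R M L (\<lambda>x. g (f x))" using assms(5,6) by (auto simp: colin_def intro: lin_comp)
  fix x assume x: "x \<in> carrier M"
  have m: "module R M" "module R N" "module R L" "lin R M N f" "lin R N L g" "\<rho> x \<in> carrier (tensor R M C)"
    using assms x by (auto simp: colin_def rcomod_def intro: lin_closed[of R M "tensor R M C"])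
  have "lt M L C (\<lambda>x. g (f x)) (\<rho> x) = lt N L C g (lt M N C f (\<rho> x))"
    using m assms(1) by (simp add: lt_comp)
  then show "lt M L C (\<lambda>x. g (f x)) (\<rho> x) = \<tau> (g (f x))"
    using assms(5,6) x m lin_closed[OF m(4)] by (simp add: colin_def)
qed

text \<open>
  Tensoring with \<open>W\<close> preserves a commutative square \<open>(u \<otimes> Q) r = (H \<otimes> s) v\<close>. The coassociativity
  of \<open>W \<otimes> M\<close>, the colinearity of \<open>W \<otimes> u\<close> and the compatibility of \<open>W \<otimes> u\<^sub>X\<close> with the
  comultiplication of the coendomorphism coalgebra are instances.
\<close>

lemma wten_assoc:
  assumes mods [simp]: "module R W" "module R A" "module R B" "module R M" "module R H" "module R P" "module R Q"
    and u [simp]: "lin R M (tensor R H P) u" and r [simp]: "lin R A (tensor R M Q) r"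
    and s [simp]: "lin R B (tensor R P Q) s" and v [simp]: "lin R A (tensor R H B) v"
    and eq: "\<And>a. a \<in> carrier A \<Longrightarrow> lt M (tensor R H P) Q u (r a) = wten H B P Q s (v a)"
    and t: "t \<in> carrier (tensor R W A)"
  shows "lt (tensor R W M) (tensor R (tensor R W H) P) Q (wten W M H P u) (wten W A M Q r t) =
    wten (tensor R W H) B P Q s (wten W A H B v t)" (is "?l t = ?r t")
proof (rule tensor_ext[where f = ?l and g = ?r and t = t])
  show "lin R (tensor R W A) (tensor R (tensor R (tensor R W H) P) Q) ?l"
    by (rule lin_comp[OF lin_wten lin_lt]) simp_all
  show "lin R (tensor R W A) (tensor R (tensor R (tensor R W H) P) Q) ?r"
    by (rule lin_comp[OF lin_wten lin_wten]) simp_all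
  fix w a assume w: "w \<in> carrier W" "a \<in> carrier A"
  have [simp]: "v a \<in> carrier (tensor R H B)" "r a \<in> carrier (tensor R M Q)"
    using w by (simp_all add: lin_closed[OF v] lin_closed[OF r])
  have [simp]: "u m \<in> carrier (tensor R H P)" if "m \<in> carrier M" for m
    using that by (rule lin_closed[OF u])
  have "?l (pure_tensor R W A w a) = lt M (tensor R (tensor R W H) P) Q (\<lambda>m. wten W M H P u (pure_tensor R W M w m)) (r a)"
    using w by (simp add: lt_comp)
  also have "\<dots> = lt M (tensor R (tensor R W H) P) Q (\<lambda>m. lt H (tensor R W H) P (pure_tensor R W H w) (u m)) (r a)"
    by (rule fun_cong[OF lt_cong]) (use w in simp)
  also have "\<dots> = lt (tensor R H P) (tensor R (tensor R W H) P) Q (lt H (tensor R W H) P (pure_tensor R W H w)) (wten H B P Q s (v a))"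
    using w by (simp add: lt_comp flip: eq)
  also have "\<dots> = wten (tensor R W H) B P Q s (lt H (tensor R W H) B (pure_tensor R W H w) (v a))"
    using w by (simp add: wten_lt)
  also have "\<dots> = ?r (pure_tensor R W A w a)"
    using w by simp
  finally show "?l (pure_tensor R W A w a) = ?r (pure_tensor R W A w a)" .
qed (simp_all add: t)

context
  fixes C :: "('r, 'c, 'z) coalgebra_scheme"
  assumes coalg: "coalg C"
begin

lemma coalgD [simp]: "module R C" "lin R C (tensor R C C) (comult C)" "lin R C (regular_module R) (counit C)"
  using coalg by (auto simp: coalg_def)

lemma comult_closed [simp]: "c \<in> carrier C \<Longrightarrow> comult C c \<in> carrier (tensor R C C)"
  by (rule lin_closed[OF coalgD(2)])

lemma rcomod_regular: "rcomod C C (comult C)"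
  using coalg by (simp add: coalg_def rcomod_def)

lemma rcomod_closed: "rcomod C M \<rho> \<Longrightarrow> x \<in> carrier M \<Longrightarrow> \<rho> x \<in> carrier (tensor R M C)"
  by (auto simp: rcomod_def intro: lin_closed)

lemma rcomod_tensor:
  assumes W [simp]: "module R W" and M: "rcomod C M \<rho>"
  shows "rcomod C (tensor R W M) (wten W M M C \<rho>)"
proof -
  have M' [simp]: "module R M" "lin R M (tensor R M C) \<rho>" and closed: "\<And>x. x \<in> carrier M \<Longrightarrow> \<rho> x \<in> carrier (tensor R M C)"
    using M by (auto simp: rcomod_def intro: lin_closed)
  have "contract (tensor R W M) C (counit C) (wten W M M C \<rho> t) = t" if t: "t \<in> carrier (tensor R W M)" for t
  proof (rule tensor_ext[where f = "\<lambda>t. contract (tensor R W M) C (counit C) (wten W M M C \<rho> t)" and g = "\<lambda>t. t" and t = t])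
    show "lin R (tensor R W M) (tensor R W M) (\<lambda>t. contract (tensor R W M) C (counit C) (wten W M M C \<rho> t))"
      by (rule lin_comp[OF lin_wten lin_contract]) simp_all
    fix w m assume w: "w \<in> carrier W" "m \<in> carrier M"
    then show "contract (tensor R W M) C (counit C) (wten W M M C \<rho> (pure_tensor R W M w m)) = pure_tensor R W M w m"
      using M closed by (simp add: contract_lt rcomod_def)
  qed (simp_all add: t)
  moreover have "lt (tensor R W M) (tensor R (tensor R W M) C) C (wten W M M C \<rho>) (wten W M M C \<rho> t) =
      wten (tensor R W M) C C C (comult C) (wten W M M C \<rho> t)" if "t \<in> carrier (tensor R W M)" for t
    by (rule wten_assoc) (use M that in \<open>simp_all add: rcomod_def\<close>)
  ultimately show ?thesis by (simp add: rcomod_def)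
qed

lemma colin_lt:
  assumes "module R V" "module R V'" "rcomod C M \<rho>" "lin R V V' f"
  shows "colin C (tensor R V M) (wten V M M C \<rho>) (tensor R V' M) (wten V' M M C \<rho>) (lt V V' M f)"
  using assms by (simp add: colin_def rcomod_def wten_lt)

lemma colin_rt:
  assumes [simp]: "module R W" and M: "rcomod C M \<rho>" and N: "rcomod C N \<sigma>" and f: "colin C M \<rho> N \<sigma> f"
  shows "colin C (tensor R W M) (wten W M M C \<rho>) (tensor R W N) (wten W N N C \<sigma>) (rt W M N f)"
  unfolding colin_def
proof (intro conjI ballI)
  have [simp]: "module R M" "module R N" "lin R M N f" "lin R M (tensor R M C) \<rho>" "lin R N (tensor R N C) \<sigma>"
    using M N f by (auto simp: rcomod_def colin_def)
  show "lin R (tensor R W M) (tensor R W N) (rt W M N f)" by simp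
  fix t assume t: "t \<in> carrier (tensor R W M)"
  have "lt (tensor R W M) (tensor R W N) C (rt W M N f) (wten W M M C \<rho> t) = wten W M N C (\<lambda>m. lt M N C f (\<rho> m)) t"
    using t by (simp add: lt_wten)
  also have "\<dots> = wten W M N C (\<lambda>m. \<sigma> (f m)) t"
    by (rule fun_cong[OF wten_cong]) (use f in \<open>simp_all add: colin_def\<close>)
  also have "\<dots> = wten W N N C \<sigma> (rt W M N f t)"
    using t by (simp add: wten_rt)
  finally show "lt (tensor R W M) (tensor R W N) C (rt W M N f) (wten W M M C \<rho> t) = wten W N N C \<sigma> (rt W M N f t)" .
qed

lemma colin_coaction:
  assumes "rcomod C M \<rho>"
  shows "colin C M \<rho> (tensor R M C) (wten M C C C (comult C)) \<rho>"
  using assms by (simp add: rcomod_def colin_def)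

text \<open>
  The coaction of \<open>S\<close> is that of \<open>M\<close>, pulled back along the injection \<open>i \<otimes> C\<close>; coassociativity is
  inherited because \<open>i \<otimes> C \<otimes> C\<close> is injective too. For flat \<open>C\<close> these conditions are automatic. In the
  version for left comodules below they also hold, for any \<open>C\<close>, if \<open>i\<close> is bijective, which transports
  structures along isomorphisms.
\<close>

lemma rcomod_sub:
  assumes M: "rcomod C M \<rho>" and S [simp]: "module R S" and i [simp]: "lin R S M i" and inj: "inj_on i (carrier S)"
    and inj1: "inj_on (lt S M C i) (carrier (tensor R S C))"
    and inj2: "inj_on (lt (tensor R S C) (tensor R M C) C (lt S M C i)) (carrier (tensor R (tensor R S C) C))"
    and im: "\<And>s. s \<in> carrier S \<Longrightarrow> \<rho> (i s) \<in> lt S M C i ` carrier (tensor R S C)"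
  shows "\<exists>\<sigma>. rcomod C S \<sigma> \<and> colin C S \<sigma> M \<rho> i"
proof -
  interpret S: module R S by (rule S)
  have M' [simp]: "module R M" "lin R M (tensor R M C) \<rho>" using M by (auto simp: rcomod_def)
  interpret SC: module R "tensor R S C" by simp
  have \<rho>: "\<And>x. x \<in> carrier M \<Longrightarrow> lt M (tensor R M C) C \<rho> (\<rho> x) = wten M C C C (comult C) (\<rho> x)"
    "\<And>x. x \<in> carrier M \<Longrightarrow> contract M C (counit C) (\<rho> x) = x"
    using M by (auto simp: rcomod_def)
  have closed [simp]: "i s \<in> carrier M" if "s \<in> carrier S" for s using that by (simp add: lin_closed[OF i])
  define \<sigma> where "\<sigma> s = inv_into (carrier (tensor R S C)) (lt S M C i) (\<rho> (i s))" for s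
  have \<sigma> [simp]: "\<sigma> s \<in> carrier (tensor R S C)" "lt S M C i (\<sigma> s) = \<rho> (i s)" if "s \<in> carrier S" for s
    unfolding \<sigma>_def by (rule inv_into_into[OF im[OF that]], rule f_inv_into_f[OF im[OF that]])
  have lin\<sigma> [simp]: "lin R S (tensor R S C) \<sigma>"
  proof (rule linI)
    fix x y assume xy: "x \<in> carrier S" "y \<in> carrier S"
    show "\<sigma> (x \<oplus>\<^bsub>S\<^esub> y) = \<sigma> x \<oplus>\<^bsub>tensor R S C\<^esub> \<sigma> y"
      by (rule inj_onD[OF inj1])
        (use xy in \<open>simp_all add: lin_add[OF i] lin_add[OF M'(2)] lin_add[OF lin_lt[OF S M'(1) coalgD(1) i]]\<close>)
  next
    fix r x assume xy: "r \<in> carrier R" "x \<in> carrier S"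
    show "\<sigma> (r \<odot>\<^bsub>S\<^esub> x) = r \<odot>\<^bsub>tensor R S C\<^esub> \<sigma> x"
      by (rule inj_onD[OF inj1])
        (use xy in \<open>simp_all add: lin_smult[OF i] lin_smult[OF M'(2)] lin_smult[OF lin_lt[OF S M'(1) coalgD(1) i]]\<close>)
  qed simp
  have "lt S (tensor R S C) C \<sigma> (\<sigma> s) = wten S C C C (comult C) (\<sigma> s)" if s: "s \<in> carrier S" for s
  proof (rule inj_onD[OF inj2])
    have "lt (tensor R S C) (tensor R M C) C (lt S M C i) (lt S (tensor R S C) C \<sigma> (\<sigma> s)) =
        lt S (tensor R M C) C (\<lambda>s. lt S M C i (\<sigma> s)) (\<sigma> s)"
      using s by (simp add: lt_comp)
    also have "\<dots> = lt S (tensor R M C) C (\<lambda>s. \<rho> (i s)) (\<sigma> s)"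
      by (rule fun_cong[OF lt_cong]) simp
    also have "\<dots> = lt M (tensor R M C) C \<rho> (lt S M C i (\<sigma> s))"
      using s by (subst lt_comp) simp_all
    also have "\<dots> = lt (tensor R S C) (tensor R M C) C (lt S M C i) (wten S C C C (comult C) (\<sigma> s))"
      using s by (simp add: \<rho> wten_lt)
    finally show "lt (tensor R S C) (tensor R M C) C (lt S M C i) (lt S (tensor R S C) C \<sigma> (\<sigma> s)) =
      lt (tensor R S C) (tensor R M C) C (lt S M C i) (wten S C C C (comult C) (\<sigma> s))" .
  qed (use s in simp_all)
  moreover have "contract S C (counit C) (\<sigma> s) = s" if s: "s \<in> carrier S" for s
    by (rule inj_onD[OF inj]) (use s in \<open>simp_all add: \<rho> flip: contract_lt[where M = S and N = M]\<close>)
  ultimately have "rcomod C S \<sigma>" by (simp add: rcomod_def)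
  then show ?thesis by (auto simp: colin_def)
qed

lemma lcomod_sub:
  assumes M: "lcomod C M \<rho>" and S [simp]: "module R S" and i [simp]: "lin R S M i" and inj: "inj_on i (carrier S)"
    and inj1: "inj_on (rt C S M i) (carrier (tensor R C S))"
    and inj2: "inj_on (rt (tensor R C C) S M i) (carrier (tensor R (tensor R C C) S))"
    and im: "\<And>s. s \<in> carrier S \<Longrightarrow> \<rho> (i s) \<in> rt C S M i ` carrier (tensor R C S)"
  shows "\<exists>\<sigma>. lcomod C S \<sigma> \<and> (\<forall>s\<in>carrier S. rt C S M i (\<sigma> s) = \<rho> (i s))"
proof -
  interpret S: module R S by (rule S)
  have M' [simp]: "module R M" "lin R M (tensor R C M) \<rho>" using M by (auto simp: lcomod_def)
  interpret SC: module R "tensor R C S" by simp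
  have \<rho>: "\<And>x. x \<in> carrier M \<Longrightarrow> lt C (tensor R C C) M (comult C) (\<rho> x) = wten C M C M \<rho> (\<rho> x)"
    "\<And>x. x \<in> carrier M \<Longrightarrow> contract M C (counit C) (tswap C M (\<rho> x)) = x"
    using M by (auto simp: lcomod_def)
  have closed [simp]: "i s \<in> carrier M" if "s \<in> carrier S" for s using that by (simp add: lin_closed[OF i])
  define \<sigma> where "\<sigma> s = inv_into (carrier (tensor R C S)) (rt C S M i) (\<rho> (i s))" for s
  have \<sigma> [simp]: "\<sigma> s \<in> carrier (tensor R C S)" "rt C S M i (\<sigma> s) = \<rho> (i s)" if "s \<in> carrier S" for s
    unfolding \<sigma>_def by (rule inv_into_into[OF im[OF that]], rule f_inv_into_f[OF im[OF that]])
  have lin\<sigma> [simp]: "lin R S (tensor R C S) \<sigma>"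
  proof (rule linI)
    fix x y assume xy: "x \<in> carrier S" "y \<in> carrier S"
    show "\<sigma> (x \<oplus>\<^bsub>S\<^esub> y) = \<sigma> x \<oplus>\<^bsub>tensor R C S\<^esub> \<sigma> y"
      by (rule inj_onD[OF inj1])
        (use xy in \<open>simp_all add: lin_add[OF i] lin_add[OF M'(2)] lin_add[OF lin_rt[OF S M'(1) coalgD(1) i]]\<close>)
  next
    fix r x assume xy: "r \<in> carrier R" "x \<in> carrier S"
    show "\<sigma> (r \<odot>\<^bsub>S\<^esub> x) = r \<odot>\<^bsub>tensor R C S\<^esub> \<sigma> x"
      by (rule inj_onD[OF inj1])
        (use xy in \<open>simp_all add: lin_smult[OF i] lin_smult[OF M'(2)] lin_smult[OF lin_rt[OF S M'(1) coalgD(1) i]]\<close>)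
  qed simp
  have "lt C (tensor R C C) S (comult C) (\<sigma> s) = wten C S C S \<sigma> (\<sigma> s)" if s: "s \<in> carrier S" for s
  proof (rule inj_onD[OF inj2])
    have "rt (tensor R C C) S M i (wten C S C S \<sigma> (\<sigma> s)) = wten C S C M (\<lambda>s. rt C S M i (\<sigma> s)) (\<sigma> s)"
      using s by (simp add: rt_wten)
    also have "\<dots> = wten C S C M (\<lambda>s. \<rho> (i s)) (\<sigma> s)"
      by (rule fun_cong[OF wten_cong]) simp_all
    also have "\<dots> = wten C M C M \<rho> (rt C S M i (\<sigma> s))"
      using s by (subst wten_rt) simp_all
    also have "\<dots> = rt (tensor R C C) S M i (lt C (tensor R C C) S (comult C) (\<sigma> s))"
      using s by (simp add: \<rho> flip: lt_rt)
    finally show "rt (tensor R C C) S M i (lt C (tensor R C C) S (comult C) (\<sigma> s)) =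
      rt (tensor R C C) S M i (wten C S C S \<sigma> (\<sigma> s))" by simp
  qed (use s in simp_all)
  moreover have "contract S C (counit C) (tswap C S (\<sigma> s)) = s" if s: "s \<in> carrier S" for s
    by (rule inj_onD[OF inj]) (use s in \<open>simp_all add: \<rho> flip: contract_lt[where M = S and N = M] tswap_rt\<close>)
  ultimately have "lcomod C S \<sigma>" by (simp add: lcomod_def)
  then show ?thesis by auto
qed

text \<open>
  The coaction \<open>\<rho>\<close> descends along a surjection if \<open>(p \<otimes> C) \<rho>\<close> vanishes on the kernel. With
  trivial kernel this transports comodule structures along isomorphisms.
\<close>

lemma rcomod_quotient:
  assumes A: "rcomod C A \<rho>" and P [simp]: "module R P" and p [simp]: "lin R A P p" and surj: "p ` carrier A = carrier P"
    and ker: "\<And>a. a \<in> carrier A \<Longrightarrow> p a = \<zero>\<^bsub>P\<^esub> \<Longrightarrow> lt A P C p (\<rho> a) = \<zero>\<^bsub>tensor R P C\<^esub>"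
  shows "\<exists>\<sigma>. rcomod C P \<sigma> \<and> colin C A \<rho> P \<sigma> p"
proof -
  have A' [simp]: "module R A" "lin R A (tensor R A C) \<rho>" using A by (auto simp: rcomod_def)
  interpret A: module R A by simp
  interpret P: module R P by simp
  interpret PC: module R "tensor R P C" by simp
  have \<rho>: "\<And>x. x \<in> carrier A \<Longrightarrow> lt A (tensor R A C) C \<rho> (\<rho> x) = wten A C C C (comult C) (\<rho> x)"
    "\<And>x. x \<in> carrier A \<Longrightarrow> contract A C (counit C) (\<rho> x) = x"
    using A by (auto simp: rcomod_def)
  have closed [simp]: "p s \<in> carrier P" "\<rho> s \<in> carrier (tensor R A C)" if "s \<in> carrier A" for s
    using that by (simp_all add: lin_closed[OF p] lin_closed[OF A'(2)])
  note lk = lin_comp[OF A'(2) lin_lt[OF A'(1) P coalgD(1) p]]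
  define \<sigma> where "\<sigma> y = lt A P C p (\<rho> (inv_into (carrier A) p y))" for y
  have \<sigma>p: "\<sigma> (p a) = lt A P C p (\<rho> a)" if a: "a \<in> carrier A" for a
  proof -
    let ?b = "inv_into (carrier A) p (p a)"
    have b: "?b \<in> carrier A" "p ?b = p a" using a by (auto intro: inv_into_into f_inv_into_f)
    then have "p (?b \<ominus>\<^bsub>A\<^esub> a) = \<zero>\<^bsub>P\<^esub>"
      using a by (simp add: lin_diff[OF A'(1) P p] P.minus_eq P.r_neg)
    then have "lt A P C p (\<rho> (?b \<ominus>\<^bsub>A\<^esub> a)) = \<zero>\<^bsub>tensor R P C\<^esub>"
      using a b by (intro ker) auto
    then have "lt A P C p (\<rho> ?b) \<ominus>\<^bsub>tensor R P C\<^esub> lt A P C p (\<rho> a) = \<zero>\<^bsub>tensor R P C\<^esub>"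
      using lin_diff[OF A'(1) PC.module_axioms lk b(1) a] by simp
    from diff_zero_imp_eq[OF PC.module_axioms _ _ this] show ?thesis
      unfolding \<sigma>_def using a b by simp
  qed
  have ex: "\<exists>a\<in>carrier A. y = p a" if "y \<in> carrier P" for y using that surj by auto
  have lin\<sigma> [simp]: "lin R P (tensor R P C) \<sigma>"
  proof (rule linI)
    fix x assume "x \<in> carrier P"
    then show "\<sigma> x \<in> carrier (tensor R P C)" using ex \<sigma>p by (metis lin_closed[OF lk])
  next
    fix x y assume "x \<in> carrier P" "y \<in> carrier P"
    then obtain a b where ab: "a \<in> carrier A" "b \<in> carrier A" "x = p a" "y = p b" using ex by metis
    then show "\<sigma> (x \<oplus>\<^bsub>P\<^esub> y) = \<sigma> x \<oplus>\<^bsub>tensor R P C\<^esub> \<sigma> y"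
      using lin_add[OF lk] by (simp add: \<sigma>p flip: lin_add[OF p])
  next
    fix r x assume r: "r \<in> carrier R" and "x \<in> carrier P"
    then obtain a where ab: "a \<in> carrier A" "x = p a" using ex by metis
    then show "\<sigma> (r \<odot>\<^bsub>P\<^esub> x) = r \<odot>\<^bsub>tensor R P C\<^esub> \<sigma> x"
      using lin_smult[OF lk] r by (simp add: \<sigma>p flip: lin_smult[OF p])
  qed
  have "lt P (tensor R P C) C \<sigma> (\<sigma> y) = wten P C C C (comult C) (\<sigma> y)" if y: "y \<in> carrier P" for y
  proof -
    obtain a where a: "a \<in> carrier A" "y = p a" using ex[OF y] by metis
    have "lt P (tensor R P C) C \<sigma> (\<sigma> y) = lt A (tensor R P C) C (\<lambda>a. \<sigma> (p a)) (\<rho> a)"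
      using a by (simp add: \<sigma>p lt_comp)
    also have "\<dots> = lt A (tensor R P C) C (\<lambda>a. lt A P C p (\<rho> a)) (\<rho> a)"
      by (rule fun_cong[OF lt_cong]) (simp add: \<sigma>p)
    also have "\<dots> = lt (tensor R A C) (tensor R P C) C (lt A P C p) (lt A (tensor R A C) C \<rho> (\<rho> a))"
      using a by (subst lt_comp) simp_all
    also have "\<dots> = wten P C C C (comult C) (\<sigma> y)"
      using a by (simp add: \<rho> wten_lt \<sigma>p)
    finally show ?thesis .
  qed
  moreover have "contract P C (counit C) (\<sigma> y) = y" if y: "y \<in> carrier P" for y
  proof -
    obtain a where a: "a \<in> carrier A" "y = p a" using ex[OF y] by metis
    then show ?thesis by (simp add: \<sigma>p contract_lt \<rho>)
  qed
  ultimately have "rcomod C P \<sigma>" by (simp add: rcomod_def)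
  moreover have "colin C A \<rho> P \<sigma> p" by (simp add: colin_def \<sigma>p)
  ultimately show ?thesis by blast
qed

end

end

section \<open>Modules in the universe\<close>

locale small_ring = over_ring R for R :: "('r, 'x) ring_scheme" (structure) +
  fixes U :: "'u itself"
  assumes universe: "universe_for U R"
begin

text \<open>
  Small modules are those with a copy in the universe \<open>'u\<close>. They are closed under tensor products,
  subsets and images, and contain the ring and all modules of functions from the ring to small sets.
\<close>

definition small :: "('m, 'y) partial_object_scheme \<Rightarrow> bool"
  where "small M \<longleftrightarrow> carrier M \<lesssim> (UNIV :: 'u set)"

lemma infinite_universe: "infinite (UNIV :: 'u set)"
  using universe by (simp add: universe_for_def)

lemma universe_square: "(UNIV :: 'u set) \<times> (UNIV :: 'u set) \<lesssim> (UNIV :: 'u set)"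
  using card_of_Times_same_infinite[OF infinite_universe]
  by (intro eqpoll_imp_lepoll) (simp only: eqpoll_iff_card_of_ordIso)

lemma small_UNIV [simp]: "small (M :: ('u, 'y) partial_object_scheme)"
  by (simp add: small_def subset_imp_lepoll)

lemma small_subset: "small M \<Longrightarrow> carrier S \<subseteq> carrier M \<Longrightarrow> small S"
  unfolding small_def by (rule lepoll_trans[OF subset_imp_lepoll])

lemma small_image: "small M \<Longrightarrow> carrier P = p ` carrier M \<Longrightarrow> small P"
  unfolding small_def by (metis image_lepoll lepoll_trans)

lemma free_Abelian_group_lepoll: "carrier (free_Abelian_group A) \<lesssim> Fpow (A \<times> (UNIV :: int set))"
proof -
  have "carrier (free_Abelian_group A) \<lesssim> {f. f ` A \<subseteq> (UNIV :: int set) \<and> {x. f x \<noteq> 0} \<subseteq> A \<and> finite {x. f x \<noteq> 0}}"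
    unfolding lepoll_def
    by (intro exI[of _ Poly_Mapping.lookup])
      (auto simp: poly_mapping_eqI lookup_not_eq_zero_eq_in_keys intro: inj_onI)
  then show ?thesis
    by (rule lepoll_trans[OF _ lepoll_restricted_funspace[where k = "\<lambda>_. 0"]])
qed

lemma small_tensor_product [simp]:
  assumes M: "module R M" "small M" and N: "module R N" "small N"
  shows "small (tensor R M N)"
proof -
  interpret M: module R M by (rule M)
  interpret N: module R N by (rule N)
  let ?A = "carrier M \<times> carrier N"
  have "carrier (tensor R M N) \<lesssim> carrier (free_Abelian_group ?A)"
    unfolding carrier_tensor[OF M(1) N(1)] by (rule image_lepoll)
  also have "\<dots> \<lesssim> Fpow (?A \<times> (UNIV :: int set))"
    by (rule free_Abelian_group_lepoll)
  also have "\<dots> \<lesssim> ?A \<times> (UNIV :: int set)"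
  proof (rule eqpoll_imp_lepoll[OF eqpoll_Fpow])
    have "?A \<noteq> {}" using M.zero_closed N.zero_closed by blast
    then show "infinite (?A \<times> (UNIV :: int set))"
      by (metis finite_cartesian_productD2 infinite_UNIV_int)
  qed
  also have "\<dots> \<lesssim> ((UNIV :: 'u set) \<times> (UNIV :: 'u set)) \<times> (UNIV :: 'u set)"
  proof (intro times_lepoll_mono)
    have "(UNIV :: int set) \<lesssim> (UNIV :: nat set)"
      using inj_to_nat[where 'a = int] by (auto simp: lepoll_def)
    also have "\<dots> \<lesssim> (UNIV :: 'u set)"
      using infinite_universe by (simp add: infinite_le_lepoll)
    finally show "(UNIV :: int set) \<lesssim> (UNIV :: 'u set)" .
  qed (use M N in \<open>auto simp: small_def\<close>)
  also have "\<dots> \<lesssim> (UNIV :: 'u set) \<times> (UNIV :: 'u set)"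
    by (intro times_lepoll_mono universe_square lepoll_refl)
  also have "\<dots> \<lesssim> (UNIV :: 'u set)"
    by (rule universe_square)
  finally show ?thesis by (simp add: small_def)
qed

lemma functions_lepoll: "(carrier R \<rightarrow>\<^sub>E (UNIV :: 'u set)) \<lesssim> (UNIV :: 'u set)"
  using universe by (simp add: universe_for_def)

lemma small_regular [simp]: "small (regular_module R)"
proof -
  obtain a b :: 'u where ab: "a \<noteq> b"
    using infinite_universe by (metis (full_types) finite.simps UNIV_eq_I singleton_iff)
  \<comment> \<open>the characteristic functions of points, with two distinct elements of the universe as values\<close>
  have "carrier R \<lesssim> (carrier R \<rightarrow>\<^sub>E (UNIV :: 'u set))"
    unfolding lepoll_def
  proof (intro exI conjI)
    show "inj_on (\<lambda>r. \<lambda>s\<in>carrier R. if s = r then a else b) (carrier R)"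
    proof (rule inj_onI)
      fix r s assume rs: "r \<in> carrier R" "s \<in> carrier R"
        "(\<lambda>t\<in>carrier R. if t = r then a else b) = (\<lambda>t\<in>carrier R. if t = s then a else b)"
      from fun_cong[OF rs(3), of r] have "a = (if r = s then a else b)" using rs(1) by simp
      then show "r = s" using ab by (metis (full_types))
    qed
  qed auto
  then show ?thesis
    using functions_lepoll lepoll_trans by (auto simp: small_def)
qed

section \<open>Copies inside the universe\<close>

lemma small_inj_inj: "small M \<Longrightarrow> inj_on (small_inj M :: 'm \<Rightarrow> 'u) (carrier M)"
  unfolding small_def lepoll_def small_inj_def
  by (metis (mono_tags, lifting) inj_on_restrict_eq someI_ex)

context
  fixes M :: "('r, 'm, 'y) module_scheme"
  assumes M: "module R M" and small: "small M"
begin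

interpretation M: module R M by (rule M)

lemma carrier_small_copy: "carrier (small_copy M :: ('r, 'u) module) = small_inj M ` carrier M"
  by (simp add: small_copy_def Let_def)

lemma small_copy_bij: "bij_betw (small_inj M) (carrier M) (carrier (small_copy M :: ('r, 'u) module))"
  using small_inj_inj[OF small] by (simp add: bij_betw_def carrier_small_copy)

lemma lin_small_inj: "lin R M (small_copy M :: ('r, 'u) module) (small_inj M)"
  using small_inj_inj[OF small]
  by (intro linI) (auto simp: small_copy_def Let_def)

lemma module_small_copy: "module R (small_copy M :: ('r, 'u) module)"
proof -
  let ?j = "small_inj M :: 'm \<Rightarrow> 'u" and ?N = "small_copy M :: ('r, 'u) module"
  have c: "carrier ?N = ?j ` carrier M" by (rule carrier_small_copy)
  have z: "\<zero>\<^bsub>?N\<^esub> = ?j \<zero>\<^bsub>M\<^esub>" by (simp add: small_copy_def Let_def)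
  have a: "?j x \<oplus>\<^bsub>?N\<^esub> ?j y = ?j (x \<oplus>\<^bsub>M\<^esub> y)" if "x \<in> carrier M" "y \<in> carrier M" for x y
    using lin_add[OF lin_small_inj that] by simp
  have s: "r \<odot>\<^bsub>?N\<^esub> ?j x = ?j (r \<odot>\<^bsub>M\<^esub> x)" if "x \<in> carrier M" "r \<in> carrier R" for x r
    using lin_smult[OF lin_small_inj that(2,1)] by simp
  show ?thesis
  proof (rule moduleI)
    show "abelian_group ?N"
    proof (rule abelian_groupI)
      fix y assume "y \<in> carrier ?N"
      then obtain x where x: "x \<in> carrier M" "y = ?j x" by (auto simp: c)
      then have "?j (\<ominus>\<^bsub>M\<^esub> x) \<oplus>\<^bsub>?N\<^esub> y = \<zero>\<^bsub>?N\<^esub>" by (simp add: a z M.l_neg)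
      then show "\<exists>z\<in>carrier ?N. z \<oplus>\<^bsub>?N\<^esub> y = \<zero>\<^bsub>?N\<^esub>" using x c by blast
    qed (auto simp: c z a M.a_ac)
  qed (auto simp: c a s cring_axioms M.smult_l_distr M.smult_r_distr M.smult_assoc1)
qed

lemma small_copy_inverse:
  obtains k where "lin R (small_copy M :: ('r, 'u) module) M k" "\<And>x. x \<in> carrier M \<Longrightarrow> k (small_inj M x) = x"
    "\<And>y. y \<in> carrier (small_copy M :: ('r, 'u) module) \<Longrightarrow> small_inj M (k y) = y"
  using lin_inverse[OF M module_small_copy lin_small_inj small_copy_bij] small_copy_bij
  by (meson bij_betw_inv_into_left bij_betw_inv_into_right)

end

section \<open>Submodules and quotients\<close>

lemma submodule_kernel:
  assumes "module R A" "module R B" "lin R A B f"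
  shows "submodule {x \<in> carrier A. f x = \<zero>\<^bsub>B\<^esub>} R A"
proof -
  interpret A: module R A by fact
  interpret B: module R B by fact
  show ?thesis
    by (rule A.submoduleI)
      (auto simp: lin_zero[OF assms] lin_minus[OF assms] lin_add[OF assms(3)] lin_smult[OF assms(3)])
qed

lemma submodule_image:
  assumes "module R A" "module R B" "lin R A B f"
  shows "submodule (f ` carrier A) R B"
proof -
  interpret A: module R A by fact
  interpret B: module R B by fact
  show ?thesis
  proof (rule B.submoduleI)
    show "f ` carrier A \<subseteq> carrier B" using lin_closed[OF assms(3)] by auto
    show "\<zero>\<^bsub>B\<^esub> \<in> f ` carrier A" using lin_zero[OF assms] A.zero_closed by (metis imageI)
  next
    fix b assume "b \<in> f ` carrier A"
    then show "\<ominus>\<^bsub>B\<^esub> b \<in> f ` carrier A"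
      by (auto simp flip: lin_minus[OF assms])
  next
    fix a b assume "a \<in> f ` carrier A" "b \<in> f ` carrier A"
    then show "a \<oplus>\<^bsub>B\<^esub> b \<in> f ` carrier A"
      by (auto simp flip: lin_add[OF assms(3)])
  next
    fix r b assume "r \<in> carrier R" "b \<in> f ` carrier A"
    then show "r \<odot>\<^bsub>B\<^esub> b \<in> f ` carrier A"
      by (auto simp flip: lin_smult[OF assms(3)])
  qed
qed

lemma
  assumes "module R A" "submodule S R A"
  shows module_submodule: "module R (A\<lparr>carrier := S\<rparr>)"
    and lin_submodule_incl: "lin R (A\<lparr>carrier := S\<rparr>) A (\<lambda>x. x)"
  using submodule.submodule_is_module[OF assms(2,1)] module.submoduleE(1)[OF assms]
  by (auto simp: lin_def)

text \<open>
  The quotient is realized on a system of representatives, the values of \<open>p\<close>, instead of cosets: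
  in this way a quotient of a module in the universe is again in the universe.
\<close>

lemma quotient_module:
  fixes A :: "('r, 'm, 'y) module_scheme"
  assumes A: "module R A" and S: "submodule S R A"
  shows "\<exists>(P :: ('r, 'm) module) p. module R P \<and> lin R A P p \<and> p ` carrier A = carrier P \<and>
    {x \<in> carrier A. p x = \<zero>\<^bsub>P\<^esub>} = S"
proof -
  interpret A: module R A by fact
  note SE = A.submoduleE[OF S]
  have S0: "\<zero>\<^bsub>A\<^esub> \<in> S"
    using S by (auto simp: submodule_def dest: subgroup.one_closed)
  have Sm: "x \<ominus>\<^bsub>A\<^esub> y \<in> S" if "x \<in> S" "y \<in> S" for x y
    using that SE by (simp add: A.minus_eq)
  define p where "p x = (SOME y. y \<in> carrier A \<and> x \<ominus>\<^bsub>A\<^esub> y \<in> S)" for x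
  have p: "p x \<in> carrier A" "x \<ominus>\<^bsub>A\<^esub> p x \<in> S" if "x \<in> carrier A" for x
    using someI[of "\<lambda>y. y \<in> carrier A \<and> x \<ominus>\<^bsub>A\<^esub> y \<in> S" x] that S0
    by (auto simp: p_def A.minus_eq A.r_neg)
  have peq: "p x = p y" if "x \<in> carrier A" "y \<in> carrier A" "x \<ominus>\<^bsub>A\<^esub> y \<in> S" for x y
  proof -
    have "x \<ominus>\<^bsub>A\<^esub> z \<in> S \<longleftrightarrow> y \<ominus>\<^bsub>A\<^esub> z \<in> S" if z: "z \<in> carrier A" for z
    proof -
      have "y \<ominus>\<^bsub>A\<^esub> z = (x \<ominus>\<^bsub>A\<^esub> z) \<ominus>\<^bsub>A\<^esub> (x \<ominus>\<^bsub>A\<^esub> y)" "x \<ominus>\<^bsub>A\<^esub> z = (x \<ominus>\<^bsub>A\<^esub> y) \<oplus>\<^bsub>A\<^esub> (y \<ominus>\<^bsub>A\<^esub> z)"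
        using that \<open>x \<in> _\<close> \<open>y \<in> _\<close>
        by (simp_all add: A.minus_eq A.minus_add A.a_ac A.r_neg1 A.r_neg2 A.r_neg A.l_neg)
      then show ?thesis using Sm[of "x \<ominus>\<^bsub>A\<^esub> z" "x \<ominus>\<^bsub>A\<^esub> y"] SE(5)[of "x \<ominus>\<^bsub>A\<^esub> y" "y \<ominus>\<^bsub>A\<^esub> z"] that(1) \<open>x \<ominus>\<^bsub>A\<^esub> y \<in> S\<close> by auto
    qed
    then show ?thesis unfolding p_def by (intro arg_cong[where f = Eps]) auto
  qed
  have peqD: "x \<ominus>\<^bsub>A\<^esub> y \<in> S" if "x \<in> carrier A" "y \<in> carrier A" "p x = p y" for x y
  proof -
    have "x \<ominus>\<^bsub>A\<^esub> y = (x \<ominus>\<^bsub>A\<^esub> z) \<oplus>\<^bsub>A\<^esub> (z \<ominus>\<^bsub>A\<^esub> y)"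
      and "z \<ominus>\<^bsub>A\<^esub> y = \<ominus>\<^bsub>A\<^esub> (y \<ominus>\<^bsub>A\<^esub> z)" if "z \<in> carrier A" for z
      using that \<open>x \<in> _\<close> \<open>y \<in> _\<close>
      by (simp_all add: A.minus_eq A.a_assoc A.r_neg1, simp add: A.minus_add A.a_comm)
    note eq = this[OF p(1)[OF that(1)]]
    have "\<ominus>\<^bsub>A\<^esub> (y \<ominus>\<^bsub>A\<^esub> p x) \<in> S" using SE(3) p(2)[OF that(2)] that(3) by simp
    then show ?thesis using SE(5) p(2)[OF that(1)] eq by simp
  qed
  have padd: "p (p x \<oplus>\<^bsub>A\<^esub> p y) = p (x \<oplus>\<^bsub>A\<^esub> y)" if "x \<in> carrier A" "y \<in> carrier A" for x y
  proof (rule peq[symmetric])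
    have "x \<oplus>\<^bsub>A\<^esub> y \<ominus>\<^bsub>A\<^esub> (p x \<oplus>\<^bsub>A\<^esub> p y) = (x \<ominus>\<^bsub>A\<^esub> p x) \<oplus>\<^bsub>A\<^esub> (y \<ominus>\<^bsub>A\<^esub> p y)"
      using that p by (simp add: A.minus_eq A.minus_add A.a_ac)
    then show "x \<oplus>\<^bsub>A\<^esub> y \<ominus>\<^bsub>A\<^esub> (p x \<oplus>\<^bsub>A\<^esub> p y) \<in> S" using SE(5) p that by simp
  qed (use that p in auto)
  have psm: "p (r \<odot>\<^bsub>A\<^esub> p x) = p (r \<odot>\<^bsub>A\<^esub> x)" if "x \<in> carrier A" "r \<in> carrier R" for x r
  proof (rule peq[symmetric])
    have "r \<odot>\<^bsub>A\<^esub> x \<ominus>\<^bsub>A\<^esub> r \<odot>\<^bsub>A\<^esub> p x = r \<odot>\<^bsub>A\<^esub> (x \<ominus>\<^bsub>A\<^esub> p x)"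
      using that p by (simp add: A.minus_eq A.smult_r_distr A.smult_r_minus)
    then show "r \<odot>\<^bsub>A\<^esub> x \<ominus>\<^bsub>A\<^esub> r \<odot>\<^bsub>A\<^esub> p x \<in> S" using SE(4) p that by simp
  qed (use that p in auto)
  define P :: "('r, 'm) module" where "P = \<lparr>carrier = p ` carrier A, monoid.mult = undefined, one = undefined,
    ring.zero = p \<zero>\<^bsub>A\<^esub>, add = \<lambda>u v. p (u \<oplus>\<^bsub>A\<^esub> v), smult = \<lambda>r u. p (r \<odot>\<^bsub>A\<^esub> u)\<rparr>"
  have P: "carrier P = p ` carrier A" "\<zero>\<^bsub>P\<^esub> = p \<zero>\<^bsub>A\<^esub>" by (simp_all add: P_def)
  have Pa: "p x \<oplus>\<^bsub>P\<^esub> p y = p (x \<oplus>\<^bsub>A\<^esub> y)" if "x \<in> carrier A" "y \<in> carrier A" for x y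
    using padd[OF that] by (simp add: P_def)
  have Ps: "r \<odot>\<^bsub>P\<^esub> p x = p (r \<odot>\<^bsub>A\<^esub> x)" if "x \<in> carrier A" "r \<in> carrier R" for x r
    using psm[OF that] by (simp add: P_def)
  have "module R P"
  proof (rule moduleI)
    show "abelian_group P"
    proof (rule abelian_groupI)
      fix y assume "y \<in> carrier P"
      then obtain x where x: "x \<in> carrier A" "y = p x" by (auto simp: P)
      then have "p (\<ominus>\<^bsub>A\<^esub> x) \<oplus>\<^bsub>P\<^esub> y = \<zero>\<^bsub>P\<^esub>" by (simp add: Pa P A.l_neg)
      then show "\<exists>z\<in>carrier P. z \<oplus>\<^bsub>P\<^esub> y = \<zero>\<^bsub>P\<^esub>" using x P by blast
    qed (auto simp: P Pa A.a_ac)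
  qed (auto simp: P Pa Ps cring_axioms A.smult_l_distr A.smult_r_distr A.smult_assoc1)
  moreover have "lin R A P p"
    by (rule linI) (auto simp: P Pa Ps)
  moreover have "{x \<in> carrier A. p x = \<zero>\<^bsub>P\<^esub>} = S"
  proof -
    have "x \<in> S \<longleftrightarrow> p x = p \<zero>\<^bsub>A\<^esub>" if "x \<in> carrier A" for x
      using peq[of x "\<zero>\<^bsub>A\<^esub>"] peqD[of x "\<zero>\<^bsub>A\<^esub>"] that A.minus_equality[of "\<zero>\<^bsub>A\<^esub>" "\<zero>\<^bsub>A\<^esub>"]
      by (auto simp: A.minus_eq)
    then show ?thesis using SE(1) by (auto simp: P)
  qed
  ultimately show ?thesis using P by blast
qed

lemma lin_factor:
  assumes A: "module R A" and P: "module R P" and B: "module R B" and p: "lin R A P p" and surj: "p ` carrier A = carrier P"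
    and f: "lin R A B f" and ker: "\<And>x. x \<in> carrier A \<Longrightarrow> p x = \<zero>\<^bsub>P\<^esub> \<Longrightarrow> f x = \<zero>\<^bsub>B\<^esub>"
  shows "\<exists>g. lin R P B g \<and> (\<forall>x\<in>carrier A. g (p x) = f x)"
proof -
  interpret A: module R A by fact
  interpret B: module R B by fact
  interpret P: module R P by fact
  define g where "g y = f (inv_into (carrier A) p y)" for y
  have gp: "g (p x) = f x" if x: "x \<in> carrier A" for x
  proof -
    let ?b = "inv_into (carrier A) p (p x)"
    have b: "?b \<in> carrier A" "p ?b = p x" using x by (auto intro: inv_into_into f_inv_into_f)
    then have "p (?b \<ominus>\<^bsub>A\<^esub> x) = \<zero>\<^bsub>P\<^esub>"
      using x by (simp add: lin_diff[OF A P p] P.minus_eq P.r_neg lin_closed[OF p])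
    then have "f (?b \<ominus>\<^bsub>A\<^esub> x) = \<zero>\<^bsub>B\<^esub>"
      using x b by (intro ker) auto
    then have "f ?b \<ominus>\<^bsub>B\<^esub> f x = \<zero>\<^bsub>B\<^esub>"
      using lin_diff[OF A B f b(1) x] by simp
    from diff_zero_imp_eq[OF B _ _ this] show ?thesis
      unfolding g_def using x b by (simp add: lin_closed[OF f])
  qed
  have ex: "\<exists>a\<in>carrier A. y = p a" if "y \<in> carrier P" for y using that surj by auto
  have "lin R P B g"
  proof (rule linI)
    fix x assume "x \<in> carrier P"
    then show "g x \<in> carrier B" using ex gp by (metis lin_closed[OF f])
  next
    fix x y assume "x \<in> carrier P" "y \<in> carrier P"
    then obtain a b where ab: "a \<in> carrier A" "b \<in> carrier A" "x = p a" "y = p b" using ex by metis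
    then show "g (x \<oplus>\<^bsub>P\<^esub> y) = g x \<oplus>\<^bsub>B\<^esub> g y"
      using lin_add[OF f] by (simp add: gp flip: lin_add[OF p])
  next
    fix r x assume r: "r \<in> carrier R" and "x \<in> carrier P"
    then obtain a where ab: "a \<in> carrier A" "x = p a" using ex by metis
    then show "g (r \<odot>\<^bsub>P\<^esub> x) = r \<odot>\<^bsub>B\<^esub> g x"
      using lin_smult[OF f] r by (simp add: gp flip: lin_smult[OF p])
  qed
  then show ?thesis using gp by blast
qed

section \<open>Flat modules\<close>

context
  fixes C :: "('r, 'u, 'z) module_scheme"
  assumes flat: "flat_module R C"
begin

lemma flatD [simp]: "module R C"
  using flat by (simp add: flat_module_def)

lemma flat_exact:
  fixes A B D :: "('r, 'u) module"
  assumes "module R A" "module R B" "module R D" "lin R A B f" "lin R B D g" "short_exact A B D f g"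
  shows "short_exact (tensor R A C) (tensor R B C) (tensor R D C) (lt A B C f) (lt B D C g)"
proof -
  let ?f = "restrict f (carrier A)" and ?g = "restrict g (carrier B)"
  have "?f \<in> mod_hom R A B" "?g \<in> mod_hom R B D" "short_exact A B D ?f ?g"
    using assms by (simp_all add: mod_hom_iff lin_restrict short_exact_def inj_on_def cong: conj_cong)
  then have "short_exact (tensor R A C) (tensor R B C) (tensor R D C) (lt A B C ?f) (lt B D C ?g)"
    using flat assms unfolding flat_module_def exact_functor_def
    by (simp add: Mod_cat_def tensor_functor_def)
  moreover have "lt A B C ?f = lt A B C f" "lt B D C ?g = lt B D C g"
    by (rule lt_cong; simp)+
  ultimately show ?thesis by simp
qed

text \<open>
  Flatness is stated for short exact sequences in the universe, so a monomorphism has to be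
  completed by its cokernel; afterwards the result is transported to all small modules.
\<close>

lemma flat_inj_universe:
  fixes A B :: "('r, 'u) module"
  assumes A: "module R A" and B: "module R B" and f: "lin R A B f" and inj: "inj_on f (carrier A)"
  shows "inj_on (lt A B C f) (carrier (tensor R A C))"
proof -
  obtain D :: "('r, 'u) module" and p where "module R D" "lin R B D p" "p ` carrier B = carrier D"
    "{x \<in> carrier B. p x = \<zero>\<^bsub>D\<^esub>} = f ` carrier A"
    using quotient_module[OF B submodule_image[OF A B f]] by blast
  then show ?thesis
    using flat_exact[OF A B _ f, of D p] inj by (simp add: short_exact_def)
qed

lemma flat_inj:
  assumes A: "module R A" "small A" and B: "module R B" "small B" and f: "lin R A B f" and inj: "inj_on f (carrier A)"
  shows "inj_on (lt A B C f) (carrier (tensor R A C))"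
proof -
  let ?A = "small_copy A :: ('r, 'u) module" and ?B = "small_copy B :: ('r, 'u) module"
  let ?i = "small_inj A :: _ \<Rightarrow> 'u" and ?j = "small_inj B :: _ \<Rightarrow> 'u"
  have [simp]: "module R ?A" "module R ?B" "lin R A ?A ?i" "lin R B ?B ?j"
    by (simp_all add: module_small_copy lin_small_inj A B)
  obtain k where k: "lin R ?A A k" "\<And>x. x \<in> carrier A \<Longrightarrow> k (?i x) = x"
    "\<And>y. y \<in> carrier ?A \<Longrightarrow> ?i (k y) = y"
    using small_copy_inverse[OF A] by metis
  let ?f = "\<lambda>x. ?j (f (k x))"
  have f' [simp]: "lin R ?A ?B ?f"
    by (rule lin_comp[OF lin_comp[OF k(1) f]]) simp
  have "inj_on ?f (carrier ?A)"
  proof (rule inj_onI)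
    fix x y assume xy: "x \<in> carrier ?A" "y \<in> carrier ?A" "?f x = ?f y"
    note kc = lin_closed[OF k(1)]
    have "f (k x) = f (k y)"
      by (rule inj_onD[OF small_inj_inj[OF B(2)] xy(3)]) (use xy kc lin_closed[OF f] in auto)
    then have "k x = k y" by (rule inj_onD[OF inj]) (use xy kc in auto)
    then show "x = y" using k(3) xy by metis
  qed
  then have inj': "inj_on (lt ?A ?B C ?f) (carrier (tensor R ?A C))"
    by (intro flat_inj_universe) simp_all
  have inji: "inj_on (lt A ?A C ?i) (carrier (tensor R A C))"
    by (rule inj_on_lt_if_left_inverse[where g = k]) (simp_all add: A k)
  have eq: "lt ?A ?B C ?f (lt A ?A C ?i t) = lt B ?B C ?j (lt A B C f t)" if t: "t \<in> carrier (tensor R A C)" for t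
  proof -
    have "lt ?A ?B C ?f (lt A ?A C ?i t) = lt A ?B C (\<lambda>x. ?f (?i x)) t"
      using t A by (intro lt_comp) simp_all
    also have "\<dots> = lt A ?B C (\<lambda>x. ?j (f x)) t"
      by (rule fun_cong[OF lt_cong]) (simp add: k)
    finally show ?thesis using t A B f by (simp add: lt_comp)
  qed
  show ?thesis
  proof (rule inj_onI)
    fix s t assume st: "s \<in> carrier (tensor R A C)" "t \<in> carrier (tensor R A C)" "lt A B C f s = lt A B C f t"
    have "lt A ?A C ?i s = lt A ?A C ?i t"
      by (rule inj_onD[OF inj']) (use st A eq in simp_all)
    then show "s = t" by (rule inj_onD[OF inji]) (use st in auto)
  qed
qed

text \<open>
  Tensoring with a flat module preserves kernels. The map \<open>f\<close> is the quotient by its kernel followed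
  by an injection, which stays injective; exactness at the middle of the quotient sequence
  yields the claim.
\<close>

lemma flat_kernel_universe:
  fixes A :: "('r, 'u) module" and B :: "('r, 'b, 'y) module_scheme"
  assumes A: "module R A" and B: "module R B" "small B" and f: "lin R A B f"
    and t: "t \<in> carrier (tensor R A C)" "lt A B C f t = \<zero>\<^bsub>tensor R B C\<^esub>"
  defines "K \<equiv> A\<lparr>carrier := {x \<in> carrier A. f x = \<zero>\<^bsub>B\<^esub>}\<rparr>"
  shows "t \<in> lt K A C (\<lambda>x. x) ` carrier (tensor R K C)"
proof -
  note sub = submodule_kernel[OF A B(1) f]
  have K: "module R K" "lin R K A (\<lambda>x. x)"
    unfolding K_def by (rule module_submodule[OF A sub], rule lin_submodule_incl[OF A sub])
  obtain P :: "('r, 'u) module" and p where P: "module R P" "lin R A P p" "p ` carrier A = carrier P"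
    "{x \<in> carrier A. p x = \<zero>\<^bsub>P\<^esub>} = carrier K"
    using quotient_module[OF A sub] unfolding K_def by auto
  have "f x = \<zero>\<^bsub>B\<^esub>" if "x \<in> carrier A" "p x = \<zero>\<^bsub>P\<^esub>" for x
  proof -
    have "x \<in> carrier K" using that P(4) by blast
    then show ?thesis by (simp add: K_def)
  qed
  then obtain g where g: "lin R P B g" "\<And>x. x \<in> carrier A \<Longrightarrow> g (p x) = f x"
    using lin_factor[OF A P(1) B(1) P(2,3) f] by metis
  have "inj_on g (carrier P)"
    unfolding lin_inj_iff[OF P(1) B(1) g(1)]
  proof (intro ballI impI)
    fix y assume "y \<in> carrier P" "g y = \<zero>\<^bsub>B\<^esub>"
    then obtain x where x: "x \<in> carrier A" "y = p x" using P(3) by auto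
    then have "x \<in> carrier K" using g(2)[OF x(1)] \<open>g y = _\<close> by (simp add: K_def)
    then show "y = \<zero>\<^bsub>P\<^esub>" using P(4) x by auto
  qed
  then have inj: "inj_on (lt P B C g) (carrier (tensor R P C))"
    by (intro flat_inj) (simp_all add: P B g)
  have "lt P B C g (lt A P C p t) = lt A B C (\<lambda>x. g (p x)) t"
    by (rule lt_comp) (simp_all add: A P B g t)
  also have "\<dots> = lt A B C f t"
    by (rule fun_cong[OF lt_cong]) (rule g(2))
  finally have "lt A P C p t = \<zero>\<^bsub>tensor R P C\<^esub>"
    using inj t unfolding lin_inj_iff[OF module_tensor[OF P(1) flatD] module_tensor[OF B(1) flatD] lin_lt[OF P(1) B(1) flatD g(1)]]
    by (simp add: A P)
  moreover have "short_exact K A P (\<lambda>x. x) p"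
    unfolding short_exact_def using P(3,4) by auto
  ultimately show ?thesis
    using flat_exact[OF K(1) A P(1) K(2) P(2)] t by (auto simp: short_exact_def)
qed

lemma flat_kernel:
  assumes A: "module R A" "small A" and B: "module R B" "small B" and f: "lin R A B f"
    and t: "t \<in> carrier (tensor R A C)" "lt A B C f t = \<zero>\<^bsub>tensor R B C\<^esub>"
  defines "K \<equiv> A\<lparr>carrier := {x \<in> carrier A. f x = \<zero>\<^bsub>B\<^esub>}\<rparr>"
  shows "t \<in> lt K A C (\<lambda>x. x) ` carrier (tensor R K C)"
proof -
  let ?A = "small_copy A :: ('r, 'u) module" and ?i = "small_inj A :: _ \<Rightarrow> 'u"
  have [simp]: "module R ?A" "lin R A ?A ?i"
    by (simp_all add: module_small_copy lin_small_inj A)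
  obtain k where k: "lin R ?A A k" "\<And>x. x \<in> carrier A \<Longrightarrow> k (?i x) = x"
    "\<And>y. y \<in> carrier ?A \<Longrightarrow> ?i (k y) = y"
    using small_copy_inverse[OF A] by metis
  let ?f = "\<lambda>x. f (k x)"
  have f' [simp]: "lin R ?A B ?f" by (rule lin_comp[OF k(1) f])
  let ?K = "?A\<lparr>carrier := {x \<in> carrier ?A. ?f x = \<zero>\<^bsub>B\<^esub>}\<rparr>"
  note sub = submodule_kernel[OF A(1) B(1) f] and sub' = submodule_kernel[OF _ B(1) f']
  have K: "module R K" "lin R K A (\<lambda>x. x)"
    unfolding K_def by (rule module_submodule[OF A(1) sub], rule lin_submodule_incl[OF A(1) sub])
  have K': "module R ?K" "lin R ?K ?A (\<lambda>x. x)"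
    by (rule module_submodule[OF _ sub'], simp, simp, rule lin_submodule_incl[OF _ sub'], simp_all)
  have kK: "lin R ?K K k"
    using k(1) by (auto simp: lin_def K_def)
  let ?t = "lt A ?A C ?i t"
  have "lt ?A B C ?f ?t = lt A B C (\<lambda>x. ?f (?i x)) t"
    using t A B by (intro lt_comp) simp_all
  also have "\<dots> = lt A B C f t"
    by (rule fun_cong[OF lt_cong]) (simp add: k)
  finally have "?t \<in> lt ?K ?A C (\<lambda>x. x) ` carrier (tensor R ?K C)"
    using t A B by (intro flat_kernel_universe) simp_all
  then obtain s where s: "s \<in> carrier (tensor R ?K C)" "?t = lt ?K ?A C (\<lambda>x. x) s" by auto
  have "t = lt A A C (\<lambda>x. k (?i x)) t"
    using t A lt_ident[OF A(1) flatD t(1)] lt_cong[where M = A and f = "\<lambda>x. k (?i x)" and g = "\<lambda>x. x" and N = A and P = C] k(2) by simp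
  also have "\<dots> = lt ?A A C k ?t"
    using t A k by (simp add: lt_comp)
  also have "\<dots> = lt ?K A C k s"
    using s(1) K' k(1) A by (simp add: s(2) lt_comp)
  also have "\<dots> = lt K A C (\<lambda>x. x) (lt ?K K C k s)"
    using s(1) K' K kK A by (simp add: lt_comp)
  finally show ?thesis
    using s(1) K K' kK by (intro image_eqI[where x = "lt ?K K C k s"]) simp_all
qed

end

end

section \<open>Characters of abelian groups\<close>

text \<open>
  A countable model of \<open>\<rat>/\<int>\<close>, written multiplicatively: the injective cogenerator of abelian groups
  has to fit into the universe, which the full circle group need not do.
\<close>

definition unity_roots :: "complex set"
  where "unity_roots = {z. \<exists>n>0. z ^ n = 1}"

lemma unity_roots_one [simp]: "1 \<in> unity_roots"
  by (auto simp: unity_roots_def)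

lemma unity_roots_mult [simp]: "z \<in> unity_roots \<Longrightarrow> w \<in> unity_roots \<Longrightarrow> z * w \<in> unity_roots"
proof -
  assume "z \<in> unity_roots" "w \<in> unity_roots"
  then obtain m n where "m > 0" "n > 0" "z ^ m = 1" "w ^ n = 1" by (auto simp: unity_roots_def)
  then have "(z * w) ^ (m * n) = 1"
    by (simp add: power_mult_distrib power_mult) (metis power_mult mult.commute power_one)
  then show ?thesis using \<open>m > 0\<close> \<open>n > 0\<close> by (auto simp: unity_roots_def intro!: exI[of _ "m * n"])
qed

lemma unity_roots_inverse [simp]: "z \<in> unity_roots \<Longrightarrow> inverse z \<in> unity_roots"
  by (auto simp: unity_roots_def power_inverse)

lemma unity_roots_nonzero: "z \<in> unity_roots \<Longrightarrow> z \<noteq> 0"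
  by (auto simp: unity_roots_def zero_power)

lemma unity_roots_power_int: "z \<in> unity_roots \<Longrightarrow> z powi k \<in> unity_roots"
proof (cases k)
  case (nonneg n)
  assume "z \<in> unity_roots"
  then have "z ^ n \<in> unity_roots" by (induction n) simp_all
  then show ?thesis using nonneg by simp
next
  case (neg n)
  assume "z \<in> unity_roots"
  then have "z ^ Suc n \<in> unity_roots" by (induction n) simp_all
  then have "inverse (z ^ Suc n) \<in> unity_roots" by (rule unity_roots_inverse)
  then show ?thesis unfolding neg by (simp only: power_int_minus power_int_of_nat)
qed

lemma unity_roots_divisible:
  assumes "c \<in> unity_roots" "n > 0"
  obtains z where "z \<in> unity_roots" "z ^ n = c"
proof -
  obtain m where m: "m > 0" "c ^ m = 1" using assms by (auto simp: unity_roots_def)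
  then have "norm c ^ m = 1" by (metis norm_one norm_power)
  then have "norm c = 1" using m(1) power_eq_imp_eq_base[of "norm c" m 1] by simp
  moreover from this have "c \<noteq> 0" by auto
  ultimately have c: "cis (Arg c) = c" by (simp add: cis_Arg sgn_eq)
  have "cis (Arg c / n) ^ n = c" using assms(2) c by (simp add: DeMoivre)
  moreover from this have "cis (Arg c / n) ^ (n * m) = 1" using m by (simp add: power_mult)
  ultimately show ?thesis
    using that[of "cis (Arg c / n)"] m(1) assms(2) unfolding unity_roots_def
    by (metis (mono_tags, lifting) mem_Collect_eq nat_0_less_mult_iff)
qed

lemma countable_unity_roots: "countable unity_roots"
proof -
  have eq: "unity_roots = (\<Union>n\<in>{0<..}. {z. z ^ n = 1})" by (auto simp: unity_roots_def)
  have "countable {z :: complex. z ^ n = 1}" if "n > 0" for n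
    using that by (intro countable_finite finite_roots_unity) simp
  then show ?thesis unfolding eq by (intro countable_UN) auto
qed

context comm_group
begin

text \<open>
  The graph of a homomorphism from a subgroup to the roots of unity. With graphs, the order of
  extension is inclusion, as needed for Zorn's lemma.
\<close>

definition partial_character :: "('a \<times> complex) set \<Rightarrow> bool"
  where "partial_character X \<longleftrightarrow> X \<subseteq> carrier G \<times> unity_roots \<and> (\<one>, 1) \<in> X \<and>
    (\<forall>x z y w. (x, z) \<in> X \<longrightarrow> (y, w) \<in> X \<longrightarrow> (x \<otimes> y, z * w) \<in> X) \<and>
    (\<forall>x z. (x, z) \<in> X \<longrightarrow> (inv x, inverse z) \<in> X) \<and>
    (\<forall>z. (\<one>, z) \<in> X \<longrightarrow> z = 1)"

context
  fixes X
  assumes X: "partial_character X"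
begin

lemma pc_closed: "(x, z) \<in> X \<Longrightarrow> x \<in> carrier G" "(x, z) \<in> X \<Longrightarrow> z \<in> unity_roots"
  using X by (auto simp: partial_character_def)

lemma pc_mult: "(x, z) \<in> X \<Longrightarrow> (y, w) \<in> X \<Longrightarrow> (x \<otimes> y, z * w) \<in> X"
  using X unfolding partial_character_def by blast

lemma pc_inv: "(x, z) \<in> X \<Longrightarrow> (inv x, inverse z) \<in> X"
  using X unfolding partial_character_def by blast

lemma pc_one: "(\<one>, 1) \<in> X" "(\<one>, z) \<in> X \<Longrightarrow> z = 1"
  using X unfolding partial_character_def by blast+

lemma pc_unique: "(x, z) \<in> X \<Longrightarrow> (x, w) \<in> X \<Longrightarrow> z = w"
proof -
  assume a: "(x, z) \<in> X" "(x, w) \<in> X"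
  have "(x \<otimes> inv x, z * inverse w) \<in> X" by (intro pc_mult pc_inv a)
  then have "z * inverse w = 1" using pc_one pc_closed a by (metis r_inv)
  then show "z = w"
    using unity_roots_nonzero[OF pc_closed(2)[OF a(2)]] by (simp add: field_simps)
qed

lemma pc_int_pow: "(x, z) \<in> X \<Longrightarrow> (x [^] (k :: int), z powi k) \<in> X"
proof -
  assume a: "(x, z) \<in> X"
  have n: "(x [^] n, z ^ n) \<in> X" for n :: nat
  proof (induction n)
    case 0
    then show ?case using pc_one by simp
  next
    case (Suc n)
    from pc_mult[OF Suc a] show ?case by (simp add: mult.commute)
  qed
  show ?thesis
  proof (cases k)
    case (nonneg m)
    then show ?thesis using n by (simp add: int_pow_int)
  next
    case (neg m)
    have "(inv (x [^] Suc m), inverse (z ^ Suc m)) \<in> X" by (rule pc_inv[OF n])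
    moreover have "x [^] k = inv (x [^] Suc m)"
      using int_pow_neg[OF pc_closed(1)[OF a], of "int (Suc m)"] by (simp only: neg int_pow_int)
    moreover have "z powi k = inverse (z ^ Suc m)"
      unfolding neg by (simp only: power_int_minus power_int_of_nat)
    ultimately show ?thesis by metis
  qed
qed

text \<open>
  A value for \<open>b\<close> can be chosen freely, as long as it agrees with the values at powers of \<open>b\<close> that
  are already determined.
\<close>

lemma pc_extend:
  assumes b: "b \<in> carrier G" and z: "z \<in> unity_roots"
    and compat: "\<And>(k :: int) w. (b [^] k, w) \<in> X \<Longrightarrow> w = z powi k"
  shows "\<exists>Y. partial_character Y \<and> X \<subseteq> Y \<and> (b, z) \<in> Y"
proof (intro exI conjI)
  let ?Y = "{(x \<otimes> b [^] k, w * z powi k) | x w (k :: int). (x, w) \<in> X}"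
  have z0: "z \<noteq> 0" using z by (rule unity_roots_nonzero)
  show "X \<subseteq> ?Y"
  proof clarify
    fix x w assume "(x, w) \<in> X"
    then show "\<exists>x' w' k. (x, w) = (x' \<otimes> b [^] (k :: int), w' * z powi k) \<and> (x', w') \<in> X"
      using pc_closed by (intro exI[of _ x] exI[of _ w] exI[of _ 0]) simp
  qed
  have "(\<one> \<otimes> b [^] (1 :: int), 1 * z powi 1) \<in> ?Y" using pc_one by blast
  then show "(b, z) \<in> ?Y" using b by simp
  show "partial_character ?Y"
    unfolding partial_character_def
  proof (intro conjI allI impI)
    show "?Y \<subseteq> carrier G \<times> unity_roots"
      using pc_closed b z by (auto intro!: unity_roots_mult unity_roots_power_int)
    show "(\<one>, 1) \<in> ?Y" using \<open>X \<subseteq> ?Y\<close> pc_one by blast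
  next
    fix x u y v assume "(x, u) \<in> ?Y" "(y, v) \<in> ?Y"
    then obtain x' u' k y' v' l where *: "(x', u') \<in> X" "x = x' \<otimes> b [^] (k :: int)" "u = u' * z powi k"
      "(y', v') \<in> X" "y = y' \<otimes> b [^] (l :: int)" "v = v' * z powi l" by blast
    have "x \<otimes> y = (x' \<otimes> y') \<otimes> b [^] (k + l)" "u * v = (u' * v') * z powi (k + l)"
      using * pc_closed b z0 by (simp_all add: m_ac int_pow_mult power_int_add)
    then show "(x \<otimes> y, u * v) \<in> ?Y" using pc_mult[OF *(1,4)] by blast
  next
    fix x u assume "(x, u) \<in> ?Y"
    then obtain x' u' k where *: "(x', u') \<in> X" "x = x' \<otimes> b [^] (k :: int)" "u = u' * z powi k" by blast
    have "inv x = inv x' \<otimes> b [^] (- k)" "inverse u = inverse u' * z powi (- k)"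
      using * pc_closed b z0 by (simp_all add: inv_mult int_pow_neg power_int_minus)
    then show "(inv x, inverse u) \<in> ?Y" using pc_inv[OF *(1)] by blast
  next
    fix u assume "(\<one>, u) \<in> ?Y"
    then obtain x' u' k where *: "(x', u') \<in> X" "\<one> = x' \<otimes> b [^] (k :: int)" "u = u' * z powi k" by blast
    have "x' = inv (b [^] k)"
      using * pc_closed b inv_equality[of x' "b [^] k"] by simp
    then have "x' = b [^] (- k)" using b by (simp add: int_pow_neg)
    then have "u' = z powi (- k)" using compat * by blast
    then show "u = 1" using * z0 by (simp add: power_int_minus)
  qed
qed

end

text \<open>The exponents of powers of \<open>b\<close> in \<open>S\<close> form a subgroup of \<open>\<int>\<close>, generated by its least positive element.\<close>

lemma int_pow_mem_subgroup:
  assumes S: "subgroup S G" and b: "b \<in> carrier G"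
  shows "(\<exists>n::nat. n > 0 \<and> (\<forall>k::int. b [^] k \<in> S \<longleftrightarrow> int n dvd k)) \<or> (\<forall>k::int. b [^] k \<in> S \<longrightarrow> k = 0)"
proof (cases "\<exists>n::nat. n > 0 \<and> b [^] (int n) \<in> S")
  case True
  define n where "n = (LEAST n. n > 0 \<and> b [^] (int n) \<in> S)"
  have n: "n > 0" "b [^] (int n) \<in> S"
    using LeastI_ex[OF True] by (auto simp: n_def)
  have least: "n \<le> m" if "m > 0" "b [^] (int m) \<in> S" for m
    unfolding n_def by (rule Least_le) (use that in blast)
  have sub: "x [^] (k :: int) \<in> S" if "x \<in> S" for x k
    using subgroup_int_pow_closed[OF S that] .
  have "b [^] k \<in> S \<longleftrightarrow> int n dvd k" for k
  proof
    assume "int n dvd k"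
    then obtain q where "k = int n * q" by blast
    then show "b [^] k \<in> S" using sub[OF n(2), of q] b by (simp add: int_pow_pow)
  next
    assume k: "b [^] k \<in> S"
    let ?r = "k mod int n"
    have "b [^] ?r = b [^] k \<otimes> b [^] (int n * - (k div int n))"
      using b by (simp add: int_pow_mult[symmetric] minus_mult_div_eq_mod[symmetric])
    also have "\<dots> \<in> S"
      using sub[OF n(2), of "- (k div int n)"] b k subgroup.m_closed[OF S] by (simp add: int_pow_pow)
    finally have "b [^] int (nat ?r) \<in> S" using n(1) by simp
    moreover have "nat ?r < n" using n(1) by (simp add: nat_less_iff)
    ultimately have "nat ?r = 0" using least[of "nat ?r"] by (cases "nat ?r = 0") auto
    then show "int n dvd k" using n(1) by (simp add: dvd_eq_mod_eq_0 nat_eq_iff2) (metis pos_mod_sign of_nat_0_less_iff order_antisym)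
  qed
  then show ?thesis using n(1) by blast
next
  case False
  have "k = 0" if k: "b [^] k \<in> S" for k :: int
  proof (rule ccontr)
    assume "k \<noteq> 0"
    have "b [^] (- k) \<in> S" using subgroup.m_inv_closed[OF S k] b by (simp add: int_pow_neg)
    then have "b [^] int (nat \<bar>k\<bar>) \<in> S" using k by (cases "k \<ge> 0") auto
    then show False using False \<open>k \<noteq> 0\<close> by (metis zero_less_abs_iff zero_less_nat_eq)
  qed
  then show ?thesis by blast
qed

text \<open>
  Injectivity of the group of roots of unity. A maximal extension is total: if \<open>n\<close> generates the
  exponents of \<open>b\<close> that lie in the domain, an \<open>n\<close>-th root of the value at \<open>b\<^sup>n\<close> extends it to \<open>b\<close>,
  and if there is no such \<open>n\<close> the value \<open>1\<close> does.
\<close>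

lemma partial_character_extends:
  assumes X0: "partial_character X0"
  shows "\<exists>\<psi>. (\<forall>x\<in>carrier G. \<psi> x \<in> unity_roots) \<and> (\<forall>x\<in>carrier G. \<forall>y\<in>carrier G. \<psi> (x \<otimes> y) = \<psi> x * \<psi> y) \<and>
    (\<forall>(x, z)\<in>X0. \<psi> x = z)"
proof -
  let ?A = "{X. partial_character X \<and> X0 \<subseteq> X}"
  have "\<exists>M\<in>?A. \<forall>X\<in>?A. M \<subseteq> X \<longrightarrow> X = M"
  proof (rule subset_Zorn)
    fix \<C> assume chain: "subset.chain ?A \<C>"
    show "\<exists>U\<in>?A. \<forall>X\<in>\<C>. X \<subseteq> U"
    proof (cases "\<C> = {}")
      case True
      then show ?thesis using X0 by auto
    next
      case False
      have mem: "partial_character X" "X0 \<subseteq> X" if "X \<in> \<C>" for X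
        using chain that by (auto simp: subset_chain_def)
      have dir: "\<exists>X\<in>\<C>. p \<in> X \<and> q \<in> X" if "p \<in> \<Union>\<C>" "q \<in> \<Union>\<C>" for p q
      proof -
        obtain Y Z where YZ: "Y \<in> \<C>" "Z \<in> \<C>" "p \<in> Y" "q \<in> Z" using \<open>p \<in> _\<close> \<open>q \<in> _\<close> by blast
        then have "Y \<subseteq> Z \<or> Z \<subseteq> Y" using chain unfolding subset_chain_def by simp
        then show ?thesis using YZ by (elim disjE) (meson subsetD)+
      qed
      have "partial_character (\<Union>\<C>)"
        unfolding partial_character_def
      proof (intro conjI allI impI)
        show "\<Union>\<C> \<subseteq> carrier G \<times> unity_roots" using pc_closed[OF mem(1)] by auto
        show "(\<one>, 1) \<in> \<Union>\<C>" using False mem(1) pc_one by blast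
      next
        fix x z y w assume "(x, z) \<in> \<Union>\<C>" "(y, w) \<in> \<Union>\<C>"
        then obtain X where "X \<in> \<C>" "(x, z) \<in> X" "(y, w) \<in> X" using dir by blast
        then show "(x \<otimes> y, z * w) \<in> \<Union>\<C>" using pc_mult mem(1) by blast
      qed (use mem(1) pc_inv pc_one in blast)+
      then show ?thesis using False mem(2) by blast
    qed
  qed
  then obtain M where M: "partial_character M" "X0 \<subseteq> M" and max: "\<And>X. partial_character X \<Longrightarrow> M \<subseteq> X \<Longrightarrow> X = M"
    by (elim bexE) (metis (mono_tags, lifting) mem_Collect_eq subset_trans)
  note pc = pc_closed[OF M(1)] pc_mult[OF M(1)] pc_inv[OF M(1)] pc_one[OF M(1)] pc_unique[OF M(1)] pc_int_pow[OF M(1)]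
  have dom: "subgroup (Domain M) G"
    by (rule subgroupI) (use pc in blast)+
  have total: "\<exists>z. (b, z) \<in> M" if b: "b \<in> carrier G" for b
  proof -
    have "\<exists>z\<in>unity_roots. \<forall>(k :: int) w. (b [^] k, w) \<in> M \<longrightarrow> w = z powi k"
      using int_pow_mem_subgroup[OF dom b]
    proof (elim disjE exE conjE)
      fix n :: nat assume n: "n > 0" and iff: "\<forall>k::int. b [^] k \<in> Domain M \<longleftrightarrow> int n dvd k"
      have "b [^] int n \<in> Domain M" using iff[rule_format, of "int n"] by simp
      then obtain c where c: "(b [^] int n, c) \<in> M" by (rule DomainE)
      then obtain z where z: "z \<in> unity_roots" "z ^ n = c"
        using unity_roots_divisible[OF pc(2)[OF c] n] by blast
      have "w = z powi k" if kw: "(b [^] k, w) \<in> M" for k :: int and w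
      proof -
        have "int n dvd k" using iff[rule_format, of k] DomainI[OF kw] by simp
        then obtain q where q: "k = int n * q" by blast
        have "(b [^] k, c powi q) \<in> M" using pc(8)[OF c, of q] b q by (simp add: int_pow_pow)
        then have "w = c powi q" using pc(7) kw by blast
        then show ?thesis using z(2) q by (simp add: power_int_mult)
      qed
      then show ?thesis using z(1) by blast
    next
      assume "\<forall>k::int. b [^] k \<in> Domain M \<longrightarrow> k = 0"
      then have "w = 1 powi k" if "(b [^] k, w) \<in> M" for k :: int and w
        using that pc(6) by (metis Domain.DomainI int_pow_0 power_int_1_left)
      then show ?thesis using unity_roots_one by blast
    qed
    then obtain z where "z \<in> unity_roots" "\<And>(k :: int) w. (b [^] k, w) \<in> M \<Longrightarrow> w = z powi k" by blast
    then show ?thesis using pc_extend[OF M(1) b] max by metis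
  qed
  define \<psi> where "\<psi> x = (THE z. (x, z) \<in> M)" for x
  have \<psi>: "\<psi> x = z" if "(x, z) \<in> M" for x z
    unfolding \<psi>_def using pc(7) that by blast
  show ?thesis
  proof (intro exI[of _ \<psi>] conjI ballI)
    fix x assume "x \<in> carrier G"
    then show "\<psi> x \<in> unity_roots" using total \<psi> pc(2) by metis
  next
    fix x y assume "x \<in> carrier G" "y \<in> carrier G"
    then show "\<psi> (x \<otimes> y) = \<psi> x * \<psi> y" using total \<psi> pc(3) by metis
  next
    fix p assume "p \<in> X0"
    then show "case p of (x, z) \<Rightarrow> \<psi> x = z" using M(2) \<psi> by auto
  qed
qed

text \<open>
  Send \<open>b\<close> to a nontrivial root of unity of order \<open>n\<close>, where \<open>n\<close> is the order of \<open>b\<close> modulo \<open>S\<close>; if this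
  order is infinite, \<open>-1\<close> will do.
\<close>

lemma character_separates:
  assumes S: "subgroup S G" and b: "b \<in> carrier G" "b \<notin> S"
  shows "\<exists>\<psi>. (\<forall>x\<in>carrier G. \<psi> x \<in> unity_roots) \<and> (\<forall>x\<in>carrier G. \<forall>y\<in>carrier G. \<psi> (x \<otimes> y) = \<psi> x * \<psi> y) \<and>
    (\<forall>x\<in>S. \<psi> x = 1) \<and> \<psi> b \<noteq> 1"
proof -
  let ?X = "S \<times> {1 :: complex}"
  have X: "partial_character ?X"
    unfolding partial_character_def using subgroup.subset[OF S] subgroup.one_closed[OF S]
      subgroup.m_closed[OF S] subgroup.m_inv_closed[OF S] by auto
  have "\<exists>z\<in>unity_roots. z \<noteq> 1 \<and> (\<forall>k::int. b [^] k \<in> S \<longrightarrow> z powi k = 1)"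
    using int_pow_mem_subgroup[OF S b(1)]
  proof (elim disjE exE conjE)
    fix n :: nat assume n: "n > 0" and iff: "\<forall>k::int. b [^] k \<in> S \<longleftrightarrow> int n dvd k"
    have "n \<noteq> 1" using iff[rule_format, of 1] b by auto
    let ?z = "cis (2 * pi / n)"
    have zn: "?z ^ n = 1" using n by (simp add: DeMoivre)
    have "?z \<noteq> 1"
    proof
      assume "?z = 1"
      then have "cos (2 * pi / n) = 1" by (metis cis.sel(1) one_complex.sel(1))
      then obtain m :: int where m: "2 * pi / n = m * 2 * pi"
        unfolding cos_one_2pi_int by (elim exE) simp
      then have "real_of_int m * n = 1" using n by (simp add: field_simps)
      then have "m * int n = 1" by (metis of_int_eq_1_iff of_int_mult of_int_of_nat_eq)
      then show False using \<open>n \<noteq> 1\<close> by (metis of_nat_eq_1_iff pos_zmult_eq_1_iff zmult_eq_1_iff of_nat_less_0_iff zero_less_one mult.commute int_ops(2) less_imp_of_nat_less n of_nat_0_less_iff)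
    qed
    moreover have "?z powi k = 1" if "b [^] k \<in> S" for k :: int
    proof -
      have "int n dvd k" using iff[rule_format, of k] that by simp
      then obtain q where "k = int n * q" by (rule dvdE)
      then show ?thesis using zn by (simp add: power_int_mult)
    qed
    ultimately show ?thesis using zn n by (auto simp: unity_roots_def)
  next
    assume *: "\<forall>k::int. b [^] k \<in> S \<longrightarrow> k = 0"
    have "(-1 :: complex) ^ 2 = 1" by simp
    then have "(-1 :: complex) \<in> unity_roots" unfolding unity_roots_def by (intro CollectI exI[of _ 2]) simp
    moreover have "(-1 :: complex) \<noteq> 1" by simp
    moreover have "(-1 :: complex) powi k = 1" if "b [^] k \<in> S" for k :: int
      using *[rule_format, OF that] by simp
    ultimately show ?thesis by blast
  qed
  then obtain z where z: "z \<in> unity_roots" "z \<noteq> 1" "\<And>k::int. b [^] k \<in> S \<Longrightarrow> z powi k = 1" by blast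
  then obtain Y where Y: "partial_character Y" "?X \<subseteq> Y" "(b, z) \<in> Y"
    using pc_extend[OF X b(1) z(1)] by auto
  obtain \<psi> where "\<forall>x\<in>carrier G. \<psi> x \<in> unity_roots" "\<forall>x\<in>carrier G. \<forall>y\<in>carrier G. \<psi> (x \<otimes> y) = \<psi> x * \<psi> y"
    and \<psi>: "\<forall>(x, z)\<in>Y. \<psi> x = z"
    using partial_character_extends[OF Y(1)] by blast
  moreover have "\<psi> b \<noteq> 1" "\<forall>x\<in>S. \<psi> x = 1" using \<psi> Y z(2) by auto
  ultimately show ?thesis by blast
qed

end

context small_ring
begin

section \<open>An injective cogenerator\<close>

text \<open>\<open>Hom\<^sub>\<int>(R, \<mu>)\<close> for the group \<open>\<mu>\<close> of roots of unity, with \<open>(s \<chi>)(r) = \<chi>(r s)\<close>\<close>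

definition character_module :: "('r, 'r \<Rightarrow> complex) module"
  where "character_module =
    \<lparr>carrier = {\<chi> \<in> carrier R \<rightarrow>\<^sub>E unity_roots. \<forall>r\<in>carrier R. \<forall>s\<in>carrier R. \<chi> (r \<oplus> s) = \<chi> r * \<chi> s},
     monoid.mult = undefined, one = undefined, ring.zero = (\<lambda>r\<in>carrier R. 1),
     add = \<lambda>\<chi> \<psi>. \<lambda>r\<in>carrier R. \<chi> r * \<psi> r, smult = \<lambda>s \<chi>. \<lambda>r\<in>carrier R. \<chi> (r \<otimes> s)\<rparr>"

lemma character_module_sel:
  "carrier character_module = {\<chi> \<in> carrier R \<rightarrow>\<^sub>E unity_roots. \<forall>r\<in>carrier R. \<forall>s\<in>carrier R. \<chi> (r \<oplus> s) = \<chi> r * \<chi> s}"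
  "\<zero>\<^bsub>character_module\<^esub> = (\<lambda>r\<in>carrier R. 1)"
  "\<chi> \<oplus>\<^bsub>character_module\<^esub> \<psi> = (\<lambda>r\<in>carrier R. \<chi> r * \<psi> r)"
  "s \<odot>\<^bsub>character_module\<^esub> \<chi> = (\<lambda>r\<in>carrier R. \<chi> (r \<otimes> s))"
  by (simp_all add: character_module_def)

lemma character_mem:
  "\<chi> \<in> carrier character_module \<longleftrightarrow> \<chi> \<in> extensional (carrier R) \<and> (\<forall>r\<in>carrier R. \<chi> r \<in> unity_roots) \<and>
    (\<forall>r\<in>carrier R. \<forall>s\<in>carrier R. \<chi> (r \<oplus> s) = \<chi> r * \<chi> s)"
  by (auto simp: character_module_sel PiE_iff)

lemma character_eqI:
  "\<chi> \<in> extensional (carrier R) \<Longrightarrow> \<psi> \<in> extensional (carrier R) \<Longrightarrow> (\<And>r. r \<in> carrier R \<Longrightarrow> \<chi> r = \<psi> r) \<Longrightarrow> \<chi> = \<psi>"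
  by (rule extensionalityI)

lemma module_character_module: "module R character_module"
proof (rule moduleI)
  note mem = character_mem and sel = character_module_sel(2-4)
  show "abelian_group character_module"
  proof (rule abelian_groupI)
    fix \<chi> assume \<chi>: "\<chi> \<in> carrier character_module"
    let ?i = "\<lambda>r\<in>carrier R. inverse (\<chi> r)"
    have "?i \<in> carrier character_module"
      using \<chi> by (simp add: mem)
    moreover have "?i \<oplus>\<^bsub>character_module\<^esub> \<chi> = \<zero>\<^bsub>character_module\<^esub>"
      using \<chi> unity_roots_nonzero by (simp add: mem sel cong: restrict_cong)
    ultimately show "\<exists>\<psi>\<in>carrier character_module. \<psi> \<oplus>\<^bsub>character_module\<^esub> \<chi> = \<zero>\<^bsub>character_module\<^esub>"
      by blast
  next
    fix \<chi> assume "\<chi> \<in> carrier character_module"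
    then show "\<zero>\<^bsub>character_module\<^esub> \<oplus>\<^bsub>character_module\<^esub> \<chi> = \<chi>"
      by (intro character_eqI) (simp_all add: mem sel)
  qed (simp_all add: mem sel mult_ac cong: restrict_cong)
  show "\<one> \<odot>\<^bsub>character_module\<^esub> \<chi> = \<chi>" if "\<chi> \<in> carrier character_module" for \<chi>
    using that by (intro character_eqI) (simp_all add: mem sel)
qed (simp_all add: character_mem character_module_sel(2-4) cring_axioms r_distr l_distr m_assoc cong: restrict_cong)

lemma small_character_module: "small character_module"
proof -
  obtain j :: "complex \<Rightarrow> 'u" where j: "inj_on j unity_roots"
  proof -
    have "unity_roots \<lesssim> (UNIV :: nat set)" using countable_unity_roots by (auto simp: countable_def lepoll_def)
    also have "\<dots> \<lesssim> (UNIV :: 'u set)" using infinite_universe by (simp add: infinite_le_lepoll)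
    finally show ?thesis using that by (auto simp: lepoll_def)
  qed
  have "inj_on (\<lambda>\<chi>. \<lambda>r\<in>carrier R. j (\<chi> r)) (carrier character_module)"
  proof (rule inj_onI)
    fix \<chi> \<psi> assume cp: "\<chi> \<in> carrier character_module" "\<psi> \<in> carrier character_module"
      "(\<lambda>r\<in>carrier R. j (\<chi> r)) = (\<lambda>r\<in>carrier R. j (\<psi> r))"
    have E: "\<chi> \<in> carrier R \<rightarrow>\<^sub>E unity_roots" "\<psi> \<in> carrier R \<rightarrow>\<^sub>E unity_roots"
      using cp by (auto simp: character_module_sel)
    show "\<chi> = \<psi>"
    proof (rule PiE_ext[OF E])
      fix r assume r: "r \<in> carrier R"
      then have "j (\<chi> r) = j (\<psi> r)" using fun_cong[OF cp(3), of r] by simp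
      then show "\<chi> r = \<psi> r" by (rule inj_onD[OF j]) (use E r in auto)
    qed
  qed
  then have "carrier character_module \<lesssim> (carrier R \<rightarrow>\<^sub>E (UNIV :: 'u set))"
    unfolding lepoll_def by (intro exI[of _ "\<lambda>\<chi>. \<lambda>r\<in>carrier R. j (\<chi> r)"]) auto
  then show ?thesis using functions_lepoll lepoll_trans unfolding small_def by blast
qed

text \<open>
  Linear maps into the character module correspond to characters of the underlying abelian group;
  the character is recovered by evaluation at \<open>1\<close>. This transfers extension and separation of
  characters to the next two lemmas.
\<close>

lemma character_lin:
  assumes "module R B"
    and "\<forall>x\<in>carrier B. \<psi> x \<in> unity_roots" "\<forall>x\<in>carrier B. \<forall>y\<in>carrier B. \<psi> (x \<oplus>\<^bsub>B\<^esub> y) = \<psi> x * \<psi> y"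
  shows "lin R B character_module (\<lambda>x. \<lambda>r\<in>carrier R. \<psi> (r \<odot>\<^bsub>B\<^esub> x))"
proof -
  interpret B: module R B by fact
  show ?thesis
    by (rule linI)
      (use assms(2,3) in \<open>auto simp: character_module_sel B.smult_l_distr B.smult_r_distr B.smult_assoc1 intro!: restrict_ext\<close>)
qed

lemma character_module_injective:
  assumes A: "module R A" and B: "module R B" and i: "lin R A B i" "inj_on i (carrier A)" and f: "lin R A character_module f"
  shows "\<exists>g. lin R B character_module g \<and> (\<forall>x\<in>carrier A. g (i x) = f x)"
proof -
  interpret A: module R A by fact
  interpret B: module R B by fact
  interpret Q: module R character_module by (rule module_character_module)
  let ?X = "(\<lambda>x. (i x, f x \<one>)) ` carrier A"
  have fc: "f x \<in> carrier character_module" if "x \<in> carrier A" for x by (rule lin_closed[OF f that])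
  have fone: "f x \<one> \<in> unity_roots" if "x \<in> carrier A" for x
    using fc[OF that] by (auto simp: character_module_sel)
  have "comm_group.partial_character (add_monoid B) ?X"
    unfolding comm_group.partial_character_def[OF B.a_comm_group]
  proof (intro conjI allI impI)
    show "?X \<subseteq> carrier (add_monoid B) \<times> unity_roots"
      using fone lin_closed[OF i(1)] by auto
    show "(\<one>\<^bsub>add_monoid B\<^esub>, 1) \<in> ?X"
      using lin_zero[OF A B i(1)] lin_zero[OF A Q.module_axioms f]
      by (intro image_eqI[of _ _ "\<zero>\<^bsub>A\<^esub>"]) (simp_all add: character_module_sel)
  next
    fix x z y w assume "(x, z) \<in> ?X" "(y, w) \<in> ?X"
    then obtain a b where ab: "a \<in> carrier A" "x = i a" "z = f a \<one>" "b \<in> carrier A" "y = i b" "w = f b \<one>" by auto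
    then show "(x \<otimes>\<^bsub>add_monoid B\<^esub> y, z * w) \<in> ?X"
      by (intro image_eqI[of _ _ "a \<oplus>\<^bsub>A\<^esub> b"]) (simp_all add: lin_add[OF i(1)] lin_add[OF f] character_module_sel)
  next
    fix x z assume "(x, z) \<in> ?X"
    then obtain a where a: "a \<in> carrier A" "x = i a" "z = f a \<one>" by auto
    have "f (\<ominus>\<^bsub>A\<^esub> a) \<oplus>\<^bsub>character_module\<^esub> f a = \<zero>\<^bsub>character_module\<^esub>"
      using a by (simp add: A.l_neg lin_zero[OF A Q.module_axioms f] flip: lin_add[OF f])
    from fun_cong[OF this, of \<one>] have "f (\<ominus>\<^bsub>A\<^esub> a) \<one> * f a \<one> = 1" by (simp add: character_module_sel)
    then have "f (\<ominus>\<^bsub>A\<^esub> a) \<one> = inverse (f a \<one>)" using unity_roots_nonzero[OF fone[OF a(1)]] by (simp add: field_simps)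
    then show "(inv\<^bsub>add_monoid B\<^esub> x, inverse z) \<in> ?X"
      using a lin_minus[OF A B i(1) a(1)]
      by (intro image_eqI[of _ _ "\<ominus>\<^bsub>A\<^esub> a"]) (simp_all add: a_inv_def)
  next
    fix z assume "(\<one>\<^bsub>add_monoid B\<^esub>, z) \<in> ?X"
    then obtain a where a: "a \<in> carrier A" "\<zero>\<^bsub>B\<^esub> = i a" "z = f a \<one>" by auto
    then have "a = \<zero>\<^bsub>A\<^esub>" using i(2) unfolding lin_inj_iff[OF A B i(1)] by metis
    then show "z = 1" using a lin_zero[OF A Q.module_axioms f] by (simp add: character_module_sel)
  qed
  from comm_group.partial_character_extends[OF B.a_comm_group this]
  obtain \<psi> where \<psi>: "\<forall>x\<in>carrier B. \<psi> x \<in> unity_roots" "\<forall>x\<in>carrier B. \<forall>y\<in>carrier B. \<psi> (x \<oplus>\<^bsub>B\<^esub> y) = \<psi> x * \<psi> y"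
    "\<forall>(x, z)\<in>?X. \<psi> x = z"
    by (elim exE conjE) simp
  let ?g = "\<lambda>x. \<lambda>r\<in>carrier R. \<psi> (r \<odot>\<^bsub>B\<^esub> x)"
  have "?g (i x) = f x" if x: "x \<in> carrier A" for x
  proof (rule PiE_ext)
    show "f x \<in> carrier R \<rightarrow>\<^sub>E unity_roots" using fc[OF x] by (simp add: character_module_sel)
    show "?g (i x) \<in> carrier R \<rightarrow>\<^sub>E unity_roots" using x \<psi>(1) lin_closed[OF i(1)] by auto
    fix r assume r: "r \<in> carrier R"
    have "?g (i x) r = \<psi> (i (r \<odot>\<^bsub>A\<^esub> x))" using x r by (simp add: lin_smult[OF i(1)])
    also have "\<dots> = f (r \<odot>\<^bsub>A\<^esub> x) \<one>" using \<psi>(3) x r by auto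
    also have "\<dots> = f x r" using x r by (simp add: lin_smult[OF f] character_module_sel)
    finally show "?g (i x) r = f x r" .
  qed
  then show ?thesis using character_lin[OF B \<psi>(1,2)] by blast
qed

lemma character_module_separates:
  assumes B: "module R B" and S: "submodule S R B" and b: "b \<in> carrier B" "b \<notin> S"
  shows "\<exists>g. lin R B character_module g \<and> (\<forall>x\<in>S. g x = \<zero>\<^bsub>character_module\<^esub>) \<and> g b \<noteq> \<zero>\<^bsub>character_module\<^esub>"
proof -
  interpret B: module R B by fact
  have "subgroup S (add_monoid B)" using S by (simp add: submodule_def)
  then obtain \<psi> where \<psi>: "\<forall>x\<in>carrier B. \<psi> x \<in> unity_roots" "\<forall>x\<in>carrier B. \<forall>y\<in>carrier B. \<psi> (x \<oplus>\<^bsub>B\<^esub> y) = \<psi> x * \<psi> y"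
    "\<forall>x\<in>S. \<psi> x = 1" "\<psi> b \<noteq> 1"
    using comm_group.character_separates[OF B.a_comm_group, of S b] b by auto
  let ?g = "\<lambda>x. \<lambda>r\<in>carrier R. \<psi> (r \<odot>\<^bsub>B\<^esub> x)"
  have "?g x = \<zero>\<^bsub>character_module\<^esub>" if "x \<in> S" for x
    using that B.submoduleE(4)[OF S] \<psi>(3) by (auto simp: character_module_sel)
  moreover have "?g b \<noteq> \<zero>\<^bsub>character_module\<^esub>"
  proof
    assume "?g b = \<zero>\<^bsub>character_module\<^esub>"
    from fun_cong[OF this, of \<one>] show False using \<psi>(4) b by (simp add: character_module_sel)
  qed
  ultimately show ?thesis using character_lin[OF B \<psi>(1,2)] by (intro exI[of _ ?g] conjI ballI)
qed

definition cogen :: "('r, 'u) module"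
  where "cogen = small_copy character_module"

lemma module_cogen [simp]: "module R cogen"
  unfolding cogen_def by (rule module_small_copy[OF module_character_module small_character_module])

lemma cogen_separates:
  assumes "module R B" "submodule S R B" "b \<in> carrier B" "b \<notin> S"
  shows "\<exists>g. lin R B cogen g \<and> (\<forall>x\<in>S. g x = \<zero>\<^bsub>cogen\<^esub>) \<and> g b \<noteq> \<zero>\<^bsub>cogen\<^esub>"
proof -
  let ?j = "small_inj character_module :: _ \<Rightarrow> 'u"
  note Q = module_character_module small_character_module
  note j = lin_small_inj[OF Q, folded cogen_def]
  have j0: "?j \<zero>\<^bsub>character_module\<^esub> = \<zero>\<^bsub>cogen\<^esub>" by (rule lin_zero[OF Q(1) module_cogen j])
  have inj: "x = \<zero>\<^bsub>character_module\<^esub>" if "?j x = \<zero>\<^bsub>cogen\<^esub>" "x \<in> carrier character_module" for x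
    using small_inj_inj[OF Q(2)] that unfolding lin_inj_iff[OF Q(1) module_cogen j] by blast
  obtain g where "lin R B character_module g" "\<forall>x\<in>S. g x = \<zero>\<^bsub>character_module\<^esub>" "g b \<noteq> \<zero>\<^bsub>character_module\<^esub>"
    using character_module_separates[OF assms] by blast
  then show ?thesis
    using lin_comp[OF _ j, of B g] j0 inj[of "g b"] assms(3) lin_closed[of R B character_module g b]
    by (intro exI[of _ "\<lambda>x. ?j (g x)"]) auto
qed

text \<open>A monomorphism equalizes the inclusion of its kernel and the zero map.\<close>

lemma mono_arrow_Mod_cat:
  assumes "mono_arrow (Mod_cat R) A B (i :: 'u \<Rightarrow> 'u)" and A: "module R A" and B: "module R B"
  shows "lin R A B i" "inj_on i (carrier A)"
proof -
  show i: "lin R A B i" using assms by (simp add: mono_arrow_def Mod_cat_def mod_hom_iff)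
  interpret A: module R A by fact
  let ?K = "A\<lparr>carrier := {x \<in> carrier A. i x = \<zero>\<^bsub>B\<^esub>}\<rparr>"
  note sub = submodule_kernel[OF A B i]
  note K = module_submodule[OF A sub] and Ki = lin_submodule_incl[OF A sub]
  let ?f = "\<lambda>x\<in>carrier ?K. x" and ?g = "\<lambda>x\<in>carrier ?K. \<zero>\<^bsub>A\<^esub>"
  have "?f \<in> mod_hom R ?K A" "?g \<in> mod_hom R ?K A"
    by (simp_all only: mod_hom_iff lin_restrict[OF K] Ki lin_const_zero[OF A] restrict_extensional simp_thms)
  moreover have "compose (carrier ?K) i ?f = compose (carrier ?K) i ?g"
    by (auto simp: compose_def lin_zero[OF A B i] intro!: restrict_ext)
  ultimately have fg: "?f = ?g"
    using assms(1) K unfolding mono_arrow_def Mod_cat_def by auto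
  show "inj_on i (carrier A)"
    unfolding lin_inj_iff[OF A B i]
  proof (intro ballI impI)
    fix x assume "x \<in> carrier A" "i x = \<zero>\<^bsub>B\<^esub>"
    then show "x = \<zero>\<^bsub>A\<^esub>" using fun_cong[OF fg, of x] by simp
  qed
qed

lemma injective_cogen: "injective_object (Mod_cat R) cogen"
  unfolding injective_object_def
proof (intro conjI ballI allI impI)
  show "cogen \<in> Ob (Mod_cat R)" by (simp add: Mod_cat_def)
  note Q = module_character_module small_character_module
  note j = lin_small_inj[OF Q, folded cogen_def]
  obtain k where k: "lin R cogen character_module k"
    "\<And>y. y \<in> carrier cogen \<Longrightarrow> small_inj character_module (k y) = y"
    using small_copy_inverse[OF Q, folded cogen_def] by metis
  fix A B :: "('r, 'u) module" and i f :: "'u \<Rightarrow> 'u"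
  assume "A \<in> Ob (Mod_cat R)" "B \<in> Ob (Mod_cat R)" and mono: "mono_arrow (Mod_cat R) A B i"
    and "f \<in> Hom (Mod_cat R) A cogen"
  then have A: "module R A" and B: "module R B" and f: "lin R A cogen f" "f \<in> extensional (carrier A)"
    by (simp_all add: Mod_cat_def mod_hom_iff)
  note i = mono_arrow_Mod_cat[OF mono A B]
  obtain g where g: "lin R B character_module g" "\<And>x. x \<in> carrier A \<Longrightarrow> g (i x) = k (f x)"
    using character_module_injective[OF A B i lin_comp[OF f(1) k(1)]] by blast
  let ?g = "\<lambda>x\<in>carrier B. small_inj character_module (g x)"
  have "?g \<in> mod_hom R B cogen"
    using lin_comp[OF g(1) j] by (simp add: mod_hom_iff lin_restrict[OF B])
  moreover have "compose (carrier A) ?g i = f"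
    by (rule extensionalityI[OF _ f(2)])
      (simp_all add: compose_def lin_closed[OF i(1)] g(2) k(2) lin_closed[OF f(1)])
  ultimately show "\<exists>g\<in>Hom (Mod_cat R) B cogen. Cmp (Mod_cat R) A B cogen g i = f"
    unfolding Mod_cat_def by auto
qed

end

section \<open>Structures with the same underlying module\<close>

text \<open>
  Tensor products and linearity depend only on these four fields. Modules of different record types,
  such as the module \<open>h(X)\<close> and the coalgebra built on it, are related in this way.
\<close>

definition same_module :: "('r, 'm, 'y) module_scheme \<Rightarrow> ('r, 'm, 'z) module_scheme \<Rightarrow> bool"
  where "same_module M N \<longleftrightarrow> carrier M = carrier N \<and> ring.zero M = ring.zero N \<and> add M = add N \<and> smult M = smult N"

lemma same_module_refl [simp]: "same_module M M"
  by (simp add: same_module_def)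

context
  fixes R :: "('r, 'x) ring_scheme"
    and M :: "('r, 'm, 'y1) module_scheme" and M' :: "('r, 'm, 'y2) module_scheme"
    and N :: "('r, 'n, 'z1) module_scheme" and N' :: "('r, 'n, 'z2) module_scheme"
  assumes M: "same_module M M'" and N: "same_module N N'"
begin

lemma same_tensor_class: "tensor_class R M N = tensor_class R M' N'"
  using M N by (simp add: same_module_def tensor_class_def tensor_relations_def fun_eq_iff)

lemma same_tensor: "tensor R M N = tensor R M' N'"
  using M N same_tensor_class by (simp add: same_module_def tensor_def tensor_relations_def)

lemma same_pure_tensor: "pure_tensor R M N = pure_tensor R M' N'"
  by (simp add: pure_tensor_def same_tensor_class fun_eq_iff)

lemma same_lin: "lin R M N = lin R M' N'"
  using M N by (simp add: lin_def same_module_def fun_eq_iff)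

end

lemma same_tensor_map:
  assumes "same_module M M'" "same_module N N'" "same_module P P'" "same_module Q Q'"
  shows "tensor_map R M N P Q f g = tensor_map R M' N' P' Q' f g"
  using assms
  by (simp add: tensor_map_def same_tensor[OF assms(1,2)] same_tensor[OF assms(3,4)]
      same_pure_tensor[OF assms(1,2)] same_pure_tensor[OF assms(3,4)]) (simp add: same_module_def)

lemma same_tensor_assoc_inv:
  assumes "same_module M M'" "same_module N N'" "same_module P P'"
  shows "tensor_assoc_inv R M N P = tensor_assoc_inv R M' N' P'"
proof -
  note t = same_tensor[OF assms(1,2), of R] same_tensor[OF assms(2,3), of R]
    same_pure_tensor[OF assms(1,2), of R] same_pure_tensor[OF assms(2,3), of R]
  note t2 = same_tensor[OF same_module_refl assms(3), of R "tensor R M' N'"] same_tensor[OF assms(1) same_module_refl, of R "tensor R N' P'"]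
    same_pure_tensor[OF same_module_refl assms(3), of R "tensor R M' N'"] same_pure_tensor[OF assms(1) same_module_refl, of R "tensor R N' P'"]
  show ?thesis
    unfolding tensor_assoc_inv_def tensor_assoc_def t t2 using assms by (simp add: same_module_def)
qed

lemma same_module_module:
  assumes "same_module M M'" "module R M"
  shows "module R M'"
proof -
  interpret M: module R M by fact
  have *: "carrier M' = carrier M" "\<zero>\<^bsub>M'\<^esub> = \<zero>\<^bsub>M\<^esub>" "add M' = add M" "smult M' = smult M"
    using assms(1) by (simp_all add: same_module_def)
  show ?thesis
  proof (rule moduleI)
    show "abelian_group M'"
      by (rule abelian_groupI) (auto simp: * M.a_ac intro: M.l_neg)
  qed (simp_all add: * M.smult_l_distr M.smult_r_distr M.smult_assoc1 M.R.is_cring)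
qed

lemma (in over_ring) same_wten:
  assumes "same_module M M'" "same_module N N'"
  shows "wten M A N B = wten M' A N' B"
  unfolding wten_def
  by (simp add: same_tensor_assoc_inv[OF assms same_module_refl] same_tensor[OF assms(2) same_module_refl]
      same_tensor_map[OF assms(1) same_module_refl assms(1) same_module_refl] fun_eq_iff id_map_def assms[unfolded same_module_def])

lemma (in over_ring) rcomod_ext:
  assumes "rcomod C M \<rho>" "\<And>x. x \<in> carrier M \<Longrightarrow> \<rho> x = \<sigma> x"
  shows "rcomod C M \<sigma>"
proof -
  have "module R M" using assms(1) by (simp add: rcomod_def)
  then have 1: "lin R M (tensor R M C) \<rho> = lin R M (tensor R M C) \<sigma>" using assms(2) by (rule lin_cong)
  have 2: "lt M (tensor R M C) C \<rho> = lt M (tensor R M C) C \<sigma>" by (rule lt_cong[OF assms(2)])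
  show ?thesis using assms unfolding rcomod_def 1 2 by simp
qed

locale coalgebra_over = small_ring R U
  for R :: "('r, 'x) ring_scheme" (structure) and U :: "'u itself" +
  fixes C :: "('r, 'u) coalgebra"
  assumes C: "coalgebra R C"
begin

lemma coalg_C: "coalg C"
  using C by (simp add: coalgebra_iff)

lemmas C_simps [simp] = coalgD[OF coalg_C]

text \<open>
  The copy of a comodule inside the universe; \<open>tensor_comodule\<close> is the case \<open>M = V \<otimes> X\<close>.
\<close>

definition small_comodule :: "('r, 'm, 'y) module_scheme \<Rightarrow> ('m \<Rightarrow> ('m, 'u) tens) \<Rightarrow> ('r, 'u) comodule"
  where "small_comodule M \<rho> = (let T = small_copy M in
    \<lparr>carrier = carrier T, monoid.mult = monoid.mult T, one = one T,
         ring.zero = ring.zero T, add = add T, smult = smult T,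
         coact = \<lambda>t\<in>carrier T. tensor_map R M C T C (small_inj M) (id_map C) (\<rho> (inv_into (carrier M) (small_inj M) t))\<rparr>)"

lemma same_small_comodule: "same_module (small_copy M) (small_comodule M \<rho>)"
  by (simp add: same_module_def small_comodule_def Let_def)

context
  fixes M :: "('r, 'm, 'y) module_scheme" and \<rho>
  assumes M: "rcomod C M \<rho>" and small: "small M"
begin

lemma module_small_comodule: "module R (small_comodule M \<rho>)"
proof -
  have "module R M" using M by (simp add: rcomod_def)
  then show ?thesis using same_module_module[OF same_small_comodule module_small_copy] small by blast
qed

lemma small_comodule_bij: "bij_betw (small_inj M) (carrier M) (carrier (small_comodule M \<rho>))"
proof -
  have "module R M" using M by (simp add: rcomod_def)
  from small_copy_bij[OF this small] show ?thesis
    using same_small_comodule[of M \<rho>] by (simp add: same_module_def)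
qed

lemma lin_small_comodule: "lin R M (small_comodule M \<rho>) (small_inj M)"
proof -
  have "module R M" using M by (simp add: rcomod_def)
  from lin_small_inj[OF this small] show ?thesis
    using same_lin[OF same_module_refl[of M] same_small_comodule[of M \<rho>], of R] by simp
qed

lemma
  shows right_comodule_small_comodule: "right_comodule R C (small_comodule M \<rho>)"
    and colin_small_inj: "colin C M \<rho> (small_comodule M \<rho>) (coact (small_comodule M \<rho>)) (small_inj M)"
proof -
  let ?T = "small_comodule M \<rho>" and ?j = "small_inj M :: _ \<Rightarrow> 'u"
  have [simp]: "module R M" using M by (simp add: rcomod_def)
  have bij: "inj_on ?j (carrier M)" "?j ` carrier M = carrier ?T"
    using small_comodule_bij by (auto simp: bij_betw_def)
  have "\<exists>\<sigma>. rcomod C ?T \<sigma> \<and> colin C M \<rho> ?T \<sigma> ?j"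
  proof (rule rcomod_quotient[OF coalg_C M module_small_comodule lin_small_comodule bij(2)])
    fix a assume "a \<in> carrier M" "?j a = \<zero>\<^bsub>?T\<^esub>"
    then have "a = \<zero>\<^bsub>M\<^esub>"
      using bij(1) unfolding lin_inj_iff[OF \<open>module R M\<close> module_small_comodule lin_small_comodule] by blast
    then show "lt M ?T C ?j (\<rho> a) = \<zero>\<^bsub>tensor R ?T C\<^esub>"
      using M lin_zero[of M "tensor R M C" \<rho>] lin_zero[of "tensor R M C" "tensor R ?T C" "lt M ?T C ?j"]
        module_small_comodule lin_small_comodule by (simp add: rcomod_def)
  qed
  then obtain \<sigma> where \<sigma>: "rcomod C ?T \<sigma>" "colin C M \<rho> ?T \<sigma> ?j" by blast
  have eq: "\<sigma> t = coact ?T t" if t: "t \<in> carrier ?T" for t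
  proof -
    obtain a where a: "a \<in> carrier M" "t = ?j a" using bij(2) t by auto
    have "coact ?T t = tensor_map R M C (small_copy M) C ?j (id_map C) (\<rho> a)"
      using t a bij(1) by (simp add: small_comodule_def Let_def)
    also have "\<dots> = lt M ?T C ?j (\<rho> a)"
      by (rule fun_cong[OF same_tensor_map]) (simp_all add: same_small_comodule)
    also have "\<dots> = \<sigma> t" using \<sigma>(2) a by (simp add: colin_def)
    finally show ?thesis ..
  qed
  have "coact ?T \<in> extensional (carrier ?T)" by (simp add: small_comodule_def Let_def)
  then show "right_comodule R C ?T"
    using rcomod_ext[OF \<sigma>(1) eq] C by (simp add: right_comodule_iff)
  show "colin C M \<rho> ?T (coact ?T) ?j"
    using \<sigma>(2) eq bij(2) by (auto simp: colin_def)
qed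

lemma small_comodule_inverse:
  obtains k where "colin C (small_comodule M \<rho>) (coact (small_comodule M \<rho>)) M \<rho> k"
    "\<And>x. x \<in> carrier M \<Longrightarrow> k (small_inj M x) = x"
    "\<And>y. y \<in> carrier (small_comodule M \<rho>) \<Longrightarrow> small_inj M (k y) = y"
    "k = inv_into (carrier M) (small_inj M)"
proof -
  let ?T = "small_comodule M \<rho>" and ?j = "small_inj M :: _ \<Rightarrow> 'u"
  let ?k = "inv_into (carrier M) ?j"
  have m [simp]: "module R M" "module R ?T" "lin R M ?T ?j" "lin R M (tensor R M C) \<rho>"
    using M module_small_comodule lin_small_comodule by (simp_all add: rcomod_def)
  have kj: "?k (?j x) = x" if "x \<in> carrier M" for x
    using that small_comodule_bij by (simp add: bij_betw_inv_into_left)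
  have jk: "?j (?k y) = y" "?k y \<in> carrier M" if "y \<in> carrier ?T" for y
    using that small_comodule_bij by (auto simp: bij_betw_inv_into_right bij_betw_def inv_into_into)
  have k [simp]: "lin R ?T M ?k" by (rule lin_inverse[OF m(1-3) small_comodule_bij])
  have "colin C ?T (coact ?T) M \<rho> ?k"
    unfolding colin_def
  proof (intro conjI ballI k)
    fix y assume y: "y \<in> carrier ?T"
    have c: "\<rho> (?k y) \<in> carrier (tensor R M C)" by (rule lin_closed[OF m(4) jk(2)[OF y]])
    have "coact ?T y = lt M ?T C ?j (\<rho> (?k y))"
      using colin_small_inj jk[OF y] by (metis (no_types, lifting) colin_def)
    then have "lt ?T M C ?k (coact ?T y) = lt M M C (\<lambda>x. ?k (?j x)) (\<rho> (?k y))"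
      using c by (simp add: lt_comp)
    also have "\<dots> = lt M M C (\<lambda>x. x) (\<rho> (?k y))"
      by (rule fun_cong[OF lt_cong]) (rule kj)
    finally show "lt ?T M C ?k (coact ?T y) = \<rho> (?k y)" using c by (simp add: lt_ident)
  qed
  then show ?thesis using that kj jk by blast
qed

end

end

section \<open>Universal arrows into comodules of the form V tensor X\<close>

locale cohom = coalgebra_over R U C
  for R :: "('r, 'x) ring_scheme" (structure) and U :: "'u itself" and C :: "('r, 'u) coalgebra" +
  fixes X :: "('r, 'u) comodule" and h and \<eta>
  assumes X: "right_comodule R C X" and adj: "cohom_functor R C X h \<eta>"
begin

abbreviation xcoact :: "('r, 'm, 'y) module_scheme \<Rightarrow> ('m, 'u) tens \<Rightarrow> (('m, 'u) tens, 'u) tens"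
  where "xcoact V \<equiv> wten V X X C (coact X)"

lemma X_rcomod: "rcomod C X (coact X)"
  using X by (simp add: right_comodule_iff)

lemma X_simps [simp]: "module R X" "lin R X (tensor R X C) (coact X)" "small X"
  using X_rcomod by (simp_all add: rcomod_def)

lemma rcomod_VX: "module R V \<Longrightarrow> rcomod C (tensor R V X) (xcoact V)"
  by (rule rcomod_tensor[OF coalg_C _ X_rcomod])

text \<open>
  \<open>H\<close> with \<open>u\<close> represents the colinear maps from \<open>M\<close> to the comodules \<open>V \<otimes> X\<close>, that is,
  \<open>H = h(M)\<close> with unit \<open>u\<close>. The test modules \<open>V\<close> range over the universe, while \<open>M\<close> and \<open>H\<close> may live
  in any type.
\<close>

definition univ :: "('r, 'm, 'y) module_scheme \<Rightarrow> ('m \<Rightarrow> ('m, 'u) tens) \<Rightarrow> ('r, 'h, 'z) module_scheme \<Rightarrow> ('m \<Rightarrow> ('h, 'u) tens) \<Rightarrow> bool"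
  where "univ M \<rho> H u \<longleftrightarrow> rcomod C M \<rho> \<and> module R H \<and> colin C M \<rho> (tensor R H X) (xcoact H) u \<and>
    (\<forall>V :: ('r, 'u) module. module R V \<longrightarrow>
      (\<forall>f. colin C M \<rho> (tensor R V X) (xcoact V) f \<longrightarrow> (\<exists>g. lin R H V g \<and> (\<forall>x\<in>carrier M. lt H V X g (u x) = f x))) \<and>
      (\<forall>f g. lin R H V f \<longrightarrow> lin R H V g \<longrightarrow> (\<forall>x\<in>carrier M. lt H V X f (u x) = lt H V X g (u x)) \<longrightarrow>
        (\<forall>y\<in>carrier H. f y = g y)))"

lemma univD:
  assumes "univ M \<rho> H u"
  shows "rcomod C M \<rho>" "module R M" "lin R M (tensor R M C) \<rho>" "module R H" "colin C M \<rho> (tensor R H X) (xcoact H) u"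
    "lin R M (tensor R H X) u" "\<And>x. x \<in> carrier M \<Longrightarrow> u x \<in> carrier (tensor R H X)"
    "\<And>x. x \<in> carrier M \<Longrightarrow> \<rho> x \<in> carrier (tensor R M C)"
  using assms by (auto simp: univ_def rcomod_def colin_def intro: lin_closed)

lemma univ_cong:
  assumes "univ M \<rho> H u" "same_module H H'"
  shows "univ M \<rho> H' u"
proof -
  note s = same_tensor[OF assms(2) same_module_refl, of R X] same_lin[OF assms(2) same_module_refl, of R]
    same_tensor_map[OF assms(2) same_module_refl same_module_refl same_module_refl, of R X]
    same_wten[OF assms(2) same_module_refl, of X X C]
  have "module R H'" using assms same_module_module univD(4) by blast
  then show ?thesis
    using assms(1) assms(2)[unfolded same_module_def] unfolding univ_def by (simp add: s)
qed

lemma colin_xcoact_lt: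
  assumes "module R V" "module R V'" "lin R V V' f"
  shows "colin C (tensor R V X) (xcoact V) (tensor R V' X) (xcoact V') (lt V V' X f)"
  by (rule colin_lt[OF coalg_C assms(1,2) X_rcomod assms(3)])

text \<open>Any small module can be used as a test module, by transport to its copy in the universe.\<close>

lemma univ_ex:
  assumes u: "univ M \<rho> H u" and V: "module R V" "small V" and f: "colin C M \<rho> (tensor R V X) (xcoact V) f"
  shows "\<exists>g. lin R H V g \<and> (\<forall>x\<in>carrier M. lt H V X g (u x) = f x)"
proof -
  note [simp] = univD[OF u] V module_small_copy[OF V] lin_small_inj[OF V]
  let ?V = "small_copy V :: ('r, 'u) module" and ?j = "small_inj V :: _ \<Rightarrow> 'u"
  obtain k where k [simp]: "lin R ?V V k" and kj: "\<And>x. x \<in> carrier V \<Longrightarrow> k (?j x) = x"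
    using small_copy_inverse[OF V] by metis
  have lf: "f x \<in> carrier (tensor R V X)" if "x \<in> carrier M" for x
    using f that by (auto simp: colin_def intro: lin_closed)
  have "colin C M \<rho> (tensor R ?V X) (xcoact ?V) (\<lambda>x. lt V ?V X ?j (f x))"
    by (rule colin_comp[OF _ univD(1)[OF u] rcomod_VX rcomod_VX f colin_xcoact_lt]) simp_all
  then obtain g where g [simp]: "lin R H ?V g" and gu: "\<And>x. x \<in> carrier M \<Longrightarrow> lt H ?V X g (u x) = lt V ?V X ?j (f x)"
    using u unfolding univ_def by (meson module_small_copy[OF V])
  show ?thesis
  proof (intro exI conjI ballI)
    show "lin R H V (\<lambda>y. k (g y))" by (rule lin_comp[OF g k])
    fix x assume x: "x \<in> carrier M"
    have "lt H V X (\<lambda>y. k (g y)) (u x) = lt ?V V X k (lt H ?V X g (u x))"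
      using x by (simp add: lt_comp)
    also have "\<dots> = lt V V X (\<lambda>y. k (?j y)) (f x)"
      using x by (simp add: gu lt_comp lf)
    also have "\<dots> = lt V V X (\<lambda>y. y) (f x)"
      by (rule fun_cong[OF lt_cong]) (rule kj)
    finally show "lt H V X (\<lambda>y. k (g y)) (u x) = f x" using x by (simp add: lt_ident lf)
  qed
qed

lemma univ_unique:
  assumes u: "univ M \<rho> H u" and V: "module R V" "small V" and f: "lin R H V f" and g: "lin R H V g"
    and eq: "\<And>x. x \<in> carrier M \<Longrightarrow> lt H V X f (u x) = lt H V X g (u x)" and y: "y \<in> carrier H"
  shows "f y = g y"
proof -
  note [simp] = univD[OF u] V module_small_copy[OF V] lin_small_inj[OF V]
  let ?V = "small_copy V :: ('r, 'u) module" and ?j = "small_inj V :: _ \<Rightarrow> 'u"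
  have jf: "lin R H ?V (\<lambda>y. ?j (f y))" "lin R H ?V (\<lambda>y. ?j (g y))"
    by (rule lin_comp[OF f lin_small_inj[OF V]], rule lin_comp[OF g lin_small_inj[OF V]])
  have "lt H ?V X (\<lambda>y. ?j (f y)) (u x) = lt H ?V X (\<lambda>y. ?j (g y)) (u x)" if x: "x \<in> carrier M" for x
    using x f g eq[OF x] by (simp flip: lt_comp[where N = V])
  then have "\<forall>y\<in>carrier H. ?j (f y) = ?j (g y)"
    using u jf unfolding univ_def by (meson module_small_copy[OF V])
  then show ?thesis
    using small_inj_inj[OF V(2)] y lin_closed[OF f y] lin_closed[OF g y] by (auto dest: inj_onD)
qed

section \<open>The adjunction\<close>

lemma small_VX [simp]: "module R V \<Longrightarrow> small V \<Longrightarrow> small (tensor R V X)"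
  by (rule small_tensor_product) simp_all

lemma tensor_comodule_eq: "tensor_comodule R C X V = small_comodule (tensor R V X) (xcoact V)"
  by (simp add: tensor_comodule_def small_comodule_def small_tensor_def to_small_def of_small_def wten_def Let_def)

lemma
  shows h_functor: "is_functor (right_comodules R C) (Mod_cat R) h"
    and eta_nat: "nat_trans (right_comodules R C) (right_comodules R C) id_functor
      (comp_functor (tensor_comodule_functor R C X) h) \<eta>"
  using adj by (simp_all add: cohom_functor_def left_adjoint_def)

text \<open>
  The adjunction is formulated with copies of tensor products in the universe; \<open>unit M\<close> is its unit with
  values in the tensor product itself.
\<close>

definition unit :: "('r, 'u) comodule \<Rightarrow> 'u \<Rightarrow> ('u, 'u) tens"
  where "unit M x = of_small R (Obj h M) X (\<eta> M x)"

context
  fixes M :: "('r, 'u) comodule"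
  assumes M: "right_comodule R C M"
begin

lemma module_h [simp]: "module R (Obj h M)"
  using h_functor M by (simp add: is_functor_def right_comodules_def Mod_cat_def)

lemma eta_colinear: "colin C M (coact M) (tensor_comodule R C X (Obj h M)) (coact (tensor_comodule R C X (Obj h M))) (\<eta> M)"
  using eta_nat M
  by (simp add: nat_trans_def right_comodules_def id_functor_def comp_functor_def tensor_comodule_functor_def right_colinear_iff)

lemma unit_colinear: "colin C M (coact M) (tensor R (Obj h M) X) (xcoact (Obj h M)) (unit M)"
proof -
  let ?H = "Obj h M"
  note VX = rcomod_VX[OF module_h] small_VX[OF module_h small_UNIV]
  obtain k where k: "colin C (small_comodule (tensor R ?H X) (xcoact ?H)) (coact (small_comodule (tensor R ?H X) (xcoact ?H))) (tensor R ?H X) (xcoact ?H) k"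
    "k = inv_into (carrier (tensor R ?H X)) (small_inj (tensor R ?H X))"
    using small_comodule_inverse[OF VX] by metis
  have "unit M = (\<lambda>x. k (\<eta> M x))"
    by (simp add: unit_def fun_eq_iff k(2) of_small_def to_small_def)
  then show ?thesis
    using colin_comp[OF _ _ _ _ eta_colinear[unfolded tensor_comodule_eq] k(1)] M
      right_comodule_small_comodule[OF VX] VX(1)
    by (simp add: right_comodule_iff)
qed

lemma eta_unit:
  assumes x: "x \<in> carrier M"
  shows "\<eta> M x = to_small R (Obj h M) X (unit M x)" "\<eta> M x \<in> carrier (small_tensor R (Obj h M) X)"
proof -
  let ?H = "Obj h M"
  note VX = rcomod_VX[OF module_h] small_VX[OF module_h small_UNIV]
  have "\<eta> M x \<in> carrier (small_comodule (tensor R ?H X) (xcoact ?H))"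
    using eta_colinear x unfolding tensor_comodule_eq colin_def by (blast intro: lin_closed)
  then show "\<eta> M x = to_small R ?H X (unit M x)" "\<eta> M x \<in> carrier (small_tensor R ?H X)"
    using small_comodule_bij[OF VX]
    by (simp_all add: unit_def of_small_def to_small_def bij_betw_inv_into_right small_comodule_def Let_def small_tensor_def)
qed

lemma arr_eta:
  assumes g: "lin R (Obj h M) V g" and V: "module R V" and x: "x \<in> carrier M"
  shows "Arr (tensor_comodule_functor R C X) (Obj h M) V g (\<eta> M x) = small_inj (tensor R V X) (lt (Obj h M) V X g (unit M x))"
  using eta_unit[OF x] x
  by (simp add: tensor_comodule_functor_def to_small_def unit_def)

lemma univ_h: "univ M (coact M) (Obj h M) (unit M)"
  unfolding univ_def
proof (intro conjI allI impI)
  let ?H = "Obj h M"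
  show "rcomod C M (coact M)" using M by (simp add: right_comodule_iff)
  show "colin C M (coact M) (tensor R ?H X) (xcoact ?H) (unit M)" by (rule unit_colinear)
  fix V :: "('r, 'u) module" assume V: "module R V"
  note VX = rcomod_VX[OF V] small_VX[OF V small_UNIV]
  let ?T = "small_comodule (tensor R V X) (xcoact V)" and ?j = "small_inj (tensor R V X) :: _ \<Rightarrow> 'u"
  have jinj: "inj_on ?j (carrier (tensor R V X))" by (rule small_inj_inj[OF VX(2)])
  have mM: "module R M" using M by (simp add: right_comodule_iff rcomod_def)
  have uc: "unit M x \<in> carrier (tensor R ?H X)" if "x \<in> carrier M" for x
    using unit_colinear that unfolding colin_def by (blast intro: lin_closed)
  have universal: "\<exists>!g. g \<in> mod_hom R ?H V \<and> compose (carrier M) (Arr (tensor_comodule_functor R C X) ?H V g) (\<eta> M) = f"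
    if "f \<in> right_colinear R C M ?T" for f
    using adj M V that
    by (simp add: cohom_functor_def left_adjoint_def right_comodules_def Mod_cat_def tensor_comodule_functor_def tensor_comodule_eq)
  {
    fix f assume f: "colin C M (coact M) (tensor R V X) (xcoact V) f"
    let ?f = "\<lambda>x\<in>carrier M. ?j (f x)"
    have "colin C M (coact M) ?T (coact ?T) (\<lambda>x. ?j (f x))"
      using colin_comp[OF _ _ VX(1) _ f colin_small_inj[OF VX]] M right_comodule_small_comodule[OF VX]
      by (simp add: right_comodule_iff)
    then have "?f \<in> right_colinear R C M ?T"
      by (simp add: right_colinear_iff colin_cong[OF mM, of ?f "\<lambda>x. ?j (f x)"])
    then obtain g where g: "g \<in> mod_hom R ?H V" "compose (carrier M) (Arr (tensor_comodule_functor R C X) ?H V g) (\<eta> M) = ?f"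
      using universal by blast
    have gl: "lin R ?H V g" using g(1) by (simp add: mod_hom_iff)
    have "lt ?H V X g (unit M x) = f x" if x: "x \<in> carrier M" for x
    proof (rule inj_onD[OF jinj])
      show "?j (lt ?H V X g (unit M x)) = ?j (f x)"
        using fun_cong[OF g(2), of x] x by (simp add: compose_def arr_eta[OF gl V])
    qed (use x uc gl V f in \<open>auto simp: colin_def intro: lin_closed\<close>)
    then show "\<exists>g. lin R ?H V g \<and> (\<forall>x\<in>carrier M. lt ?H V X g (unit M x) = f x)"
      using gl by blast
  next
    fix f g assume f: "lin R ?H V f" and g: "lin R ?H V g"
      and eq: "\<forall>x\<in>carrier M. lt ?H V X f (unit M x) = lt ?H V X g (unit M x)"
    let ?f = "restrict f (carrier ?H)" and ?g = "restrict g (carrier ?H)"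
    have l: "lin R ?H V ?f" "lin R ?H V ?g" using f g by (simp_all add: lin_restrict)
    have c: "lt ?H V X ?f = lt ?H V X f" "lt ?H V X ?g = lt ?H V X g" by (rule lt_cong; simp)+
    let ?k = "\<lambda>x\<in>carrier M. ?j (lt ?H V X f (unit M x))"
    have "colin C M (coact M) ?T (coact ?T) (\<lambda>x. ?j (lt ?H V X f (unit M x)))"
      using colin_comp[OF _ _ VX(1) _ colin_comp[OF _ _ rcomod_VX VX(1) unit_colinear colin_xcoact_lt] colin_small_inj[OF VX]]
        M right_comodule_small_comodule[OF VX] f V
      by (simp add: right_comodule_iff)
    then have "?k \<in> right_colinear R C M ?T"
      by (simp add: right_colinear_iff colin_cong[OF mM, of ?k "\<lambda>x. ?j (lt ?H V X f (unit M x))"])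
    moreover have "compose (carrier M) (Arr (tensor_comodule_functor R C X) ?H V ?f) (\<eta> M) = ?k"
      "compose (carrier M) (Arr (tensor_comodule_functor R C X) ?H V ?g) (\<eta> M) = ?k"
      using eq unfolding compose_def by (auto simp: arr_eta[OF l(1) V] arr_eta[OF l(2) V] c intro!: restrict_ext)
    ultimately have "?f = ?g" using universal[of ?k] l by (auto simp: mod_hom_iff)
    then show "\<forall>y\<in>carrier ?H. f y = g y" by (metis restrict_apply')
  }
qed simp

end

lemma unit_natural:
  assumes A: "right_comodule R C A" and B: "right_comodule R C B" and f: "f \<in> right_colinear R C A B" and x: "x \<in> carrier A"
  shows "Arr h A B f \<in> mod_hom R (Obj h A) (Obj h B)"
    and "lt (Obj h A) (Obj h B) X (Arr h A B f) (unit A x) = unit B (f x)"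
proof -
  show "Arr h A B f \<in> mod_hom R (Obj h A) (Obj h B)"
    using h_functor A B f by (simp add: is_functor_def right_comodules_def Mod_cat_def)
  then have l: "lin R (Obj h A) (Obj h B) (Arr h A B f)" by (simp add: mod_hom_iff)
  have fx: "f x \<in> carrier B" using f x by (auto simp: right_colinear_iff colin_def intro: lin_closed)
  have "compose (carrier A) (\<eta> B) f = compose (carrier A) (Arr (tensor_comodule_functor R C X) (Obj h A) (Obj h B) (Arr h A B f)) (\<eta> A)"
    using eta_nat A B f
    by (simp add: nat_trans_def right_comodules_def id_functor_def comp_functor_def)
  from fun_cong[OF this, of x] have "\<eta> B (f x) = small_inj (tensor R (Obj h B) X) (lt (Obj h A) (Obj h B) X (Arr h A B f) (unit A x))"
    using x by (simp add: compose_def arr_eta[OF A l module_h[OF B]])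
  then have "small_inj (tensor R (Obj h B) X) (unit B (f x)) = (small_inj (tensor R (Obj h B) X) (lt (Obj h A) (Obj h B) X (Arr h A B f) (unit A x)) :: 'u)"
    using eta_unit(1)[OF B fx] by (simp add: to_small_def)
  then show "lt (Obj h A) (Obj h B) X (Arr h A B f) (unit A x) = unit B (f x)"
    by (rule inj_onD[OF small_inj_inj[OF small_VX[OF module_h[OF B] small_UNIV]], symmetric])
      (use univD(7)[OF univ_h[OF A] x] univD(7)[OF univ_h[OF B] fx] l A B in simp_all)
qed

lemma univ_exists:
  assumes M: "rcomod C M \<rho>" "small M"
  shows "\<exists>(H :: ('r, 'u) module) u. univ M \<rho> H u"
proof -
  let ?T = "small_comodule M \<rho>" and ?j = "small_inj M :: _ \<Rightarrow> 'u"
  note T = right_comodule_small_comodule[OF M]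
  note un = univ_h[OF T] 
  note j = colin_small_inj[OF M]
  have jc: "?j x \<in> carrier ?T" if "x \<in> carrier M" for x using j that by (auto simp: colin_def intro: lin_closed)
  obtain k where k: "colin C ?T (coact ?T) M \<rho> k"
    "\<And>x. x \<in> carrier M \<Longrightarrow> k (?j x) = x" "\<And>y. y \<in> carrier ?T \<Longrightarrow> ?j (k y) = y"
    using small_comodule_inverse[OF M] by metis
  have kc: "k y \<in> carrier M" if "y \<in> carrier ?T" for y using k(1) that by (auto simp: colin_def intro: lin_closed)
  let ?u = "\<lambda>x. unit ?T (?j x)"
  have "univ M \<rho> (Obj h ?T) ?u"
    unfolding univ_def
  proof (intro conjI allI impI)
    show "rcomod C M \<rho>" by (rule M)
    show "module R (Obj h ?T)" by (rule module_h[OF T])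
    show "colin C M \<rho> (tensor R (Obj h ?T) X) (xcoact (Obj h ?T)) ?u"
      by (rule colin_comp[OF _ M(1) univD(1)[OF un] rcomod_VX j univD(5)[OF un]]) (simp_all add: module_h[OF T])
    fix V :: "('r, 'u) module" assume V: "module R V"
    {
      fix f assume f: "colin C M \<rho> (tensor R V X) (xcoact V) f"
      have "colin C ?T (coact ?T) (tensor R V X) (xcoact V) (\<lambda>y. f (k y))"
        by (rule colin_comp[OF _ univD(1)[OF un] M(1) rcomod_VX k(1) f]) (simp_all add: V)
      from univ_ex[OF un V small_UNIV this]
      show "\<exists>g. lin R (Obj h ?T) V g \<and> (\<forall>x\<in>carrier M. lt (Obj h ?T) V X g (?u x) = f x)"
        using jc k(2) by metis
    next
      fix f g assume "lin R (Obj h ?T) V f" "lin R (Obj h ?T) V g"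
        and "\<forall>x\<in>carrier M. lt (Obj h ?T) V X f (?u x) = lt (Obj h ?T) V X g (?u x)"
      then show "\<forall>y\<in>carrier (Obj h ?T). f y = g y"
        using univ_unique[OF un V small_UNIV, of f g] kc k(3) by metis
    }
  qed
  then show ?thesis by blast
qed

end

context over_ring
begin

lemma colin_pure_tensor:
  assumes "module R C" "module R W" "rcomod C M \<rho>" "w \<in> carrier W"
  shows "colin C M \<rho> (tensor R W M) (wten W M M C \<rho>) (pure_tensor R W M w)"
  using assms by (simp add: colin_def rcomod_def)

lemma inj_on_rt_if_left_inverse:
  assumes "module R M" "module R N" "module R P" "lin R M N f" "lin R N M g"
    and "\<And>x. x \<in> carrier M \<Longrightarrow> g (f x) = x"
  shows "inj_on (rt P M N f) (carrier (tensor R P M))"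
  unfolding rt_inj_iff_lt_inj[OF assms(1-4)] by (rule inj_on_lt_if_left_inverse) fact+

end

context cohom
begin

section \<open>Universal arrows and tensor products\<close>

lemma wten_colin:
  assumes W [simp]: "module R W" and H [simp]: "module R H" and M: "rcomod C M \<rho>"
    and u: "colin C M \<rho> (tensor R H X) (xcoact H) u"
  shows "colin C (tensor R W M) (wten W M M C \<rho>) (tensor R (tensor R W H) X) (xcoact (tensor R W H)) (wten W M H X u)"
proof -
  have [simp]: "module R M" "lin R M (tensor R M C) \<rho>" "lin R M (tensor R H X) u"
    using M u by (simp_all add: rcomod_def colin_def)
  show ?thesis
    unfolding colin_def
    by (intro conjI ballI lin_wten wten_assoc) (use u in \<open>simp_all add: colin_def\<close>)
qed

text \<open>
  For a colinear map \<open>f\<close> on \<open>W \<otimes> M\<close> and \<open>w \<in> W\<close>, the map \<open>f (w \<otimes> -)\<close> factors through \<open>u\<close> by a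
  unique linear map \<open>g w\<close>. By uniqueness \<open>g w\<close> depends linearly on \<open>w\<close>, and so defines a linear map
  on \<open>W \<otimes> H\<close>.
\<close>

lemma univ_tensor:
  assumes W [simp]: "module R W" and u: "univ M \<rho> H u"
  shows "univ (tensor R W M) (wten W M M C \<rho>) (tensor R W H) (wten W M H X u)"
  unfolding univ_def
proof (intro conjI allI impI)
  note [simp] = univD[OF u]
  show "rcomod C (tensor R W M) (wten W M M C \<rho>)" by (rule rcomod_tensor[OF coalg_C]) simp_all
  show "module R (tensor R W H)" by simp
  show "colin C (tensor R W M) (wten W M M C \<rho>) (tensor R (tensor R W H) X) (xcoact (tensor R W H)) (wten W M H X u)"
    by (rule wten_colin) simp_all
  interpret W: module R W by simp
  fix V :: "('r, 'u) module" assume V [simp]: "module R V"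
  interpret V: module R V by simp
  have G_pure: "lt (tensor R W H) V X G (wten W M H X u (pure_tensor R W M w m)) = lt H V X (\<lambda>y. G (pure_tensor R W H w y)) (u m)"
    if "lin R (tensor R W H) V G" "w \<in> carrier W" "m \<in> carrier M" for G w m
    using that by (simp add: lt_comp)
  {
    fix f assume f: "colin C (tensor R W M) (wten W M M C \<rho>) (tensor R V X) (xcoact V) f"
    have lf [simp]: "lin R (tensor R W M) (tensor R V X) f" using f by (simp add: colin_def)
    have "\<exists>g. lin R H V g \<and> (\<forall>m\<in>carrier M. lt H V X g (u m) = f (pure_tensor R W M w m))" if w: "w \<in> carrier W" for w
      by (rule univ_ex[OF u V small_UNIV], rule colin_comp[OF _ univD(1)[OF u] rcomod_tensor[OF coalg_C W] rcomod_VX colin_pure_tensor f])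
        (simp_all add: w)
    then obtain g where g: "\<And>w. w \<in> carrier W \<Longrightarrow> lin R H V (g w)"
      "\<And>w m. w \<in> carrier W \<Longrightarrow> m \<in> carrier M \<Longrightarrow> lt H V X (g w) (u m) = f (pure_tensor R W M w m)"
      by metis
    have b: "bilin W H V g"
    proof (rule bilinI, rule g, assumption)
      fix y assume y: "y \<in> carrier H"
      show "lin R W V (\<lambda>w. g w y)"
      proof (rule linI)
        fix w w' assume w: "w \<in> carrier W" "w' \<in> carrier W"
        show "g (w \<oplus>\<^bsub>W\<^esub> w') y = g w y \<oplus>\<^bsub>V\<^esub> g w' y"
          by (rule univ_unique[OF u V small_UNIV g(1) lin_plus[OF V g(1) g(1)] _ y])
            (use w in \<open>simp_all add: g lt_plus pure_tensor_add_left lin_add[OF lf]\<close>)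
      next
        fix r w assume w: "r \<in> carrier R" "w \<in> carrier W"
        show "g (r \<odot>\<^bsub>W\<^esub> w) y = r \<odot>\<^bsub>V\<^esub> g w y"
          by (rule univ_unique[OF u V small_UNIV g(1) lin_scale[OF V g(1)] _ y])
            (use w in \<open>simp_all add: g lt_scale pure_tensor_smult_left lin_smult[OF lf]\<close>)
      qed (use g(1) y in \<open>auto intro: lin_closed\<close>)
    qed
    let ?G = "tlift W H V g"
    have G [simp]: "lin R (tensor R W H) V ?G" by (rule lin_tlift) (simp_all add: b)
    have "lt (tensor R W H) V X ?G (wten W M H X u t) = f t" if t: "t \<in> carrier (tensor R W M)" for t
    proof (rule tensor_ext[where f = "\<lambda>t. lt (tensor R W H) V X ?G (wten W M H X u t)" and g = f and t = t])
      show "lin R (tensor R W M) (tensor R V X) (\<lambda>t. lt (tensor R W H) V X ?G (wten W M H X u t))"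
        by (rule lin_comp[OF lin_wten lin_lt]) simp_all
      fix w m assume w: "w \<in> carrier W" "m \<in> carrier M"
      have "lt (tensor R W H) V X ?G (wten W M H X u (pure_tensor R W M w m)) = lt H V X (\<lambda>y. ?G (pure_tensor R W H w y)) (u m)"
        by (rule G_pure[OF G w])
      also have "\<dots> = lt H V X (g w) (u m)"
        by (rule fun_cong[OF lt_cong]) (use w in \<open>simp add: tlift_pure b\<close>)
      finally show "lt (tensor R W H) V X ?G (wten W M H X u (pure_tensor R W M w m)) = f (pure_tensor R W M w m)"
        using w by (simp add: g)
    qed (simp_all add: t)
    then show "\<exists>G. lin R (tensor R W H) V G \<and> (\<forall>t\<in>carrier (tensor R W M). lt (tensor R W H) V X G (wten W M H X u t) = f t)"
      using G by blast
  next
    fix f g assume f [simp]: "lin R (tensor R W H) V f" and g [simp]: "lin R (tensor R W H) V g"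
      and eq: "\<forall>t\<in>carrier (tensor R W M). lt (tensor R W H) V X f (wten W M H X u t) = lt (tensor R W H) V X g (wten W M H X u t)"
    show "\<forall>y\<in>carrier (tensor R W H). f y = g y"
    proof
      fix y assume y: "y \<in> carrier (tensor R W H)"
      show "f y = g y"
      proof (rule tensor_ext[OF W univD(4)[OF u] V f g _ y])
        fix w z assume w: "w \<in> carrier W" and z: "z \<in> carrier H"
        show "f (pure_tensor R W H w z) = g (pure_tensor R W H w z)"
        proof (rule univ_unique[OF u V small_UNIV _ _ _ z])
          show "lin R H V (\<lambda>z. f (pure_tensor R W H w z))" "lin R H V (\<lambda>z. g (pure_tensor R W H w z))"
            by (rule lin_comp[OF lin_pure_tensor_right]; simp add: w)+
          fix m assume "m \<in> carrier M"
          then show "lt H V X (\<lambda>z. f (pure_tensor R W H w z)) (u m) = lt H V X (\<lambda>z. g (pure_tensor R W H w z)) (u m)"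
            using eq[rule_format, of "pure_tensor R W M w m"] w by (simp add: G_pure[symmetric] del: wten_pure)
        qed
      qed
    qed
  }
qed

section \<open>The coendomorphism coalgebra\<close>

abbreviation uX where "uX \<equiv> unit X"

definition E :: "('r, 'u) coalgebra"
  where "E = coend_coalgebra R X h \<eta>"

lemma same_E: "same_module (Obj h X) E"
  by (simp add: same_module_def E_def coend_coalgebra_def Let_def)

lemma univ_X: "univ X (coact X) E uX"
  by (rule univ_cong[OF univ_h[OF X] same_E])

lemmas E_simps [simp] = univD(4)[OF univ_X] univD(6,7)[OF univ_X]

lemma univ_VX: "module R V \<Longrightarrow> univ (tensor R V X) (xcoact V) (tensor R V E) (wten V X E X uX)"
  by (rule univ_tensor[OF _ univ_X])

text \<open>
  The composite of \<open>u\<close> with \<open>H \<otimes> u\<^sub>X\<close> is colinear, hence factors through \<open>u\<close>. The resulting \<open>\<theta>\<close> is a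
  coaction of \<open>E\<close> on \<open>h(M)\<close>; for \<open>M = X\<close> it is the comultiplication.
\<close>

lemma comodule_structure_ex:
  assumes u: "univ M \<rho> H u" and H: "small H"
  shows "\<exists>\<theta>. lin R H (tensor R H E) \<theta> \<and> (\<forall>x\<in>carrier M. lt H (tensor R H E) X \<theta> (u x) = wten H X E X uX (u x))"
proof (rule univ_ex[OF u])
  note [simp] = univD[OF u]
  show "colin C M \<rho> (tensor R (tensor R H E) X) (xcoact (tensor R H E)) (\<lambda>x. wten H X E X uX (u x))"
    by (rule colin_comp[OF _ univD(1)[OF u] rcomod_VX rcomod_VX univD(5)[OF u] wten_colin])
      (simp_all add: X_rcomod univD(5)[OF univ_X])
  show "small (tensor R H E)" using H by (intro small_tensor_product) simp_all
qed (simp_all add: univD[OF u])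

lemma coend_unit_apply: "x \<in> carrier X \<Longrightarrow> coend_unit R X h \<eta> x = uX x"
  by (simp add: coend_unit_def unit_def)

text \<open>
  The definite descriptions in the coendomorphism coalgebra are meaningful, since the universal
  property of \<open>X\<close> gives existence and uniqueness; most of the work is to replace \<open>h(X)\<close> by \<open>E\<close>, which
  has the same underlying module.
\<close>

lemma
  shows comult_E_hom: "comult E \<in> mod_hom R E (tensor R E E)"
    and comult_E: "\<And>x. x \<in> carrier X \<Longrightarrow> lt E (tensor R E E) X (comult E) (uX x) = wten E X E X uX (uX x)"
    and counit_E_hom: "counit E \<in> mod_hom R E (regular_module R)"
    and counit_E: "\<And>x. x \<in> carrier X \<Longrightarrow> lt E (regular_module R) X (counit E) (uX x) = pure_tensor R (regular_module R) X \<one> x"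
proof -
  note small_EE = small_tensor_product[OF E_simps(1) small_UNIV E_simps(1) small_UNIV]
  note [simp] = module_regular
  let ?P = "\<lambda>\<Delta>. \<Delta> \<in> mod_hom R E (tensor R E E) \<and>
    (\<forall>x\<in>carrier X. lt E (tensor R E E) X \<Delta> (uX x) = wten E X E X uX (uX x))"
  let ?Q = "\<lambda>\<epsilon>. \<epsilon> \<in> mod_hom R E (regular_module R) \<and>
    (\<forall>x\<in>carrier X. lt E (regular_module R) X \<epsilon> (uX x) = pure_tensor R (regular_module R) X \<one> x)"
  note s1 = same_tensor[OF same_E same_E, of R] same_tensor[OF same_E same_module_refl, of R X]
    same_lin[OF same_E same_module_refl, of R]
    same_tensor_map[OF same_E same_module_refl[of X] same_module_refl same_module_refl, of R]
    same_tensor_map[OF same_E same_module_refl same_E same_module_refl, of R]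
  have mh: "mod_hom R (Obj h X) (tensor R E E) = mod_hom R E (tensor R E E)"
    "mod_hom R (Obj h X) (regular_module R) = mod_hom R E (regular_module R)"
    using same_E by (simp_all add: mod_hom_def same_module_def)
  have ta: "tensor_assoc R (Obj h X) (Obj h X) X = tensor_assoc R E E X"
    unfolding tensor_assoc_def s1 same_tensor[OF same_E same_module_refl, of R "tensor R E X"]
      same_pure_tensor[OF same_E same_E, of R] same_pure_tensor[OF same_E same_module_refl, of R X]
      same_pure_tensor[OF same_E same_module_refl, of R "tensor R E X"]
    using same_E by (simp add: same_module_def)
  have ccong: "rt E X (tensor R E X) (coend_unit R X h \<eta>) = rt E X (tensor R E X) uX"
    by (rule rt_cong) (rule coend_unit_apply)
  have idE: "id_map (Obj h X) = id_map E" using same_E by (simp add: id_map_def same_module_def)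
  have "comult E = (THE \<Delta>. \<Delta> \<in> mod_hom R (Obj h X) (tensor R (Obj h X) (Obj h X)) \<and>
           (\<forall>x\<in>carrier X.
              tensor_assoc R (Obj h X) (Obj h X) X (tensor_map R (Obj h X) X (tensor R (Obj h X) (Obj h X)) X \<Delta> (id_map X) (coend_unit R X h \<eta> x)) =
              tensor_map R (Obj h X) X (Obj h X) (tensor R (Obj h X) X) (id_map (Obj h X)) (coend_unit R X h \<eta>) (coend_unit R X h \<eta> x)))"
    by (simp add: E_def coend_coalgebra_def Let_def)
  also have "\<dots> = (THE \<Delta>. \<Delta> \<in> mod_hom R E (tensor R E E) \<and>
           (\<forall>x\<in>carrier X.
              tensor_assoc R E E X (tensor_map R E X (tensor R E E) X \<Delta> (id_map X) (coend_unit R X h \<eta> x)) =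
              tensor_map R E X E (tensor R E X) (id_map E) (coend_unit R X h \<eta>) (coend_unit R X h \<eta> x)))"
    unfolding ta s1 mh idE ..
  also have "\<dots> = The ?P"
    by (intro arg_cong[where f = The] ext conj_cong refl ball_cong)
      (simp add: coend_unit_apply ccong wten_eq_iff mod_hom_iff)
  finally have 1: "comult E = The ?P" .
  obtain \<Delta> where D: "lin R E (tensor R E E) \<Delta>" "\<And>x. x \<in> carrier X \<Longrightarrow> lt E (tensor R E E) X \<Delta> (uX x) = wten E X E X uX (uX x)"
    using comodule_structure_ex[OF univ_X small_UNIV] by blast
  have rD: "lt E (tensor R E E) X (restrict \<Delta> (carrier E)) = lt E (tensor R E E) X \<Delta>" by (rule lt_cong) simp
  have "?P (restrict \<Delta> (carrier E))" using D by (simp add: mod_hom_iff lin_restrict rD)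
  moreover have "f = g" if "?P f" "?P g" for f g
  proof (rule extensionalityI[of _ "carrier E"])
    show "f \<in> extensional (carrier E)" "g \<in> extensional (carrier E)" using that by (simp_all add: mod_hom_iff)
    fix y assume y: "y \<in> carrier E"
    show "f y = g y"
      by (rule univ_unique[OF univ_X _ small_EE _ _ _ y]) (use that in \<open>simp_all add: mod_hom_iff\<close>)
  qed
  ultimately have "\<exists>!\<Delta>. ?P \<Delta>" by blast
  then have "?P (comult E)" unfolding 1 by (rule theI')
  then show "comult E \<in> mod_hom R E (tensor R E E)"
    and "\<And>x. x \<in> carrier X \<Longrightarrow> lt E (tensor R E E) X (comult E) (uX x) = wten E X E X uX (uX x)" by blast+
  have "counit E = (THE \<epsilon>. \<epsilon> \<in> mod_hom R (Obj h X) (regular_module R) \<and>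
           (\<forall>x\<in>carrier X.
              tensor_map R (Obj h X) X (regular_module R) X \<epsilon> (id_map X) (coend_unit R X h \<eta> x) =
              pure_tensor R (regular_module R) X \<one>\<^bsub>R\<^esub> x))"
    by (simp add: E_def coend_coalgebra_def Let_def)
  also have "\<dots> = (THE \<epsilon>. \<epsilon> \<in> mod_hom R E (regular_module R) \<and>
           (\<forall>x\<in>carrier X.
              tensor_map R E X (regular_module R) X \<epsilon> (id_map X) (coend_unit R X h \<eta> x) =
              pure_tensor R (regular_module R) X \<one>\<^bsub>R\<^esub> x))"
    unfolding mh s1 ..
  also have "\<dots> = The ?Q"
    by (intro arg_cong[where f = The] ext conj_cong refl ball_cong) (simp add: coend_unit_apply)
  finally have 2: "counit E = The ?Q" .
  have "colin C X (coact X) (tensor R (regular_module R) X) (xcoact (regular_module R)) (pure_tensor R (regular_module R) X \<one>)"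
    by (rule colin_pure_tensor) (simp_all add: X_rcomod)
  from univ_ex[OF univ_X _ small_regular this] obtain e where e: "lin R E (regular_module R) e"
    "\<And>x. x \<in> carrier X \<Longrightarrow> lt E (regular_module R) X e (uX x) = pure_tensor R (regular_module R) X \<one> x"
    by auto
  have re: "lt E (regular_module R) X (restrict e (carrier E)) = lt E (regular_module R) X e" by (rule lt_cong) simp
  have "?Q (restrict e (carrier E))" using e by (simp add: mod_hom_iff lin_restrict re)
  moreover have "f = g" if "?Q f" "?Q g" for f g
  proof (rule extensionalityI[of _ "carrier E"])
    show "f \<in> extensional (carrier E)" "g \<in> extensional (carrier E)" using that by (simp_all add: mod_hom_iff)
    fix y assume y: "y \<in> carrier E"
    show "f y = g y"
      by (rule univ_unique[OF univ_X _ small_regular _ _ _ y]) (use that in \<open>simp_all add: mod_hom_iff\<close>)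
  qed
  ultimately have "\<exists>!\<epsilon>. ?Q \<epsilon>" by blast
  then have "?Q (counit E)" unfolding 2 by (rule theI')
  then show "counit E \<in> mod_hom R E (regular_module R)"
    and "\<And>x. x \<in> carrier X \<Longrightarrow> lt E (regular_module R) X (counit E) (uX x) = pure_tensor R (regular_module R) X \<one> x" by blast+
qed

lemma E_lin [simp]: "lin R E (tensor R E E) (comult E)" "lin R E (regular_module R) (counit E)"
  using comult_E_hom counit_E_hom by (simp_all add: mod_hom_iff)

lemma wten_comult_E:
  assumes [simp]: "module R N" and t: "t \<in> carrier (tensor R N X)"
  shows "lt (tensor R N E) (tensor R (tensor R N E) E) X (wten N E E E (comult E)) (wten N X E X uX t) =
    wten (tensor R N E) X E X uX (wten N X E X uX t)"
  by (rule wten_assoc) (simp_all add: comult_E t)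

text \<open>
  Tensoring the characterization of the counit with \<open>N\<close>: the counit of \<open>E\<close> splits the unit of
  \<open>N \<otimes> X\<close>.
\<close>

lemma contract_unit:
  assumes N [simp]: "module R N" and t: "t \<in> carrier (tensor R N X)"
  shows "lt (tensor R N E) N X (contract N E (counit E)) (wten N X E X uX t) = t" (is "?l t = t")
proof (rule tensor_ext[where f = ?l and g = "\<lambda>t. t" and t = t])
  interpret N: module R N by simp
  show "lin R (tensor R N X) (tensor R N X) ?l"
    by (rule lin_comp[OF lin_wten lin_lt]) simp_all
  fix n x assume n: "n \<in> carrier N" "x \<in> carrier X"
  note sa = lin_scalar_action[OF N n(1)]
  have "?l (pure_tensor R N X n x) = lt E N X (\<lambda>e. contract N E (counit E) (pure_tensor R N E n e)) (uX x)"
    using n by (simp add: lt_comp)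
  also have "\<dots> = lt E N X (\<lambda>e. counit E e \<odot>\<^bsub>N\<^esub> n) (uX x)"
    by (rule fun_cong[OF lt_cong]) (simp add: n)
  also have "\<dots> = lt (regular_module R) N X (\<lambda>r. r \<odot>\<^bsub>N\<^esub> n) (lt E (regular_module R) X (counit E) (uX x))"
    using n sa by (simp add: lt_comp module_regular)
  also have "\<dots> = pure_tensor R N X n x"
    using n sa by (simp add: counit_E module_regular)
  finally show "?l (pure_tensor R N X n x) = pure_tensor R N X n x" .
qed (simp_all add: t)

lemma unit_VX_inj:
  assumes "module R N"
  shows "inj_on (wten N X E X uX) (carrier (tensor R N X))"
  by (rule inj_on_inverseI) (rule contract_unit[OF assms])

text \<open>Both axioms are equalities of linear maps on \<open>h(M)\<close>, so it suffices to compare them after the unit.\<close>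

lemma comodule_structure:
  assumes u: "univ M \<rho> H u" and H: "small H" and th [simp]: "lin R H (tensor R H E) \<theta>"
    and eq: "\<And>x. x \<in> carrier M \<Longrightarrow> lt H (tensor R H E) X \<theta> (u x) = wten H X E X uX (u x)"
  shows "rcomod E H \<theta>"
  unfolding rcomod_def
proof (intro conjI ballI)
  note [simp] = univD[OF u]
  note sm = small_tensor_product[OF univD(4)[OF u] H E_simps(1) small_UNIV]
  note sm2 = small_tensor_product[OF module_tensor[OF univD(4)[OF u] E_simps(1)] sm E_simps(1) small_UNIV]
  show "module R H" "lin R H (tensor R H E) \<theta>" by simp_all
  fix y assume y: "y \<in> carrier H"
  show "lt H (tensor R H E) E \<theta> (\<theta> y) = wten H E E E (comult E) (\<theta> y)"
  proof (rule univ_unique[OF u _ sm2 _ _ _ y])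
    show [simp]: "lin R H (tensor R (tensor R H E) E) (\<lambda>y. lt H (tensor R H E) E \<theta> (\<theta> y))"
      by (rule lin_comp[OF th lin_lt]) simp_all
    show [simp]: "lin R H (tensor R (tensor R H E) E) (\<lambda>y. wten H E E E (comult E) (\<theta> y))"
      by (rule lin_comp[OF th lin_wten]) simp_all
    fix x assume x: "x \<in> carrier M"
    have "lt H (tensor R (tensor R H E) E) X (\<lambda>y. lt H (tensor R H E) E \<theta> (\<theta> y)) (u x) =
        lt (tensor R H E) (tensor R (tensor R H E) E) X (lt H (tensor R H E) E \<theta>) (wten H X E X uX (u x))"
      using x by (simp add: lt_comp flip: eq)
    also have "\<dots> = wten (tensor R H E) X E X uX (wten H X E X uX (u x))"
      using x by (simp add: wten_lt eq)
    also have "\<dots> = lt (tensor R H E) (tensor R (tensor R H E) E) X (wten H E E E (comult E)) (lt H (tensor R H E) X \<theta> (u x))"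
      using x by (simp add: wten_comult_E eq)
    also have "\<dots> = lt H (tensor R (tensor R H E) E) X (\<lambda>y. wten H E E E (comult E) (\<theta> y)) (u x)"
      using x by (simp add: lt_comp)
    finally show "lt H (tensor R (tensor R H E) E) X (\<lambda>y. lt H (tensor R H E) E \<theta> (\<theta> y)) (u x) =
      lt H (tensor R (tensor R H E) E) X (\<lambda>y. wten H E E E (comult E) (\<theta> y)) (u x)" .
  qed simp
  show "contract H E (counit E) (\<theta> y) = y"
  proof (rule univ_unique[OF u _ H _ lin_id _ y])
    show "lin R H H (\<lambda>y. contract H E (counit E) (\<theta> y))"
      by (rule lin_comp[OF th lin_contract]) simp_all
    fix x assume x: "x \<in> carrier M"
    have "lt H H X (\<lambda>y. contract H E (counit E) (\<theta> y)) (u x) = lt (tensor R H E) H X (contract H E (counit E)) (lt H (tensor R H E) X \<theta> (u x))"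
      using x by (simp add: lt_comp)
    then show "lt H H X (\<lambda>y. contract H E (counit E) (\<theta> y)) (u x) = lt H H X (\<lambda>y. y) (u x)"
      using x by (simp add: eq contract_unit lt_ident)
  qed simp
qed

lemma left_counit_X: "x \<in> carrier X \<Longrightarrow> contract X E (counit E) (tswap E X (uX x)) = x"
  using lt_counit_iff[of X E "counit E" "uX x" x] by (simp add: counit_E)

text \<open>
  The remaining counit law of the coalgebra: contracting the left factor commutes with \<open>u\<^sub>X\<close> acting
  on the right one, so after the unit the law becomes the characterization of the counit.
\<close>

lemma left_counit_E:
  assumes y: "y \<in> carrier E"
  shows "contract E E (counit E) (tswap E E (comult E y)) = y"
proof (rule univ_unique[OF univ_X _ small_UNIV _ lin_id _ y])
  interpret E: module R E by simp
  have lct [simp]: "lin R (tensor R E E) E (\<lambda>t. contract E E (counit E) (tswap E E t))"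
    by (rule lin_comp[OF lin_tswap lin_contract]) simp_all
  show "lin R E E (\<lambda>y. contract E E (counit E) (tswap E E (comult E y)))"
    by (rule lin_comp[OF E_lin(1) lct])
  let ?l = "\<lambda>t. lt (tensor R E E) E X (\<lambda>t. contract E E (counit E) (tswap E E t)) (wten E X E X uX t)"
  let ?r = "\<lambda>t. uX (contract X E (counit E) (tswap E X t))"
  have lr: "?l t = ?r t" if t: "t \<in> carrier (tensor R E X)" for t
  proof (rule tensor_ext[where f = ?l and g = ?r and t = t])
    show "lin R (tensor R E X) (tensor R E X) ?l"
      by (rule lin_comp[OF lin_wten lin_lt]) simp_all
    show "lin R (tensor R E X) (tensor R E X) ?r"
      by (rule lin_comp[OF lin_comp[OF lin_tswap lin_contract] E_simps(2)]) simp_all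
    fix e x assume e: "e \<in> carrier E" "x \<in> carrier X"
    have ce: "counit E e \<in> carrier R" by (rule functional_closed[OF E_lin(2) e(1)])
    have "?l (pure_tensor R E X e x) = lt E E X (\<lambda>e'. contract E E (counit E) (tswap E E (pure_tensor R E E e e'))) (uX x)"
      using e by (simp add: lt_comp)
    also have "\<dots> = lt E E X (\<lambda>e'. counit E e \<odot>\<^bsub>E\<^esub> e') (uX x)"
      by (rule fun_cong[OF lt_cong]) (use e in \<open>simp add: tswap_pure\<close>)
    also have "\<dots> = counit E e \<odot>\<^bsub>tensor R E X\<^esub> uX x"
      using e ce lt_scale[of E E X "\<lambda>y. y" "counit E e" "uX x"] by (simp add: lt_ident)
    also have "\<dots> = ?r (pure_tensor R E X e x)"
      using e ce lin_smult[OF E_simps(2)] by (simp add: tswap_pure)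
    finally show "?l (pure_tensor R E X e x) = ?r (pure_tensor R E X e x)" .
  qed (simp_all add: t)
  fix x assume x: "x \<in> carrier X"
  have "lt E E X (\<lambda>y. contract E E (counit E) (tswap E E (comult E y))) (uX x) = ?l (uX x)"
    using x by (simp add: lt_comp flip: comult_E)
  then show "lt E E X (\<lambda>y. contract E E (counit E) (tswap E E (comult E y))) (uX x) = lt E E X (\<lambda>y. y) (uX x)"
    using x by (simp add: lr left_counit_X lt_ident)
qed simp

lemma coalgebra_E: "coalgebra R E"
  using comodule_structure[OF univ_X small_UNIV E_lin(1) comult_E] left_counit_E comult_E_hom counit_E_hom
  by (simp add: coalgebra_iff coalg_def rcomod_def mod_hom_iff)

end

context over_ring
begin

lemma contract_section:
  assumes Z [simp]: "module R Z" and W [simp]: "module R W" and C [simp]: "module R C" and e [simp]: "lin R C (regular_module R) e"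
    and w: "w \<in> carrier W" and s: "s \<in> carrier (tensor R Z C)"
  shows "tswap Z W (rt Z (tensor R W C) W (contract W C e) (rt Z C (tensor R W C) (pure_tensor R W C w) s)) =
    pure_tensor R W Z w (contract Z C e s)" (is "?l s = ?r s")
proof (rule tensor_ext[where f = ?l and g = ?r and t = s])
  interpret W: module R W by simp
  note pw = lin_pure_tensor_right[OF W C w]
  show "lin R (tensor R Z C) (tensor R W Z) ?l"
    by (rule lin_comp[OF lin_comp[OF lin_rt lin_rt] lin_tswap]) (simp_all add: pw)
  show "lin R (tensor R Z C) (tensor R W Z) ?r"
    by (rule lin_comp[OF lin_contract lin_pure_tensor_right]) (simp_all add: w)
  fix z c assume z: "z \<in> carrier Z" "c \<in> carrier C"
  have "e c \<in> carrier R" by (rule functional_closed[OF e z(2)])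
  then show "?l (pure_tensor R Z C z c) = ?r (pure_tensor R Z C z c)"
    using z w pw by (simp add: tswap_pure pure_tensor_balanced)
qed (simp_all add: s)

text \<open>
  The map \<open>W \<otimes> Z \<rightarrow> Z \<otimes> (W \<otimes> C)\<close> with \<open>w \<otimes> x \<mapsto> (id \<otimes> (w \<otimes> -)) (z x)\<close> for a coaction \<open>z\<close>. For
  \<open>Z = C\<close> it is a left coaction on \<open>W \<otimes> C\<close>, and in general it identifies \<open>W \<otimes> Z\<close> with the cotensor
  product of \<open>Z\<close> and \<open>W \<otimes> C\<close>.
\<close>

definition lam :: "('r, 'w, 'y1) module_scheme \<Rightarrow> ('r, 'm, 'y2) module_scheme \<Rightarrow> ('r, 'c, 'y3) module_scheme
    \<Rightarrow> ('m \<Rightarrow> ('m, 'c) tens) \<Rightarrow> ('w, 'm) tens \<Rightarrow> ('m, ('w, 'c) tens) tens"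
  where "lam W Z C z t = tensor_assoc R Z W C (lt (tensor R W Z) (tensor R Z W) C (tswap W Z) (wten W Z Z C z t))"

context
  fixes W :: "('r, 'w, 'y1) module_scheme" and Z :: "('r, 'm, 'y2) module_scheme" and C :: "('r, 'c, 'y3) module_scheme" and z
  assumes W [simp]: "module R W" and Z [simp]: "module R Z" and C [simp]: "module R C" and z [simp]: "lin R Z (tensor R Z C) z"
begin

lemma lin_lam [simp]: "lin R (tensor R W Z) (tensor R Z (tensor R W C)) (lam W Z C z)"
  unfolding lam_def by (rule lin_comp[OF lin_comp[OF lin_wten lin_lt] lin_tensor_assoc]) (simp_all add: lin_tswap)

lemma lam_pure [simp]:
  assumes w: "w \<in> carrier W" and x: "x \<in> carrier Z"
  shows "lam W Z C z (pure_tensor R W Z w x) = rt Z C (tensor R W C) (pure_tensor R W C w) (z x)"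
proof -
  note lt = lin_tswap[OF W Z] and pw = lin_pure_tensor_right[OF W Z w] and pw' = lin_pure_tensor_right[OF W C w]
    and pl = lin_pure_tensor_left[OF Z W w]
  have zx [simp]: "z x \<in> carrier (tensor R Z C)" by (rule lin_closed[OF z x])
  have "lam W Z C z (pure_tensor R W Z w x) = tensor_assoc R Z W C (lt Z (tensor R Z W) C (\<lambda>y. tswap W Z (pure_tensor R W Z w y)) (z x))"
    using w x lt pw by (simp add: lam_def lt_comp)
  also have "lt Z (tensor R Z W) C (\<lambda>y. tswap W Z (pure_tensor R W Z w y)) = lt Z (tensor R Z W) C (\<lambda>y. pure_tensor R Z W y w)"
    by (rule lt_cong) (use w in \<open>simp add: tswap_pure\<close>)
  also have "tensor_assoc R Z W C (lt Z (tensor R Z W) C (\<lambda>y. pure_tensor R Z W y w) s) = rt Z C (tensor R W C) (pure_tensor R W C w) s"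
    if s: "s \<in> carrier (tensor R Z C)" for s
  proof (rule tensor_ext[where t = s])
    show "lin R (tensor R Z C) (tensor R Z (tensor R W C)) (\<lambda>s. tensor_assoc R Z W C (lt Z (tensor R Z W) C (\<lambda>y. pure_tensor R Z W y w) s))"
      by (rule lin_comp[OF lin_lt lin_tensor_assoc]) (simp_all add: pl)
    show "lin R (tensor R Z C) (tensor R Z (tensor R W C)) (rt Z C (tensor R W C) (pure_tensor R W C w))"
      by (simp add: pw')
  qed (use s w pl pw' in \<open>simp_all add: tensor_assoc_pure\<close>)
  finally show ?thesis by simp
qed

end

end

locale cohom_injector = cohom R U C X h \<eta>
  for R :: "('r, 'x) ring_scheme" (structure) and U :: "'u itself" and C :: "('r, 'u) coalgebra"
    and X :: "('r, 'u) comodule" and h and \<eta> +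
  assumes flat: "flat_module R C" and injector: "injector R C X" and coflat: "faithfully_coflat R C X"
begin

section \<open>Cohomomorphisms preserve monomorphisms\<close>

lemma mono_arrow_comodules:
  assumes "i \<in> right_colinear R C A B" "inj_on i (carrier A)"
  shows "mono_arrow (right_comodules R C) A B i"
  unfolding mono_arrow_def
proof (intro conjI ballI impI)
  show "i \<in> Hom (right_comodules R C) A B" using assms(1) by (simp add: right_comodules_def)
  fix D f g assume "f \<in> Hom (right_comodules R C) D A" "g \<in> Hom (right_comodules R C) D A"
    and eq: "Cmp (right_comodules R C) D A B i f = Cmp (right_comodules R C) D A B i g"
  then have fg: "lin R D A f" "f \<in> extensional (carrier D)" "lin R D A g" "g \<in> extensional (carrier D)"
    by (simp_all add: right_comodules_def right_colinear_iff colin_def)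
  show "f = g"
  proof (rule extensionalityI[OF fg(2,4)])
    fix x assume x: "x \<in> carrier D"
    have "i (f x) = i (g x)" using fun_cong[OF eq, of x] x by (simp add: right_comodules_def compose_def)
    then show "f x = g x" by (rule inj_onD[OF assms(2)]) (use x fg lin_closed in metis)+
  qed
qed

text \<open>
  The injector hypothesis at the cogenerator: \<open>cogen \<otimes> X\<close> is an injective comodule, also with respect to
  monomorphisms of small comodules outside the universe.
\<close>

lemma colinear_extension:
  assumes M: "rcomod C M \<rho>" "small M" and N: "rcomod C N \<sigma>" "small N"
    and f: "colin C M \<rho> N \<sigma> f" "inj_on f (carrier M)"
    and p: "colin C M \<rho> (tensor R cogen X) (xcoact cogen) p"
  shows "\<exists>q. colin C N \<sigma> (tensor R cogen X) (xcoact cogen) q \<and> (\<forall>x\<in>carrier M. q (f x) = p x)"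
proof -
  let ?M = "small_comodule M \<rho>" and ?N = "small_comodule N \<sigma>" and ?Q = "small_comodule (tensor R cogen X) (xcoact cogen)"
  let ?jM = "small_inj M :: _ \<Rightarrow> 'u" and ?jN = "small_inj N :: _ \<Rightarrow> 'u" and ?jQ = "small_inj (tensor R cogen X) :: _ \<Rightarrow> 'u"
  note Q = rcomod_VX[OF module_cogen] small_VX[OF module_cogen small_UNIV]
  note rc = right_comodule_small_comodule[OF M] right_comodule_small_comodule[OF N] right_comodule_small_comodule[OF Q]
  have rm: "rcomod C ?M (coact ?M)" "rcomod C ?N (coact ?N)" "rcomod C ?Q (coact ?Q)"
    using rc by (simp_all add: right_comodule_iff)
  have md: "module R ?M" "module R ?N" "module R ?Q" "module R M" "module R N" using rm M N by (simp_all add: rcomod_def)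
  obtain kM where kM: "colin C ?M (coact ?M) M \<rho> kM" "\<And>x. x \<in> carrier M \<Longrightarrow> kM (?jM x) = x" "\<And>y. y \<in> carrier ?M \<Longrightarrow> ?jM (kM y) = y"
    using small_comodule_inverse[OF M] by metis
  obtain kQ where kQ: "colin C ?Q (coact ?Q) (tensor R cogen X) (xcoact cogen) kQ"
    "\<And>x. x \<in> carrier (tensor R cogen X) \<Longrightarrow> kQ (?jQ x) = x"
    using small_comodule_inverse[OF Q] by metis
  note jM = colin_small_inj[OF M] and jN = colin_small_inj[OF N] and jQ = colin_small_inj[OF Q]
  let ?f = "\<lambda>x\<in>carrier ?M. ?jN (f (kM x))" and ?p = "\<lambda>x\<in>carrier ?M. ?jQ (p (kM x))"
  have "colin C ?M (coact ?M) ?N (coact ?N) (\<lambda>x. ?jN (f (kM x)))"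
    by (rule colin_comp[OF C_simps(1) rm(1) N(1) rm(2) colin_comp[OF C_simps(1) rm(1) M(1) N(1) kM(1) f(1)] jN])
  then have f': "?f \<in> right_colinear R C ?M ?N"
    by (simp add: right_colinear_iff colin_cong[OF md(1), of ?f "\<lambda>x. ?jN (f (kM x))"])
  have "colin C ?M (coact ?M) ?Q (coact ?Q) (\<lambda>x. ?jQ (p (kM x)))"
    by (rule colin_comp[OF C_simps(1) rm(1) Q(1) rm(3) colin_comp[OF C_simps(1) rm(1) M(1) Q(1) kM(1) p] jQ])
  then have p': "?p \<in> right_colinear R C ?M ?Q"
    by (simp add: right_colinear_iff colin_cong[OF md(1), of ?p "\<lambda>x. ?jQ (p (kM x))"])
  note cl = lin_closed[OF colin_lin[OF kM(1)]] lin_closed[OF colin_lin[OF f(1)]] lin_closed[OF colin_lin[OF p]]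
    lin_closed[OF colin_lin[OF jM]] lin_closed[OF colin_lin[OF jN]]
  have "inj_on ?f (carrier ?M)"
  proof (rule inj_onI)
    fix x y assume xy: "x \<in> carrier ?M" "y \<in> carrier ?M" "?f x = ?f y"
    have "f (kM x) = f (kM y)"
      by (rule inj_onD[OF small_inj_inj[OF N(2)]]) (use xy cl in simp_all)
    then have "kM x = kM y" by (rule inj_onD[OF f(2)]) (use xy cl in simp_all)
    then show "x = y" using xy kM(3) by metis
  qed
  then have mono: "mono_arrow (right_comodules R C) ?M ?N ?f" by (rule mono_arrow_comodules[OF f'])
  have "injective_object (right_comodules R C) ?Q"
    using injector injective_cogen by (auto simp: injector_def tensor_comodule_functor_def tensor_comodule_eq)
  then obtain q where q: "q \<in> right_colinear R C ?N ?Q" "compose (carrier ?M) q ?f = ?p"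
    using mono p' rc unfolding injective_object_def right_comodules_def by fastforce
  have qc: "colin C ?N (coact ?N) ?Q (coact ?Q) q" using q(1) by (simp add: right_colinear_iff)
  show ?thesis
  proof (intro exI conjI ballI)
    show "colin C N \<sigma> (tensor R cogen X) (xcoact cogen) (\<lambda>x. kQ (q (?jN x)))"
      by (rule colin_comp[OF C_simps(1) N(1) rm(3) Q(1) colin_comp[OF C_simps(1) N(1) rm(2) rm(3) jN qc] kQ(1)])
    fix x assume x: "x \<in> carrier M"
    have "q (?jN (f x)) = ?jQ (p x)"
      using fun_cong[OF q(2), of "?jM x"] x cl kM(2) by (simp add: compose_def)
    then show "kQ (q (?jN (f x))) = p x" using x cl kQ(2) by simp
  qed
qed

text \<open>
  The map \<open>g\<close> is \<open>h(f)\<close>. If \<open>y\<close> is a nonzero element of its kernel, choose a form \<open>p\<close> on \<open>H\<close> with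
  values in the cogenerator and \<open>p y \<noteq> 0\<close>. Extending \<open>(p \<otimes> X) u\<close> along \<open>f\<close> and passing back through
  the adjunction exhibits \<open>p\<close> as \<open>k \<circ> g\<close>, a contradiction.
\<close>

lemma univ_mono:
  assumes u: "univ M \<rho> H u" and u': "univ N \<sigma> H' u'" and sm: "small M" "small N"
    and f: "colin C M \<rho> N \<sigma> f" "inj_on f (carrier M)"
    and g: "lin R H H' g" and eq: "\<And>x. x \<in> carrier M \<Longrightarrow> lt H H' X g (u x) = u' (f x)"
  shows "inj_on g (carrier H)"
  unfolding lin_inj_iff[OF univD(4)[OF u] univD(4)[OF u'] g]
proof (intro ballI impI)
  note [simp] = univD[OF u] univD[OF u'] g
  fix y assume y: "y \<in> carrier H" "g y = \<zero>\<^bsub>H'\<^esub>"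
  interpret H: module R H by simp
  show "y = \<zero>\<^bsub>H\<^esub>"
  proof (rule ccontr)
    assume "y \<noteq> \<zero>\<^bsub>H\<^esub>"
    moreover have "submodule {\<zero>\<^bsub>H\<^esub>} R H" by (rule H.submoduleI) (auto simp: H.minus_equality)
    ultimately obtain p where p [simp]: "lin R H cogen p" "p y \<noteq> \<zero>\<^bsub>cogen\<^esub>"
      using cogen_separates[of H "{\<zero>\<^bsub>H\<^esub>}" y] y(1) by auto
    have "colin C M \<rho> (tensor R cogen X) (xcoact cogen) (\<lambda>x. lt H cogen X p (u x))"
      by (rule colin_comp[OF C_simps(1) univD(1)[OF u] rcomod_VX rcomod_VX univD(5)[OF u] colin_xcoact_lt]) simp_all
    from colinear_extension[OF univD(1)[OF u] sm(1) univD(1)[OF u'] sm(2) f this]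
    obtain q where q: "colin C N \<sigma> (tensor R cogen X) (xcoact cogen) q" "\<And>x. x \<in> carrier M \<Longrightarrow> q (f x) = lt H cogen X p (u x)"
      by blast
    obtain k where k [simp]: "lin R H' cogen k" and ku: "\<And>x. x \<in> carrier N \<Longrightarrow> lt H' cogen X k (u' x) = q x"
      using univ_ex[OF u' module_cogen small_UNIV q(1)] by blast
    have "k (g y) = p y"
    proof (rule univ_unique[OF u module_cogen small_UNIV lin_comp[OF g k] p(1) _ y(1)])
      fix x assume x: "x \<in> carrier M"
      have "lt H cogen X (\<lambda>y. k (g y)) (u x) = lt H' cogen X k (lt H H' X g (u x))" using x by (simp add: lt_comp)
      then show "lt H cogen X (\<lambda>y. k (g y)) (u x) = lt H cogen X p (u x)"
        using x lin_closed[OF colin_lin[OF f(1)] x] by (simp add: eq ku q)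
    qed
    then show False using y(2) p(2) lin_zero[OF _ module_cogen k] by simp
  qed
qed

section \<open>Faithfulness of the cotensor product\<close>

lemma flat_rt_inj:
  assumes "module R A" "small A" "module R B" "small B" "lin R A B f" "inj_on f (carrier A)"
  shows "inj_on (rt C A B f) (carrier (tensor R C A))"
  unfolding rt_inj_iff_lt_inj[OF assms(1,3) C_simps(1) assms(5)] by (rule flat_inj[OF flat]) fact+

text \<open>Up to associativity, \<open>(D \<otimes> F) \<otimes> f\<close> is \<open>D \<otimes> (F \<otimes> f)\<close>.\<close>

lemma rt_tensor_inj:
  assumes D [simp]: "module R D" and F [simp]: "module R F" and A [simp]: "module R A" and B [simp]: "module R B" and f [simp]: "lin R A B f"
    and inj: "inj_on (rt D (tensor R F A) (tensor R F B) (rt F A B f)) (carrier (tensor R D (tensor R F A)))"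
  shows "inj_on (rt (tensor R D F) A B f) (carrier (tensor R (tensor R D F) A))"
proof -
  let ?a = "wten D (tensor R F A) F A (\<lambda>x. x)" and ?b = "wten D (tensor R F B) F B (\<lambda>x. x)"
  have eq: "rt (tensor R D F) A B f (?a t) = ?b (rt D (tensor R F A) (tensor R F B) (rt F A B f) t)"
    if t: "t \<in> carrier (tensor R D (tensor R F A))" for t
    using t by (simp add: rt_wten wten_rt)
  have surj: "\<exists>t\<in>carrier (tensor R D (tensor R F A)). s = ?a t" if s: "s \<in> carrier (tensor R (tensor R D F) A)" for s
  proof
    show t: "tensor_assoc R D F A s \<in> carrier (tensor R D (tensor R F A))"
      by (rule lin_closed[OF lin_tensor_assoc]) (simp_all add: s)
    show "s = ?a (tensor_assoc R D F A s)"
      using t s by (simp add: wten_def rt_ident tensor_assoc_inv_assoc)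
  qed
  have binj: "inj_on ?b (carrier (tensor R D (tensor R F B)))"
    by (subst inj_wten_iff) (auto intro!: inj_onI simp: rt_ident)
  show ?thesis
  proof (rule inj_onI)
    fix s s' assume s: "s \<in> carrier (tensor R (tensor R D F) A)" "s' \<in> carrier (tensor R (tensor R D F) A)"
      "rt (tensor R D F) A B f s = rt (tensor R D F) A B f s'"
    obtain t t' where t: "t \<in> carrier (tensor R D (tensor R F A))" "s = ?a t" "t' \<in> carrier (tensor R D (tensor R F A))" "s' = ?a t'"
      using surj[OF s(1)] surj[OF s(2)] by metis
    have "rt D (tensor R F A) (tensor R F B) (rt F A B f) t = rt D (tensor R F A) (tensor R F B) (rt F A B f) t'"
      by (rule inj_onD[OF binj]) (use s(3) t in \<open>simp_all add: eq[symmetric]\<close>)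
    then have "t = t'" by (rule inj_onD[OF inj]) (use t in simp_all)
    then show "s = s'" using t by simp
  qed
qed

lemma small_left_comodule:
  assumes A: "lcomod C A \<alpha>" "small A"
  shows "\<exists>(S :: ('r, 'u) comodule) k. left_comodule R C S \<and> lin R S A k \<and> bij_betw k (carrier S) (carrier A) \<and>
    (\<forall>s\<in>carrier S. rt C S A k (coact S s) = \<alpha> (k s))"
proof -
  have mA [simp]: "module R A" "lin R A (tensor R C A) \<alpha>" using A by (simp_all add: lcomod_def)
  let ?T = "small_copy A :: ('r, 'u) module" and ?j = "small_inj A :: _ \<Rightarrow> 'u"
  have [simp]: "module R ?T" "lin R A ?T ?j" by (simp_all add: module_small_copy lin_small_inj A)
  obtain k where k [simp]: "lin R ?T A k" and kj: "\<And>x. x \<in> carrier A \<Longrightarrow> k (?j x) = x" and jk: "\<And>y. y \<in> carrier ?T \<Longrightarrow> ?j (k y) = y"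
    using small_copy_inverse[OF mA(1) A(2)] by metis
  have bij: "bij_betw k (carrier ?T) (carrier A)"
    by (rule bij_betw_byWitness[where f' = ?j])
      (use kj jk lin_closed[OF k] lin_closed[OF lin_small_inj[OF mA(1) A(2)]] in auto)
  have "\<exists>\<sigma>. lcomod C ?T \<sigma> \<and> (\<forall>s\<in>carrier ?T. rt C ?T A k (\<sigma> s) = \<alpha> (k s))"
  proof (rule lcomod_sub[OF coalg_C A(1)])
    show "inj_on k (carrier ?T)" using bij by (simp add: bij_betw_def)
    show "inj_on (rt C ?T A k) (carrier (tensor R C ?T))" "inj_on (rt (tensor R C C) ?T A k) (carrier (tensor R (tensor R C C) ?T))"
      by (rule inj_on_rt_if_left_inverse[where g = ?j]; simp add: jk)+
    fix s assume "s \<in> carrier ?T"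
    then have a: "\<alpha> (k s) \<in> carrier (tensor R C A)" using lin_closed[OF mA(2)] lin_closed[OF k] by blast
    have "\<alpha> (k s) = rt C A A (\<lambda>x. k (?j x)) (\<alpha> (k s))"
      using a rt_ident[of A C] rt_cong[of A "\<lambda>x. k (?j x)" "\<lambda>x. x" C A] kj by simp
    also have "\<dots> = rt C ?T A k (rt C A ?T ?j (\<alpha> (k s)))" using a by (simp add: rt_comp)
    finally show "\<alpha> (k s) \<in> rt C ?T A k ` carrier (tensor R C ?T)" using a by (metis imageI rt_closed C_simps(1) mA(1) \<open>module R ?T\<close> \<open>lin R A ?T ?j\<close>)
  qed simp_all
  then obtain \<sigma> where \<sigma>: "lcomod C ?T \<sigma>" "\<And>s. s \<in> carrier ?T \<Longrightarrow> rt C ?T A k (\<sigma> s) = \<alpha> (k s)" by blast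
  define S :: "('r, 'u) comodule" where "S = \<lparr>carrier = carrier ?T, monoid.mult = monoid.mult ?T, one = one ?T,
         ring.zero = ring.zero ?T, add = add ?T, smult = smult ?T, coact = restrict \<sigma> (carrier ?T)\<rparr>"
  have same: "same_module ?T S" by (simp add: same_module_def S_def)
  have cS: "carrier S = carrier ?T" "\<And>s. s \<in> carrier S \<Longrightarrow> coact S s = \<sigma> s" by (simp_all add: S_def)
  have mS: "module R S" by (rule same_module_module[OF same]) simp
  have id: "id_map S = id_map ?T" by (simp add: id_map_def cS)
  have lS: "lin R S (tensor R C ?T) (coact S)"
  proof -
    have "lin R S (tensor R C ?T) \<sigma>" using \<sigma>(1) same_lin[OF same same_module_refl[of "tensor R C ?T"], of R] by (simp add: lcomod_def)
    then show ?thesis using lin_cong[OF mS, of "coact S" \<sigma>] cS(2) by blast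
  qed
  have rtS: "rt C ?T A k = rt C S A k"
    by (rule same_tensor_map) (simp_all add: same)
  have "lcomod C S (coact S)"
    unfolding lcomod_def
  proof (intro conjI ballI mS)
    show "lin R S (tensor R C S) (coact S)" using lS same_tensor[OF same_module_refl same, of R C] by simp
    fix s assume s: "s \<in> carrier S"
    have sT: "s \<in> carrier ?T" using s cS by simp
    have "lt C (tensor R C C) S (comult C) (coact S s) = lt C (tensor R C C) ?T (comult C) (\<sigma> s)"
      using same_tensor_map[OF same_module_refl same same_module_refl same, of R C "tensor R C C"] cS(2)[OF s] by (simp add: id)
    also have "\<dots> = wten C ?T C ?T \<sigma> (\<sigma> s)" using \<sigma>(1) sT by (simp add: lcomod_def)
    also have "\<dots> = wten C ?T C ?T (coact S) (\<sigma> s)"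
      by (rule fun_cong[OF wten_cong]) (simp_all add: cS)
    also have "\<dots> = wten C S C S (coact S) (\<sigma> s)"
      unfolding wten_def by (simp add: same_tensor_assoc_inv[OF same_module_refl same_module_refl same]
        same_tensor[OF same_module_refl same] same_tensor_map[OF same_module_refl same same_module_refl same_module_refl])
    finally show "lt C (tensor R C C) S (comult C) (coact S s) = wten C S C S (coact S) (coact S s)"
      using cS(2)[OF s] by simp
    have "contract ?T C (counit C) (tswap C ?T (\<sigma> s)) = s" using \<sigma>(1) sT by (simp add: lcomod_def)
    moreover have "lt C (regular_module R) S (counit C) (coact S s) = lt C (regular_module R) ?T (counit C) (\<sigma> s)"
      using same_tensor_map[OF same_module_refl same same_module_refl same, of R C "regular_module R"] cS(2)[OF s] by (simp add: id)
    moreover have "pure_tensor R (regular_module R) S = pure_tensor R (regular_module R) ?T"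
      using same_pure_tensor[OF same_module_refl same, of R "regular_module R"] by simp
    moreover have "\<sigma> s \<in> carrier (tensor R C ?T)" using \<sigma>(1) sT by (auto simp: lcomod_def intro: lin_closed)
    ultimately show "contract S C (counit C) (tswap C S (coact S s)) = s"
      using lt_counit_iff[of ?T C "counit C" "\<sigma> s" s] lt_counit_iff[OF mS C_simps(1,3), of "coact S s" s] s sT
        same_tensor[OF same_module_refl same, of R C] cS(2)[OF s]
      by simp
  qed
  then have "left_comodule R C S" using C by (simp add: left_comodule_iff) (simp add: S_def)
  moreover have "lin R S A k" using k same_lin[OF same same_module_refl[of A], of R] by simp
  moreover have "bij_betw k (carrier S) (carrier A)" using bij cS by simp
  moreover have "\<forall>s\<in>carrier S. rt C S A k (coact S s) = \<alpha> (k s)"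
    using \<sigma>(2) cS rtS by simp
  ultimately show ?thesis by blast
qed

lemma cotensor_map:
  assumes A: "lcomod C A \<alpha>" and B: "lcomod C B \<beta>" and i [simp]: "lin R A B i"
    and eq: "\<And>a. a \<in> carrier A \<Longrightarrow> rt C A B i (\<alpha> a) = \<beta> (i a)"
    and z: "z \<in> carrier (tensor R X A)" "lt X (tensor R X C) A (coact X) z = wten X A C A \<alpha> z"
  shows "lt X (tensor R X C) B (coact X) (rt X A B i z) = wten X B C B \<beta> (rt X A B i z)"
proof -
  have [simp]: "module R A" "module R B" "lin R A (tensor R C A) \<alpha>" "lin R B (tensor R C B) \<beta>"
    using A B by (simp_all add: lcomod_def)
  have "lt X (tensor R X C) B (coact X) (rt X A B i z) = rt (tensor R X C) A B i (wten X A C A \<alpha> z)"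
    using z by (simp add: lt_rt)
  also have "\<dots> = wten X A C B (\<lambda>a. rt C A B i (\<alpha> a)) z"
    using z by (simp add: rt_wten)
  also have "\<dots> = wten X A C B (\<lambda>a. \<beta> (i a)) z"
    by (rule fun_cong[OF wten_cong]) (simp_all add: eq)
  finally show ?thesis using z by (simp add: wten_rt)
qed

text \<open>
  Faithfulness of the cotensor functor in the form used below: a left colinear map that induces the
  zero map on cotensor products is zero. The comodules may be outside the universe.
\<close>

lemma cotensor_faithful:
  assumes A: "lcomod C A \<alpha>" "small A" and B: "lcomod C B \<beta>" "small B" and i [simp]: "lin R A B i"
    and eq: "\<And>a. a \<in> carrier A \<Longrightarrow> rt C A B i (\<alpha> a) = \<beta> (i a)"
    and zero: "\<And>z. z \<in> carrier (tensor R X A) \<Longrightarrow> lt X (tensor R X C) A (coact X) z = wten X A C A \<alpha> z \<Longrightarrow>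
      rt X A B i z = \<zero>\<^bsub>tensor R X B\<^esub>"
    and a: "a \<in> carrier A"
  shows "i a = \<zero>\<^bsub>B\<^esub>"
proof -
  have [simp]: "module R A" "module R B" "lin R A (tensor R C A) \<alpha>" "lin R B (tensor R C B) \<beta>"
    using A B by (simp_all add: lcomod_def)
  obtain A' :: "('r, 'u) comodule" and k where A': "left_comodule R C A'" "lin R A' A k" "bij_betw k (carrier A') (carrier A)"
    "\<And>s. s \<in> carrier A' \<Longrightarrow> rt C A' A k (coact A' s) = \<alpha> (k s)" using small_left_comodule[OF A] by blast
  obtain B' :: "('r, 'u) comodule" and l where B': "left_comodule R C B'" "lin R B' B l" "bij_betw l (carrier B') (carrier B)"
    "\<And>s. s \<in> carrier B' \<Longrightarrow> rt C B' B l (coact B' s) = \<beta> (l s)" using small_left_comodule[OF B] by blast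
  have A'l: "lcomod C A' (coact A')" and B'l: "lcomod C B' (coact B')" using A'(1) B'(1) by (simp_all add: left_comodule_iff)
  have [simp]: "module R A'" "module R B'" "lin R A' (tensor R C A') (coact A')" "lin R B' (tensor R C B') (coact B')" "lin R A' A k" "lin R B' B l"
    using A'l B'l A'(2) B'(2) by (simp_all add: lcomod_def)
  let ?m = "inv_into (carrier B') l"
  have m [simp]: "lin R B B' ?m" by (rule lin_inverse[OF _ _ B'(2,3)]) simp_all
  have ml: "?m (l y) = y" if "y \<in> carrier B'" for y using B'(3) that by (rule bij_betw_inv_into_left)
  have lm: "l (?m y) = y" if "y \<in> carrier B" for y using B'(3) that by (rule bij_betw_inv_into_right)
  have ik [simp]: "lin R A' B (\<lambda>x. i (k x))" by (rule lin_comp[OF A'(2) i])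
  have f [simp]: "lin R A' B' (\<lambda>x. ?m (i (k x)))" by (rule lin_comp[OF ik m])
  have aA: "coact A' s \<in> carrier (tensor R C A')" if "s \<in> carrier A'" for s using that by (simp add: lin_closed[of R A' "tensor R C A'"])
  have bB: "\<beta> s \<in> carrier (tensor R C B)" if "s \<in> carrier B" for s using that by (simp add: lin_closed[of R B "tensor R C B"])
  have kc: "k x \<in> carrier A" if "x \<in> carrier A'" for x using that by (rule lin_closed[OF A'(2)])
  have ic: "i x \<in> carrier B" if "x \<in> carrier A" for x using that by (rule lin_closed[OF i])
  have mc: "?m x \<in> carrier B'" if "x \<in> carrier B" for x using that by (rule lin_closed[OF m])
  have m_col: "rt C B B' ?m (\<beta> y) = coact B' (?m y)" if y: "y \<in> carrier B" for y
  proof -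
    have c: "coact B' (?m y) \<in> carrier (tensor R C B')" using mc[OF y] by (simp add: lin_closed[of R B' "tensor R C B'"])
    have "rt C B B' ?m (\<beta> y) = rt C B B' ?m (rt C B' B l (coact B' (?m y)))" using B'(4)[OF mc[OF y]] lm[OF y] by simp
    also have "\<dots> = rt C B' B' (\<lambda>x. ?m (l x)) (coact B' (?m y))" using c by (simp add: rt_comp)
    also have "\<dots> = rt C B' B' (\<lambda>x. x) (coact B' (?m y))" by (rule fun_cong[OF rt_cong]) (rule ml)
    finally show ?thesis using c by (simp add: rt_ident)
  qed
  let ?f = "\<lambda>x\<in>carrier A'. ?m (i (k x))" and ?o = "\<lambda>x\<in>carrier A'. \<zero>\<^bsub>B'\<^esub>"
  have rf: "rt D A' B' ?f = rt D A' B' (\<lambda>x. ?m (i (k x)))" "rt D A' B' ?o = rt D A' B' (\<lambda>x. \<zero>\<^bsub>B'\<^esub>)" for D :: "('r, 'u, 'q) module_scheme"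
    by (rule rt_cong; simp)+
  have o: "lin R A' B' (\<lambda>x. \<zero>\<^bsub>B'\<^esub>)" by (rule lin_const_zero) simp
  have "?f \<in> left_colinear R C A' B'"
    unfolding left_colinear_def mod_hom_iff
  proof (intro CollectI conjI ballI)
    fix x assume x: "x \<in> carrier A'"
    have "rt C A' B' ?f (coact A' x) = rt C B B' ?m (rt C A B i (rt C A' A k (coact A' x)))"
      using aA[OF x] by (simp add: rf rt_comp)
    also have "\<dots> = coact B' (?f x)" using x kc ic by (simp add: A'(4) eq m_col)
    finally show "rt C A' B' ?f (coact A' x) = coact B' (?f x)" .
  qed (simp_all add: lin_restrict)
  moreover have "?o \<in> left_colinear R C A' B'"
    unfolding left_colinear_def mod_hom_iff
    using aA o by (simp add: lin_restrict rf rt_zero lin_zero[of B' "tensor R C B'"])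
  moreover have "Arr (cotensor_functor R C X) A' B' ?f = Arr (cotensor_functor R C X) A' B' ?o"
  proof -
    have "rt X A' B' ?f z = rt X A' B' ?o z" if "z \<in> carrier (cotensor R C X A')" for z
    proof -
      have z: "z \<in> carrier (tensor R X A')" using that by (simp add: cotensor_def)
      have c: "lt X (tensor R X C) A' (coact X) z \<in> carrier (tensor R (tensor R X C) A')" using z by simp
      have zeq: "lt X (tensor R X C) A' (coact X) z = wten X A' C A' (coact A') z"
        using that z c by (simp add: cotensor_def wten_eq_iff)
      let ?z = "rt X A' A k z"
      have "lt X (tensor R X C) A (coact X) ?z = wten X A C A \<alpha> ?z"
        by (rule cotensor_map[OF A'l A(1) A'(2) A'(4) z zeq])
      then have 0: "rt X A B i ?z = \<zero>\<^bsub>tensor R X B\<^esub>" using z by (intro zero) simp_all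
      have "rt X A' B' ?f z = rt X B B' ?m (rt X A B i ?z)" using z by (simp add: rf rt_comp)
      also have "\<dots> = \<zero>\<^bsub>tensor R X B'\<^esub>" unfolding 0 by (rule lin_zero[OF _ _ lin_rt]) simp_all
      also have "\<dots> = rt X A' B' ?o z" using z by (simp add: rf rt_zero)
      finally show ?thesis .
    qed
    then show ?thesis by (auto simp: cotensor_functor_def intro!: restrict_ext)
  qed
  ultimately have "?f = ?o"
    using coflat A'(1) B'(1) unfolding faithfully_coflat_def faithful_functor_def left_comodules_def inj_on_def by auto
  moreover have "a \<in> k ` carrier A'" using a A'(3) by (simp add: bij_betw_def)
  then obtain x where x: "x \<in> carrier A'" "k x = a" by (metis imageE)
  ultimately have "?m (i a) = \<zero>\<^bsub>B'\<^esub>" by (metis (no_types, lifting) restrict_apply')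
  then have "l (?m (i a)) = l \<zero>\<^bsub>B'\<^esub>" by simp
  then show ?thesis using lm[OF ic[OF a]] lin_zero[of B' B l] by simp
qed

end

lemma (in over_ring) wten_const_zero:
  assumes "module R W" "module R M" "module R H" "module R P" "t \<in> carrier (tensor R W M)"
  shows "wten W M H P (\<lambda>_. \<zero>\<^bsub>tensor R H P\<^esub>) t = \<zero>\<^bsub>tensor R (tensor R W H) P\<^esub>"
  using assms by (simp add: wten_def rt_zero lin_zero[OF _ _ lin_tensor_assoc_inv])

context cohom_injector
begin

context
  fixes W :: "('r, 'w, 'y1) module_scheme" and Y :: "('r, 'u) module" and uC
  assumes W [simp]: "module R W" and smallW: "small W" and uC: "univ C (comult C) Y uC"
begin

text \<open>
  The module \<open>T = W \<otimes> C\<close> with its right coaction \<open>r\<close>, its left coaction \<open>l\<close>, and the contraction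
  \<open>W \<otimes> \<epsilon>\<close>
\<close>

abbreviation (input) T_WC where "T_WC \<equiv> tensor R W C"
abbreviation (input) r_WC where "r_WC \<equiv> wten W C C C (comult C)"
abbreviation (input) l_WC where "l_WC \<equiv> lam W C C (comult C)"
abbreviation (input) c_WC where "c_WC \<equiv> contract W C (counit C)"

lemma cW [simp]: "lin R T_WC W c_WC"
  by simp

lemma pure_W_lin: "w \<in> carrier W \<Longrightarrow> module R Z \<Longrightarrow> lin R Z (tensor R W Z) (pure_tensor R W Z w)"
  by simp

text \<open>By the counit law of \<open>Z\<close>, contracting \<open>C\<close> is a left inverse of \<open>lam\<close> up to the swap.\<close>

lemma lam_retract:
  assumes Z: "rcomod C Z \<zeta>" and t: "t \<in> carrier (tensor R W Z)"
  shows "tswap Z W (rt Z T_WC W c_WC (lam W Z C \<zeta> t)) = t" (is "?l t = t")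
proof (rule tensor_ext[where f = ?l and g = "\<lambda>t. t" and t = t])
  have [simp]: "module R Z" "lin R Z (tensor R Z C) \<zeta>" using Z by (simp_all add: rcomod_def)
  show "lin R (tensor R W Z) (tensor R W Z) ?l"
    by (rule lin_comp[OF lin_comp[OF lin_lam lin_rt] lin_tswap]) simp_all
  fix w x assume w: "w \<in> carrier W" "x \<in> carrier Z"
  then show "?l (pure_tensor R W Z w x) = pure_tensor R W Z w x"
    using Z by (simp add: contract_section lin_closed[of R Z "tensor R Z C" \<zeta>] rcomod_def)
qed (use Z t in \<open>simp_all add: rcomod_def\<close>)

lemma lam_colinear:
  assumes Z: "rcomod C Z \<zeta>"
  shows "colin C (tensor R W Z) (wten W Z Z C \<zeta>) (tensor R Z T_WC) (wten Z T_WC T_WC C r_WC) (lam W Z C \<zeta>)"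
  unfolding colin_def
proof (intro conjI ballI)
  have [simp]: "module R Z" "lin R Z (tensor R Z C) \<zeta>" using Z by (simp_all add: rcomod_def)
  have zc [simp]: "\<zeta> x \<in> carrier (tensor R Z C)" if "x \<in> carrier Z" for x using that by (simp add: lin_closed[of R Z "tensor R Z C"])
  show "lin R (tensor R W Z) (tensor R Z T_WC) (lam W Z C \<zeta>)" by simp
  fix t assume t: "t \<in> carrier (tensor R W Z)"
  let ?l = "\<lambda>t. lt (tensor R W Z) (tensor R Z T_WC) C (lam W Z C \<zeta>) (wten W Z Z C \<zeta> t)"
  let ?r = "\<lambda>t. wten Z T_WC T_WC C r_WC (lam W Z C \<zeta> t)"
  show "?l t = ?r t"
  proof (rule tensor_ext[where f = ?l and g = ?r and t = t])
    show "lin R (tensor R W Z) (tensor R (tensor R Z T_WC) C) ?l"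
      by (rule lin_comp[OF lin_wten lin_lt]) simp_all
    show "lin R (tensor R W Z) (tensor R (tensor R Z T_WC) C) ?r"
      by (rule lin_comp[OF lin_lam lin_wten]) simp_all
    fix w x assume w: "w \<in> carrier W" and x: "x \<in> carrier Z"
    note pw [simp] = pure_W_lin[OF w]
    have rp: "lin R C (tensor R T_WC C) (\<lambda>c. r_WC (pure_tensor R W C w c))" by (rule lin_comp[OF pw lin_wten]) simp_all
    have "?l (pure_tensor R W Z w x) = lt Z (tensor R Z T_WC) C (\<lambda>x. lam W Z C \<zeta> (pure_tensor R W Z w x)) (\<zeta> x)"
      using w x by (simp add: lt_comp)
    also have "\<dots> = lt Z (tensor R Z T_WC) C (\<lambda>x. rt Z C T_WC (pure_tensor R W C w) (\<zeta> x)) (\<zeta> x)"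
      by (rule fun_cong[OF lt_cong]) (simp add: w)
    also have "\<dots> = lt (tensor R Z C) (tensor R Z T_WC) C (rt Z C T_WC (pure_tensor R W C w)) (lt Z (tensor R Z C) C \<zeta> (\<zeta> x))"
      using w x by (simp add: lt_comp)
    also have "\<dots> = lt (tensor R Z C) (tensor R Z T_WC) C (rt Z C T_WC (pure_tensor R W C w)) (wten Z C C C (comult C) (\<zeta> x))"
      using Z x by (simp add: rcomod_def)
    also have "\<dots> = wten Z C T_WC C (\<lambda>c. lt C T_WC C (pure_tensor R W C w) (comult C c)) (\<zeta> x)"
      using w x by (simp add: lt_wten)
    also have "\<dots> = wten Z C T_WC C (\<lambda>c. r_WC (pure_tensor R W C w c)) (\<zeta> x)"
      by (rule fun_cong[OF wten_cong]) (simp_all add: w)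
    also have "\<dots> = ?r (pure_tensor R W Z w x)"
      using w x by (simp add: wten_rt del: wten_pure)
    finally show "?l (pure_tensor R W Z w x) = ?r (pure_tensor R W Z w x)" .
  qed (simp_all add: t)
qed

text \<open>
  The image of \<open>lam\<close> lies in the cotensor product of \<open>Z\<close> and \<open>W \<otimes> C\<close>. For \<open>Z = C\<close> this is the
  coassociativity of the left coaction.
\<close>

lemma lam_cotensor:
  assumes Z: "rcomod C Z \<zeta>" and t: "t \<in> carrier (tensor R W Z)"
  shows "lt Z (tensor R Z C) T_WC \<zeta> (lam W Z C \<zeta> t) = wten Z T_WC C T_WC l_WC (lam W Z C \<zeta> t)" (is "?l t = ?r t")
proof (rule tensor_ext[where f = ?l and g = ?r and t = t])
  have [simp]: "module R Z" "lin R Z (tensor R Z C) \<zeta>" using Z by (simp_all add: rcomod_def)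
  have zc [simp]: "\<zeta> x \<in> carrier (tensor R Z C)" if "x \<in> carrier Z" for x using that by (simp add: lin_closed[of R Z "tensor R Z C"])
  show "lin R (tensor R W Z) (tensor R (tensor R Z C) T_WC) ?l"
    by (rule lin_comp[OF lin_lam lin_lt]) simp_all
  show "lin R (tensor R W Z) (tensor R (tensor R Z C) T_WC) ?r"
    by (rule lin_comp[OF lin_lam lin_wten]) simp_all
  fix w x assume w: "w \<in> carrier W" and x: "x \<in> carrier Z"
  note pw [simp] = pure_W_lin[OF w]
  have "?l (pure_tensor R W Z w x) = rt (tensor R Z C) C T_WC (pure_tensor R W C w) (lt Z (tensor R Z C) C \<zeta> (\<zeta> x))"
    using w x by (simp add: lt_rt)
  also have "\<dots> = wten Z C C T_WC (\<lambda>c. rt C C T_WC (pure_tensor R W C w) (comult C c)) (\<zeta> x)"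
    using Z w x by (simp add: rcomod_def rt_wten)
  also have "\<dots> = wten Z C C T_WC (\<lambda>c. l_WC (pure_tensor R W C w c)) (\<zeta> x)"
    by (rule fun_cong[OF wten_cong]) (simp_all add: w)
  also have "\<dots> = ?r (pure_tensor R W Z w x)"
    using w x by (simp add: wten_rt del: wten_pure)
  finally show "?l (pure_tensor R W Z w x) = ?r (pure_tensor R W Z w x)" .
qed (use Z t in \<open>simp_all add: rcomod_def\<close>)

lemma lcomod_WC: "lcomod C T_WC l_WC"
  unfolding lcomod_def
proof (intro conjI ballI)
  fix t assume t: "t \<in> carrier T_WC"
  show "lt C (tensor R C C) T_WC (comult C) (l_WC t) = wten C T_WC C T_WC l_WC (l_WC t)"
    by (rule lam_cotensor[OF rcomod_regular[OF coalg_C] t])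
  let ?l = "\<lambda>t. contract T_WC C (counit C) (tswap C T_WC (l_WC t))"
  show "?l t = t"
  proof (rule tensor_ext[where f = ?l and g = "\<lambda>t. t" and t = t])
    show "lin R T_WC T_WC ?l"
      by (rule lin_comp[OF lin_comp[OF lin_lam lin_tswap] lin_contract]) simp_all
    fix w c assume w: "w \<in> carrier W" "c \<in> carrier C"
    then show "?l (pure_tensor R W C w c) = pure_tensor R W C w c"
      using coalg_C by (simp add: tswap_rt contract_lt comult_closed[OF coalg_C]) (simp add: coalg_def)
  qed (simp_all add: t)
qed simp_all

text \<open>
  Conversely every element of \<open>X \<box>\<^sub>C (W \<otimes> C)\<close> comes from \<open>W \<otimes> X\<close>. Both sides of the cotensor
  condition lie in \<open>(X \<otimes> C) \<otimes> (W \<otimes> C)\<close>; contracting the last factor turns the left side into the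
  image under \<open>lam\<close> of the contracted element, and the right side into \<open>t\<close>.
\<close>

lemma cotensor_in_image_lam:
  assumes t: "t \<in> carrier (tensor R X T_WC)"
    and eq: "lt X (tensor R X C) T_WC (coact X) t = wten X T_WC C T_WC l_WC t"
  shows "t = lam W X C (coact X) (tswap X W (rt X T_WC W c_WC t))"
proof -
  let ?mu = "\<lambda>v. rt X (tensor R C W) T_WC (tswap C W) (tensor_assoc R X C W v)"
  have lmu [simp]: "lin R (tensor R (tensor R X C) W) (tensor R X T_WC) ?mu"
    by (rule lin_comp[OF lin_tensor_assoc lin_rt]) (simp_all add: lin_tswap)
  have mu: "?mu (pure_tensor R (tensor R X C) W s w) = rt X C T_WC (pure_tensor R W C w) s"
    if s: "s \<in> carrier (tensor R X C)" and w: "w \<in> carrier W" for s w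
  proof (rule tensor_ext[where t = s])
    show "lin R (tensor R X C) (tensor R X T_WC) (\<lambda>s. ?mu (pure_tensor R (tensor R X C) W s w))"
      by (rule lin_comp[OF lin_pure_tensor_left lmu]) (simp_all add: w)
    fix x c assume "x \<in> carrier X" "c \<in> carrier C"
    then show "?mu (pure_tensor R (tensor R X C) W (pure_tensor R X C x c) w) = rt X C T_WC (pure_tensor R W C w) (pure_tensor R X C x c)"
      using w by (simp add: tensor_assoc_pure lin_tswap tswap_pure)
  qed (simp_all add: w s)
  let ?m = "\<lambda>v. ?mu (rt (tensor R X C) T_WC W c_WC v)"
  have lm [simp]: "lin R (tensor R (tensor R X C) T_WC) (tensor R X T_WC) ?m"
    by (rule lin_comp[OF lin_rt lmu]) simp_all
  have xc [simp]: "coact X x \<in> carrier (tensor R X C)" if "x \<in> carrier X" for x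
    using that by (simp add: lin_closed[of R X "tensor R X C"])
  have 1: "?m (lt X (tensor R X C) T_WC (coact X) t) = lam W X C (coact X) (tswap X W (rt X T_WC W c_WC t))"
    (is "?l t = ?r t")
  proof (rule tensor_ext[where f = ?l and g = ?r and t = t])
    show "lin R (tensor R X T_WC) (tensor R X T_WC) ?l"
      by (rule lin_comp[OF lin_lt lm]) simp_all
    show "lin R (tensor R X T_WC) (tensor R X T_WC) ?r"
      by (rule lin_comp[OF lin_comp[OF lin_rt lin_tswap] lin_lam]) simp_all
    fix x s assume "x \<in> carrier X" "s \<in> carrier T_WC"
    then show "?l (pure_tensor R X T_WC x s) = ?r (pure_tensor R X T_WC x s)"
      by (simp add: mu tswap_pure)
  qed (simp_all add: t)
  have 2: "?m (wten X T_WC C T_WC l_WC t) = t" (is "?l t = t")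
  proof (rule tensor_ext[where f = ?l and g = "\<lambda>t. t" and t = t])
    show "lin R (tensor R X T_WC) (tensor R X T_WC) ?l"
      by (rule lin_comp[OF lin_wten lm]) simp_all
    fix x s assume x: "x \<in> carrier X" and s: "s \<in> carrier T_WC"
    have ls: "l_WC s \<in> carrier (tensor R C T_WC)" by (rule lin_closed[OF lin_lam s]) simp_all
    have "?m (lt C (tensor R X C) T_WC (pure_tensor R X C x) v) = pure_tensor R X T_WC x (tswap C W (rt C T_WC W c_WC v))"
      (is "?a v = ?b v") if v: "v \<in> carrier (tensor R C T_WC)" for v
    proof (rule tensor_ext[where f = ?a and g = ?b and t = v])
      show "lin R (tensor R C T_WC) (tensor R X T_WC) ?a"
        by (rule lin_comp[OF lin_lt lm]) (simp_all add: x)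
      show "lin R (tensor R C T_WC) (tensor R X T_WC) ?b"
        by (rule lin_comp[OF lin_comp[OF lin_rt lin_tswap] lin_pure_tensor_right]) (simp_all add: x)
      fix c s assume "c \<in> carrier C" "s \<in> carrier T_WC"
      then show "?a (pure_tensor R C T_WC c s) = ?b (pure_tensor R C T_WC c s)"
        using x by (simp add: mu tswap_pure)
    qed (simp_all add: v)
    from this[OF ls] show "?l (pure_tensor R X T_WC x s) = pure_tensor R X T_WC x s"
      using x s lam_retract[OF rcomod_regular[OF coalg_C] s] by simp
  qed (simp_all add: t)
  show ?thesis using 1 2 eq by simp
qed

text \<open>
  Let \<open>K\<close> be the kernel of the unit of \<open>T = W \<otimes> C\<close>. It is a left subcomodule, because the left
  coaction of \<open>T\<close>, being right colinear, induces a map \<open>g\<close> between the values of \<open>h\<close>, and \<open>C\<close> is flat. An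
  element of \<open>X \<box>\<^sub>C K\<close> becomes \<open>lam s\<close> in \<open>X \<otimes> T\<close> with \<open>s \<in> W \<otimes> X\<close>, and \<open>X \<otimes> u\<^sub>T\<close> kills it.
  But \<open>(X \<otimes> u\<^sub>T) lam = (k \<otimes> X) (W \<otimes> u\<^sub>X)\<close>, where \<open>W \<otimes> u\<^sub>X\<close> is split injective and \<open>k = h(lam)\<close>.
  Since \<open>lam\<close> is split as a linear map, \<open>X \<otimes> lam\<close> is injective, hence so is
  \<open>h(X \<otimes> lam) = X \<otimes> k\<close>. Thus \<open>s = 0\<close>, and faithfulness applies.
\<close>

lemma unit_WC_inj: "inj_on (wten W C Y X uC) (carrier T_WC)"
proof -
  let ?u = "wten W C Y X uC" and ?H = "tensor R W Y"
  note [simp] = univD[OF uC]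
  have uT: "univ T_WC r_WC ?H ?u" by (rule univ_tensor[OF W uC])
  note [simp] = univD(5)[OF uC]
  have sT [simp]: "small T_WC" by (rule small_tensor_product[OF W smallW]) simp_all
  have sH [simp]: "small ?H" by (rule small_tensor_product[OF W smallW]) simp_all
  have lu [simp]: "lin R T_WC (tensor R ?H X) ?u" by simp
  let ?K = "T_WC\<lparr>carrier := {t \<in> carrier T_WC. ?u t = \<zero>\<^bsub>tensor R ?H X\<^esub>}\<rparr>"
  have sub: "submodule {t \<in> carrier T_WC. ?u t = \<zero>\<^bsub>tensor R ?H X\<^esub>} R T_WC"
    by (rule submodule_kernel) simp_all
  have K [simp]: "module R ?K" and i [simp]: "lin R ?K T_WC (\<lambda>x. x)"
    by (rule module_submodule[OF _ sub], simp, rule lin_submodule_incl[OF _ sub], simp)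
  have sK [simp]: "small ?K" by (rule small_subset[OF sT]) auto
  have iinj: "inj_on (\<lambda>x. x) (carrier ?K)" by simp
  note r1 = flat_rt_inj[OF K sK module_tensor[OF W C_simps(1)] sT i iinj]
  have sCK [simp]: "small (tensor R C ?K)" "small (tensor R C T_WC)" by (rule small_tensor_product; simp)+
  have r2: "inj_on (rt (tensor R C C) ?K T_WC (\<lambda>x. x)) (carrier (tensor R (tensor R C C) ?K))"
    by (rule rt_tensor_inj, simp_all only: C_simps(1) K module_tensor[OF W C_simps(1)] i)
      (rule flat_rt_inj[OF _ _ _ _ _ r1]; simp)
  \<comment> \<open>\<open>g = h(l)\<close> for the left coaction \<open>l\<close> of \<open>T\<close>, with \<open>h(C \<otimes> T) = C \<otimes> h(T)\<close>\<close>
  have uCT: "univ (tensor R C T_WC) (wten C T_WC T_WC C r_WC) (tensor R C ?H) (wten C T_WC ?H X ?u)"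
    by (rule univ_tensor[OF C_simps(1) uT])
  have "colin C T_WC r_WC (tensor R (tensor R C ?H) X) (xcoact (tensor R C ?H)) (\<lambda>t. wten C T_WC ?H X ?u (l_WC t))"
    by (rule colin_comp[OF C_simps(1) univD(1)[OF uT] univD(1)[OF uCT] rcomod_VX lam_colinear[OF rcomod_regular[OF coalg_C]] univD(5)[OF uCT]]) simp
  from univ_ex[OF uT _ _ this] obtain g where g: "lin R ?H (tensor R C ?H) g"
    "\<And>t. t \<in> carrier T_WC \<Longrightarrow> lt ?H (tensor R C ?H) X g (?u t) = wten C T_WC ?H X ?u (l_WC t)"
    using small_tensor_product[OF C_simps(1) small_UNIV _ sH] by auto
  have im: "l_WC s \<in> rt C ?K T_WC (\<lambda>x. x) ` carrier (tensor R C ?K)" if s: "s \<in> carrier ?K" for s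
  proof -
    have sT: "s \<in> carrier T_WC" "?u s = \<zero>\<^bsub>tensor R ?H X\<^esub>" using s by simp_all
    have ls: "l_WC s \<in> carrier (tensor R C T_WC)" by (rule lin_closed[OF lin_lam sT(1)]) simp_all
    have "wten C T_WC ?H X ?u (l_WC s) = \<zero>\<^bsub>tensor R (tensor R C ?H) X\<^esub>"
      using g(2)[OF sT(1)] lin_zero[OF _ _ lin_lt[OF _ _ _ g(1)], of X] sT(2) by simp
    then have "rt C T_WC (tensor R ?H X) ?u (l_WC s) = tensor_assoc R C ?H X \<zero>\<^bsub>tensor R (tensor R C ?H) X\<^esub>"
      using ls by (simp add: wten_def) (metis C_simps(1) E_simps(1) X_simps(1) lu module_tensor rt_closed tensor_assoc_assoc_inv W univD(4)[OF uC])
    also have "\<dots> = \<zero>\<^bsub>tensor R C (tensor R ?H X)\<^esub>" by (rule lin_zero[OF _ _ lin_tensor_assoc]) simp_all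
    finally have "lt T_WC (tensor R ?H X) C ?u (tswap C T_WC (l_WC s)) = tswap C (tensor R ?H X) \<zero>\<^bsub>tensor R C (tensor R ?H X)\<^esub>"
      using ls by (simp flip: tswap_rt)
    also have "\<dots> = \<zero>\<^bsub>tensor R (tensor R ?H X) C\<^esub>" by (rule lin_zero[OF _ _ lin_tswap]) simp_all
    finally have "tswap C T_WC (l_WC s) \<in> lt ?K T_WC C (\<lambda>x. x) ` carrier (tensor R ?K C)"
      using ls by (intro flat_kernel[OF flat]) simp_all
    then obtain v where v: "v \<in> carrier (tensor R ?K C)" "tswap C T_WC (l_WC s) = lt ?K T_WC C (\<lambda>x. x) v" by auto
    have "tswap T_WC C (tswap C T_WC (l_WC s)) = l_WC s" by (rule tswap_tswap) (use ls in simp_all)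
    then have "l_WC s = tswap T_WC C (lt ?K T_WC C (\<lambda>x. x) v)" unfolding v(2) by (rule sym)
    also have "\<dots> = rt C ?K T_WC (\<lambda>x. x) (tswap ?K C v)" by (rule tswap_lt) (use v in simp_all)
    finally show ?thesis using tswap_closed[OF K C_simps(1) v(1)] by blast
  qed
  obtain \<kappa> where \<kappa>: "lcomod C ?K \<kappa>" "\<And>s. s \<in> carrier ?K \<Longrightarrow> rt C ?K T_WC (\<lambda>x. x) (\<kappa> s) = l_WC s"
    using lcomod_sub[OF coalg_C lcomod_WC K i iinj r1 r2 im] by blast
  have \<kappa>l [simp]: "lin R ?K (tensor R C ?K) \<kappa>" using \<kappa>(1) by (simp add: lcomod_def)
  have "rt X ?K T_WC (\<lambda>x. x) z = \<zero>\<^bsub>tensor R X T_WC\<^esub>"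
    if z: "z \<in> carrier (tensor R X ?K)" and zeq: "lt X (tensor R X C) ?K (coact X) z = wten X ?K C ?K \<kappa> z" for z
  proof -
    let ?z = "rt X ?K T_WC (\<lambda>x. x) z"
    have zc: "?z \<in> carrier (tensor R X T_WC)" by (rule rt_closed) (use z in simp_all)
    have "lt X (tensor R X C) T_WC (coact X) ?z = wten X T_WC C T_WC l_WC ?z"
      by (rule cotensor_map[OF \<kappa>(1) lcomod_WC i \<kappa>(2) z zeq])
    note zl = cotensor_in_image_lam[OF zc this]
    let ?s = "tswap X W (rt X T_WC W c_WC ?z)" and ?lX = "lam W X C (coact X)"
    have s: "?s \<in> carrier (tensor R W X)" using zc by simp
    \<comment> \<open>\<open>k = h(lam)\<close>, between \<open>h(W \<otimes> X) = W \<otimes> E\<close> and \<open>h(X \<otimes> T) = X \<otimes> h(T)\<close>\<close>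
    note uWX = univ_VX[OF W]
    have uXT: "univ (tensor R X T_WC) (wten X T_WC T_WC C r_WC) (tensor R X ?H) (wten X T_WC ?H X ?u)"
      by (rule univ_tensor[OF X_simps(1) uT])
    note lX = lam_colinear[OF X_rcomod]
    have "colin C (tensor R W X) (xcoact W) (tensor R (tensor R X ?H) X) (xcoact (tensor R X ?H)) (\<lambda>t. wten X T_WC ?H X ?u (?lX t))"
      by (rule colin_comp[OF C_simps(1) univD(1)[OF uWX] univD(1)[OF uXT] rcomod_VX lX univD(5)[OF uXT]]) simp
    from univ_ex[OF uWX _ _ this] obtain k where k [simp]: "lin R (tensor R W E) (tensor R X ?H) k"
      and ku: "\<And>t. t \<in> carrier (tensor R W X) \<Longrightarrow>
        lt (tensor R W E) (tensor R X ?H) X k (wten W X E X uX t) = wten X T_WC ?H X ?u (?lX t)"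
      using small_tensor_product[OF X_simps(1) small_UNIV _ sH] by auto
    have lXl [simp]: "lin R (tensor R W X) (tensor R X T_WC) ?lX" by simp
    have sm [simp]: "small (tensor R W X)"
      by (rule small_tensor_product[OF W smallW]) simp_all
    have sm' [simp]: "small (tensor R X T_WC)"
      by (rule small_tensor_product) simp_all
    have "inj_on (rt X (tensor R W E) (tensor R X ?H) k) (carrier (tensor R X (tensor R W E)))"
    proof (rule univ_mono[OF univ_tensor[OF X_simps(1) uWX] univ_tensor[OF X_simps(1) uXT]])
      show "colin C (tensor R X (tensor R W X)) (wten X (tensor R W X) (tensor R W X) C (xcoact W))
          (tensor R X (tensor R X T_WC)) (wten X (tensor R X T_WC) (tensor R X T_WC) C (wten X T_WC T_WC C r_WC))
          (rt X (tensor R W X) (tensor R X T_WC) ?lX)"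
        by (rule colin_rt[OF coalg_C X_simps(1) univD(1)[OF uWX] univD(1)[OF uXT] lX])
      show "inj_on (rt X (tensor R W X) (tensor R X T_WC) ?lX) (carrier (tensor R X (tensor R W X)))"
        by (rule inj_on_rt_if_left_inverse[where g = "\<lambda>t. tswap X W (rt X T_WC W c_WC t)"])
          (auto intro!: lin_comp[OF lin_rt lin_tswap] simp: lam_retract[OF X_rcomod])
      fix t assume t: "t \<in> carrier (tensor R X (tensor R W X))"
      have "lt (tensor R X (tensor R W E)) (tensor R X (tensor R X ?H)) X (rt X (tensor R W E) (tensor R X ?H) k)
          (wten X (tensor R W X) (tensor R W E) X (wten W X E X uX) t) =
        wten X (tensor R W X) (tensor R X ?H) X (\<lambda>m. lt (tensor R W E) (tensor R X ?H) X k (wten W X E X uX m)) t"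
        using t by (simp add: lt_wten)
      also have "\<dots> = wten X (tensor R W X) (tensor R X ?H) X (\<lambda>m. wten X T_WC ?H X ?u (?lX m)) t"
        by (rule fun_cong[OF wten_cong]) (simp_all add: ku)
      also have "\<dots> = wten X (tensor R X T_WC) (tensor R X ?H) X (wten X T_WC ?H X ?u) (rt X (tensor R W X) (tensor R X T_WC) ?lX t)"
        using t by (simp add: wten_rt)
      finally show "lt (tensor R X (tensor R W E)) (tensor R X (tensor R X ?H)) X (rt X (tensor R W E) (tensor R X ?H) k)
          (wten X (tensor R W X) (tensor R W E) X (wten W X E X uX) t) =
        wten X (tensor R X T_WC) (tensor R X ?H) X (wten X T_WC ?H X ?u) (rt X (tensor R W X) (tensor R X T_WC) ?lX t)" .
    qed (simp_all add: small_tensor_product)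
    then have kinj: "inj_on (lt (tensor R W E) (tensor R X ?H) X k) (carrier (tensor R (tensor R W E) X))"
      by (subst (asm) rt_inj_iff_lt_inj) simp_all
    have "wten X T_WC ?H X ?u ?z = wten X ?K ?H X (\<lambda>x. ?u x) z"
      by (rule wten_rt) (use z in simp_all)
    also have "\<dots> = wten X ?K ?H X (\<lambda>x. \<zero>\<^bsub>tensor R ?H X\<^esub>) z"
      by (rule fun_cong[OF wten_cong]) simp_all
    also have "\<dots> = \<zero>\<^bsub>tensor R (tensor R X ?H) X\<^esub>"
      by (rule wten_const_zero) (use z in simp_all)
    finally have "lt (tensor R W E) (tensor R X ?H) X k (wten W X E X uX ?s) = \<zero>\<^bsub>tensor R (tensor R X ?H) X\<^esub>"
      using ku[OF s] zl by simp
    then have "wten W X E X uX ?s = \<zero>\<^bsub>tensor R (tensor R W E) X\<^esub>"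
      using kinj s by (subst (asm) lin_inj_iff[OF _ _ lin_lt]) simp_all
    then have "?s = \<zero>\<^bsub>tensor R W X\<^esub>"
      using unit_VX_inj[OF W] s by (subst (asm) lin_inj_iff[OF _ _ lin_wten]) simp_all
    then have "?z = ?lX \<zero>\<^bsub>tensor R W X\<^esub>" using zl by simp
    also have "\<dots> = \<zero>\<^bsub>tensor R X T_WC\<^esub>" by (rule lin_zero) simp_all
    finally show ?thesis .
  qed
  note vanish = this
  have "s = \<zero>\<^bsub>T_WC\<^esub>" if "s \<in> carrier ?K" for s
    by (rule cotensor_faithful[OF \<kappa>(1) sK lcomod_WC sT i \<kappa>(2) vanish that])
  then show ?thesis by (subst lin_inj_iff[OF _ _ lu]) simp_all
qed

end

text \<open>The coaction \<open>M \<rightarrow> M \<otimes> C\<close> is an injective colinear map, and units are natural.\<close>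

lemma unit_inj:
  assumes u: "univ M \<rho> H u" and M: "small M"
  shows "inj_on u (carrier M)"
proof -
  note [simp] = univD[OF u]
  have "rcomod C C (comult C)" by (rule rcomod_regular[OF coalg_C])
  then obtain Y :: "('r, 'u) module" and uC where uC: "univ C (comult C) Y uC"
    using univ_exists[OF _ small_UNIV] by metis
  note [simp] = univD(4)[OF uC] univD(6)[OF uC]
  note uMC = univ_tensor[OF univD(2)[OF u] uC]
  have "colin C M \<rho> (tensor R (tensor R M Y) X) (xcoact (tensor R M Y)) (\<lambda>x. wten M C Y X uC (\<rho> x))"
    by (rule colin_comp[OF C_simps(1) univD(1)[OF u] univD(1)[OF uMC] rcomod_VX colin_coaction[OF coalg_C univD(1)[OF u]] univD(5)[OF uMC]]) simp
  from univ_ex[OF u _ _ this] obtain g where g: "lin R H (tensor R M Y) g"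
    "\<And>x. x \<in> carrier M \<Longrightarrow> lt H (tensor R M Y) X g (u x) = wten M C Y X uC (\<rho> x)"
    using small_tensor_product[OF univD(2)[OF u] M univD(4)[OF uC] small_UNIV] by auto
  have \<rho>inj: "inj_on \<rho> (carrier M)"
    by (rule inj_on_inverseI[where g = "contract M C (counit C)"]) (use univD(1)[OF u] in \<open>simp add: rcomod_def\<close>)
  show ?thesis
  proof (rule inj_onI)
    fix x y assume xy: "x \<in> carrier M" "y \<in> carrier M" "u x = u y"
    then have "wten M C Y X uC (\<rho> x) = wten M C Y X uC (\<rho> y)" using g(2) by metis
    then have "\<rho> x = \<rho> y" by (rule inj_onD[OF unit_WC_inj[OF univD(2)[OF u] M uC]]) (use xy in simp_all)
    then show "x = y" by (rule inj_onD[OF \<rho>inj]) (use xy in simp_all)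
  qed
qed

end

context over_ring
begin

context
  fixes D :: "('r, 'c, 'z) coalgebra_scheme"
  assumes D: "coalg D"
begin

lemma D_module [simp]: "module R D"
  by (rule coalgD[OF D])

lemma colin_plus:
  assumes M: "rcomod D M \<rho>" and N: "rcomod D N \<sigma>" and f: "colin D M \<rho> N \<sigma> f" and g: "colin D M \<rho> N \<sigma> g"
  shows "colin D M \<rho> N \<sigma> (\<lambda>x. f x \<oplus>\<^bsub>N\<^esub> g x)"
proof -
  have [simp]: "module R M" "module R N" "lin R N (tensor R N D) \<sigma>" "lin R M N f" "lin R M N g"
    using M N f g by (simp_all add: rcomod_def colin_def)
  have "\<rho> x \<in> carrier (tensor R M D)" if "x \<in> carrier M" for x using that by (rule rcomod_closed[OF D M])
  then show ?thesis
    using f g by (simp add: colin_def lin_plus lt_plus lin_add[of R N "tensor R N D" \<sigma>] lin_closed[of R M N])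
qed

lemma colin_scale:
  assumes M: "rcomod D M \<rho>" and N: "rcomod D N \<sigma>" and f: "colin D M \<rho> N \<sigma> f" and r: "r \<in> carrier R"
  shows "colin D M \<rho> N \<sigma> (\<lambda>x. r \<odot>\<^bsub>N\<^esub> f x)"
proof -
  have [simp]: "module R M" "module R N" "lin R N (tensor R N D) \<sigma>" "lin R M N f"
    using M N f by (simp_all add: rcomod_def colin_def)
  have "\<rho> x \<in> carrier (tensor R M D)" if "x \<in> carrier M" for x using that by (rule rcomod_closed[OF D M])
  then show ?thesis
    using f r by (simp add: colin_def lin_scale lt_scale lin_smult[of R N "tensor R N D" \<sigma>] lin_closed[of R M N])
qed

lemma colin_inverse:
  assumes M: "rcomod D M \<rho>" and N: "rcomod D N \<sigma>" and f: "colin D M \<rho> N \<sigma> f" and bij: "bij_betw f (carrier M) (carrier N)"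
  shows "colin D N \<sigma> M \<rho> (inv_into (carrier M) f)"
  unfolding colin_def
proof (intro conjI ballI)
  let ?g = "inv_into (carrier M) f"
  have [simp]: "module R M" "module R N" "lin R N (tensor R N D) \<sigma>" "lin R M (tensor R M D) \<rho>" "lin R M N f"
    using M N f by (simp_all add: rcomod_def colin_def)
  show [simp]: "lin R N M ?g" by (rule lin_inverse) (simp_all add: bij)
  fix y assume y: "y \<in> carrier N"
  then have x: "?g y \<in> carrier M" "f (?g y) = y" using bij by (auto simp: bij_betw_def inv_into_into f_inv_into_f)
  have c: "\<rho> (?g y) \<in> carrier (tensor R M D)" by (rule rcomod_closed[OF D M x(1)])
  have "lt N M D ?g (\<sigma> y) = lt N M D ?g (lt M N D f (\<rho> (?g y)))" using f x by (simp add: colin_def)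
  also have "\<dots> = lt M M D (\<lambda>x. ?g (f x)) (\<rho> (?g y))" using c by (simp add: lt_comp)
  also have "\<dots> = lt M M D (\<lambda>x. x) (\<rho> (?g y))"
    by (rule fun_cong[OF lt_cong]) (rule bij_betw_inv_into_left[OF bij])
  finally show "lt N M D ?g (\<sigma> y) = \<rho> (?g y)" using c by (simp add: lt_ident)
qed

lemma iso_arrow_comodules:
  assumes A: "right_comodule R D A" and B: "right_comodule R D B" and f: "f \<in> right_colinear R D A B" and bij: "bij_betw f (carrier A) (carrier B)"
  shows "iso_arrow (right_comodules R D) A B f"
    and "restrict (inv_into (carrier A) f) (carrier B) \<in> right_colinear R D B A"
proof -
  let ?g = "restrict (inv_into (carrier A) f) (carrier B)"
  have rc: "rcomod D A (coact A)" "rcomod D B (coact B)" "module R B" using A B by (simp_all add: right_comodule_iff rcomod_def)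
  have "colin D B (coact B) A (coact A) (inv_into (carrier A) f)"
    using f by (intro colin_inverse rc bij) (simp add: right_colinear_iff)
  then show g: "?g \<in> right_colinear R D B A"
    by (simp add: right_colinear_iff colin_cong[OF rc(3), of ?g "inv_into (carrier A) f"])
  have fc: "f x \<in> carrier B" if "x \<in> carrier A" for x using bij that by (auto simp: bij_betw_def)
  have gc: "inv_into (carrier A) f y \<in> carrier A" if "y \<in> carrier B" for y using bij that by (auto simp: bij_betw_def inv_into_into)
  have "compose (carrier A) ?g f = id_map A"
    using bij fc by (auto simp: compose_def id_map_def bij_betw_inv_into_left intro!: restrict_ext)
  moreover have "compose (carrier B) f ?g = id_map B"
    using bij gc by (auto simp: compose_def id_map_def bij_betw_inv_into_right intro!: restrict_ext)
  ultimately show "iso_arrow (right_comodules R D) A B f"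
    using f g by (auto simp: iso_arrow_def right_comodules_def intro!: bexI[of _ ?g])
qed

end

end

context cohom_injector
begin

lemma coalg_E: "coalg E"
  using coalgebra_E by (simp add: coalgebra_iff)

text \<open>Colinearity can be checked after an injective colinear map, since \<open>i \<otimes> C\<close> is again injective.\<close>

lemma colin_factor:
  assumes A: "rcomod C A \<alpha>" and B: "rcomod C B \<beta>" "small B" and B': "rcomod C B' \<beta>'" "small B'"
    and i: "colin C B \<beta> B' \<beta>' i" "inj_on i (carrier B)"
    and f: "\<And>x. x \<in> carrier A \<Longrightarrow> f x \<in> carrier B" and fi: "colin C A \<alpha> B' \<beta>' (\<lambda>x. i (f x))"
  shows "colin C A \<alpha> B \<beta> f"
proof -
  have [simp]: "module R A" "module R B" "module R B'" "lin R B B' i" "lin R A (tensor R A C) \<alpha>"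
    using A B B' i by (simp_all add: rcomod_def colin_def)
  interpret A: module R A by simp
  interpret B: module R B by simp
  have li: "lin R A B' (\<lambda>x. i (f x))" using fi by (simp add: colin_def)
  have lf [simp]: "lin R A B f"
  proof (rule linI)
    fix x y assume xy: "x \<in> carrier A" "y \<in> carrier A"
    show "f (x \<oplus>\<^bsub>A\<^esub> y) = f x \<oplus>\<^bsub>B\<^esub> f y"
      by (rule inj_onD[OF i(2)]) (use xy f in \<open>simp_all add: lin_add[OF li] lin_add[of R B B' i]\<close>)
  next
    fix r x assume xy: "r \<in> carrier R" "x \<in> carrier A"
    show "f (r \<odot>\<^bsub>A\<^esub> x) = r \<odot>\<^bsub>B\<^esub> f x"
      by (rule inj_onD[OF i(2)]) (use xy f in \<open>simp_all add: lin_smult[OF li] lin_smult[of R B B' i]\<close>)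
  qed (rule f)
  have inj: "inj_on (lt B B' C i) (carrier (tensor R B C))"
    by (rule flat_inj[OF flat]) (simp_all add: B(2) B'(2) i(2))
  show ?thesis
    unfolding colin_def
  proof (intro conjI ballI lf)
    fix x assume x: "x \<in> carrier A"
    have c: "\<alpha> x \<in> carrier (tensor R A C)" "\<beta> (f x) \<in> carrier (tensor R B C)"
      by (rule rcomod_closed[OF coalg_C A x], rule rcomod_closed[OF coalg_C B(1) f[OF x]])
    show "lt A B C f (\<alpha> x) = \<beta> (f x)"
    proof (rule inj_onD[OF inj])
      show "lt B B' C i (lt A B C f (\<alpha> x)) = lt B B' C i (\<beta> (f x))"
        using fi i(1) x f c by (simp add: colin_def lt_comp)
    qed (use c in simp_all)
  qed
qed

lemma colin_of_quotient:
  assumes A: "rcomod C A \<alpha>" and P: "rcomod C P \<pi>" and B: "module R B"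
    and p: "colin C A \<alpha> P \<pi> p" "p ` carrier A = carrier P" and g: "lin R P B g" and gp: "colin C A \<alpha> B \<beta> (\<lambda>x. g (p x))"
  shows "colin C P \<pi> B \<beta> g"
  unfolding colin_def
proof (intro conjI ballI g)
  fix y assume "y \<in> carrier P"
  then obtain a where a: "a \<in> carrier A" "y = p a" using p(2) by (metis imageE)
  have "\<alpha> a \<in> carrier (tensor R A C)" by (rule rcomod_closed[OF coalg_C A a(1)])
  then have "lt P B C g (lt A P C p (\<alpha> a)) = lt A B C (\<lambda>x. g (p x)) (\<alpha> a)"
    using A P B p g by (intro lt_comp) (simp_all add: rcomod_def colin_def)
  then show "lt P B C g (\<pi> y) = \<beta> (g y)" using p(1) gp a by (simp add: colin_def)
qed

section \<open>The functor to comodules over the coendomorphism coalgebra\<close>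

text \<open>The coaction of \<open>E\<close> on \<open>h(M)\<close>\<close>

definition theta :: "('r, 'u) comodule \<Rightarrow> 'u \<Rightarrow> ('u, 'u) tens"
  where "theta M = (SOME \<theta>. lin R (Obj h M) (tensor R (Obj h M) E) \<theta> \<and>
    (\<forall>x\<in>carrier M. lt (Obj h M) (tensor R (Obj h M) E) X \<theta> (unit M x) = wten (Obj h M) X E X uX (unit M x)))"

definition F_ob :: "('r, 'u) comodule \<Rightarrow> ('r, 'u) comodule"
  where "F_ob M = (let H = Obj h M in
    \<lparr>carrier = carrier H, monoid.mult = monoid.mult H, one = one H, ring.zero = ring.zero H, add = add H,
     smult = smult H, coact = restrict (theta M) (carrier H)\<rparr>)"

lemma same_F: "same_module (Obj h M) (F_ob M)"
  by (simp add: same_module_def F_ob_def Let_def)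

lemma carrier_F: "carrier (F_ob M) = carrier (Obj h M)"
  by (simp add: F_ob_def Let_def)

context
  fixes M :: "('r, 'u) comodule"
  assumes M: "right_comodule R C M"
begin

lemma univ_F: "univ M (coact M) (F_ob M) (unit M)"
  by (rule univ_cong[OF univ_h[OF M] same_F])

lemma
  shows lin_coact_F: "lin R (F_ob M) (tensor R (F_ob M) E) (coact (F_ob M))"
    and coact_F: "x \<in> carrier M \<Longrightarrow>
      lt (F_ob M) (tensor R (F_ob M) E) X (coact (F_ob M)) (unit M x) = wten (F_ob M) X E X uX (unit M x)"
proof -
  have "lin R (Obj h M) (tensor R (Obj h M) E) (theta M) \<and>
    (\<forall>x\<in>carrier M. lt (Obj h M) (tensor R (Obj h M) E) X (theta M) (unit M x) = wten (Obj h M) X E X uX (unit M x))"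
    unfolding theta_def by (rule someI_ex[OF comodule_structure_ex[OF univ_h[OF M] small_UNIV]])
  then have *: "lin R (F_ob M) (tensor R (F_ob M) E) (theta M)"
    "\<And>x. x \<in> carrier M \<Longrightarrow> lt (F_ob M) (tensor R (F_ob M) E) X (theta M) (unit M x) = wten (F_ob M) X E X uX (unit M x)"
    by (simp_all add: same_tensor[OF same_F same_module_refl] same_lin[OF same_F same_module_refl]
        same_tensor_map[OF same_F same_module_refl same_module_refl same_module_refl]
        same_wten[OF same_F same_module_refl])
  have eq: "coact (F_ob M) y = theta M y" if "y \<in> carrier (F_ob M)" for y
    using that by (simp add: F_ob_def Let_def)
  show "lin R (F_ob M) (tensor R (F_ob M) E) (coact (F_ob M))"
    by (rule lin_cong[where f = "coact (F_ob M)" and g = "theta M", OF univD(4)[OF univ_F] eq, THEN iffD2, OF _ *(1)])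
  have "lt (F_ob M) (tensor R (F_ob M) E) X (coact (F_ob M)) = lt (F_ob M) (tensor R (F_ob M) E) X (theta M)"
    by (rule lt_cong[OF eq])
  then show "x \<in> carrier M \<Longrightarrow>
      lt (F_ob M) (tensor R (F_ob M) E) X (coact (F_ob M)) (unit M x) = wten (F_ob M) X E X uX (unit M x)"
    using *(2) by simp
qed

lemma right_comodule_F: "right_comodule R E (F_ob M)"
  using comodule_structure[OF univ_F small_UNIV lin_coact_F coact_F] coalgebra_E
  by (simp add: right_comodule_iff) (simp add: F_ob_def Let_def)

end

definition F :: "(('r, 'u) comodule, 'u \<Rightarrow> 'u, ('r, 'u) comodule, 'u \<Rightarrow> 'u) functor_data"
  where "F = \<lparr>Obj = F_ob, Arr = Arr h\<rparr>"

lemma unit_natural_F: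
  assumes "right_comodule R C A" "right_comodule R C B" "f \<in> right_colinear R C A B"
  shows "lin R (F_ob A) (F_ob B) (Arr h A B f)" "Arr h A B f \<in> extensional (carrier (F_ob A))"
    and "x \<in> carrier A \<Longrightarrow> lt (F_ob A) (F_ob B) X (Arr h A B f) (unit A x) = unit B (f x)"
proof -
  have A: "x \<in> carrier A \<Longrightarrow> Arr h A B f \<in> mod_hom R (Obj h A) (Obj h B)" for x
    using unit_natural(1)[OF assms] by blast
  have "\<zero>\<^bsub>A\<^esub> \<in> carrier A"
  proof -
    interpret A: right_comodule R C A by (rule assms(1))
    show ?thesis by simp
  qed
  from A[OF this] show "lin R (F_ob A) (F_ob B) (Arr h A B f)" "Arr h A B f \<in> extensional (carrier (F_ob A))"
    by (simp_all add: mod_hom_iff carrier_F same_lin[OF same_F same_F])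
  show "x \<in> carrier A \<Longrightarrow> lt (F_ob A) (F_ob B) X (Arr h A B f) (unit A x) = unit B (f x)"
    using unit_natural(2)[OF assms] by (simp add: same_tensor_map[OF same_F same_module_refl same_F same_module_refl])
qed

lemma right_colinearD:
  assumes "f \<in> right_colinear R D A B"
  shows "colin D A (coact A) B (coact B) f" "lin R A B f" "f \<in> extensional (carrier A)" "\<And>x. x \<in> carrier A \<Longrightarrow> f x \<in> carrier B"
  using assms by (auto simp: right_colinear_iff colin_def intro: lin_closed)

lemma rcD:
  assumes "right_comodule R D A"
  shows "rcomod D A (coact A)" "module R A" "lin R A (tensor R A D) (coact A)"
  using assms by (simp_all add: right_comodule_iff rcomod_def)

lemma F_arr:
  assumes A: "right_comodule R C A" and B: "right_comodule R C B" and f: "f \<in> right_colinear R C A B"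
  shows "Arr h A B f \<in> right_colinear R E (F_ob A) (F_ob B)"
proof -
  let ?g = "Arr h A B f"
  note uA = univ_F[OF A] and uB = univ_F[OF B]
  note [simp] = univD[OF uA] univD[OF uB] lin_coact_F[OF A] lin_coact_F[OF B] unit_natural_F(1)[OF A B f]
  have sBE: "small (tensor R (F_ob B) E)" by (rule small_tensor_product) simp_all
  note fc = right_colinearD(4)[OF f]
  have "lt (F_ob A) (F_ob B) E ?g (coact (F_ob A) y) = coact (F_ob B) (?g y)" if y: "y \<in> carrier (F_ob A)" for y
  proof (rule univ_unique[OF uA _ sBE _ _ _ y])
    show [simp]: "lin R (F_ob A) (tensor R (F_ob B) E) (\<lambda>y. lt (F_ob A) (F_ob B) E ?g (coact (F_ob A) y))"
      by (rule lin_comp[OF lin_coact_F[OF A] lin_lt]) simp_all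
    show [simp]: "lin R (F_ob A) (tensor R (F_ob B) E) (\<lambda>y. coact (F_ob B) (?g y))"
      by (rule lin_comp[OF unit_natural_F(1)[OF A B f] lin_coact_F[OF B]])
    fix x assume x: "x \<in> carrier A"
    have "lt (F_ob A) (tensor R (F_ob B) E) X (\<lambda>y. lt (F_ob A) (F_ob B) E ?g (coact (F_ob A) y)) (unit A x) =
        lt (tensor R (F_ob A) E) (tensor R (F_ob B) E) X (lt (F_ob A) (F_ob B) E ?g) (wten (F_ob A) X E X uX (unit A x))"
      using x by (simp add: lt_comp flip: coact_F[OF A])
    also have "\<dots> = wten (F_ob B) X E X uX (unit B (f x))"
      using x by (simp add: wten_lt unit_natural_F(3)[OF A B f])
    also have "\<dots> = lt (F_ob B) (tensor R (F_ob B) E) X (coact (F_ob B)) (lt (F_ob A) (F_ob B) X ?g (unit A x))"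
      using x fc by (simp add: coact_F[OF B] unit_natural_F(3)[OF A B f])
    also have "\<dots> = lt (F_ob A) (tensor R (F_ob B) E) X (\<lambda>y. coact (F_ob B) (?g y)) (unit A x)"
      using x by (simp add: lt_comp)
    finally show "lt (F_ob A) (tensor R (F_ob B) E) X (\<lambda>y. lt (F_ob A) (F_ob B) E ?g (coact (F_ob A) y)) (unit A x) =
      lt (F_ob A) (tensor R (F_ob B) E) X (\<lambda>y. coact (F_ob B) (?g y)) (unit A x)" .
  qed simp
  then show ?thesis
    using unit_natural_F(2)[OF A B f] by (simp add: right_colinear_iff colin_def)
qed

lemma functor_F: "is_functor (right_comodules R C) (right_comodules R E) F"
proof -
  have id: "id_map (F_ob A) = id_map (Obj h A)" for A by (simp add: id_map_def carrier_F)
  show ?thesis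
    using h_functor right_comodule_F F_arr
    by (simp add: is_functor_def right_comodules_def F_def Mod_cat_def id carrier_F)
qed

lemma linear_functor_F: "linear_functor R (right_comodules R C) F"
  unfolding linear_functor_def
proof (intro conjI ballI)
  fix A B f g assume "A \<in> Ob (right_comodules R C)" "B \<in> Ob (right_comodules R C)"
    "f \<in> Hom (right_comodules R C) A B" "g \<in> Hom (right_comodules R C) A B"
  then have A: "right_comodule R C A" and B: "right_comodule R C B" and f: "f \<in> right_colinear R C A B" and g: "g \<in> right_colinear R C A B"
    by (simp_all add: right_comodules_def)
  note [simp] = rcD(2)[OF A] rcD(2)[OF B]
  note uA = univ_F[OF A] and uB = univ_F[OF B]
  interpret B: module R B by simp
  let ?s = "\<lambda>x\<in>carrier A. f x \<oplus>\<^bsub>B\<^esub> g x"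
  have s: "?s \<in> right_colinear R C A B"
    using colin_plus[OF coalg_C rcD(1)[OF A] rcD(1)[OF B] right_colinearD(1)[OF f] right_colinearD(1)[OF g]]
    by (simp add: right_colinear_iff colin_cong[OF rcD(2)[OF A], of ?s "\<lambda>x. f x \<oplus>\<^bsub>B\<^esub> g x"])
  note n = unit_natural_F[OF A B]
  have l: "lin R (F_ob A) (F_ob B) (\<lambda>y. Arr h A B f y \<oplus>\<^bsub>F_ob B\<^esub> Arr h A B g y)"
    by (intro lin_plus n(1) f g univD(4)[OF uB])
  have "Arr h A B ?s = (\<lambda>y\<in>carrier (F_ob A). Arr h A B f y \<oplus>\<^bsub>F_ob B\<^esub> Arr h A B g y)"
  proof (rule extensionalityI[OF n(2)[OF s]])
    fix y assume y: "y \<in> carrier (F_ob A)"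
    have "Arr h A B ?s y = Arr h A B f y \<oplus>\<^bsub>F_ob B\<^esub> Arr h A B g y"
    proof (rule univ_unique[OF uA univD(4)[OF uB] small_UNIV n(1)[OF s] l _ y])
      fix x assume x: "x \<in> carrier A"
      show "lt (F_ob A) (F_ob B) X (Arr h A B ?s) (unit A x) =
        lt (F_ob A) (F_ob B) X (\<lambda>y. Arr h A B f y \<oplus>\<^bsub>F_ob B\<^esub> Arr h A B g y) (unit A x)"
        using x n(1)[OF f] n(1)[OF g] univD[OF uA] univD[OF uB] right_colinearD(4)[OF f] right_colinearD(4)[OF g]
        by (simp add: n(3)[OF s] n(3)[OF f] n(3)[OF g] lt_plus lin_add[OF univD(6)[OF uB]])
    qed
    then show "Arr h A B ?s y = (\<lambda>y\<in>carrier (F_ob A). Arr h A B f y \<oplus>\<^bsub>F_ob B\<^esub> Arr h A B g y) y" using y by simp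
  qed simp
  then show "Arr F A B ?s = (\<lambda>x\<in>carrier (Obj F A). Arr F A B f x \<oplus>\<^bsub>Obj F B\<^esub> Arr F A B g x)"
    by (simp add: F_def)
next
  fix A B r f assume "A \<in> Ob (right_comodules R C)" "B \<in> Ob (right_comodules R C)" and r: "r \<in> carrier R"
    and "f \<in> Hom (right_comodules R C) A B"
  then have A: "right_comodule R C A" and B: "right_comodule R C B" and f: "f \<in> right_colinear R C A B"
    by (simp_all add: right_comodules_def)
  note [simp] = rcD(2)[OF A] rcD(2)[OF B]
  note uA = univ_F[OF A] and uB = univ_F[OF B]
  interpret B: module R B by simp
  let ?s = "\<lambda>x\<in>carrier A. r \<odot>\<^bsub>B\<^esub> f x"
  have s: "?s \<in> right_colinear R C A B"
    using colin_scale[OF coalg_C rcD(1)[OF A] rcD(1)[OF B] right_colinearD(1)[OF f] r]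
    by (simp add: right_colinear_iff colin_cong[OF rcD(2)[OF A], of ?s "\<lambda>x. r \<odot>\<^bsub>B\<^esub> f x"])
  note n = unit_natural_F[OF A B]
  have l: "lin R (F_ob A) (F_ob B) (\<lambda>y. r \<odot>\<^bsub>F_ob B\<^esub> Arr h A B f y)"
    by (intro lin_scale n(1) f univD(4)[OF uB] r)
  have "Arr h A B ?s = (\<lambda>y\<in>carrier (F_ob A). r \<odot>\<^bsub>F_ob B\<^esub> Arr h A B f y)"
  proof (rule extensionalityI[OF n(2)[OF s]])
    fix y assume y: "y \<in> carrier (F_ob A)"
    have "Arr h A B ?s y = r \<odot>\<^bsub>F_ob B\<^esub> Arr h A B f y"
    proof (rule univ_unique[OF uA univD(4)[OF uB] small_UNIV n(1)[OF s] l _ y])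
      fix x assume x: "x \<in> carrier A"
      show "lt (F_ob A) (F_ob B) X (Arr h A B ?s) (unit A x) =
        lt (F_ob A) (F_ob B) X (\<lambda>y. r \<odot>\<^bsub>F_ob B\<^esub> Arr h A B f y) (unit A x)"
        using x r n(1)[OF f] univD[OF uA] univD[OF uB] right_colinearD(4)[OF f]
        by (simp add: n(3)[OF s] n(3)[OF f] lt_scale lin_smult[OF univD(6)[OF uB]])
    qed
    then show "Arr h A B ?s y = (\<lambda>y\<in>carrier (F_ob A). r \<odot>\<^bsub>F_ob B\<^esub> Arr h A B f y) y" using y by simp
  qed simp
  then show "Arr F A B ?s = (\<lambda>x\<in>carrier (Obj F A). r \<odot>\<^bsub>Obj F B\<^esub> Arr F A B f x)"
    by (simp add: F_def)
qed

section \<open>The cotensor product with X over the coendomorphism coalgebra\<close>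

text \<open>The cotensor product \<open>N \<box>\<^sub>E X\<close>, where \<open>E\<close> coacts on \<open>X\<close> from the left by the unit \<open>u\<^sub>X\<close>\<close>

definition boxX :: "('r, 'u) comodule \<Rightarrow> ('r, ('u, 'u) tens) module"
  where "boxX N = (tensor R N X)\<lparr>carrier := {t \<in> carrier (tensor R N X).
    lt N (tensor R N E) X (coact N) t = wten N X E X uX t}\<rparr>"

text \<open>
  The difference of the two maps that \<open>boxX N\<close> equalizes. Negation is written as scaling by \<open>-1\<close>, so
  that colinearity follows from that of sums and multiples.
\<close>

definition dif :: "('r, 'u) comodule \<Rightarrow> ('u, 'u) tens \<Rightarrow> (('u, 'u) tens, 'u) tens"
  where "dif N t = lt N (tensor R N E) X (coact N) t \<oplus>\<^bsub>tensor R (tensor R N E) X\<^esub>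
    (\<ominus> \<one>) \<odot>\<^bsub>tensor R (tensor R N E) X\<^esub> wten N X E X uX t"

definition boxX_coact :: "('r, 'u) comodule \<Rightarrow> ('u, 'u) tens \<Rightarrow> (('u, 'u) tens, 'u) tens"
  where "boxX_coact N = (SOME \<sigma>. rcomod C (boxX N) \<sigma> \<and> colin C (boxX N) \<sigma> (tensor R N X) (xcoact N) (\<lambda>t. t))"

definition G_ob :: "('r, 'u) comodule \<Rightarrow> ('r, 'u) comodule"
  where "G_ob N = small_comodule (boxX N) (boxX_coact N)"

text \<open>The inclusion of \<open>N \<box>\<^sub>E X\<close> into \<open>N \<otimes> X\<close>, on the copy in the universe\<close>

definition iota :: "('r, 'u) comodule \<Rightarrow> 'u \<Rightarrow> ('u, 'u) tens"
  where "iota N = inv_into (carrier (boxX N)) (small_inj (boxX N))"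

definition G_arr :: "('r, 'u) comodule \<Rightarrow> ('r, 'u) comodule \<Rightarrow> ('u \<Rightarrow> 'u) \<Rightarrow> 'u \<Rightarrow> 'u"
  where "G_arr A B f = (\<lambda>y\<in>carrier (G_ob A). small_inj (boxX B) (lt A B X f (iota A y)))"

context
  fixes N :: "('r, 'u) comodule"
  assumes N: "right_comodule R E N"
begin

lemma N_simps [simp]: "module R N" "lin R N (tensor R N E) (coact N)" "small (tensor R N X)" "small (tensor R N E)"
  "small (tensor R (tensor R N E) X)"
proof -
  show m: "module R N" "lin R N (tensor R N E) (coact N)" using rcD[OF N] by simp_all
  show "small (tensor R N X)" using m by (intro small_tensor_product) simp_all
  show s: "small (tensor R N E)" using m by (intro small_tensor_product) simp_all
  show "small (tensor R (tensor R N E) X)" using m s by (intro small_tensor_product) simp_all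
qed

lemma colin_dif: "colin C (tensor R N X) (xcoact N) (tensor R (tensor R N E) X) (xcoact (tensor R N E)) (dif N)"
  unfolding dif_def[abs_def]
  by (intro colin_plus colin_scale coalg_C rcomod_VX colin_xcoact_lt univD(5)[OF univ_VX]) simp_all

lemma lin_dif [simp]: "lin R (tensor R N X) (tensor R (tensor R N E) X) (dif N)"
  by (rule colin_lin[OF colin_dif])

lemma dif_eq_zero_iff:
  assumes t: "t \<in> carrier (tensor R N X)"
  shows "dif N t = \<zero>\<^bsub>tensor R (tensor R N E) X\<^esub> \<longleftrightarrow> lt N (tensor R N E) X (coact N) t = wten N X E X uX t"
proof -
  interpret T: module R "tensor R (tensor R N E) X" by simp
  have "dif N t = lt N (tensor R N E) X (coact N) t \<ominus>\<^bsub>tensor R (tensor R N E) X\<^esub> wten N X E X uX t"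
    using t by (simp add: dif_def T.minus_eq T.smult_l_minus)
  then show ?thesis
    using t diff_zero_imp_eq[OF T.module_axioms, of "lt N (tensor R N E) X (coact N) t" "wten N X E X uX t"]
    by (auto simp del: wten_pure simp: T.minus_eq T.r_neg)
qed

lemma boxX_kernel: "boxX N = (tensor R N X)\<lparr>carrier := {t \<in> carrier (tensor R N X). dif N t = \<zero>\<^bsub>tensor R (tensor R N E) X\<^esub>}\<rparr>"
  unfolding boxX_def by (simp add: dif_eq_zero_iff cong: conj_cong)

lemma submodule_boxX: "submodule (carrier (boxX N)) R (tensor R N X)"
  using submodule_kernel[OF _ _ lin_dif] by (simp add: boxX_kernel)

lemma boxX_simps [simp]: "module R (boxX N)" "lin R (boxX N) (tensor R N X) (\<lambda>t. t)" "small (boxX N)"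
proof -
  have "boxX N = (tensor R N X)\<lparr>carrier := carrier (boxX N)\<rparr>" by (simp add: boxX_def)
  then show "module R (boxX N)" "lin R (boxX N) (tensor R N X) (\<lambda>t. t)"
    using module_submodule[OF _ submodule_boxX] lin_submodule_incl[OF _ submodule_boxX] by simp_all
  show "small (boxX N)" by (rule small_subset[OF N_simps(3)]) (auto simp: boxX_def)
qed

lemma boxX_mem: "t \<in> carrier (boxX N) \<longleftrightarrow> t \<in> carrier (tensor R N X) \<and> lt N (tensor R N E) X (coact N) t = wten N X E X uX t"
  by (simp add: boxX_def)

text \<open>A kernel of a colinear map, which is a subcomodule because \<open>C\<close> is flat.\<close>

lemma rcomod_boxX: "rcomod C (boxX N) (boxX_coact N)"
  and colin_boxX: "colin C (boxX N) (boxX_coact N) (tensor R N X) (xcoact N) (\<lambda>t. t)"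
proof -
  have inj1: "inj_on (lt (boxX N) (tensor R N X) C (\<lambda>t. t)) (carrier (tensor R (boxX N) C))"
    by (rule flat_inj[OF flat]) simp_all
  have sm: "small (tensor R (boxX N) C)" "small (tensor R (tensor R N X) C)" by (rule small_tensor_product; simp)+
  have inj2: "inj_on (lt (tensor R (boxX N) C) (tensor R (tensor R N X) C) C (lt (boxX N) (tensor R N X) C (\<lambda>t. t)))
      (carrier (tensor R (tensor R (boxX N) C) C))"
    by (rule flat_inj[OF flat _ sm(1) _ sm(2) _ inj1]) simp_all
  have im: "xcoact N t \<in> lt (boxX N) (tensor R N X) C (\<lambda>t. t) ` carrier (tensor R (boxX N) C)" if t: "t \<in> carrier (boxX N)" for t
    unfolding boxX_kernel
  proof (rule flat_kernel[OF flat])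
    have t': "t \<in> carrier (tensor R N X)" "dif N t = \<zero>\<^bsub>tensor R (tensor R N E) X\<^esub>" using t by (simp_all add: boxX_kernel)
    show "xcoact N t \<in> carrier (tensor R (tensor R N X) C)" using t' by simp
    have "lt (tensor R N X) (tensor R (tensor R N E) X) C (dif N) (xcoact N t) = xcoact (tensor R N E) (dif N t)"
      using colin_dif t'(1) by (simp add: colin_def)
    then show "lt (tensor R N X) (tensor R (tensor R N E) X) C (dif N) (xcoact N t) = \<zero>\<^bsub>tensor R (tensor R (tensor R N E) X) C\<^esub>"
      unfolding t'(2) by (simp add: lin_zero[OF _ _ lin_wten])
  qed simp_all
  have "\<exists>\<sigma>. rcomod C (boxX N) \<sigma> \<and> colin C (boxX N) \<sigma> (tensor R N X) (xcoact N) (\<lambda>t. t)"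
    by (rule rcomod_sub[OF coalg_C rcomod_VX _ _ _ inj1 inj2 im]) simp_all
  from someI_ex[OF this] show "rcomod C (boxX N) (boxX_coact N)" "colin C (boxX N) (boxX_coact N) (tensor R N X) (xcoact N) (\<lambda>t. t)"
    by (simp_all add: boxX_coact_def)
qed

lemma right_comodule_G: "right_comodule R C (G_ob N)"
  unfolding G_ob_def by (rule right_comodule_small_comodule[OF rcomod_boxX]) simp

lemma iota_bij: "bij_betw (iota N) (carrier (G_ob N)) (carrier (boxX N))"
  unfolding iota_def G_ob_def by (rule bij_betw_inv_into[OF small_comodule_bij[OF rcomod_boxX]]) simp

lemma iota_small_inj: "t \<in> carrier (boxX N) \<Longrightarrow> small_inj (boxX N) t \<in> carrier (G_ob N)"
  "t \<in> carrier (boxX N) \<Longrightarrow> iota N (small_inj (boxX N) t) = t"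
  using small_comodule_bij[OF rcomod_boxX boxX_simps(3)]
  by (auto simp: iota_def G_ob_def bij_betw_inv_into_left bij_betw_def)

lemma iota_inj: "inj_on (iota N) (carrier (G_ob N))"
  using iota_bij by (simp add: bij_betw_def)

lemma iota_mem: "y \<in> carrier (G_ob N) \<Longrightarrow> iota N y \<in> carrier (boxX N)"
  using iota_bij by (auto simp: bij_betw_def)

lemma colin_iota: "colin C (G_ob N) (coact (G_ob N)) (tensor R N X) (xcoact N) (iota N)"
proof -
  obtain k where "colin C (small_comodule (boxX N) (boxX_coact N)) (coact (small_comodule (boxX N) (boxX_coact N))) (boxX N) (boxX_coact N) k"
    "k = inv_into (carrier (boxX N)) (small_inj (boxX N))"
    using small_comodule_inverse[OF rcomod_boxX boxX_simps(3)] by metis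
  then have "colin C (G_ob N) (coact (G_ob N)) (boxX N) (boxX_coact N) (iota N)" by (simp add: iota_def G_ob_def)
  from colin_comp[OF C_simps(1) rcD(1)[OF right_comodule_G] rcomod_boxX rcomod_VX this colin_boxX] show ?thesis by simp
qed

lemma lin_iota [simp]: "lin R (G_ob N) (tensor R N X) (iota N)"
  by (rule colin_lin[OF colin_iota])

lemma iota_closed [simp]: "y \<in> carrier (G_ob N) \<Longrightarrow> iota N y \<in> carrier (tensor R N X)"
  by (rule lin_closed[OF lin_iota])

end

lemma boxX_map:
  assumes A: "right_comodule R E A" and B: "right_comodule R E B" and f: "f \<in> right_colinear R E A B" and t: "t \<in> carrier (boxX A)"
  shows "lt A B X f t \<in> carrier (boxX B)"
proof -
  note [simp] = N_simps(1,2)[OF A] N_simps(1,2)[OF B] right_colinearD(2)[OF f]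
  have t': "t \<in> carrier (tensor R A X)" "lt A (tensor R A E) X (coact A) t = wten A X E X uX t"
    using t by (simp_all add: boxX_mem[OF A])
  have l: "lin R A (tensor R B E) (\<lambda>a. lt A B E f (coact A a))" by (rule lin_comp[OF N_simps(2)[OF A] lin_lt]) simp_all
  have "lt B (tensor R B E) X (coact B) (lt A B X f t) = lt A (tensor R B E) X (\<lambda>a. coact B (f a)) t"
    using t' by (simp add: lt_comp)
  also have "\<dots> = lt A (tensor R B E) X (\<lambda>a. lt A B E f (coact A a)) t"
    by (rule fun_cong[OF lt_cong]) (use right_colinearD(1)[OF f] in \<open>simp add: colin_def\<close>)
  also have "\<dots> = lt (tensor R A E) (tensor R B E) X (lt A B E f) (wten A X E X uX t)"
    using t'(1) by (simp add: lt_comp flip: t'(2))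
  also have "\<dots> = wten B X E X uX (lt A B X f t)"
    using t' by (simp add: wten_lt)
  finally show ?thesis using t' by (simp add: boxX_mem[OF B])
qed

lemma iota_G_arr:
  assumes A: "right_comodule R E A" and B: "right_comodule R E B" and f: "f \<in> right_colinear R E A B" and y: "y \<in> carrier (G_ob A)"
  shows "iota B (G_arr A B f y) = lt A B X f (iota A y)" "G_arr A B f y \<in> carrier (G_ob B)"
  using y iota_small_inj[OF B boxX_map[OF A B f iota_mem[OF A y]]] by (simp_all add: G_arr_def)

lemma G_arr_colinear:
  assumes A: "right_comodule R E A" and B: "right_comodule R E B" and f: "f \<in> right_colinear R E A B"
  shows "G_arr A B f \<in> right_colinear R C (G_ob A) (G_ob B)"
proof -
  note GA = right_comodule_G[OF A] and GB = right_comodule_G[OF B]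
  have "colin C (G_ob A) (coact (G_ob A)) (tensor R B X) (xcoact B) (\<lambda>y. lt A B X f (iota A y))"
    by (rule colin_comp[OF C_simps(1) rcD(1)[OF GA] rcomod_VX rcomod_VX colin_iota[OF A] colin_xcoact_lt])
      (simp_all add: N_simps[OF A] N_simps[OF B] right_colinearD[OF f])
  then have "colin C (G_ob A) (coact (G_ob A)) (tensor R B X) (xcoact B) (\<lambda>y. iota B (G_arr A B f y))"
    by (subst colin_cong[OF rcD(2)[OF GA], of _ "\<lambda>y. lt A B X f (iota A y)"]) (simp_all add: iota_G_arr[OF A B f])
  then have "colin C (G_ob A) (coact (G_ob A)) (G_ob B) (coact (G_ob B)) (G_arr A B f)"
    by (intro colin_factor[OF rcD(1)[OF GA] rcD(1)[OF GB] small_UNIV rcomod_VX _ colin_iota[OF B] iota_inj[OF B]])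
      (simp_all add: N_simps[OF B] iota_G_arr[OF A B f])
  then show ?thesis by (simp add: right_colinear_iff G_arr_def)
qed

lemma G_arr_eqI:
  assumes A: "right_comodule R E A" and B: "right_comodule R E B" and f: "f \<in> right_colinear R E A B"
    and g: "g \<in> extensional (carrier (G_ob A))" "\<And>y. y \<in> carrier (G_ob A) \<Longrightarrow> g y \<in> carrier (G_ob B)"
      "\<And>y. y \<in> carrier (G_ob A) \<Longrightarrow> iota B (g y) = lt A B X f (iota A y)"
  shows "G_arr A B f = g"
proof (rule extensionalityI[OF _ g(1)])
  show "G_arr A B f \<in> extensional (carrier (G_ob A))" by (simp add: G_arr_def)
  fix y assume y: "y \<in> carrier (G_ob A)"
  show "G_arr A B f y = g y"
    by (rule inj_onD[OF iota_inj[OF B]]) (use y g iota_G_arr[OF A B f] in simp_all)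
qed

definition G :: "(('r, 'u) comodule, 'u \<Rightarrow> 'u, ('r, 'u) comodule, 'u \<Rightarrow> 'u) functor_data"
  where "G = \<lparr>Obj = G_ob, Arr = G_arr\<rparr>"

lemma module_coalgebra:
  assumes "right_comodule R D A"
  shows "module R D"
  using coalgebra.axioms(1)[OF right_comodule.axioms(1)[OF assms]] .

lemma id_colinear:
  assumes A: "right_comodule R D A"
  shows "id_map A \<in> right_colinear R D A A"
  using colin_id[OF module_coalgebra[OF A] rcD(1)[OF A]]
  by (simp add: right_colinear_iff colin_cong[OF rcD(2)[OF A], of "id_map A" "\<lambda>x. x"]) (simp add: id_map_def)

lemma comp_colinear:
  assumes "right_comodule R D A" "right_comodule R D B" "right_comodule R D L"
    "f \<in> right_colinear R D A B" "g \<in> right_colinear R D B L"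
  shows "compose (carrier A) g f \<in> right_colinear R D A L"
proof -
  note m = module_coalgebra[OF assms(1)]
  have "colin D A (coact A) L (coact L) (\<lambda>x. g (f x))"
    by (rule colin_comp[OF m rcD(1)[OF assms(1)] rcD(1)[OF assms(2)] rcD(1)[OF assms(3)] right_colinearD(1)[OF assms(4)] right_colinearD(1)[OF assms(5)]])
  then show ?thesis
    by (simp add: right_colinear_iff compose_def colin_cong[OF rcD(2)[OF assms(1)], of "\<lambda>x\<in>carrier A. g (f x)" "\<lambda>x. g (f x)"])
qed

lemma functor_G: "is_functor (right_comodules R E) (right_comodules R C) G"
proof -
  have id: "G_arr A A (id_map A) = id_map (G_ob A)" if A: "right_comodule R E A" for A
  proof (rule G_arr_eqI[OF A A id_colinear[OF A]])
    fix y assume y: "y \<in> carrier (G_ob A)"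
    have "lt A A X (id_map A) = lt A A X (\<lambda>x. x)" by (rule lt_cong) simp
    then show "iota A (id_map (G_ob A) y) = lt A A X (id_map A) (iota A y)"
      using y N_simps(1)[OF A] iota_closed[OF A] by (simp add: lt_ident)
  qed (simp_all add: id_map_def)
  have comp: "G_arr A D (compose (carrier A) g f) = compose (carrier (G_ob A)) (G_arr B D g) (G_arr A B f)"
    if A: "right_comodule R E A" and B: "right_comodule R E B" and D: "right_comodule R E D"
      and f: "f \<in> right_colinear R E A B" and g: "g \<in> right_colinear R E B D" for A B D f g
  proof (rule G_arr_eqI[OF A D comp_colinear[OF A B D f g]])
    fix y assume y: "y \<in> carrier (G_ob A)"
    then show "compose (carrier (G_ob A)) (G_arr B D g) (G_arr A B f) y \<in> carrier (G_ob D)"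
      by (simp add: compose_def iota_G_arr[OF A B f] iota_G_arr[OF B D g])
    have "lt A D X (compose (carrier A) g f) = lt A D X (\<lambda>x. g (f x))" by (rule lt_cong) (simp add: compose_def)
    then show "iota D (compose (carrier (G_ob A)) (G_arr B D g) (G_arr A B f) y) = lt A D X (compose (carrier A) g f) (iota A y)"
      using y right_colinearD(2)[OF f] right_colinearD(2)[OF g]
      by (simp add: compose_def iota_G_arr[OF A B f] iota_G_arr[OF B D g] lt_comp N_simps(1)[OF A] N_simps(1)[OF B] N_simps(1)[OF D] iota_closed[OF A])
  qed simp
  show ?thesis
    unfolding is_functor_def
    using right_comodule_G G_arr_colinear id comp by (simp add: right_comodules_def G_def)
qed

lemma linear_functor_G: "linear_functor R (right_comodules R E) G"
  unfolding linear_functor_def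
proof (intro conjI ballI)
  fix A B f g assume "A \<in> Ob (right_comodules R E)" "B \<in> Ob (right_comodules R E)"
    "f \<in> Hom (right_comodules R E) A B" "g \<in> Hom (right_comodules R E) A B"
  then have A: "right_comodule R E A" and B: "right_comodule R E B" and f: "f \<in> right_colinear R E A B" and g: "g \<in> right_colinear R E A B"
    by (simp_all add: right_comodules_def)
  note [simp] = N_simps(1)[OF A] N_simps(1)[OF B] right_colinearD(2)[OF f] right_colinearD(2)[OF g]
  interpret GB: module R "G_ob B" by (rule rcD(2)[OF right_comodule_G[OF B]])
  let ?s = "\<lambda>x\<in>carrier A. f x \<oplus>\<^bsub>B\<^esub> g x"
  have s: "?s \<in> right_colinear R E A B"
    using colin_plus[OF coalg_E rcD(1)[OF A] rcD(1)[OF B] right_colinearD(1)[OF f] right_colinearD(1)[OF g]]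
    by (simp add: right_colinear_iff colin_cong[OF rcD(2)[OF A], of ?s "\<lambda>x. f x \<oplus>\<^bsub>B\<^esub> g x"])
  have c: "lt A B X ?s = lt A B X (\<lambda>x. f x \<oplus>\<^bsub>B\<^esub> g x)" by (rule lt_cong) simp
  have "G_arr A B ?s = (\<lambda>y\<in>carrier (G_ob A). G_arr A B f y \<oplus>\<^bsub>G_ob B\<^esub> G_arr A B g y)"
    by (rule G_arr_eqI[OF A B s])
      (simp_all add: iota_G_arr[OF A B f] iota_G_arr[OF A B g] c lt_plus iota_closed[OF A] lin_add[OF lin_iota[OF B]])
  then show "Arr G A B ?s = (\<lambda>x\<in>carrier (Obj G A). Arr G A B f x \<oplus>\<^bsub>Obj G B\<^esub> Arr G A B g x)"
    by (simp add: G_def)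
next
  fix A B r f assume "A \<in> Ob (right_comodules R E)" "B \<in> Ob (right_comodules R E)" and r: "r \<in> carrier R"
    and "f \<in> Hom (right_comodules R E) A B"
  then have A: "right_comodule R E A" and B: "right_comodule R E B" and f: "f \<in> right_colinear R E A B"
    by (simp_all add: right_comodules_def)
  note [simp] = N_simps(1)[OF A] N_simps(1)[OF B] right_colinearD(2)[OF f]
  interpret GB: module R "G_ob B" by (rule rcD(2)[OF right_comodule_G[OF B]])
  let ?s = "\<lambda>x\<in>carrier A. r \<odot>\<^bsub>B\<^esub> f x"
  have s: "?s \<in> right_colinear R E A B"
    using colin_scale[OF coalg_E rcD(1)[OF A] rcD(1)[OF B] right_colinearD(1)[OF f] r]
    by (simp add: right_colinear_iff colin_cong[OF rcD(2)[OF A], of ?s "\<lambda>x. r \<odot>\<^bsub>B\<^esub> f x"])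
  have c: "lt A B X ?s = lt A B X (\<lambda>x. r \<odot>\<^bsub>B\<^esub> f x)" by (rule lt_cong) simp
  have "G_arr A B ?s = (\<lambda>y\<in>carrier (G_ob A). r \<odot>\<^bsub>G_ob B\<^esub> G_arr A B f y)"
    by (rule G_arr_eqI[OF A B s])
      (simp_all add: r iota_G_arr[OF A B f] c lt_scale iota_closed[OF A] lin_smult[OF lin_iota[OF B]])
  then show "Arr G A B ?s = (\<lambda>x\<in>carrier (Obj G A). r \<odot>\<^bsub>Obj G B\<^esub> Arr G A B f x)"
    by (simp add: G_def)
qed

end

context cohom_injector
begin

section \<open>The unit of the equivalence\<close>

lemma unit_mem_boxX:
  assumes A: "right_comodule R C A" and x: "x \<in> carrier A"
  shows "unit A x \<in> carrier (boxX (F_ob A))"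
  using univD(7)[OF univ_F[OF A] x] coact_F[OF A x] by (simp add: boxX_mem[OF right_comodule_F[OF A]])

text \<open>
  Let \<open>p : h(A) \<otimes> X \<rightarrow> P\<close> be the cokernel of the unit of \<open>A\<close>. The map \<open>u\<^sub>P p\<close> factors as
  \<open>(k \<otimes> X) (h(A) \<otimes> u\<^sub>X)\<close>, and \<open>k\<close> vanishes after the coaction of \<open>h(A)\<close>, by uniqueness at the unit of
  \<open>A\<close>, which \<open>p\<close> kills. On \<open>h(A) \<box>\<^sub>E X\<close> the maps \<open>h(A) \<otimes> u\<^sub>X\<close> and coaction \<open>\<otimes> X\<close> agree, so
  \<open>u\<^sub>P p\<close> is zero there, and \<open>p\<close> as well since \<open>u\<^sub>P\<close> is injective.
\<close>

lemma boxX_F_subset_unit: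
  assumes A: "right_comodule R C A" and t: "t \<in> carrier (boxX (F_ob A))"
  shows "t \<in> unit A ` carrier A"
proof -
  let ?H = "F_ob A"
  note uA = univ_F[OF A]
  note [simp] = univD[OF uA] lin_coact_F[OF A]
  have tV: "t \<in> carrier (tensor R ?H X)" "lt ?H (tensor R ?H E) X (coact ?H) t = wten ?H X E X uX t"
    using t by (simp_all add: boxX_mem[OF right_comodule_F[OF A]])
  have sub: "submodule (unit A ` carrier A) R (tensor R ?H X)" by (rule submodule_image) simp_all
  obtain P :: "('r, ('u, 'u) tens) module" and p where P [simp]: "module R P" "lin R (tensor R ?H X) P p"
    and psurj: "p ` carrier (tensor R ?H X) = carrier P" and pker: "{t \<in> carrier (tensor R ?H X). p t = \<zero>\<^bsub>P\<^esub>} = unit A ` carrier A"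
    using quotient_module[OF module_tensor[OF univD(4)[OF uA] X_simps(1)] sub] by (elim exE conjE) (rule that)
  have sP: "small P" by (rule small_image[OF small_VX psurj[symmetric]]) simp_all
  have pu: "p (unit A x) = \<zero>\<^bsub>P\<^esub>" if "x \<in> carrier A" for x using pker that by blast
  have "\<exists>\<sigma>. rcomod C P \<sigma> \<and> colin C (tensor R ?H X) (xcoact ?H) P \<sigma> p"
  proof (rule rcomod_quotient[OF coalg_C rcomod_VX P psurj])
    fix a assume "a \<in> carrier (tensor R ?H X)" "p a = \<zero>\<^bsub>P\<^esub>"
    then have "a \<in> unit A ` carrier A" using pker by blast
    then obtain x where x: "x \<in> carrier A" "a = unit A x" by blast
    have c: "xcoact ?H (unit A x) = lt A (tensor R ?H X) C (unit A) (coact A x)"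
      using univD(5)[OF uA] x by (simp add: colin_def)
    have "lt (tensor R ?H X) P C p (xcoact ?H a) = lt A P C (\<lambda>x. p (unit A x)) (coact A x)"
      unfolding x(2) c by (rule lt_comp) (use x in simp_all)
    also have "\<dots> = lt A P C (\<lambda>x. \<zero>\<^bsub>P\<^esub>) (coact A x)"
      by (rule fun_cong[OF lt_cong]) (rule pu)
    finally show "lt (tensor R ?H X) P C p (xcoact ?H a) = \<zero>\<^bsub>tensor R P C\<^esub>" using x by (simp add: lt_zero)
  qed simp
  then obtain \<sigma> where \<sigma>: "rcomod C P \<sigma>" "colin C (tensor R ?H X) (xcoact ?H) P \<sigma> p" by blast
  obtain HP :: "('r, 'u) module" and uP where uP: "univ P \<sigma> HP uP" using univ_exists[OF \<sigma>(1) sP] by blast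
  note [simp] = univD(4)[OF uP] univD(6)[OF uP]
  note uHX = univ_VX[OF univD(4)[OF uA]]
  have "colin C (tensor R ?H X) (xcoact ?H) (tensor R HP X) (xcoact HP) (\<lambda>t. uP (p t))"
    by (rule colin_comp[OF C_simps(1) rcomod_VX \<sigma>(1) rcomod_VX \<sigma>(2) univD(5)[OF uP]]) simp_all
  from univ_ex[OF uHX univD(4)[OF uP] small_UNIV this] obtain k where k [simp]: "lin R (tensor R ?H E) HP k"
    and ku: "\<And>t. t \<in> carrier (tensor R ?H X) \<Longrightarrow> lt (tensor R ?H E) HP X k (wten ?H X E X uX t) = uP (p t)"
    by blast
  have lk [simp]: "lin R ?H HP (\<lambda>y. k (coact ?H y))" by (rule lin_comp[OF lin_coact_F[OF A] k])
  have lkt: "lt ?H HP X (\<lambda>y. k (coact ?H y)) t = lt (tensor R ?H E) HP X k (lt ?H (tensor R ?H E) X (coact ?H) t)"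
    if "t \<in> carrier (tensor R ?H X)" for t using that by (simp add: lt_comp)
  have zero: "k (coact ?H y) = \<zero>\<^bsub>HP\<^esub>" if y: "y \<in> carrier ?H" for y
  proof (rule univ_unique[OF uA univD(4)[OF uP] small_UNIV lk lin_const_zero _ y])
    fix x assume x: "x \<in> carrier A"
    have "lt ?H HP X (\<lambda>y. k (coact ?H y)) (unit A x) = uP (p (unit A x))"
      using x by (simp add: lkt coact_F[OF A] ku)
    also have "\<dots> = \<zero>\<^bsub>tensor R HP X\<^esub>" using x by (simp add: pu lin_zero[OF P(1) _ univD(6)[OF uP]])
    finally show "lt ?H HP X (\<lambda>y. k (coact ?H y)) (unit A x) = lt ?H HP X (\<lambda>_. \<zero>\<^bsub>HP\<^esub>) (unit A x)"
      using x by (simp add: lt_zero)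
  qed simp
  have "uP (p t) = lt ?H HP X (\<lambda>y. k (coact ?H y)) t" using tV by (simp add: lkt ku)
  also have "\<dots> = lt ?H HP X (\<lambda>_. \<zero>\<^bsub>HP\<^esub>) t" by (rule fun_cong[OF lt_cong]) (rule zero)
  also have "\<dots> = \<zero>\<^bsub>tensor R HP X\<^esub>" using tV by (simp add: lt_zero)
  finally have "uP (p t) = \<zero>\<^bsub>tensor R HP X\<^esub>" .
  then have "p t = \<zero>\<^bsub>P\<^esub>"
    using unit_inj[OF uP sP] lin_closed[OF P(2) tV(1)]
    unfolding lin_inj_iff[OF P(1) module_tensor[OF univD(4)[OF uP] X_simps(1)] univD(6)[OF uP]] by blast
  then show ?thesis using pker tV(1) by blast
qed

text \<open>The unit \<open>u\<^sub>A\<close>, corestricted to \<open>h(A) \<box>\<^sub>E X\<close>\<close>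

definition sigma :: "('r, 'u) comodule \<Rightarrow> 'u \<Rightarrow> 'u"
  where "sigma A = (\<lambda>x\<in>carrier A. small_inj (boxX (F_ob A)) (unit A x))"

context
  fixes A :: "('r, 'u) comodule"
  assumes A: "right_comodule R C A"
begin

lemma iota_sigma: "x \<in> carrier A \<Longrightarrow> iota (F_ob A) (sigma A x) = unit A x"
  and sigma_closed: "x \<in> carrier A \<Longrightarrow> sigma A x \<in> carrier (G_ob (F_ob A))"
  using iota_small_inj[OF right_comodule_F[OF A] unit_mem_boxX[OF A]] by (simp_all add: sigma_def)

lemma sigma_colinear: "sigma A \<in> right_colinear R C A (G_ob (F_ob A))"
proof -
  note FA = right_comodule_F[OF A]
  have "colin C A (coact A) (tensor R (F_ob A) X) (xcoact (F_ob A)) (\<lambda>x. iota (F_ob A) (sigma A x))"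
    by (subst colin_cong[OF rcD(2)[OF A], of _ "unit A"]) (simp_all add: iota_sigma univD(5)[OF univ_F[OF A]])
  then have "colin C A (coact A) (G_ob (F_ob A)) (coact (G_ob (F_ob A))) (sigma A)"
    by (intro colin_factor[OF rcD(1)[OF A] rcD(1)[OF right_comodule_G[OF FA]] small_UNIV rcomod_VX _ colin_iota[OF FA] iota_inj[OF FA]])
      (simp_all add: N_simps[OF FA] sigma_closed)
  then show ?thesis by (simp add: right_colinear_iff sigma_def)
qed

lemma sigma_bij: "bij_betw (sigma A) (carrier A) (carrier (G_ob (F_ob A)))"
  unfolding bij_betw_def
proof
  note FA = right_comodule_F[OF A]
  show "inj_on (sigma A) (carrier A)"
  proof (rule inj_onI)
    fix x y assume xy: "x \<in> carrier A" "y \<in> carrier A" "sigma A x = sigma A y"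
    then have "unit A x = unit A y" by (metis iota_sigma)
    then show "x = y" by (rule inj_onD[OF unit_inj[OF univ_F[OF A] small_UNIV]]) (use xy in simp_all)
  qed
  show "sigma A ` carrier A = carrier (G_ob (F_ob A))"
  proof (intro subset_antisym subsetI)
    fix y assume y: "y \<in> carrier (G_ob (F_ob A))"
    obtain x where x: "x \<in> carrier A" "iota (F_ob A) y = unit A x"
      using boxX_F_subset_unit[OF A iota_mem[OF FA y]] by blast
    have "y = sigma A x"
      by (rule inj_onD[OF iota_inj[OF FA]]) (use x y in \<open>simp_all add: iota_sigma sigma_closed\<close>)
    then show "y \<in> sigma A ` carrier A" using x by blast
  qed (use sigma_closed in blast)
qed

end

lemma sigma_natural:
  assumes A: "right_comodule R C A" and B: "right_comodule R C B" and f: "f \<in> right_colinear R C A B" and x: "x \<in> carrier A"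
  shows "sigma B (f x) = G_arr (F_ob A) (F_ob B) (Arr h A B f) (sigma A x)"
proof (rule inj_onD[OF iota_inj[OF right_comodule_F[OF B]]])
  note FA = right_comodule_F[OF A] and FB = right_comodule_F[OF B]
  note g = iota_G_arr[OF FA FB F_arr[OF A B f] sigma_closed[OF A x]]
  show "iota (F_ob B) (sigma B (f x)) = iota (F_ob B) (G_arr (F_ob A) (F_ob B) (Arr h A B f) (sigma A x))"
    using g(1) x right_colinearD(4)[OF f x] by (simp add: iota_sigma[OF A] iota_sigma[OF B] unit_natural_F(3)[OF A B f])
  show "sigma B (f x) \<in> carrier (G_ob (F_ob B))" "G_arr (F_ob A) (F_ob B) (Arr h A B f) (sigma A x) \<in> carrier (G_ob (F_ob B))"
    using g(2) sigma_closed[OF B right_colinearD(4)[OF f x]] by simp_all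
qed

lemma GF_iso: "naturally_isomorphic (right_comodules R C) (right_comodules R C) (comp_functor G F) id_functor"
proof -
  let ?t = "\<lambda>A. restrict (inv_into (carrier A) (sigma A)) (carrier (G_ob (F_ob A)))"
  have GF: "right_comodule R C (G_ob (F_ob A))" if "right_comodule R C A" for A
    by (rule right_comodule_G[OF right_comodule_F[OF that]])
  have t: "?t A \<in> right_colinear R C (G_ob (F_ob A)) A" if A: "right_comodule R C A" for A
    by (rule iso_arrow_comodules(2)[OF coalg_C A GF[OF A] sigma_colinear[OF A] sigma_bij[OF A]])
  have tb: "bij_betw (?t A) (carrier (G_ob (F_ob A))) (carrier A)" if A: "right_comodule R C A" for A
    using bij_betw_inv_into[OF sigma_bij[OF A]] by (simp cong: bij_betw_cong)
  have ts: "?t A (sigma A x) = x" if A: "right_comodule R C A" and x: "x \<in> carrier A" for A x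
    using x sigma_closed[OF A x] sigma_bij[OF A] by (simp add: bij_betw_inv_into_left)
  have "nat_trans (right_comodules R C) (right_comodules R C) (comp_functor G F) id_functor ?t"
    unfolding nat_trans_def
  proof (intro conjI ballI)
    fix A assume "A \<in> Ob (right_comodules R C)"
    then show "?t A \<in> Hom (right_comodules R C) (Obj (comp_functor G F) A) (Obj id_functor A)"
      using t by (simp add: right_comodules_def comp_functor_def id_functor_def F_def G_def)
  next
    fix A B f assume "A \<in> Ob (right_comodules R C)" "B \<in> Ob (right_comodules R C)" "f \<in> Hom (right_comodules R C) A B"
    then have A: "right_comodule R C A" and B: "right_comodule R C B" and f: "f \<in> right_colinear R C A B"
      by (simp_all add: right_comodules_def)
    let ?g = "G_arr (F_ob A) (F_ob B) (Arr h A B f)"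
    have "compose (carrier (G_ob (F_ob A))) (?t B) ?g = compose (carrier (G_ob (F_ob A))) f (?t A)"
      unfolding compose_def
    proof (rule restrict_ext)
      fix y assume "y \<in> carrier (G_ob (F_ob A))"
      then obtain x where x: "x \<in> carrier A" "y = sigma A x" using sigma_bij[OF A] by (metis bij_betw_imp_surj_on imageE)
      have "?t B (?g y) = ?t B (sigma B (f x))" using sigma_natural[OF A B f x(1)] x(2) by simp
      also have "\<dots> = f x" by (rule ts[OF B right_colinearD(4)[OF f x(1)]])
      also have "\<dots> = f (?t A y)" using ts[OF A x(1)] x(2) by simp
      finally show "?t B (?g y) = f (?t A y)" .
    qed
    then show "Cmp (right_comodules R C) (Obj (comp_functor G F) A) (Obj (comp_functor G F) B) (Obj id_functor B) (?t B) (Arr (comp_functor G F) A B f) =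
       Cmp (right_comodules R C) (Obj (comp_functor G F) A) (Obj id_functor A) (Obj id_functor B) (Arr id_functor A B f) (?t A)"
      by (simp add: right_comodules_def comp_functor_def id_functor_def F_def G_def)
  qed
  moreover have "iso_arrow (right_comodules R C) (Obj (comp_functor G F) A) (Obj id_functor A) (?t A)"
    if "A \<in> Ob (right_comodules R C)" for A
    using iso_arrow_comodules(1)[OF coalg_C GF _ t tb] that
    by (simp add: right_comodules_def comp_functor_def id_functor_def F_def G_def)
  ultimately show ?thesis unfolding naturally_isomorphic_def by blast
qed

section \<open>The counit of the equivalence\<close>

text \<open>The map \<open>h(N \<box>\<^sub>E X) \<rightarrow> N\<close> that corresponds to the inclusion \<open>iota\<close> under the adjunction\<close>

definition tau :: "('r, 'u) comodule \<Rightarrow> 'u \<Rightarrow> 'u"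
  where "tau N = restrict (SOME g. lin R (F_ob (G_ob N)) N g \<and>
    (\<forall>y\<in>carrier (G_ob N). lt (F_ob (G_ob N)) N X g (unit (G_ob N) y) = iota N y)) (carrier (F_ob (G_ob N)))"

context
  fixes N :: "('r, 'u) comodule"
  assumes N: "right_comodule R E N"
begin

lemma GN: "right_comodule R C (G_ob N)"
  by (rule right_comodule_G[OF N])

lemma N_facts [simp]: "module R N" "lin R N (tensor R N E) (coact N)" "small (tensor R N X)" "small (tensor R N E)"
  "small (tensor R (tensor R N E) X)" "lin R (G_ob N) (tensor R N X) (iota N)"
  using N_simps[OF N] lin_iota[OF N] by simp_all

lemma univ_FG: "univ (G_ob N) (coact (G_ob N)) (F_ob (G_ob N)) (unit (G_ob N))"
  by (rule univ_F[OF GN])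

lemmas FG_facts [simp] = univD[OF univ_FG] lin_coact_F[OF GN]

lemma lin_tau [simp]: "lin R (F_ob (G_ob N)) N (tau N)"
  and tau_unit: "y \<in> carrier (G_ob N) \<Longrightarrow> lt (F_ob (G_ob N)) N X (tau N) (unit (G_ob N) y) = iota N y"
proof -
  let ?P = "\<lambda>g. lin R (F_ob (G_ob N)) N g \<and>
    (\<forall>y\<in>carrier (G_ob N). lt (F_ob (G_ob N)) N X g (unit (G_ob N) y) = iota N y)"
  have "?P (Eps ?P)" by (rule someI_ex[OF univ_ex[OF univ_FG _ small_UNIV colin_iota[OF N]]]) simp
  moreover have "lt (F_ob (G_ob N)) N X (tau N) = lt (F_ob (G_ob N)) N X (Eps ?P)"
    by (rule lt_cong) (simp add: tau_def)
  ultimately show "lin R (F_ob (G_ob N)) N (tau N)"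
    "y \<in> carrier (G_ob N) \<Longrightarrow> lt (F_ob (G_ob N)) N X (tau N) (unit (G_ob N) y) = iota N y"
    by (simp_all add: tau_def lin_restrict)
qed

lemma iota_eq: "y \<in> carrier (G_ob N) \<Longrightarrow> lt N (tensor R N E) X (coact N) (iota N y) = wten N X E X uX (iota N y)"
  using iota_mem[OF N] by (simp add: boxX_mem[OF N])

lemma coact_tau_unit:
  assumes "y \<in> carrier (G_ob N)"
  shows "lt (F_ob (G_ob N)) (tensor R N E) X (\<lambda>v. coact N (tau N v)) (unit (G_ob N) y) = wten N X E X uX (iota N y)"
  using assms by (simp add: tau_unit iota_eq flip: lt_comp[where N = N])

lemma lin_coact_tau [simp]: "lin R (F_ob (G_ob N)) (tensor R N E) (\<lambda>v. coact N (tau N v))"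
  by (rule lin_comp[OF lin_tau]) simp

lemma tau_colinear: "tau N \<in> right_colinear R E (F_ob (G_ob N)) N"
proof -
  let ?H = "F_ob (G_ob N)"
  have "lt ?H N E (tau N) (coact ?H v) = coact N (tau N v)" if v: "v \<in> carrier ?H" for v
  proof (rule univ_unique[OF univ_FG _ N_facts(4) _ lin_coact_tau _ v])
    show [simp]: "lin R ?H (tensor R N E) (\<lambda>v. lt ?H N E (tau N) (coact ?H v))"
      by (rule lin_comp[OF lin_coact_F[OF GN] lin_lt]) simp_all
    fix y assume y: "y \<in> carrier (G_ob N)"
    have "lt ?H (tensor R N E) X (\<lambda>v. lt ?H N E (tau N) (coact ?H v)) (unit (G_ob N) y) =
        lt (tensor R ?H E) (tensor R N E) X (lt ?H N E (tau N)) (wten ?H X E X uX (unit (G_ob N) y))"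
      using y by (simp add: lt_comp flip: coact_F[OF GN])
    also have "\<dots> = wten N X E X uX (iota N y)"
      using y by (simp add: wten_lt tau_unit)
    finally show "lt ?H (tensor R N E) X (\<lambda>v. lt ?H N E (tau N) (coact ?H v)) (unit (G_ob N) y) =
      lt ?H (tensor R N E) X (\<lambda>v. coact N (tau N v)) (unit (G_ob N) y)"
      using y by (simp add: coact_tau_unit)
  qed simp
  then show ?thesis by (simp add: right_colinear_iff colin_def) (simp add: tau_def)
qed

text \<open>
  The composite of \<open>tau\<close> with the coaction of \<open>N\<close> is \<open>h(iota) : h(N \<box>\<^sub>E X) \<rightarrow> h(N \<otimes> X) = N \<otimes> E\<close>,
  and \<open>h\<close> preserves injectivity.
\<close>

lemma tau_inj: "inj_on (tau N) (carrier (F_ob (G_ob N)))"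
proof -
  have "inj_on (\<lambda>v. coact N (tau N v)) (carrier (F_ob (G_ob N)))"
    by (rule univ_mono[OF univ_FG univ_VX small_UNIV N_facts(3) colin_iota[OF N] iota_inj[OF N] lin_coact_tau coact_tau_unit]) simp
  then show ?thesis by (auto simp: inj_on_def)
qed

text \<open>
  A form \<open>q\<close> that separates \<open>n\<close> from the image of \<open>tau\<close> gives a colinear map \<open>q \<otimes> X\<close> that vanishes on
  \<open>N \<box>\<^sub>E X\<close>. It is therefore \<open>a \<circ> p\<close> for the quotient \<open>p : N \<otimes> X \<rightarrow> P\<close> by \<open>N \<box>\<^sub>E X\<close>; the map
  \<open>dif = d \<circ> p\<close> embeds \<open>P\<close> into \<open>(N \<otimes> E) \<otimes> X\<close>, and \<open>a\<close> extends along \<open>d\<close> to a colinear map \<open>b\<close>,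
  which corresponds to a linear map \<open>k\<close> on \<open>(N \<otimes> E) \<otimes> E\<close>. The identity \<open>q \<otimes> X = b \<circ> dif\<close> then says
  \<open>q (N \<otimes> \<epsilon>) + k (N \<otimes> \<Delta>) = k (\<rho> \<otimes> E)\<close> on \<open>N \<otimes> E\<close>; evaluated at \<open>\<rho> n\<close>, it gives \<open>q n = 0\<close>.
\<close>

lemma tau_surj: "tau N ` carrier (F_ob (G_ob N)) = carrier N"
proof (rule ccontr)
  let ?H = "F_ob (G_ob N)" and ?Q = "cogen"
  interpret Q: module R cogen by simp
  note rn = rcD(1)[OF N]
  assume ne: "tau N ` carrier ?H \<noteq> carrier N"
  have "tau N ` carrier ?H \<subseteq> carrier N" using lin_closed[OF lin_tau] by blast
  then obtain n where n: "n \<in> carrier N" "n \<notin> tau N ` carrier ?H" using ne by blast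
  have "submodule (tau N ` carrier ?H) R N" by (rule submodule_image) simp_all
  from cogen_separates[OF N_facts(1) this n] obtain q where q [simp]: "lin R N cogen q"
    and q0: "\<And>v. v \<in> carrier ?H \<Longrightarrow> q (tau N v) = \<zero>\<^bsub>cogen\<^esub>" and qn: "q n \<noteq> \<zero>\<^bsub>cogen\<^esub>"
    by blast
  note boxX [simp] = boxX_simps[OF N]
  obtain P :: "('r, ('u, 'u) tens) module" and p where P [simp]: "module R P" "lin R (tensor R N X) P p"
    and psurj: "p ` carrier (tensor R N X) = carrier P" and pker: "{t \<in> carrier (tensor R N X). p t = \<zero>\<^bsub>P\<^esub>} = carrier (boxX N)"
    using quotient_module[OF module_tensor[OF N_facts(1) X_simps(1)] submodule_boxX[OF N]] by (elim exE conjE) (rule that)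
  have sP: "small P" by (rule small_image[OF N_facts(3) psurj[symmetric]])
  have boxP: "t \<in> carrier (boxX N)" if "t \<in> carrier (tensor R N X)" "p t = \<zero>\<^bsub>P\<^esub>" for t using pker that by blast
  have p_box: "p t = \<zero>\<^bsub>P\<^esub>" if "t \<in> carrier (boxX N)" for t using pker that by blast
  have "\<exists>\<sigma>. rcomod C P \<sigma> \<and> colin C (tensor R N X) (xcoact N) P \<sigma> p"
  proof (rule rcomod_quotient[OF coalg_C rcomod_VX P psurj])
    fix t assume "t \<in> carrier (tensor R N X)" "p t = \<zero>\<^bsub>P\<^esub>"
    then have t: "t \<in> carrier (boxX N)" by (rule boxP)
    have c: "boxX_coact N t \<in> carrier (tensor R (boxX N) C)" by (rule rcomod_closed[OF coalg_C rcomod_boxX[OF N] t])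
    have "lt (tensor R N X) P C p (xcoact N t) = lt (tensor R N X) P C p (lt (boxX N) (tensor R N X) C (\<lambda>t. t) (boxX_coact N t))"
      using colin_boxX[OF N] t by (simp add: colin_def)
    also have "\<dots> = lt (boxX N) P C (\<lambda>t. p t) (boxX_coact N t)" using c by (simp add: lt_comp)
    also have "\<dots> = lt (boxX N) P C (\<lambda>t. \<zero>\<^bsub>P\<^esub>) (boxX_coact N t)" by (rule fun_cong[OF lt_cong]) (rule p_box)
    finally show "lt (tensor R N X) P C p (xcoact N t) = \<zero>\<^bsub>tensor R P C\<^esub>" using c by (simp add: lt_zero)
  qed simp
  then obtain \<sigma> where \<sigma>: "rcomod C P \<sigma>" "colin C (tensor R N X) (xcoact N) P \<sigma> p" by blast
  obtain d where d [simp]: "lin R P (tensor R (tensor R N E) X) d" and dp: "\<And>t. t \<in> carrier (tensor R N X) \<Longrightarrow> d (p t) = dif N t"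
proof -
    have "dif N t = \<zero>\<^bsub>tensor R (tensor R N E) X\<^esub>" if "t \<in> carrier (tensor R N X)" "p t = \<zero>\<^bsub>P\<^esub>" for t
      using boxP[OF that] that(1) by (simp add: dif_eq_zero_iff[OF N] boxX_mem[OF N])
    then show ?thesis
      using lin_factor[OF _ P(1) _ P(2) psurj lin_dif[OF N]] that by auto
  qed
  obtain a where a [simp]: "lin R P (tensor R cogen X) a" and ap: "\<And>t. t \<in> carrier (tensor R N X) \<Longrightarrow> a (p t) = lt N cogen X q t"
  proof -
    have "lt N cogen X q t = \<zero>\<^bsub>tensor R cogen X\<^esub>" if t: "t \<in> carrier (tensor R N X)" "p t = \<zero>\<^bsub>P\<^esub>" for t
    proof -
      obtain y where y: "y \<in> carrier (G_ob N)" "t = iota N y"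
        using iota_bij[OF N] boxP[OF t] by (metis bij_betw_imp_surj_on imageE)
      have "lt N cogen X q t = lt ?H cogen X (\<lambda>v. q (tau N v)) (unit (G_ob N) y)"
        using y by (simp add: lt_comp flip: tau_unit)
      also have "\<dots> = lt ?H cogen X (\<lambda>v. \<zero>\<^bsub>cogen\<^esub>) (unit (G_ob N) y)" by (rule fun_cong[OF lt_cong]) (rule q0)
      finally show ?thesis using y by (simp add: lt_zero)
    qed
    then show ?thesis using lin_factor[OF _ P(1) _ P(2) psurj, of "tensor R cogen X" "lt N cogen X q"] that by auto
  qed
  have dc: "colin C P \<sigma> (tensor R (tensor R N E) X) (xcoact (tensor R N E)) d"
    by (rule colin_of_quotient[OF rcomod_VX \<sigma>(1) _ \<sigma>(2) psurj d], simp, simp,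
        subst colin_cong[where g = "dif N"], simp_all add: dp colin_dif[OF N])
  have ac: "colin C P \<sigma> (tensor R cogen X) (xcoact cogen) a"
    by (rule colin_of_quotient[OF rcomod_VX \<sigma>(1) _ \<sigma>(2) psurj a], simp, simp,
        subst colin_cong[where g = "lt N cogen X q"], simp_all add: ap colin_xcoact_lt)
  have dinj: "inj_on d (carrier P)"
    unfolding lin_inj_iff[OF P(1) module_tensor[OF module_tensor[OF N_facts(1) E_simps(1)] X_simps(1)] d]
  proof (intro ballI impI)
    fix y assume "y \<in> carrier P" "d y = \<zero>\<^bsub>tensor R (tensor R N E) X\<^esub>"
    then obtain t where t: "t \<in> carrier (tensor R N X)" "y = p t" using psurj by (metis imageE)
    then have "dif N t = \<zero>\<^bsub>tensor R (tensor R N E) X\<^esub>" using \<open>d y = _\<close> dp by simp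
    then have "t \<in> carrier (boxX N)" using t(1) by (simp add: dif_eq_zero_iff[OF N] boxX_mem[OF N])
    then show "y = \<zero>\<^bsub>P\<^esub>" using p_box t by simp
  qed
  obtain b where b: "colin C (tensor R (tensor R N E) X) (xcoact (tensor R N E)) (tensor R cogen X) (xcoact cogen) b"
    and bd: "\<And>y. y \<in> carrier P \<Longrightarrow> b (d y) = a y"
    using colinear_extension[OF \<sigma>(1) sP rcomod_VX N_facts(5) dc dinj ac] by auto
  note lb = colin_lin[OF b]
  obtain k where k [simp]: "lin R (tensor R (tensor R N E) E) cogen k"
    and ku: "\<And>t. t \<in> carrier (tensor R (tensor R N E) X) \<Longrightarrow> lt (tensor R (tensor R N E) E) cogen X k (wten (tensor R N E) X E X uX t) = b t"
    using univ_ex[OF univ_VX[of "tensor R N E"] module_cogen small_UNIV b] by auto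
  let ?f = "\<lambda>v. q (contract N E (counit E) v)" and ?g = "\<lambda>v. k (wten N E E E (comult E) v)"
    and ?m = "\<lambda>v. k (lt N (tensor R N E) E (coact N) v)"
  have l1 [simp]: "lin R (tensor R N E) cogen ?f" by (rule lin_comp[OF lin_contract q]) simp_all
  have l2 [simp]: "lin R (tensor R N E) cogen ?g" by (rule lin_comp[OF lin_wten k]) simp_all
  have l3 [simp]: "lin R (tensor R N E) cogen ?m" by (rule lin_comp[OF lin_lt k]) simp_all
  \<comment> \<open>by uniqueness on \<open>N \<otimes> E = h(N \<otimes> X)\<close>, it suffices to compare after the unit \<open>N \<otimes> u\<^sub>X\<close>\<close>
  have key: "?f v \<oplus>\<^bsub>cogen\<^esub> ?g v = ?m v" if v: "v \<in> carrier (tensor R N E)" for v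
  proof (rule univ_unique[OF univ_VX[of N] module_cogen small_UNIV lin_plus[OF module_cogen l1 l2] l3 _ v])
    interpret QX: module R "tensor R cogen X" by simp
    fix t assume t: "t \<in> carrier (tensor R N X)"
    let ?w = "wten N X E X uX t"
    have w: "?w \<in> carrier (tensor R (tensor R N E) X)" using t by simp
    have lc: "lt N (tensor R N E) X (coact N) t \<in> carrier (tensor R (tensor R N E) X)" using t by simp
    have "lt (tensor R N E) cogen X ?f ?w = lt N cogen X q (lt (tensor R N E) N X (contract N E (counit E)) ?w)"
      using w by (simp add: lt_comp del: wten_pure)
    then have 1: "lt (tensor R N E) cogen X ?f ?w = lt N cogen X q t" using t by (simp add: contract_unit)
    have "lt (tensor R N E) cogen X ?g ?w = lt (tensor R (tensor R N E) E) cogen X k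
        (lt (tensor R N E) (tensor R (tensor R N E) E) X (wten N E E E (comult E)) ?w)"
      using w by (simp add: lt_comp)
    then have 2: "lt (tensor R N E) cogen X ?g ?w = b ?w" using t w by (simp add: wten_comult_E ku)
    have "lt (tensor R N E) cogen X ?m ?w = lt (tensor R (tensor R N E) E) cogen X k
        (lt (tensor R N E) (tensor R (tensor R N E) E) X (lt N (tensor R N E) E (coact N)) ?w)"
      using w by (simp add: lt_comp)
    then have 3: "lt (tensor R N E) cogen X ?m ?w = b (lt N (tensor R N E) X (coact N) t)"
      using t lc by (simp add: wten_lt ku)
    have pt: "p t \<in> carrier P" using lin_closed[OF P(2) t] .
    have "lt N cogen X q t = b (dif N t)" using bd[OF pt] ap[OF t] dp[OF t] by simp
    also have "\<dots> = b (lt N (tensor R N E) X (coact N) t) \<oplus>\<^bsub>tensor R cogen X\<^esub> (\<ominus> \<one>) \<odot>\<^bsub>tensor R cogen X\<^esub> b ?w"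
    proof -
      interpret NX: module R "tensor R (tensor R N E) X" by simp
      show ?thesis using lc w by (simp add: dif_def lin_add[OF lb] lin_smult[OF lb])
    qed
    finally have "lt N cogen X q t \<oplus>\<^bsub>tensor R cogen X\<^esub> b ?w = b (lt N (tensor R N E) X (coact N) t)"
      using lin_closed[OF lb lc] lin_closed[OF lb w] by (simp add: QX.smult_l_minus QX.a_assoc QX.l_neg)
    then show "lt (tensor R N E) cogen X (\<lambda>v. ?f v \<oplus>\<^bsub>cogen\<^esub> ?g v) ?w = lt (tensor R N E) cogen X ?m ?w"
      using w 1 2 3 by (simp add: lt_plus)
  qed simp
  have cn: "coact N n \<in> carrier (tensor R N E)" by (rule rcomod_closed[OF coalg_E rn n(1)])
  have "q n \<oplus>\<^bsub>cogen\<^esub> k (wten N E E E (comult E) (coact N n)) = k (wten N E E E (comult E) (coact N n))"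
    using key[OF cn] rn n(1) by (simp add: rcomod_def)
  moreover have "k (wten N E E E (comult E) (coact N n)) \<in> carrier cogen" "q n \<in> carrier cogen"
    using lin_closed[OF l2 cn] lin_closed[OF q n(1)] by simp_all
  ultimately have "q n = \<zero>\<^bsub>cogen\<^esub>" by (metis Q.M.add.r_cancel_one)
  then show False using qn by simp
qed

lemma tau_bij: "bij_betw (tau N) (carrier (F_ob (G_ob N))) (carrier N)"
  using tau_inj tau_surj by (simp add: bij_betw_def)

end

lemma tau_natural:
  assumes A: "right_comodule R E A" and B: "right_comodule R E B" and f: "f \<in> right_colinear R E A B" and v: "v \<in> carrier (F_ob (G_ob A))"
  shows "tau B (Arr h (G_ob A) (G_ob B) (G_arr A B f) v) = f (tau A v)"
proof -
  let ?a = "G_arr A B f" and ?g = "Arr h (G_ob A) (G_ob B) (G_arr A B f)"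
  note GA = right_comodule_G[OF A] and GB = right_comodule_G[OF B]
  note ga = G_arr_colinear[OF A B f]
  note uA = univ_F[OF GA] and uB = univ_F[OF GB]
  note n = unit_natural_F[OF GA GB ga]
  note [simp] = univD[OF uA] univD[OF uB] n(1) lin_tau[OF A] lin_tau[OF B] N_simps(1)[OF A] N_simps(1)[OF B] right_colinearD(2)[OF f]
  show ?thesis
  proof (rule univ_unique[OF uA _ small_UNIV lin_comp[OF n(1) lin_tau[OF B]] lin_comp[OF lin_tau[OF A] right_colinearD(2)[OF f]] _ v])
    fix y assume y: "y \<in> carrier (G_ob A)"
    note ay = right_colinearD(4)[OF ga y]
    have "lt (F_ob (G_ob A)) B X (\<lambda>v. tau B (?g v)) (unit (G_ob A) y) = lt (F_ob (G_ob B)) B X (tau B) (unit (G_ob B) (?a y))"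
      using y by (simp add: n(3) flip: lt_comp[where N = "F_ob (G_ob B)"])
    also have "\<dots> = lt A B X f (iota A y)" using y ay by (simp add: tau_unit[OF B] iota_G_arr[OF A B f])
    also have "\<dots> = lt (F_ob (G_ob A)) B X (\<lambda>v. f (tau A v)) (unit (G_ob A) y)"
      using y by (simp add: lt_comp flip: tau_unit[OF A])
    finally show "lt (F_ob (G_ob A)) B X (\<lambda>v. tau B (?g v)) (unit (G_ob A) y) = lt (F_ob (G_ob A)) B X (\<lambda>v. f (tau A v)) (unit (G_ob A) y)" .
  qed simp
qed

lemma FG_iso: "naturally_isomorphic (right_comodules R E) (right_comodules R E) (comp_functor F G) id_functor"
proof -
  have "nat_trans (right_comodules R E) (right_comodules R E) (comp_functor F G) id_functor tau"
    unfolding nat_trans_def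
  proof (intro conjI ballI)
    fix A assume "A \<in> Ob (right_comodules R E)"
    then show "tau A \<in> Hom (right_comodules R E) (Obj (comp_functor F G) A) (Obj id_functor A)"
      using tau_colinear by (simp add: right_comodules_def comp_functor_def id_functor_def F_def G_def)
  next
    fix A B f assume "A \<in> Ob (right_comodules R E)" "B \<in> Ob (right_comodules R E)" "f \<in> Hom (right_comodules R E) A B"
    then have A: "right_comodule R E A" and B: "right_comodule R E B" and f: "f \<in> right_colinear R E A B"
      by (simp_all add: right_comodules_def)
    have "compose (carrier (F_ob (G_ob A))) (tau B) (Arr h (G_ob A) (G_ob B) (G_arr A B f)) = compose (carrier (F_ob (G_ob A))) f (tau A)"
      unfolding compose_def by (rule restrict_ext) (rule tau_natural[OF A B f])
    then show "Cmp (right_comodules R E) (Obj (comp_functor F G) A) (Obj (comp_functor F G) B) (Obj id_functor B) (tau B) (Arr (comp_functor F G) A B f) =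
       Cmp (right_comodules R E) (Obj (comp_functor F G) A) (Obj id_functor A) (Obj id_functor B) (Arr id_functor A B f) (tau A)"
      by (simp add: right_comodules_def comp_functor_def id_functor_def F_def G_def)
  qed
  moreover have "iso_arrow (right_comodules R E) (Obj (comp_functor F G) A) (Obj id_functor A) (tau A)"
    if "A \<in> Ob (right_comodules R E)" for A
    using iso_arrow_comodules(1)[OF coalg_E right_comodule_F[OF right_comodule_G] _ tau_colinear tau_bij] that
    by (simp add: right_comodules_def comp_functor_def id_functor_def F_def G_def)
  ultimately show ?thesis unfolding naturally_isomorphic_def by blast
qed

theorem morita_takeuchi_E: "morita_takeuchi R C E"
  unfolding morita_takeuchi_def
  using C coalgebra_E functor_F functor_G linear_functor_F linear_functor_G GF_iso FG_iso by blast

end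

theorem corollary6p7:
  fixes R :: "('r, 'x) ring_scheme"
    and C :: "('r, 'u) coalgebra"
    and X :: "('r, 'u) comodule"
  assumes "universe_for TYPE('u) R"
    and "cring R"
    and "coalgebra R C"
    and "flat_module R C"
    and "right_comodule R C X"
    and "quasi_finite R C X"
    and "faithfully_coflat R C X"
    and "injector R C X"
  shows "\<forall>h \<eta>. cohom_functor R C X h \<eta> \<longrightarrow> morita_takeuchi R C (coend_coalgebra R X h \<eta>)"
proof (intro allI impI)
  fix h \<eta> assume adj: "cohom_functor R C X h \<eta>"
  interpret cohom_injector R "TYPE('u)" C X h \<eta>
    using assms adj
    by (simp add: cohom_injector_def cohom_injector_axioms_def cohom_def cohom_axioms_def coalgebra_over_def
        coalgebra_over_axioms_def small_ring_def small_ring_axioms_def over_ring_def)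
  show "morita_takeuchi R C (coend_coalgebra R X h \<eta>)"
    using morita_takeuchi_E by (simp add: E_def)
qed

end
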